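(* Let $H$ be a finite-dimensional Hopf algebra over a field $\Bbbk$ with antipode $S$. Then $$\exp(H\rtimes\Bbbk\langle S^2\rangle)=\operatorname{lcm}(\exp_0(H),\exp(H)).$$
   Context: Let $(H,m,u,\Delta,\varepsilon)$ be a Hopf algebra with bijective antipode $S$ over a field $\Bbbk$. For $n\ge 1$ let $m_n:H^{\otimes n}\to H$, $h_1\otimes\cdots\otimes h_n\mapsto h_1\cdots h_n$, and $\Delta_n:H\to H^{\otimes n}$, $h\mapsto\sum h_{(1)}\otimes\cdots\otimes h_{(n)}$. Define $\exp(H):=\min\{n\ge 1\mid m_n\circ(\mathrm{id}\otimes S^{-2}\otimes\cdots\otimes S^{-2n+2})\circ\Delta_n=u\circ\varepsilon\}$ and $\exp_0(H):=\min\{n\ge 1\mid m_n\circ\Delta_n=u\circ\varepsilon\}$. Conventions: $\min\varnothing=\infty$; every positive integer and $\infty$ divide $\infty$; $\infty$ divides only $\infty$. In particular an lcm is $\infty$ as soon as one of its arguments is $\infty$. For $H$ finite-dimensional, the group $\langle S^2\rangle$ generated by $S^2$ in $\operatorname{End}_{\Bbbk}(H)$ is finite. The Hopf algebra $H\rtimes\Bbbk\langle S^2\rangle$ is $H\otimes\Bbbk\langle S^2\rangle$ as a coalgebra (with $\Bbbk\langle S^2\rangle$ the group algebra), with multiplication $(h\rtimes S^{2i})(k\rtimes S^{2j})=hS^{2i}(k)\rtimes S^{2(i+j)}$ for $h,k\in H$, $i,j\in\mathbb Z$, unit $1\rtimes\mathrm{id}$, and antipode $h\rtimes S^{2i}\mapsto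 S^{-2i+1}(h)\rtimes S^{-2i}$. *)

theory Defs
  imports
    "Jordan_Normal_Form.Missing_VectorSpace"
    "HOL-Algebra.AbelCoset"
    "HOL-Algebra.Bij"
    "HOL-Algebra.Generated_Groups"
    "HOL-Library.Extended_Nat"
begin

section \<open>Modules by generators and relations\<close>

text \<open>
  In all module records below that are not algebras, the fields \<open>mult\<close> and \<open>one\<close>
  (inherited from the ring record) are irrelevant and left \<open>undefined\<close>.
\<close>

definition self_module :: "('k, 'r) ring_scheme \<Rightarrow> ('k, 'k) module" where
  "self_module K =
    \<lparr>carrier = carrier K, mult = mult K, one = \<one>\<^bsub>K\<^esub>, zero = \<zero>\<^bsub>K\<^esub>, add = add K, smult = mult K\<rparr>"

definition free_module :: "('k, 'r) ring_scheme \<Rightarrow> 'x set \<Rightarrow> ('k, 'x \<Rightarrow> 'k) module" where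
  "free_module K X =
    \<lparr>carrier = {p. p \<in> UNIV \<rightarrow> carrier K \<and> finite {x. p x \<noteq> \<zero>\<^bsub>K\<^esub>} \<and> {x. p x \<noteq> \<zero>\<^bsub>K\<^esub>} \<subseteq> X},
     mult = undefined, one = undefined,
     zero = (\<lambda>_. \<zero>\<^bsub>K\<^esub>),
     add = (\<lambda>p q x. p x \<oplus>\<^bsub>K\<^esub> q x),
     smult = (\<lambda>r p x. r \<otimes>\<^bsub>K\<^esub> p x)\<rparr>"

definition free_gen :: "('k, 'r) ring_scheme \<Rightarrow> 'x \<Rightarrow> 'x \<Rightarrow> 'k" where
  "free_gen K x = (\<lambda>y. if y = x then \<one>\<^bsub>K\<^esub> else \<zero>\<^bsub>K\<^esub>)"

text \<open>The linear extension of a map on generators to the free module.\<close>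

definition free_ext ::
  "('k, 'r) ring_scheme \<Rightarrow> ('k, 'n, 's) module_scheme \<Rightarrow> ('x \<Rightarrow> 'n) \<Rightarrow> ('x \<Rightarrow> 'k) \<Rightarrow> 'n" where
  "free_ext K N f p = (\<Oplus>\<^bsub>N\<^esub>x\<in>{x. p x \<noteq> \<zero>\<^bsub>K\<^esub>}. p x \<odot>\<^bsub>N\<^esub> f x)"

definition quotient_module :: "('k, 'm, 's) module_scheme \<Rightarrow> 'm set \<Rightarrow> ('k, 'm set) module" where
  "quotient_module M N =
    \<lparr>carrier = a_rcosets\<^bsub>M\<^esub> N,
     mult = undefined, one = undefined,
     zero = N,
     add = (\<lambda>A B. A <+>\<^bsub>M\<^esub> B),
     smult = (\<lambda>r A. \<Union>a\<in>A. N +>\<^bsub>M\<^esub> (r \<odot>\<^bsub>M\<^esub> a))\<rparr>"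

definition presented_module ::
  "('k, 'r) ring_scheme \<Rightarrow> 'x set \<Rightarrow> ('x \<Rightarrow> 'k) set \<Rightarrow> ('k, ('x \<Rightarrow> 'k) set) module" where
  "presented_module K X E =
    quotient_module (free_module K X) (LinearCombinations.module.span K (free_module K X) E)"

definition presented_gen ::
  "('k, 'r) ring_scheme \<Rightarrow> 'x set \<Rightarrow> ('x \<Rightarrow> 'k) set \<Rightarrow> 'x \<Rightarrow> ('x \<Rightarrow> 'k) set" where
  "presented_gen K X E x =
    LinearCombinations.module.span K (free_module K X) E +>\<^bsub>free_module K X\<^esub> free_gen K x"

text \<open>
  The linear map out of a presented module induced by a map \<open>f\<close> on generators. The value does
  not depend on the chosen representative whenever \<open>f\<close> respects the relations, e.g. when \<open>f\<close> is
  bilinear or multilinear in the cases below; it is only used for such \<open>f\<close>.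
\<close>

definition lin_ext ::
  "('k, 'r) ring_scheme \<Rightarrow> ('k, 'n, 's) module_scheme \<Rightarrow> ('x \<Rightarrow> 'n) \<Rightarrow> ('x \<Rightarrow> 'k) set \<Rightarrow> 'n" where
  "lin_ext K N f t = free_ext K N f (SOME p. p \<in> t)"


section \<open>Tensor products\<close>

subsection \<open>The tensor product of two modules\<close>

definition bilinear_rels ::
  "('k, 'r) ring_scheme \<Rightarrow> ('k, 'm, 's) module_scheme \<Rightarrow> ('k, 'n, 't) module_scheme
    \<Rightarrow> ('m \<times> 'n \<Rightarrow> 'k) set" where
  "bilinear_rels K M N = (let F = free_module K (carrier M \<times> carrier N); \<delta> = free_gen K in
      {\<delta> (a \<oplus>\<^bsub>M\<^esub> b, c) \<ominus>\<^bsub>F\<^esub> (\<delta> (a, c) \<oplus>\<^bsub>F\<^esub> \<delta> (b, c)) | a b c.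
        a \<in> carrier M \<and> b \<in> carrier M \<and> c \<in> carrier N}
    \<union> {\<delta> (a, c \<oplus>\<^bsub>N\<^esub> d) \<ominus>\<^bsub>F\<^esub> (\<delta> (a, c) \<oplus>\<^bsub>F\<^esub> \<delta> (a, d)) | a c d.
        a \<in> carrier M \<and> c \<in> carrier N \<and> d \<in> carrier N}
    \<union> {\<delta> (r \<odot>\<^bsub>M\<^esub> a, c) \<ominus>\<^bsub>F\<^esub> (r \<odot>\<^bsub>F\<^esub> \<delta> (a, c)) | r a c.
        r \<in> carrier K \<and> a \<in> carrier M \<and> c \<in> carrier N}
    \<union> {\<delta> (a, r \<odot>\<^bsub>N\<^esub> c) \<ominus>\<^bsub>F\<^esub> (r \<odot>\<^bsub>F\<^esub> \<delta> (a, c)) | r a c.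
        r \<in> carrier K \<and> a \<in> carrier M \<and> c \<in> carrier N})"

definition tensor_product ::
  "('k, 'r) ring_scheme \<Rightarrow> ('k, 'm, 's) module_scheme \<Rightarrow> ('k, 'n, 't) module_scheme
    \<Rightarrow> ('k, ('m \<times> 'n \<Rightarrow> 'k) set) module" where
  "tensor_product K M N = presented_module K (carrier M \<times> carrier N) (bilinear_rels K M N)"

definition tensor_pure ::
  "('k, 'r) ring_scheme \<Rightarrow> ('k, 'm, 's) module_scheme \<Rightarrow> ('k, 'n, 't) module_scheme
    \<Rightarrow> 'm \<Rightarrow> 'n \<Rightarrow> ('m \<times> 'n \<Rightarrow> 'k) set" where
  "tensor_pure K M N a c =
    presented_gen K (carrier M \<times> carrier N) (bilinear_rels K M N) (a, c)"

subsection \<open>Tensor powers\<close>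

text \<open>
  The \<open>n\<close>-fold tensor power is generated by lists of length \<open>n\<close>, so that all tensor powers
  of a module live in one type.
\<close>

definition power_gens :: "('k, 'm, 's) module_scheme \<Rightarrow> nat \<Rightarrow> 'm list set" where
  "power_gens M n = {xs. length xs = n \<and> set xs \<subseteq> carrier M}"

definition multilinear_rels ::
  "('k, 'r) ring_scheme \<Rightarrow> ('k, 'm, 's) module_scheme \<Rightarrow> nat \<Rightarrow> ('m list \<Rightarrow> 'k) set" where
  "multilinear_rels K M n = (let F = free_module K (power_gens M n); \<delta> = free_gen K in
      {\<delta> (xs @ [a \<oplus>\<^bsub>M\<^esub> b] @ ys) \<ominus>\<^bsub>F\<^esub> (\<delta> (xs @ [a] @ ys) \<oplus>\<^bsub>F\<^esub> \<delta> (xs @ [b] @ ys)) | xs a b ys.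
        xs @ [a] @ ys \<in> power_gens M n \<and> b \<in> carrier M}
    \<union> {\<delta> (xs @ [r \<odot>\<^bsub>M\<^esub> a] @ ys) \<ominus>\<^bsub>F\<^esub> (r \<odot>\<^bsub>F\<^esub> \<delta> (xs @ [a] @ ys)) | r xs a ys.
        r \<in> carrier K \<and> xs @ [a] @ ys \<in> power_gens M n})"

definition tensor_power ::
  "('k, 'r) ring_scheme \<Rightarrow> ('k, 'm, 's) module_scheme \<Rightarrow> nat \<Rightarrow> ('k, ('m list \<Rightarrow> 'k) set) module" where
  "tensor_power K M n = presented_module K (power_gens M n) (multilinear_rels K M n)"

definition power_pure ::
  "('k, 'r) ring_scheme \<Rightarrow> ('k, 'm, 's) module_scheme \<Rightarrow> 'm list \<Rightarrow> ('m list \<Rightarrow> 'k) set" where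
  "power_pure K M xs =
    presented_gen K (power_gens M (length xs)) (multilinear_rels K M (length xs)) xs"

text \<open>The canonical map from \<open>M\<^sup>m \<times> M\<^sup>n\<close> to \<open>M\<^sup>m\<^sup>+\<^sup>n\<close> (tensor powers).\<close>

definition tensor_append ::
  "('k, 'r) ring_scheme \<Rightarrow> ('k, 'm, 's) module_scheme \<Rightarrow> nat \<Rightarrow> nat
    \<Rightarrow> ('m list \<Rightarrow> 'k) set \<Rightarrow> ('m list \<Rightarrow> 'k) set \<Rightarrow> ('m list \<Rightarrow> 'k) set" where
  "tensor_append K M m n s t =
    lin_ext K (tensor_power K M (m + n))
      (\<lambda>xs. lin_ext K (tensor_power K M (m + n)) (\<lambda>ys. power_pure K M (xs @ ys)) t) s"

text \<open>The map \<open>f\<^sub>1 \<otimes> \<dots> \<otimes> f\<^sub>n\<close> on the \<open>n\<close>-fold tensor power, for \<open>fs = [f\<^sub>1, \<dots>, f\<^sub>n]\<close>.\<close>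

definition tensor_maps ::
  "('k, 'r) ring_scheme \<Rightarrow> ('k, 'm, 's) module_scheme \<Rightarrow> ('m \<Rightarrow> 'm) list
    \<Rightarrow> ('m list \<Rightarrow> 'k) set \<Rightarrow> ('m list \<Rightarrow> 'k) set" where
  "tensor_maps K M fs =
    lin_ext K (tensor_power K M (length fs)) (\<lambda>xs. power_pure K M (map2 (\<lambda>f x. f x) fs xs))"

text \<open>The componentwise multiplication of the \<open>n\<close>-fold tensor power of an algebra.\<close>

definition tensor_mult ::
  "('k, 'r) ring_scheme \<Rightarrow> ('k, 'm, 's) module_scheme \<Rightarrow> nat
    \<Rightarrow> ('m list \<Rightarrow> 'k) set \<Rightarrow> ('m list \<Rightarrow> 'k) set \<Rightarrow> ('m list \<Rightarrow> 'k) set" where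
  "tensor_mult K A n s t =
    lin_ext K (tensor_power K A n)
      (\<lambda>xs. lin_ext K (tensor_power K A n) (\<lambda>ys. power_pure K A (map2 (mult A) xs ys)) t) s"

text \<open>The multiplication map \<open>h\<^sub>1 \<otimes> \<dots> \<otimes> h\<^sub>n \<mapsto> h\<^sub>1 \<cdots> h\<^sub>n\<close>.\<close>

definition iter_mult ::
  "('k, 'r) ring_scheme \<Rightarrow> ('k, 'm, 's) module_scheme \<Rightarrow> ('m list \<Rightarrow> 'k) set \<Rightarrow> 'm" where
  "iter_mult K A = lin_ext K A (\<lambda>xs. foldr (mult A) xs \<one>\<^bsub>A\<^esub>)"


section \<open>Hopf algebras\<close>

text \<open>The comultiplication takes values in the second tensor power.\<close>

record ('k, 'h) hopf = "('k, 'h) module" +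
  comult :: "'h \<Rightarrow> ('h list \<Rightarrow> 'k) set"
  counit :: "'h \<Rightarrow> 'k"
  antipode :: "'h \<Rightarrow> 'h"

locale hopf_algebra = vectorspace K H + H: ring H
  for K :: "('k, 'r) ring_scheme" and H :: "('k, 'h, 's) hopf_scheme" +
  assumes smult_mult_left:
      "\<lbrakk>r \<in> carrier K; x \<in> carrier H; y \<in> carrier H\<rbrakk>
        \<Longrightarrow> (r \<odot>\<^bsub>H\<^esub> x) \<otimes>\<^bsub>H\<^esub> y = r \<odot>\<^bsub>H\<^esub> (x \<otimes>\<^bsub>H\<^esub> y)"
    and smult_mult_right:
      "\<lbrakk>r \<in> carrier K; x \<in> carrier H; y \<in> carrier H\<rbrakk>
        \<Longrightarrow> x \<otimes>\<^bsub>H\<^esub> (r \<odot>\<^bsub>H\<^esub> y) = r \<odot>\<^bsub>H\<^esub> (x \<otimes>\<^bsub>H\<^esub> y)"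
    and comult_hom: "comult H \<in> LinearCombinations.module_hom K H (tensor_power K H 2)"
    and counit_hom: "counit H \<in> LinearCombinations.module_hom K H (self_module K)"
    and coassoc:
      "h \<in> carrier H \<Longrightarrow>
        lin_ext K (tensor_power K H 3)
          (\<lambda>xs. tensor_append K H 2 1 (comult H (xs ! 0)) (power_pure K H [xs ! 1])) (comult H h)
        = lin_ext K (tensor_power K H 3)
          (\<lambda>xs. tensor_append K H 1 2 (power_pure K H [xs ! 0]) (comult H (xs ! 1))) (comult H h)"
    and counit_left:
      "h \<in> carrier H \<Longrightarrow> lin_ext K H (\<lambda>xs. counit H (xs ! 0) \<odot>\<^bsub>H\<^esub> xs ! 1) (comult H h) = h"
    and counit_right:
      "h \<in> carrier H \<Longrightarrow> lin_ext K H (\<lambda>xs. counit H (xs ! 1) \<odot>\<^bsub>H\<^esub> xs ! 0) (comult H h) = h"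
    and comult_mult:
      "\<lbrakk>x \<in> carrier H; y \<in> carrier H\<rbrakk>
        \<Longrightarrow> comult H (x \<otimes>\<^bsub>H\<^esub> y) = tensor_mult K H 2 (comult H x) (comult H y)"
    and comult_one: "comult H \<one>\<^bsub>H\<^esub> = power_pure K H [\<one>\<^bsub>H\<^esub>, \<one>\<^bsub>H\<^esub>]"
    and counit_mult:
      "\<lbrakk>x \<in> carrier H; y \<in> carrier H\<rbrakk> \<Longrightarrow> counit H (x \<otimes>\<^bsub>H\<^esub> y) = counit H x \<otimes>\<^bsub>K\<^esub> counit H y"
    and counit_one: "counit H \<one>\<^bsub>H\<^esub> = \<one>\<^bsub>K\<^esub>"
    and antipode_hom: "antipode H \<in> LinearCombinations.module_hom K H H"
    and antipode_left:
      "h \<in> carrier H \<Longrightarrow>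
        lin_ext K H (\<lambda>xs. antipode H (xs ! 0) \<otimes>\<^bsub>H\<^esub> xs ! 1) (comult H h) = counit H h \<odot>\<^bsub>H\<^esub> \<one>\<^bsub>H\<^esub>"
    and antipode_right:
      "h \<in> carrier H \<Longrightarrow>
        lin_ext K H (\<lambda>xs. xs ! 0 \<otimes>\<^bsub>H\<^esub> antipode H (xs ! 1)) (comult H h) = counit H h \<odot>\<^bsub>H\<^esub> \<one>\<^bsub>H\<^esub>"

text \<open>
  The iterated comultiplication \<open>h \<mapsto> h\<^sub>(\<^sub>1\<^sub>) \<otimes> \<dots> \<otimes> h\<^sub>(\<^sub>n\<^sub>)\<close>. The first equation is the usual
  convention for \<open>n = 0\<close>; the exponents only involve \<open>n \<ge> 1\<close>.
\<close>

fun iter_comult ::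
  "('k, 'r) ring_scheme \<Rightarrow> ('k, 'h, 's) hopf_scheme \<Rightarrow> nat \<Rightarrow> 'h \<Rightarrow> ('h list \<Rightarrow> 'k) set" where
  "iter_comult K H 0 h = counit H h \<odot>\<^bsub>tensor_power K H 0\<^esub> power_pure K H []"
| "iter_comult K H (Suc 0) h = power_pure K H [h]"
| "iter_comult K H (Suc (Suc n)) h =
    lin_ext K (tensor_power K H (Suc (Suc n)))
      (\<lambda>xs. tensor_append K H (Suc n) 1
        (iter_comult K H (Suc n) (xs ! 0)) (power_pure K H [xs ! 1]))
      (comult H h)"


section \<open>Exponents\<close>

text \<open>The infimum of the empty set in \<^typ>\<open>enat\<close> is \<open>\<infinity>\<close>.\<close>

definition hopf_exp :: "('k, 'r) ring_scheme \<Rightarrow> ('k, 'h, 's) hopf_scheme \<Rightarrow> enat" where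
  "hopf_exp K H = Inf (enat ` {n. 1 \<le> n \<and> (\<forall>h\<in>carrier H.
    iter_mult K H
      (tensor_maps K H (map (\<lambda>i. inv_into (carrier H) (antipode H) ^^ (2 * i)) [0..<n])
        (iter_comult K H n h))
    = counit H h \<odot>\<^bsub>H\<^esub> \<one>\<^bsub>H\<^esub>)})"

definition hopf_exp0 :: "('k, 'r) ring_scheme \<Rightarrow> ('k, 'h, 's) hopf_scheme \<Rightarrow> enat" where
  "hopf_exp0 K H = Inf (enat ` {n. 1 \<le> n \<and> (\<forall>h\<in>carrier H.
    iter_mult K H (iter_comult K H n h) = counit H h \<odot>\<^bsub>H\<^esub> \<one>\<^bsub>H\<^esub>)})"

fun enat_lcm :: "enat \<Rightarrow> enat \<Rightarrow> enat" where
  "enat_lcm (enat m) (enat n) = enat (lcm m n)"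
| "enat_lcm \<infinity> _ = \<infinity>"
| "enat_lcm _ \<infinity> = \<infinity>"


section \<open>The Hopf algebra \<open>H \<rtimes> K\<langle>S\<^sup>2\<rangle>\<close>\<close>

definition group_algebra ::
  "('k, 'r) ring_scheme \<Rightarrow> ('g, 's) monoid_scheme \<Rightarrow> ('k, 'g \<Rightarrow> 'k) hopf" where
  "group_algebra K G = (let F = free_module K (carrier G); \<delta> = free_gen K in
    \<lparr>carrier = carrier F,
     mult = (\<lambda>p q. free_ext K F (\<lambda>g. free_ext K F (\<lambda>h. \<delta> (g \<otimes>\<^bsub>G\<^esub> h)) q) p),
     one = \<delta> \<one>\<^bsub>G\<^esub>,
     zero = \<zero>\<^bsub>F\<^esub>,
     add = add F,
     smult = smult F,
     comult = free_ext K (tensor_power K F 2) (\<lambda>g. power_pure K F [\<delta> g, \<delta> g]),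
     counit = free_ext K (self_module K) (\<lambda>_. \<one>\<^bsub>K\<^esub>),
     antipode = free_ext K F (\<lambda>g. \<delta> (inv\<^bsub>G\<^esub> g))\<rparr>)"

text \<open>
  The tensor product of two coalgebras, with
  \<open>\<Delta>(c \<otimes> d) = \<Sum> (c\<^sub>(\<^sub>1\<^sub>) \<otimes> d\<^sub>(\<^sub>1\<^sub>)) \<otimes> (c\<^sub>(\<^sub>2\<^sub>) \<otimes> d\<^sub>(\<^sub>2\<^sub>))\<close> and \<open>\<epsilon>(c \<otimes> d) = \<epsilon>(c) \<epsilon>(d)\<close>.
\<close>

definition tensor_comult ::
  "('k, 'r) ring_scheme \<Rightarrow> ('k, 'c, 's) hopf_scheme \<Rightarrow> ('k, 'd, 't) hopf_scheme
    \<Rightarrow> ('c \<times> 'd \<Rightarrow> 'k) set \<Rightarrow> (('c \<times> 'd \<Rightarrow> 'k) set list \<Rightarrow> 'k) set" where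
  "tensor_comult K C D = (let T = tensor_product K C D; P = tensor_power K T 2 in
    lin_ext K P (\<lambda>(c, d).
      lin_ext K P (\<lambda>xs.
        lin_ext K P (\<lambda>ys.
          power_pure K T [tensor_pure K C D (xs ! 0) (ys ! 0), tensor_pure K C D (xs ! 1) (ys ! 1)])
        (comult D d))
      (comult C c)))"

definition tensor_counit ::
  "('k, 'r) ring_scheme \<Rightarrow> ('k, 'c, 's) hopf_scheme \<Rightarrow> ('k, 'd, 't) hopf_scheme
    \<Rightarrow> ('c \<times> 'd \<Rightarrow> 'k) set \<Rightarrow> 'k" where
  "tensor_counit K C D =
    lin_ext K (self_module K) (\<lambda>(c, d). counit C c \<otimes>\<^bsub>K\<^esub> counit D d)"

text \<open>
  The smash product of \<open>H\<close> with a group \<open>G\<close> of Hopf algebra automorphisms of \<open>H\<close>: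
  \<open>(h \<rtimes> \<sigma>) (k \<rtimes> \<tau>) = h \<sigma>(k) \<rtimes> \<sigma>\<tau>\<close>, with antipode \<open>h \<rtimes> \<sigma> \<mapsto> \<sigma>\<inverse>(S(h)) \<rtimes> \<sigma>\<inverse>\<close>. For
  \<open>\<sigma> = S\<^sup>2\<^sup>i\<close> the latter is \<open>S\<^sup>-\<^sup>2\<^sup>i\<^sup>+\<^sup>1(h) \<rtimes> S\<^sup>-\<^sup>2\<^sup>i\<close>.
\<close>

definition smash_product ::
  "('k, 'r) ring_scheme \<Rightarrow> ('k, 'h, 's) hopf_scheme \<Rightarrow> ('h \<Rightarrow> 'h, 't) monoid_scheme
    \<Rightarrow> ('k, ('h \<times> (('h \<Rightarrow> 'h) \<Rightarrow> 'k) \<Rightarrow> 'k) set) hopf" where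
  "smash_product K H G =
    (let A = group_algebra K G; T = tensor_product K H A;
         el = (\<lambda>h \<sigma>. tensor_pure K H A h (free_gen K \<sigma>)) in
    \<lparr>carrier = carrier T,
     mult = (\<lambda>s t.
       lin_ext K T (\<lambda>(h, p). free_ext K T (\<lambda>\<sigma>.
         lin_ext K T (\<lambda>(k, q). free_ext K T (\<lambda>\<tau>.
           el (h \<otimes>\<^bsub>H\<^esub> \<sigma> k) (\<sigma> \<otimes>\<^bsub>G\<^esub> \<tau>)) q) t) p) s),
     one = el \<one>\<^bsub>H\<^esub> \<one>\<^bsub>G\<^esub>,
     zero = \<zero>\<^bsub>T\<^esub>,
     add = add T,
     smult = smult T,
     comult = tensor_comult K H A,
     counit = tensor_counit K H A,
     antipode = lin_ext K T (\<lambda>(h, p). free_ext K T (\<lambda>\<sigma>.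
       el ((inv\<^bsub>G\<^esub> \<sigma>) (antipode H h)) (inv\<^bsub>G\<^esub> \<sigma>)) p)\<rparr>)"

text \<open>
  The group generated by the square of the antipode. Elements of \<^const>\<open>BijGroup\<close> are restricted
  to the carrier, so that two of them are equal iff they agree as maps on \<open>H\<close>.
\<close>

definition antipode_sq_group :: "('k, 'h, 's) hopf_scheme \<Rightarrow> ('h \<Rightarrow> 'h) monoid" where
  "antipode_sq_group H =
    subgroup_generated (BijGroup (carrier H)) {\<lambda>h\<in>carrier H. antipode H (antipode H h)}"

end

(*
Write g for the square of the antipode and * for convolution of linear endomorphisms of H, and put
P_j(n) = id * g^j * g^(2j) * ... * g^((n-1)j). The condition defining exp_0(H) is P_0(n) = eps, the
one defining exp(H) is P_{-1}(n) = eps, and on h # g^j the element whose triviality defines the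
exponent of the smash product is P_{j-1}(n)(h) # g^(nj). So n is admissible for the smash product
iff g^n = id and P_j(n) = eps for all integers j. If P_{-1}(n) = eps, then computing P_{-1}(n+1)
with the last, respectively the first, factor split off gives g^(-n) = id. Radford's formula says
that g^2 is conjugation by a grouplike element a composed with the coadjoint action of a character
alpha; it rests on the existence of integrals and shows that P_{j+2}(n) = eps implies P_j(n) = eps,
and periodicity in j then gives all j from j = 0 and j = -1. As P_j(m+n) = P_j(m) * g^(mj) P_j(n),
the two sets of admissible n consist of the multiples of their minimum, and their intersection of
the multiples of the lcm.
*)
theory Submission
  imports Defs
begin

section \<open>Modules by generators and relations\<close>

text \<open>Elements of tensor powers are cosets without a normal form, so identities are stated
  through Sweedler sums \<open>sw h B\<close> with values in H, and linear forms are endomorphisms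
  with values in the multiples of 1. End(H) is then the only convolution algebra: uniqueness
  arguments that usually live in Hom(H \<otimes> H, H) or Hom(H, H \<otimes> H) are carried out one
  variable at a time by cancelling \<open>idm\<close> against \<open>S\<close>, or in coordinates. A
  nonzero integral comes from a trace formula; uniqueness of integrals is replaced by computations
  with a pair l, \<Lambda> such that l(\<Lambda>) = 1. Radford's formula gives the step from j + 2
  to j through Z(h) = \<alpha>(h) a, for which it reads g^i * Z = Z * g^(i+2). Insert a Z after each
  of the n factors of P_{j+2}(n) and move all of them to the front: the exponent m(j+2) of factor m
  becomes mj + 2n, so Z^n times a translate of P_j(n) arises. The same interleaved product is, up to
  a scalar, the image of P_{j+2}(n) under a convolution homomorphism, hence trivial, and Z^n is
  trivial as well.\<close>

abbreviation linear_maps ::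
  "('k, 'r) ring_scheme \<Rightarrow> ('k, 'm, 's) module_scheme \<Rightarrow> ('k, 'n, 't) module_scheme \<Rightarrow> ('m \<Rightarrow> 'n) set" where
  "linear_maps \<equiv> LinearCombinations.module_hom"

lemma linear_mapsI:
  assumes "\<And>x. x \<in> carrier M \<Longrightarrow> f x \<in> carrier N"
    and "\<And>x y. x \<in> carrier M \<Longrightarrow> y \<in> carrier M \<Longrightarrow> f (x \<oplus>\<^bsub>M\<^esub> y) = f x \<oplus>\<^bsub>N\<^esub> f y"
    and "\<And>r x. r \<in> carrier K \<Longrightarrow> x \<in> carrier M \<Longrightarrow> f (r \<odot>\<^bsub>M\<^esub> x) = r \<odot>\<^bsub>N\<^esub> f x"
  shows "f \<in> linear_maps K M N"
  using assms by (auto simp: LinearCombinations.module_hom_def)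

lemma linear_maps_closed: "f \<in> linear_maps K M N \<Longrightarrow> x \<in> carrier M \<Longrightarrow> f x \<in> carrier N"
  using LinearCombinations.module_hom_closed by fastforce

lemmas linear_maps_add = LinearCombinations.module_hom_add
lemmas linear_maps_smult = LinearCombinations.module_hom_smult

lemma linear_maps_compose:
  assumes "f \<in> linear_maps K M N" "g \<in> linear_maps K N P"
  shows "(\<lambda>x. g (f x)) \<in> linear_maps K M P"
  using assms by (auto intro!: linear_mapsI
    simp: linear_maps_closed linear_maps_add linear_maps_smult)

lemma mod_homI:
  assumes "Module.module K M" "Module.module K N" "f \<in> linear_maps K M N"
  shows "mod_hom K M N f"
  using assms by (simp add: mod_hom_def mod_hom_axioms_def)

section \<open>Free modules and linear extension from generators\<close>

lemma free_simps:
  "carrier (free_module K X) =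
    {p. p \<in> UNIV \<rightarrow> carrier K \<and> finite {x. p x \<noteq> \<zero>\<^bsub>K\<^esub>} \<and> {x. p x \<noteq> \<zero>\<^bsub>K\<^esub>} \<subseteq> X}"
  "p \<oplus>\<^bsub>free_module K X\<^esub> q = (\<lambda>x. p x \<oplus>\<^bsub>K\<^esub> q x)"
  "r \<odot>\<^bsub>free_module K X\<^esub> p = (\<lambda>x. r \<otimes>\<^bsub>K\<^esub> p x)"
  "\<zero>\<^bsub>free_module K X\<^esub> = (\<lambda>_. \<zero>\<^bsub>K\<^esub>)"
  by (simp_all add: free_module_def)

lemma (in cring) free_add_closed:
  assumes "p \<in> carrier (free_module R X)" "q \<in> carrier (free_module R X)"
  shows "(\<lambda>x. p x \<oplus> q x) \<in> carrier (free_module R X)"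
proof -
  have "{x. p x \<oplus> q x \<noteq> \<zero>} \<subseteq> {x. p x \<noteq> \<zero>} \<union> {x. q x \<noteq> \<zero>}" by auto
  then show ?thesis using assms by (auto simp: free_simps Pi_iff intro: finite_subset)
qed

lemma (in cring) free_smult_closed:
  assumes "p \<in> carrier (free_module R X)" "r \<in> carrier R"
  shows "(\<lambda>x. r \<otimes> p x) \<in> carrier (free_module R X)"
proof -
  have "{x. r \<otimes> p x \<noteq> \<zero>} \<subseteq> {x. p x \<noteq> \<zero>}" using assms by auto
  then show ?thesis using assms by (auto simp: free_simps Pi_iff intro: finite_subset)
qed

lemma (in cring) free_module_module: "Module.module R (free_module R X)"
proof (rule moduleI)
  show "abelian_group (free_module R X)"
  proof (rule abelian_groupI)
    fix p assume p: "p \<in> carrier (free_module R X)"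
    then have "(\<lambda>x. (\<ominus> \<one>) \<otimes> p x) \<in> carrier (free_module R X)"
      by (intro free_smult_closed) auto
    moreover have "(\<lambda>x. (\<ominus> \<one>) \<otimes> p x) \<oplus>\<^bsub>free_module R X\<^esub> p = \<zero>\<^bsub>free_module R X\<^esub>"
      using p by (auto simp: free_simps Pi_iff fun_eq_iff l_minus l_neg)
    ultimately show "\<exists>q\<in>carrier (free_module R X). q \<oplus>\<^bsub>free_module R X\<^esub> p = \<zero>\<^bsub>free_module R X\<^esub>"
      by blast
  qed (use free_add_closed in \<open>auto simp: free_simps Pi_iff fun_eq_iff a_ac\<close>)
next
  fix r p assume "r \<in> carrier R" "p \<in> carrier (free_module R X)"
  then show "r \<odot>\<^bsub>free_module R X\<^esub> p \<in> carrier (free_module R X)"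
    by (subst free_simps(3)) (rule free_smult_closed)
qed (auto simp: free_simps Pi_iff fun_eq_iff l_distr r_distr m_assoc is_cring)

lemma (in cring) free_gen_closed: "x \<in> X \<Longrightarrow> free_gen R x \<in> carrier (free_module R X)"
proof -
  assume "x \<in> X"
  moreover have "{y. free_gen R x y \<noteq> \<zero>} \<subseteq> {x}" by (auto simp: free_gen_def)
  ultimately show ?thesis
    by (auto simp: free_simps free_gen_def intro: finite_subset)
qed

text \<open>\<open>free_ext\<close> sums over the exact support, and the support of p + q can be
  smaller than the union of the two supports. Summing over a common finite superset, where the
  additional terms vanish, makes additivity provable.\<close>

lemma (in Module.module) free_ext_superset:
  assumes "p \<in> carrier (free_module R X)" "f \<in> X \<rightarrow> carrier M"
    and "finite A" "{x. p x \<noteq> \<zero>} \<subseteq> A" "A \<subseteq> X"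
  shows "free_ext R M f p = (\<Oplus>\<^bsub>M\<^esub>x\<in>A. p x \<odot>\<^bsub>M\<^esub> f x)"
  unfolding free_ext_def using assms
  by (intro M.add.finprod_mono_neutral_cong_left) (auto simp: free_simps Pi_iff subset_iff)

lemma (in Module.module) free_ext_hom:
  assumes f: "f \<in> X \<rightarrow> carrier M"
  shows "free_ext R M f \<in> linear_maps R (free_module R X) M"
proof (rule linear_mapsI)
  fix p assume p: "p \<in> carrier (free_module R X)"
  then show "free_ext R M f p \<in> carrier M"
    using f unfolding free_ext_def by (intro M.finsum_closed) (auto simp: free_simps Pi_iff)
next
  fix p q assume p: "p \<in> carrier (free_module R X)" and q: "q \<in> carrier (free_module R X)"
  let ?A = "{x. p x \<noteq> \<zero>} \<union> {x. q x \<noteq> \<zero>}"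
  have fin: "finite ?A" "?A \<subseteq> X" using p q by (auto simp: free_simps)
  have c: "p x \<in> carrier R" "q x \<in> carrier R" for x using p q by (auto simp: free_simps)
  have "free_ext R M f (\<lambda>x. p x \<oplus> q x) = (\<Oplus>\<^bsub>M\<^esub>x\<in>?A. (p x \<oplus> q x) \<odot>\<^bsub>M\<^esub> f x)"
    using c by (intro free_ext_superset[of _ X] R.free_add_closed p q f fin) auto
  also have "\<dots> = (\<Oplus>\<^bsub>M\<^esub>x\<in>?A. p x \<odot>\<^bsub>M\<^esub> f x \<oplus>\<^bsub>M\<^esub> q x \<odot>\<^bsub>M\<^esub> f x)"
    using c f fin by (intro M.finsum_cong' refl) (auto simp: smult_l_distr Pi_iff subset_iff)
  also have "\<dots> = (\<Oplus>\<^bsub>M\<^esub>x\<in>?A. p x \<odot>\<^bsub>M\<^esub> f x) \<oplus>\<^bsub>M\<^esub> (\<Oplus>\<^bsub>M\<^esub>x\<in>?A. q x \<odot>\<^bsub>M\<^esub> f x)"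
    using c f fin by (intro M.finsum_addf) (auto simp: Pi_iff subset_iff)
  also have "\<dots> = free_ext R M f p \<oplus>\<^bsub>M\<^esub> free_ext R M f q"
    using p q f fin by (simp add: free_ext_superset[of p X f ?A] free_ext_superset[of q X f ?A])
  finally show "free_ext R M f (p \<oplus>\<^bsub>free_module R X\<^esub> q) = free_ext R M f p \<oplus>\<^bsub>M\<^esub> free_ext R M f q"
    by (simp add: free_simps)
next
  fix r p assume r: "r \<in> carrier R" and p: "p \<in> carrier (free_module R X)"
  let ?A = "{x. p x \<noteq> \<zero>}"
  have fin: "finite ?A" "?A \<subseteq> X" using p by (auto simp: free_simps)
  have c: "p x \<in> carrier R" for x using p by (auto simp: free_simps)
  have "free_ext R M f (\<lambda>x. r \<otimes> p x) = (\<Oplus>\<^bsub>M\<^esub>x\<in>?A. (r \<otimes> p x) \<odot>\<^bsub>M\<^esub> f x)"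
    using r by (intro free_ext_superset[of _ X] R.free_smult_closed p f fin) auto
  also have "\<dots> = (\<Oplus>\<^bsub>M\<^esub>x\<in>?A. r \<odot>\<^bsub>M\<^esub> (p x \<odot>\<^bsub>M\<^esub> f x))"
    using c f fin r by (intro M.finsum_cong' refl) (auto simp: smult_assoc1 Pi_iff subset_iff)
  also have "\<dots> = r \<odot>\<^bsub>M\<^esub> free_ext R M f p"
    unfolding free_ext_def using c f fin r
    by (intro finsum_smult_ldistr[symmetric]) (auto simp: Pi_iff subset_iff)
  finally show "free_ext R M f (r \<odot>\<^bsub>free_module R X\<^esub> p) = r \<odot>\<^bsub>M\<^esub> free_ext R M f p"
    by (simp add: free_simps)
qed

lemma (in Module.module) free_ext_gen:
  assumes "f \<in> X \<rightarrow> carrier M" "x \<in> X"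
  shows "free_ext R M f (free_gen R x) = f x"
proof -
  have "free_ext R M f (free_gen R x) = (\<Oplus>\<^bsub>M\<^esub>y\<in>{x}. free_gen R x y \<odot>\<^bsub>M\<^esub> f y)"
    using assms by (intro free_ext_superset[of _ X] R.free_gen_closed) (auto simp: free_gen_def)
  also have "\<dots> = f x" using assms by (subst M.finsum_insert) (auto simp: free_gen_def Pi_iff)
  finally show ?thesis .
qed

lemma (in cring) free_induct:
  assumes "p \<in> carrier (free_module R X)"
    and "P (\<lambda>_. \<zero>)"
    and "\<And>c x p. \<lbrakk>c \<in> carrier R; x \<in> X; p \<in> carrier (free_module R X); P p\<rbrakk>
      \<Longrightarrow> P (c \<odot>\<^bsub>free_module R X\<^esub> free_gen R x \<oplus>\<^bsub>free_module R X\<^esub> p)"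
  shows "P p"
  using assms(1)
proof (induction "card {x. p x \<noteq> \<zero>}" arbitrary: p)
  case 0
  then have "p = (\<lambda>_. \<zero>)" by (auto simp: free_simps)
  then show ?case using assms(2) by simp
next
  case (Suc n)
  have c: "p x \<in> carrier R" for x using Suc.prems by (auto simp: free_simps)
  obtain x where x: "p x \<noteq> \<zero>" using Suc.hyps(2) by (metis (mono_tags) card.empty empty_Collect_eq nat.simps(3))
  let ?q = "p(x := \<zero>)"
  have eq: "{y. ?q y \<noteq> \<zero>} = {y. p y \<noteq> \<zero>} - {x}" by auto
  have q: "?q \<in> carrier (free_module R X)"
    using Suc.prems eq by (auto simp: free_simps Pi_iff)
  have "n = card {y. ?q y \<noteq> \<zero>}"
    using Suc.hyps(2) Suc.prems x unfolding eq by (subst card_Diff_singleton) (auto simp: free_simps)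
  then have "P ?q" using Suc.hyps(1) q by blast
  moreover have "x \<in> X" using x Suc.prems by (auto simp: free_simps)
  ultimately have "P (p x \<odot>\<^bsub>free_module R X\<^esub> free_gen R x \<oplus>\<^bsub>free_module R X\<^esub> ?q)"
    using assms(3) c q by blast
  moreover have "p x \<odot>\<^bsub>free_module R X\<^esub> free_gen R x \<oplus>\<^bsub>free_module R X\<^esub> ?q = p"
    using c by (auto simp: free_simps fun_eq_iff free_gen_def)
  ultimately show ?case by simp
qed

section \<open>Quotient modules\<close>

lemma submodule_abelian_subgroup:
  assumes "LinearCombinations.submodule K N M"
  shows "abelian_subgroup N M"
proof -
  interpret S: LinearCombinations.submodule K N M by fact
  interpret Module.module K M by (fact S.module)
  have "subgroup N (add_monoid M)"
  proof (rule group.subgroupI[OF M.a_group])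
    fix a assume a: "a \<in> N"
    have "(\<ominus>\<^bsub>K\<^esub> \<one>\<^bsub>K\<^esub>) \<odot>\<^bsub>M\<^esub> a \<in> N" using a by (intro S.smult_closed R.a_inv_closed R.one_closed)
    moreover have "(\<ominus>\<^bsub>K\<^esub> \<one>\<^bsub>K\<^esub>) \<odot>\<^bsub>M\<^esub> a = \<ominus>\<^bsub>M\<^esub> a"
      using a S.subset smult_l_minus[of "\<one>\<^bsub>K\<^esub>" a] by auto
    ultimately show "inv\<^bsub>add_monoid M\<^esub> a \<in> N" by (simp add: a_inv_def)
  qed (use S.subset S.zero_closed in \<open>auto simp del: S.zero_closed\<close>)
  then show ?thesis
    by (intro abelian_subgroupI3 additive_subgroup.intro M.abelian_group_axioms)
qed

context
  fixes K :: "('k, 'r) ring_scheme" and M :: "('k, 'm, 's) module_scheme" and N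
  assumes sub: "LinearCombinations.submodule K N M"
begin

interpretation S: LinearCombinations.submodule K N M by (fact sub)
interpretation Module.module K M by (fact S.module)
interpretation A: abelian_subgroup N M by (rule submodule_abelian_subgroup[OF sub])

lemma quotient_simps:
  "carrier (quotient_module M N) = (\<lambda>a. N +>\<^bsub>M\<^esub> a) ` carrier M"
  "\<zero>\<^bsub>quotient_module M N\<^esub> = N +>\<^bsub>M\<^esub> \<zero>\<^bsub>M\<^esub>"
  using A.a_rcos_const[OF S.zero_closed]
  by (auto simp: quotient_module_def A_RCOSETS_def RCOSETS_def a_r_coset_def image_def)

lemma quotient_add:
  "a \<in> carrier M \<Longrightarrow> b \<in> carrier M \<Longrightarrow>
    (N +>\<^bsub>M\<^esub> a) \<oplus>\<^bsub>quotient_module M N\<^esub> (N +>\<^bsub>M\<^esub> b) = N +>\<^bsub>M\<^esub> (a \<oplus>\<^bsub>M\<^esub> b)"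
  by (simp add: quotient_module_def A.a_rcos_sum)

lemma in_coset_iff: "x \<in> N +>\<^bsub>M\<^esub> b \<longleftrightarrow> (\<exists>a\<in>N. x = a \<oplus>\<^bsub>M\<^esub> b)"
  by (auto simp: a_r_coset_def')

lemma coset_eqI:
  assumes "a \<in> N" "b \<in> carrier M"
  shows "N +>\<^bsub>M\<^esub> (a \<oplus>\<^bsub>M\<^esub> b) = N +>\<^bsub>M\<^esub> b"
proof -
  have "a \<oplus>\<^bsub>M\<^esub> b \<in> N +>\<^bsub>M\<^esub> b" using assms in_coset_iff by blast
  from M.a_repr_independence[OF this assms(2) A.a_subgroup] show ?thesis by (rule sym)
qed

text \<open>The scalar action on a coset is defined as a union over its representatives. All members
  of that union coincide, and the index set is nonempty because b lies in its own coset.\<close>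

lemma quotient_smult:
  assumes "r \<in> carrier K" "b \<in> carrier M"
  shows "r \<odot>\<^bsub>quotient_module M N\<^esub> (N +>\<^bsub>M\<^esub> b) = N +>\<^bsub>M\<^esub> (r \<odot>\<^bsub>M\<^esub> b)"
proof -
  have "N +>\<^bsub>M\<^esub> (r \<odot>\<^bsub>M\<^esub> x) = N +>\<^bsub>M\<^esub> (r \<odot>\<^bsub>M\<^esub> b)" if x: "x \<in> N +>\<^bsub>M\<^esub> b" for x
  proof -
    obtain a where a: "a \<in> N" "x = a \<oplus>\<^bsub>M\<^esub> b" using x in_coset_iff by blast
    then have "r \<odot>\<^bsub>M\<^esub> x = r \<odot>\<^bsub>M\<^esub> a \<oplus>\<^bsub>M\<^esub> r \<odot>\<^bsub>M\<^esub> b"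
      using assms S.subset by (simp add: smult_r_distr subset_iff)
    then show ?thesis using a assms by (simp add: coset_eqI)
  qed
  moreover have "b \<in> N +>\<^bsub>M\<^esub> b" 
    unfolding in_coset_iff using assms by (intro bexI[of _ "\<zero>\<^bsub>M\<^esub>"]) (simp_all add: S.zero_closed)
  ultimately have "(\<Union>x\<in>N +>\<^bsub>M\<^esub> b. N +>\<^bsub>M\<^esub> (r \<odot>\<^bsub>M\<^esub> x)) = N +>\<^bsub>M\<^esub> (r \<odot>\<^bsub>M\<^esub> b)"
    by (metis (no_types, lifting) SUP_cong UN_constant empty_iff)
  then show ?thesis by (simp add: quotient_module_def)
qed

lemma quotient_module_module: "Module.module K (quotient_module M N)"
proof (rule moduleI)
  show "abelian_group (quotient_module M N)"
  proof (rule abelian_groupI)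
    fix x assume "x \<in> carrier (quotient_module M N)"
    then obtain a where a: "a \<in> carrier M" "x = N +>\<^bsub>M\<^esub> a" by (auto simp: quotient_simps)
    then show "\<exists>y\<in>carrier (quotient_module M N).
        y \<oplus>\<^bsub>quotient_module M N\<^esub> x = \<zero>\<^bsub>quotient_module M N\<^esub>"
      by (intro bexI[of _ "N +>\<^bsub>M\<^esub> (\<ominus>\<^bsub>M\<^esub> a)"]) (auto simp: quotient_simps quotient_add M.l_neg)
  qed (auto simp: quotient_simps quotient_add M.a_ac)
qed (auto simp: quotient_simps quotient_add quotient_smult smult_l_distr smult_r_distr smult_assoc1
      R.is_cring)

end

section \<open>Presented modules and their universal property\<close>

locale module_presentation = cring K
  for K :: "('k, 'r) ring_scheme" +
  fixes X :: "'x set" and E :: "('x \<Rightarrow> 'k) set"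
  assumes rels_closed: "E \<subseteq> carrier (free_module K X)"
begin

abbreviation "rel_span \<equiv> LinearCombinations.module.span K (free_module K X) E"

lemma rel_submodule: "LinearCombinations.submodule K rel_span (free_module K X)"
  by (rule module.span_is_submodule[OF free_module_module rels_closed])

lemma presented_module_module: "Module.module K (presented_module K X E)"
  unfolding presented_module_def by (rule quotient_module_module[OF rel_submodule])

lemma coset_hom:
  "(\<lambda>p. rel_span +>\<^bsub>free_module K X\<^esub> p) \<in> linear_maps K (free_module K X) (presented_module K X E)"
  unfolding presented_module_def
  by (rule linear_mapsI)
    (auto simp: quotient_simps[OF rel_submodule] quotient_add[OF rel_submodule]
      quotient_smult[OF rel_submodule])

lemma presented_gen_closed: "x \<in> X \<Longrightarrow> presented_gen K X E x \<in> carrier (presented_module K X E)"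
  unfolding presented_gen_def by (rule linear_maps_closed[OF coset_hom free_gen_closed])

lemma presented_induct [consumes 1, case_names zero step]:
  assumes "t \<in> carrier (presented_module K X E)"
    and zero: "P \<zero>\<^bsub>presented_module K X E\<^esub>"
    and step: "\<And>c x t. \<lbrakk>c \<in> carrier K; x \<in> X; t \<in> carrier (presented_module K X E); P t\<rbrakk>
      \<Longrightarrow> P (c \<odot>\<^bsub>presented_module K X E\<^esub> presented_gen K X E x \<oplus>\<^bsub>presented_module K X E\<^esub> t)"
  shows "P t"
proof -
  let ?c = "\<lambda>p. rel_span +>\<^bsub>free_module K X\<^esub> p"
  obtain p where p: "p \<in> carrier (free_module K X)" "t = ?c p"
    using assms(1) by (auto simp: presented_module_def quotient_simps[OF rel_submodule])
  interpret F: Module.module K "free_module K X" by (rule free_module_module)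
  have "P (?c p)" using p(1)
  proof (rule free_induct)
    show "P (?c (\<lambda>_. \<zero>\<^bsub>K\<^esub>))"
      using zero by (simp add: presented_module_def quotient_simps[OF rel_submodule] free_simps)
  next
    fix c x p assume *: "c \<in> carrier K" "x \<in> X" "p \<in> carrier (free_module K X)" "P (?c p)"
    have "?c (c \<odot>\<^bsub>free_module K X\<^esub> free_gen K x \<oplus>\<^bsub>free_module K X\<^esub> p) =
      c \<odot>\<^bsub>presented_module K X E\<^esub> presented_gen K X E x \<oplus>\<^bsub>presented_module K X E\<^esub> ?c p"
      using * unfolding presented_gen_def
      by (simp add: linear_maps_add[OF coset_hom] linear_maps_smult[OF coset_hom] free_gen_closed)
    then show "P (?c (c \<odot>\<^bsub>free_module K X\<^esub> free_gen K x \<oplus>\<^bsub>free_module K X\<^esub> p))"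
      using step * linear_maps_closed[OF coset_hom] by simp
  qed
  then show ?thesis using p by simp
qed

text \<open>The principle behind all later arguments that verify a linear identity on pure tensors
  only.\<close>

lemma presented_hom_eq:
  assumes "Module.module K N"
    and "f \<in> linear_maps K (presented_module K X E) N" "g \<in> linear_maps K (presented_module K X E) N"
    and "\<And>x. x \<in> X \<Longrightarrow> f (presented_gen K X E x) = g (presented_gen K X E x)"
    and "t \<in> carrier (presented_module K X E)"
  shows "f t = g t"
proof -
  interpret P: Module.module K "presented_module K X E" by (rule presented_module_module)
  interpret f: mod_hom K "presented_module K X E" N f
    using assms by (intro mod_homI presented_module_module)
  interpret g: mod_hom K "presented_module K X E" N g
    using assms by (intro mod_homI presented_module_module)
  show ?thesis using assms(5)
  proof (induction rule: presented_induct)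
    case zero
    then show ?case by simp
  next
    case (step c x t)
    then show ?case
      using assms(4)
      by (simp add: f.f_add f.f_smult g.f_add g.f_smult presented_gen_closed)
  qed
qed

context
  fixes N :: "('k, 'n, 's) module_scheme" and f :: "'x \<Rightarrow> 'n"
  assumes N: "Module.module K N" and f: "f \<in> X \<rightarrow> carrier N"
    and rels: "\<And>e. e \<in> E \<Longrightarrow> free_ext K N f e = \<zero>\<^bsub>N\<^esub>"
begin

interpretation N: Module.module K N by (fact N)
interpretation F: Module.module K "free_module K X" by (rule free_module_module)
interpretation f: mod_hom K "free_module K X" N "free_ext K N f"
  by (intro mod_homI free_module_module N N.free_ext_hom f)

text \<open>The representative picked by \<open>SOME\<close> differs from p by an element of the
  span of the relations. The kernel of \<open>free_ext\<close> is a submodule that contains the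
  relations, hence their span, so the choice has no influence.\<close>

lemma lin_ext_coset:
  assumes "p \<in> carrier (free_module K X)"
  shows "lin_ext K N f (rel_span +>\<^bsub>free_module K X\<^esub> p) = free_ext K N f p"
proof -
  let ?t = "rel_span +>\<^bsub>free_module K X\<^esub> p"
  have "p \<in> ?t"
    using assms submodule.zero_closed[OF rel_submodule]
    unfolding in_coset_iff[OF rel_submodule]
    by (intro bexI[of _ "\<zero>\<^bsub>free_module K X\<^esub>"]) simp_all
  then have "(SOME q. q \<in> ?t) \<in> ?t" by (rule someI[where P = "\<lambda>q. q \<in> ?t"])
  then obtain a where a: "a \<in> rel_span" "(SOME q. q \<in> ?t) = a \<oplus>\<^bsub>free_module K X\<^esub> p"
    using in_coset_iff[OF rel_submodule] by blast
  have "rel_span \<subseteq> f.ker"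
    using rels rels_closed by (intro F.span_is_subset f.ker_is_submodule) (auto simp: f.ker_def)
  then have "a \<in> carrier (free_module K X)" "free_ext K N f a = \<zero>\<^bsub>N\<^esub>"
    using a by (auto simp: f.ker_def)
  then show ?thesis
    unfolding lin_ext_def a(2) using assms by (simp add: f.f_add)
qed

lemma lin_ext_gen: "x \<in> X \<Longrightarrow> lin_ext K N f (presented_gen K X E x) = f x"
  unfolding presented_gen_def using f by (simp add: lin_ext_coset free_gen_closed N.free_ext_gen)

lemma lin_ext_hom: "lin_ext K N f \<in> linear_maps K (presented_module K X E) N"
  unfolding presented_module_def
  by (rule linear_mapsI)
    (auto simp: quotient_simps[OF rel_submodule] quotient_add[OF rel_submodule]
      quotient_smult[OF rel_submodule] lin_ext_coset f.f_add f.f_smult)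

end

end


section \<open>Tensor powers and tensor products\<close>

text \<open>Linearity is required in the slot between a prefix and a suffix, which is the shape of
  the lists in \<open>multilinear_rels\<close>. For n = 0 that condition is vacuous.\<close>

definition multilinear ::
  "('k, 'r) ring_scheme \<Rightarrow> ('k, 'm, 's) module_scheme \<Rightarrow> ('k, 'n, 't) module_scheme \<Rightarrow> nat
    \<Rightarrow> ('m list \<Rightarrow> 'n) \<Rightarrow> bool" where
  "multilinear K M N n F \<longleftrightarrow> F \<in> power_gens M n \<rightarrow> carrier N \<and>
    (\<forall>xs ys. Suc (length xs + length ys) = n \<longrightarrow> set xs \<subseteq> carrier M \<longrightarrow> set ys \<subseteq> carrier M \<longrightarrow>
      (\<lambda>x. F (xs @ x # ys)) \<in> linear_maps K M N)"

lemma in_power_gens: "xs \<in> power_gens M n \<longleftrightarrow> length xs = n \<and> set xs \<subseteq> carrier M"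
  by (simp add: power_gens_def)

locale two_modules = M: Module.module K M + N: Module.module K N
  for K :: "('k, 'r) ring_scheme" and M :: "('k, 'm, 's) module_scheme"
    and N :: "('k, 'n, 't) module_scheme"

context Module.module
begin

lemma free_ext_diff_gen:
  assumes "f \<in> X \<rightarrow> carrier M" "x \<in> X" "p \<in> carrier (free_module R X)"
  shows "free_ext R M f (free_gen R x \<ominus>\<^bsub>free_module R X\<^esub> p) = f x \<ominus>\<^bsub>M\<^esub> free_ext R M f p"
proof -
  interpret f: mod_hom R "free_module R X" M "free_ext R M f"
    by (intro mod_homI R.free_module_module module_axioms free_ext_hom assms(1))
  show ?thesis using assms by (simp add: f.f_minus R.free_gen_closed free_ext_gen)
qed

lemma multilinear_rels_presentation: "module_presentation R (power_gens M n) (multilinear_rels R M n)"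
proof -
  interpret F: Module.module R "free_module R (power_gens M n)" by (rule R.free_module_module)
  show ?thesis
  proof
    show "multilinear_rels R M n \<subseteq> carrier (free_module R (power_gens M n))"
      unfolding multilinear_rels_def Let_def
      by (safe; intro F.M.minus_closed F.M.a_closed F.smult_closed R.free_gen_closed)
        (auto simp: in_power_gens)
  qed
qed

lemma tensor_power_module: "Module.module R (tensor_power R M n)"
  unfolding tensor_power_def
  by (rule module_presentation.presented_module_module[OF multilinear_rels_presentation])

lemma power_pure_closed: "xs \<in> power_gens M n \<Longrightarrow> power_pure R M xs \<in> carrier (tensor_power R M n)"
  using module_presentation.presented_gen_closed[OF multilinear_rels_presentation]
  by (auto simp: power_pure_def tensor_power_def in_power_gens)

lemma power_pure_eq: "xs \<in> power_gens M n \<Longrightarrow>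
    power_pure R M xs = presented_gen R (power_gens M n) (multilinear_rels R M n) xs"
  by (auto simp: power_pure_def in_power_gens)

end

context two_modules
begin

text \<open>The two families of relations are additivity and homogeneity in one slot, which is just
  what a multilinear F sends to zero.\<close>

lemma free_ext_multilinear_rels:
  assumes F: "multilinear K M N n F" and e: "e \<in> multilinear_rels K M n"
  shows "free_ext K N F e = \<zero>\<^bsub>N\<^esub>"
proof -
  have FX: "F \<in> power_gens M n \<rightarrow> carrier N" using F by (simp add: multilinear_def)
  interpret FM: Module.module K "free_module K (power_gens M n)" by (rule M.R.free_module_module)
  interpret f: mod_hom K "free_module K (power_gens M n)" N "free_ext K N F"
    by (intro mod_homI M.R.free_module_module N.module_axioms N.free_ext_hom FX)
  have lin: "(\<lambda>x. F (xs @ x # ys)) \<in> linear_maps K M N"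
    if "xs @ [a] @ ys \<in> power_gens M n" for xs a ys
    using F that by (simp add: multilinear_def in_power_gens)
  show ?thesis using e unfolding multilinear_rels_def Let_def
  proof (elim UnE CollectE exE conjE, goal_cases)
    case (1 xs a b ys)
    then have g: "xs @ (a \<oplus>\<^bsub>M\<^esub> b) # ys \<in> power_gens M n" "xs @ a # ys \<in> power_gens M n"
        "xs @ b # ys \<in> power_gens M n"
      by (auto simp: in_power_gens)
    show ?case
      using g FX 1 linear_maps_add[OF lin[OF 1(2)], of a b]
      by (simp add: N.free_ext_diff_gen f.f_add M.R.free_gen_closed N.free_ext_gen in_power_gens
          N.M.minus_eq N.M.r_neg Pi_iff)
  next
    case (2 r xs a ys)
    then have g: "xs @ (r \<odot>\<^bsub>M\<^esub> a) # ys \<in> power_gens M n" "xs @ a # ys \<in> power_gens M n"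
      by (auto simp: in_power_gens)
    show ?case
      using g FX 2 linear_maps_smult[OF lin[OF 2(3)], of r a]
      by (simp add: N.free_ext_diff_gen f.f_smult M.R.free_gen_closed N.free_ext_gen in_power_gens
          N.M.minus_eq N.M.r_neg Pi_iff)
  qed
qed

lemma lin_ext_power_hom:
  assumes "multilinear K M N n F"
  shows "lin_ext K N F \<in> linear_maps K (tensor_power K M n) N"
  unfolding tensor_power_def
  by (rule module_presentation.lin_ext_hom[OF M.multilinear_rels_presentation N.module_axioms _
        free_ext_multilinear_rels[OF assms]])
    (use assms in \<open>simp add: multilinear_def\<close>)

lemma lin_ext_power_pure:
  assumes "multilinear K M N n F" "xs \<in> power_gens M n"
  shows "lin_ext K N F (power_pure K M xs) = F xs"
  unfolding M.power_pure_eq[OF assms(2)]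
  by (rule module_presentation.lin_ext_gen[OF M.multilinear_rels_presentation N.module_axioms _
        free_ext_multilinear_rels[OF assms(1)] assms(2)])
    (use assms in \<open>simp add: multilinear_def\<close>)

lemma power_hom_eq:
  assumes "f \<in> linear_maps K (tensor_power K M n) N" "g \<in> linear_maps K (tensor_power K M n) N"
    and "\<And>xs. xs \<in> power_gens M n \<Longrightarrow> f (power_pure K M xs) = g (power_pure K M xs)"
    and "t \<in> carrier (tensor_power K M n)"
  shows "f t = g t"
  by (rule module_presentation.presented_hom_eq[OF M.multilinear_rels_presentation N.module_axioms
        assms(1,2)[unfolded tensor_power_def] _ assms(4)[unfolded tensor_power_def]])
    (metis assms(3) M.power_pure_eq)

end

lemma (in Module.module) power_pure_multilinear:
  "multilinear R M (tensor_power R M n) n (power_pure R M)"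
  unfolding multilinear_def
proof (intro conjI allI impI linear_mapsI)
  show "power_pure R M \<in> power_gens M n \<rightarrow> carrier (tensor_power R M n)"
    using power_pure_closed by auto
next
  fix xs ys x assume *: "Suc (length xs + length ys) = n" "set xs \<subseteq> carrier M" "set ys \<subseteq> carrier M"
  let ?X = "power_gens M n" and ?E = "multilinear_rels R M n"
  let ?F = "free_module R ?X" and ?P = "presented_module R ?X ?E"
  have gen: "xs @ x # ys \<in> ?X" if "x \<in> carrier M" for x using * that by (auto simp: in_power_gens)
  show "power_pure R M (xs @ x # ys) \<in> carrier (tensor_power R M n)" if "x \<in> carrier M" for x
    using gen that power_pure_closed by blast
  interpret MP: module_presentation R ?X ?E by (rule multilinear_rels_presentation)
  interpret F: Module.module R ?F by (rule R.free_module_module)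
  let ?c = "\<lambda>p. MP.rel_span +>\<^bsub>?F\<^esub> p"
  \<comment> \<open>A difference that is one of the relations lies in their span, so adding it to q
    does not change the coset.\<close>
  have rel: "?c p = ?c q"
    if "p \<ominus>\<^bsub>?F\<^esub> q \<in> ?E" "p \<in> carrier ?F" "q \<in> carrier ?F" for p q
  proof -
    have "p \<ominus>\<^bsub>?F\<^esub> q \<in> MP.rel_span" using that F.in_own_span[OF MP.rels_closed] by blast
    then have "?c ((p \<ominus>\<^bsub>?F\<^esub> q) \<oplus>\<^bsub>?F\<^esub> q) = ?c q"
      using that by (intro coset_eqI[OF MP.rel_submodule]) auto
    moreover have "(p \<ominus>\<^bsub>?F\<^esub> q) \<oplus>\<^bsub>?F\<^esub> q = p"
      using that by (simp add: F.M.minus_eq F.M.a_assoc F.M.l_neg)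
    ultimately show ?thesis by simp
  qed
  note hom = linear_maps_add[OF MP.coset_hom] linear_maps_smult[OF MP.coset_hom]
  note gc = R.free_gen_closed[of _ ?X]
  have pp: "power_pure R M (xs @ z # ys) = ?c (free_gen R (xs @ z # ys))" if "z \<in> carrier M" for z
    using power_pure_eq[OF gen[OF that]] by (simp add: presented_gen_def)
  { fix x y assume xy: "x \<in> carrier M" "y \<in> carrier M"
    have "free_gen R (xs @ [x \<oplus>\<^bsub>M\<^esub> y] @ ys) \<ominus>\<^bsub>?F\<^esub>
        (free_gen R (xs @ [x] @ ys) \<oplus>\<^bsub>?F\<^esub> free_gen R (xs @ [y] @ ys)) \<in> ?E"
      unfolding multilinear_rels_def Let_def using xy gen[of x]
      by (intro UnI1 CollectI exI[of _ xs] exI[of _ x] exI[of _ y] exI[of _ ys] conjI refl) auto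
    then have "?c (free_gen R (xs @ (x \<oplus>\<^bsub>M\<^esub> y) # ys)) =
        ?c (free_gen R (xs @ x # ys) \<oplus>\<^bsub>?F\<^esub> free_gen R (xs @ y # ys))"
      using xy by (intro rel) (auto intro!: gc gen)
    then show "power_pure R M (xs @ (x \<oplus>\<^bsub>M\<^esub> y) # ys) =
        power_pure R M (xs @ x # ys) \<oplus>\<^bsub>tensor_power R M n\<^esub> power_pure R M (xs @ y # ys)"
      using xy gen gc by (simp add: pp hom tensor_power_def) }
  { fix r x assume rx: "r \<in> carrier R" "x \<in> carrier M"
    have "free_gen R (xs @ [r \<odot>\<^bsub>M\<^esub> x] @ ys) \<ominus>\<^bsub>?F\<^esub> (r \<odot>\<^bsub>?F\<^esub> free_gen R (xs @ [x] @ ys)) \<in> ?E"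
      unfolding multilinear_rels_def Let_def using rx gen[of x]
      by (intro UnI2 CollectI exI[of _ r] exI[of _ xs] exI[of _ x] exI[of _ ys] conjI refl) auto
    then have "?c (free_gen R (xs @ (r \<odot>\<^bsub>M\<^esub> x) # ys)) = ?c (r \<odot>\<^bsub>?F\<^esub> free_gen R (xs @ x # ys))"
      using rx by (intro rel) (auto intro!: gc gen)
    then show "power_pure R M (xs @ (r \<odot>\<^bsub>M\<^esub> x) # ys) =
        r \<odot>\<^bsub>tensor_power R M n\<^esub> power_pure R M (xs @ x # ys)"
      using rx gen gc by (simp add: pp hom tensor_power_def) }
qed

section \<open>The tensor product of two modules\<close>

definition bilinear ::
  "('k, 'r) ring_scheme \<Rightarrow> ('k, 'l, 's) module_scheme \<Rightarrow> ('k, 'm, 't) module_scheme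
    \<Rightarrow> ('k, 'n, 'u) module_scheme \<Rightarrow> ('l \<Rightarrow> 'm \<Rightarrow> 'n) \<Rightarrow> bool" where
  "bilinear K L M N B \<longleftrightarrow>
    (\<forall>x\<in>carrier L. B x \<in> linear_maps K M N) \<and> (\<forall>y\<in>carrier M. (\<lambda>x. B x y) \<in> linear_maps K L N)"

context two_modules
begin

abbreviation "MN \<equiv> tensor_product K M N"
abbreviation "pure \<equiv> tensor_pure K M N"

lemma bilinear_rels_presentation:
  "module_presentation K (carrier M \<times> carrier N) (bilinear_rels K M N)"
proof -
  interpret F: Module.module K "free_module K (carrier M \<times> carrier N)"
    by (rule M.R.free_module_module)
  show ?thesis
  proof
    show "bilinear_rels K M N \<subseteq> carrier (free_module K (carrier M \<times> carrier N))"
      by (auto simp: bilinear_rels_def Let_def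
        intro!: F.M.minus_closed F.M.a_closed F.smult_closed M.R.free_gen_closed)
  qed
qed

lemma tensor_product_module: "Module.module K MN"
  unfolding tensor_product_def
  by (rule module_presentation.presented_module_module[OF bilinear_rels_presentation])

lemma tensor_pure_closed: "x \<in> carrier M \<Longrightarrow> y \<in> carrier N \<Longrightarrow> pure x y \<in> carrier MN"
  unfolding tensor_pure_def tensor_product_def
  by (rule module_presentation.presented_gen_closed[OF bilinear_rels_presentation]) simp

lemma bilinear_closed:
  "bilinear K M N P B \<Longrightarrow> x \<in> carrier M \<Longrightarrow> y \<in> carrier N \<Longrightarrow> B x y \<in> carrier P"
  unfolding bilinear_def by (blast intro: linear_maps_closed)

lemma free_ext_bilinear_rels:
  assumes P: "Module.module K P" and F: "bilinear K M N P (\<lambda>x y. F (x, y))"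
    and e: "e \<in> bilinear_rels K M N"
  shows "free_ext K P F e = \<zero>\<^bsub>P\<^esub>"
proof -
  let ?X = "carrier M \<times> carrier N"
  interpret P: Module.module K P by (rule P)
  have FX: "F \<in> ?X \<rightarrow> carrier P" using bilinear_closed[OF F] by auto
  interpret FM: Module.module K "free_module K ?X" by (rule M.R.free_module_module)
  interpret f: mod_hom K "free_module K ?X" P "free_ext K P F"
    by (intro mod_homI M.R.free_module_module P P.free_ext_hom FX)
  have F1: "x \<in> carrier M \<Longrightarrow> (\<lambda>y. F (x, y)) \<in> linear_maps K N P" for x
    using F by (simp add: bilinear_def)
  have F2: "y \<in> carrier N \<Longrightarrow> (\<lambda>x. F (x, y)) \<in> linear_maps K M P" for y
    using F by (simp add: bilinear_def)
  have FX': "F (x, y) \<in> carrier P" if "x \<in> carrier M" "y \<in> carrier N" for x y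
    using FX that by auto
  note simps = P.free_ext_diff_gen[OF FX] f.f_add f.f_smult M.R.free_gen_closed
    P.free_ext_gen[OF FX] P.M.minus_eq P.M.r_neg FX'
  show ?thesis using e unfolding bilinear_rels_def Let_def
  proof (elim UnE CollectE exE conjE, goal_cases)
    case (1 a b c)
    then show ?case by (simp add: simps linear_maps_add[OF F2])
  next
    case (2 a c d)
    then show ?case by (simp add: simps linear_maps_add[OF F1])
  next
    case (3 r a c)
    then show ?case by (simp add: simps linear_maps_smult[OF F2])
  next
    case (4 r a c)
    then show ?case by (simp add: simps linear_maps_smult[OF F1])
  qed
qed

lemma lin_ext_product_hom:
  assumes "Module.module K P" "bilinear K M N P (\<lambda>x y. F (x, y))"
  shows "lin_ext K P F \<in> linear_maps K MN P"
  unfolding tensor_product_def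
  by (rule module_presentation.lin_ext_hom[OF bilinear_rels_presentation assms(1) _
        free_ext_bilinear_rels[OF assms]])
    (use bilinear_closed[OF assms(2)] in auto)

lemma lin_ext_product_pure:
  assumes "Module.module K P" "bilinear K M N P (\<lambda>x y. F (x, y))"
    and "x \<in> carrier M" "y \<in> carrier N"
  shows "lin_ext K P F (pure x y) = F (x, y)"
  unfolding tensor_pure_def
  by (rule module_presentation.lin_ext_gen[OF bilinear_rels_presentation assms(1) _
        free_ext_bilinear_rels[OF assms(1,2)]])
    (use bilinear_closed[OF assms(2)] assms(3-) in auto)

lemma product_hom_eq:
  assumes "Module.module K P" "f \<in> linear_maps K MN P" "g \<in> linear_maps K MN P"
    and "\<And>x y. x \<in> carrier M \<Longrightarrow> y \<in> carrier N \<Longrightarrow> f (pure x y) = g (pure x y)"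
    and "t \<in> carrier MN"
  shows "f t = g t"
  by (rule module_presentation.presented_hom_eq[OF bilinear_rels_presentation assms(1)
        assms(2,3)[unfolded tensor_product_def] _ assms(5)[unfolded tensor_product_def]])
    (use assms(4) in \<open>auto simp: tensor_pure_def\<close>)

lemma tensor_pure_bilinear: "bilinear K M N MN pure"
proof -
  let ?X = "carrier M \<times> carrier N" and ?E = "bilinear_rels K M N"
  let ?F = "free_module K ?X"
  interpret MP: module_presentation K ?X ?E by (rule bilinear_rels_presentation)
  interpret F: Module.module K ?F by (rule M.R.free_module_module)
  let ?c = "\<lambda>p. MP.rel_span +>\<^bsub>?F\<^esub> p"
  have rel: "?c p = ?c q"
    if "p \<ominus>\<^bsub>?F\<^esub> q \<in> ?E" "p \<in> carrier ?F" "q \<in> carrier ?F" for p q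
  proof -
    have "p \<ominus>\<^bsub>?F\<^esub> q \<in> MP.rel_span" using that F.in_own_span[OF MP.rels_closed] by blast
    then have "?c ((p \<ominus>\<^bsub>?F\<^esub> q) \<oplus>\<^bsub>?F\<^esub> q) = ?c q"
      using that by (intro coset_eqI[OF MP.rel_submodule]) auto
    moreover have "(p \<ominus>\<^bsub>?F\<^esub> q) \<oplus>\<^bsub>?F\<^esub> q = p"
      using that by (simp add: F.M.minus_eq F.M.a_assoc F.M.l_neg)
    ultimately show ?thesis by simp
  qed
  note hom = linear_maps_add[OF MP.coset_hom] linear_maps_smult[OF MP.coset_hom]
  note gc = M.R.free_gen_closed[of _ ?X]
  have eq: "pure x y = ?c (free_gen K (x, y))" for x y
    by (simp add: tensor_pure_def presented_gen_def)
  note E = bilinear_rels_def[of K M N, unfolded Let_def]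
  have a: "?c (free_gen K (x \<oplus>\<^bsub>M\<^esub> y, z)) = ?c (free_gen K (x, z) \<oplus>\<^bsub>?F\<^esub> free_gen K (y, z))"
    if "x \<in> carrier M" "y \<in> carrier M" "z \<in> carrier N" for x y z
    using that by (intro rel F.M.a_closed F.smult_closed gc, subst E, intro UnI1 UnI1 UnI1 CollectI
      exI[of _ x] exI[of _ y] exI[of _ z] conjI refl) auto
  have b: "?c (free_gen K (z, x \<oplus>\<^bsub>N\<^esub> y)) = ?c (free_gen K (z, x) \<oplus>\<^bsub>?F\<^esub> free_gen K (z, y))"
    if "x \<in> carrier N" "y \<in> carrier N" "z \<in> carrier M" for x y z
    using that by (intro rel F.M.a_closed F.smult_closed gc, subst E, intro UnI1 UnI1 UnI2 CollectI
      exI[of _ z] exI[of _ x] exI[of _ y] conjI refl) auto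
  have c: "?c (free_gen K (r \<odot>\<^bsub>M\<^esub> x, z)) = ?c (r \<odot>\<^bsub>?F\<^esub> free_gen K (x, z))"
    if "r \<in> carrier K" "x \<in> carrier M" "z \<in> carrier N" for r x z
    using that by (intro rel F.M.a_closed F.smult_closed gc, subst E, intro UnI1 UnI2 CollectI
      exI[of _ r] exI[of _ x] exI[of _ z] conjI refl) auto
  have d: "?c (free_gen K (z, r \<odot>\<^bsub>N\<^esub> x)) = ?c (r \<odot>\<^bsub>?F\<^esub> free_gen K (z, x))"
    if "r \<in> carrier K" "x \<in> carrier N" "z \<in> carrier M" for r x z
    using that by (intro rel F.M.a_closed F.smult_closed gc, subst E, intro UnI2 CollectI
      exI[of _ r] exI[of _ z] exI[of _ x] conjI refl) auto
  show ?thesis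
    unfolding bilinear_def
    using tensor_pure_closed a b c d gc
    by (auto intro!: linear_mapsI simp: eq hom tensor_product_def)
qed

end


section \<open>Multilinear maps\<close>

lemma linear_maps_id: "(\<lambda>x. x) \<in> linear_maps K M M"
  by (rule linear_mapsI) auto

lemma linear_maps_cong:
  assumes "f \<in> linear_maps K M N" "Module.module K M" "\<And>x. x \<in> carrier M \<Longrightarrow> g x = f x"
  shows "g \<in> linear_maps K M N"
proof -
  interpret Module.module K M by fact
  show ?thesis using assms
    by (intro linear_mapsI) (simp_all add: linear_maps_closed linear_maps_add linear_maps_smult)
qed

lemma (in two_modules) linear_maps_sum:
  assumes "f \<in> linear_maps K M N" "g \<in> linear_maps K M N"
  shows "(\<lambda>x. f x \<oplus>\<^bsub>N\<^esub> g x) \<in> linear_maps K M N"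
  using assms
  by (intro linear_mapsI)
    (simp_all add: linear_maps_closed linear_maps_add linear_maps_smult N.M.a_ac N.smult_r_distr)

lemma (in two_modules) linear_maps_scale:
  assumes "f \<in> linear_maps K M N" "r \<in> carrier K"
  shows "(\<lambda>x. r \<odot>\<^bsub>N\<^esub> f x) \<in> linear_maps K M N"
  using assms
  by (intro linear_mapsI)
    (simp_all add: linear_maps_closed linear_maps_add linear_maps_smult N.smult_r_distr
      N.smult_assoc1[symmetric] M.R.m_comm)

lemma multilinear_closed: "multilinear K M N n F \<Longrightarrow> xs \<in> power_gens M n \<Longrightarrow> F xs \<in> carrier N"
  by (auto simp: multilinear_def)

lemma multilinearI:
  assumes "\<And>xs. length xs = n \<Longrightarrow> set xs \<subseteq> carrier M \<Longrightarrow> F xs \<in> carrier N"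
    and "\<And>xs ys. Suc (length xs + length ys) = n \<Longrightarrow> set xs \<subseteq> carrier M \<Longrightarrow> set ys \<subseteq> carrier M \<Longrightarrow>
      (\<lambda>x. F (xs @ x # ys)) \<in> linear_maps K M N"
  shows "multilinear K M N n F"
  using assms by (auto simp: multilinear_def in_power_gens)

lemma multilinearD:
  assumes "multilinear K M N n F"
    and "Suc (length xs + length ys) = n" "set xs \<subseteq> carrier M" "set ys \<subseteq> carrier M"
  shows "(\<lambda>x. F (xs @ x # ys)) \<in> linear_maps K M N"
  using assms by (auto simp: multilinear_def)

lemma multilinear_compose:
  assumes "multilinear K M N n F" "\<phi> \<in> linear_maps K N P"
  shows "multilinear K M P n (\<lambda>xs. \<phi> (F xs))"
proof (rule multilinearI)
  fix xs assume "length xs = n" "set xs \<subseteq> carrier M"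
  then show "\<phi> (F xs) \<in> carrier P"
    by (intro linear_maps_closed[OF assms(2)] multilinear_closed[OF assms(1)]) (simp add: in_power_gens)
qed (rule linear_maps_compose[OF multilinearD[OF assms(1)] assms(2)])

lemma multilinear_append_left:
  assumes "multilinear K M N (m + n) F" "ys \<in> power_gens M n"
  shows "multilinear K M N m (\<lambda>xs. F (xs @ ys))"
proof (rule multilinearI)
  fix us vs assume "Suc (length us + length vs) = m" "set us \<subseteq> carrier M" "set vs \<subseteq> carrier M"
  then show "(\<lambda>x. F ((us @ x # vs) @ ys)) \<in> linear_maps K M N"
    using multilinearD[OF assms(1), of us "vs @ ys"] assms(2) by (auto simp: in_power_gens)
qed (use assms in \<open>auto simp: multilinear_def in_power_gens\<close>)

lemma multilinear_append_right:
  assumes "multilinear K M N (m + n) F" "xs \<in> power_gens M m"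
  shows "multilinear K M N n (\<lambda>ys. F (xs @ ys))"
proof (rule multilinearI)
  fix us vs assume "Suc (length us + length vs) = n" "set us \<subseteq> carrier M" "set vs \<subseteq> carrier M"
  then show "(\<lambda>y. F (xs @ us @ y # vs)) \<in> linear_maps K M N"
    using multilinearD[OF assms(1), of "xs @ us" vs] assms(2) by (auto simp: in_power_gens)
qed (use assms in \<open>auto simp: multilinear_def in_power_gens\<close>)

lemma map2_closed:
  assumes "set fs \<subseteq> linear_maps K M P" "length xs = length fs" "set xs \<subseteq> carrier M"
  shows "set (map2 (\<lambda>f x. f x) fs xs) \<subseteq> carrier P"
proof
  fix y assume "y \<in> set (map2 (\<lambda>f x. f x) fs xs)"
  then obtain f x where "f \<in> set fs" "x \<in> set xs" "y = f x"
    by (auto dest: set_zip_leftD set_zip_rightD)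
  then show "y \<in> carrier P" using assms by (blast intro: linear_maps_closed)
qed

text \<open>The list of maps is split at the slot that varies: there one has a composite of linear
  maps, while the other slots contribute fixed entries.\<close>

lemma multilinear_map2:
  assumes "multilinear K P N n F" "set fs \<subseteq> linear_maps K M P" "length fs = n"
  shows "multilinear K M N n (\<lambda>xs. F (map2 (\<lambda>f x. f x) fs xs))"
proof (rule multilinearI)
  fix xs assume "length xs = n" "set xs \<subseteq> carrier M"
  then show "F (map2 (\<lambda>f x. f x) fs xs) \<in> carrier N"
    using assms map2_closed[OF assms(2), of xs]
    by (intro multilinear_closed[OF assms(1)]) (auto simp: in_power_gens)
next
  fix us vs assume *: "Suc (length us + length vs) = n" "set us \<subseteq> carrier M" "set vs \<subseteq> carrier M"
  obtain gs g hs where fs: "fs = gs @ g # hs" "length gs = length us"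
    using * assms(3) by (metis add_Suc_right id_take_nth_drop length_take less_add_Suc1 min.absorb4)
  then have "length hs = length vs" using * assms(3) by simp
  then have "(\<lambda>x. F (map2 (\<lambda>f x. f x) gs us @ g x # map2 (\<lambda>f x. f x) hs vs)) \<in> linear_maps K M N"
    using * fs assms map2_closed[of gs K M P us] map2_closed[of hs K M P vs]
    by (intro linear_maps_compose[OF _ multilinearD[OF assms(1)]]) auto
  then show "(\<lambda>x. F (map2 (\<lambda>f x. f x) fs (us @ x # vs))) \<in> linear_maps K M N"
    using fs by (simp add: zip_append)
qed

text \<open>Bridge from curried bilinear maps to maps on lists of length 2, the format of the second
  tensor power in which the comultiplication takes its values.\<close>

lemma multilinear_pair:
  fixes M :: "('k, 'm, 's) module_scheme"
  assumes "bilinear K M M N B"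
  shows "multilinear K M N 2 (\<lambda>xs. B (xs ! 0) (xs ! 1))"
proof (rule multilinearI)
  fix us vs assume *: "Suc (length us + length vs) = 2" "set us \<subseteq> carrier M" "set vs \<subseteq> carrier M"
  then consider v where "us = []" "vs = [v]" | u where "us = [u]" "vs = []"
    by (cases us; cases vs) auto
  then show "(\<lambda>x. B ((us @ x # vs) ! 0) ((us @ x # vs) ! 1)) \<in> linear_maps K M N"
    by cases (use * assms in \<open>simp_all add: bilinear_def\<close>)
next
  fix xs assume "length xs = 2" "set xs \<subseteq> carrier M"
  then have "xs ! 0 \<in> carrier M" "xs ! 1 \<in> carrier M" by (auto simp: subset_iff)
  then show "B (xs ! 0) (xs ! 1) \<in> carrier N"
    using assms unfolding bilinear_def by (blast intro: linear_maps_closed[where M = M])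
qed

context two_modules
begin

lemma lin_ext_power_closed:
  "multilinear K M N n F \<Longrightarrow> t \<in> carrier (tensor_power K M n) \<Longrightarrow> lin_ext K N F t \<in> carrier N"
  by (rule linear_maps_closed[OF lin_ext_power_hom])

lemma lin_ext_power_unique:
  assumes "multilinear K M N n F" "\<phi> \<in> linear_maps K (tensor_power K M n) N"
    and "\<And>xs. xs \<in> power_gens M n \<Longrightarrow> \<phi> (power_pure K M xs) = F xs"
    and "t \<in> carrier (tensor_power K M n)"
  shows "\<phi> t = lin_ext K N F t"
  by (rule power_hom_eq[OF assms(2) lin_ext_power_hom[OF assms(1)] _ assms(4)])
    (simp add: assms(3) lin_ext_power_pure[OF assms(1)])

text \<open>Both sides are linear in t and agree on pure tensors. This is how a linear map is later
  moved under a Sweedler sum.\<close>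

lemma lin_ext_power_compose:
  assumes "multilinear K M N n F" "Module.module K P" "\<phi> \<in> linear_maps K N P"
    and "t \<in> carrier (tensor_power K M n)"
  shows "\<phi> (lin_ext K N F t) = lin_ext K P (\<lambda>xs. \<phi> (F xs)) t"
proof -
  interpret MP: two_modules K M P by (intro two_modules.intro M.module_axioms assms)
  show ?thesis
    by (rule MP.lin_ext_power_unique[where \<phi> = "\<lambda>t. \<phi> (lin_ext K N F t)",
          OF multilinear_compose[OF assms(1,3)]
          linear_maps_compose[OF lin_ext_power_hom[OF assms(1)] assms(3)] _ assms(4)])
      (simp add: lin_ext_power_pure[OF assms(1)])
qed

lemma lin_ext_power_cong:
  assumes "multilinear K M N n F" "\<And>xs. xs \<in> power_gens M n \<Longrightarrow> G xs = F xs"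
    and "t \<in> carrier (tensor_power K M n)"
  shows "lin_ext K N G t = lin_ext K N F t"
proof -
  have "multilinear K M N n G"
  proof (rule multilinearI)
    fix xs ys assume *: "Suc (length xs + length ys) = n" "set xs \<subseteq> carrier M" "set ys \<subseteq> carrier M"
    show "(\<lambda>x. G (xs @ x # ys)) \<in> linear_maps K M N"
      by (rule linear_maps_cong[OF multilinearD[OF assms(1) *] M.module_axioms])
        (use * in \<open>simp add: assms(2) in_power_gens\<close>)
  qed (simp add: assms(2) in_power_gens multilinear_closed[OF assms(1)])
  then have "lin_ext K N F t = lin_ext K N G t"
    by (intro lin_ext_power_unique[OF _ lin_ext_power_hom[OF assms(1)] _ assms(3)])
      (simp_all add: lin_ext_power_pure[OF assms(1)] assms(2))
  then show ?thesis by (rule sym)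
qed

text \<open>By uniqueness, a combination of linear extensions is the extension of the combination.
  This provides the linearity of a Sweedler sum in the free variables of its summand.\<close>

lemma linear_maps_lin_ext_param:
  assumes F: "\<And>x. x \<in> carrier P \<Longrightarrow> multilinear K M N n (F x)" "Module.module K P"
    and lin: "\<And>xs. xs \<in> power_gens M n \<Longrightarrow> (\<lambda>x. F x xs) \<in> linear_maps K P N"
    and t: "t \<in> carrier (tensor_power K M n)"
  shows "(\<lambda>x. lin_ext K N (F x) t) \<in> linear_maps K P N"
proof -
  interpret P: Module.module K P by fact
  interpret T: two_modules K "tensor_power K M n" N
    by (intro two_modules.intro M.tensor_power_module N.module_axioms)
  show ?thesis
  proof (rule linear_mapsI)
    fix x assume "x \<in> carrier P"
    then show "lin_ext K N (F x) t \<in> carrier N" by (rule lin_ext_power_closed[OF F(1) t])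
  next
    fix x y assume x: "x \<in> carrier P" and y: "y \<in> carrier P"
    then have xy: "x \<oplus>\<^bsub>P\<^esub> y \<in> carrier P" by simp
    show "lin_ext K N (F (x \<oplus>\<^bsub>P\<^esub> y)) t = lin_ext K N (F x) t \<oplus>\<^bsub>N\<^esub> lin_ext K N (F y) t"
      by (rule lin_ext_power_unique[OF F(1)[OF xy] T.linear_maps_sum[OF
            lin_ext_power_hom[OF F(1)[OF x]] lin_ext_power_hom[OF F(1)[OF y]]] _ t, symmetric])
        (simp add: lin_ext_power_pure[OF F(1)] x y linear_maps_add[OF lin])
  next
    fix r x assume r: "r \<in> carrier K" and x: "x \<in> carrier P"
    then have rx: "r \<odot>\<^bsub>P\<^esub> x \<in> carrier P" by simp
    show "lin_ext K N (F (r \<odot>\<^bsub>P\<^esub> x)) t = r \<odot>\<^bsub>N\<^esub> lin_ext K N (F x) t"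
      by (rule lin_ext_power_unique[OF F(1)[OF rx] T.linear_maps_scale[OF
            lin_ext_power_hom[OF F(1)[OF x]] r] _ t, symmetric])
        (simp add: lin_ext_power_pure[OF F(1)] r x linear_maps_smult[OF lin])
  qed
qed

end

text \<open>Maps that are multilinear in two lists separately extend to two tensors at once.
  Appending tensors, the componentwise product of tensors and the comultiplication of a tensor
  product of coalgebras are all of this kind.\<close>

locale double_multilinear = L: two_modules K L N + M: two_modules K M N
  for K :: "('k, 'r) ring_scheme" and L :: "('k, 'l, 's) module_scheme"
    and M :: "('k, 'm, 't) module_scheme" and N :: "('k, 'n, 'u) module_scheme" +
  fixes m n :: nat and G :: "'l list \<Rightarrow> 'm list \<Rightarrow> 'n"
  assumes right: "xs \<in> power_gens L m \<Longrightarrow> multilinear K M N n (G xs)"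
    and left: "ys \<in> power_gens M n \<Longrightarrow> multilinear K L N m (\<lambda>xs. G xs ys)"
begin

definition "ext s t = lin_ext K N (\<lambda>xs. lin_ext K N (G xs) t) s"

lemma multilinear_inner:
  assumes "t \<in> carrier (tensor_power K M n)"
  shows "multilinear K L N m (\<lambda>xs. lin_ext K N (G xs) t)"
proof (rule multilinearI)
  fix us vs assume *: "Suc (length us + length vs) = m" "set us \<subseteq> carrier L" "set vs \<subseteq> carrier L"
  show "(\<lambda>x. lin_ext K N (G (us @ x # vs)) t) \<in> linear_maps K L N"
    using * assms by (intro M.linear_maps_lin_ext_param[where n = n] right L.M.module_axioms
        multilinearD[OF left]) (auto simp: in_power_gens)
qed (use assms right in \<open>auto intro!: M.lin_ext_power_closed simp: in_power_gens\<close>)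

lemma ext_bilinear: "bilinear K (tensor_power K L m) (tensor_power K M n) N ext"
  unfolding bilinear_def ext_def
proof (intro conjI ballI)
  fix t assume "t \<in> carrier (tensor_power K M n)"
  then show "(\<lambda>s. lin_ext K N (\<lambda>xs. lin_ext K N (G xs) t) s) \<in> linear_maps K (tensor_power K L m) N"
    by (intro L.lin_ext_power_hom multilinear_inner)
next
  fix s assume "s \<in> carrier (tensor_power K L m)"
  then show "(\<lambda>t. lin_ext K N (\<lambda>xs. lin_ext K N (G xs) t) s) \<in> linear_maps K (tensor_power K M n) N"
    by (intro L.linear_maps_lin_ext_param[where n = m] multilinear_inner M.M.tensor_power_module
        M.lin_ext_power_hom right)
qed

lemma ext_pure:
  assumes "xs \<in> power_gens L m" "ys \<in> power_gens M n"
  shows "ext (power_pure K L xs) (power_pure K M ys) = G xs ys"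
  unfolding ext_def using assms
  by (simp add: L.lin_ext_power_pure[OF multilinear_inner] M.M.power_pure_closed
      M.lin_ext_power_pure[OF right])

text \<open>A Fubini rule: the extension in the opposite order is linear in each of the two tensors
  and takes the same values on pure tensors. It is the source of \<open>sw_swap\<close>.\<close>

lemma ext_swap:
  assumes "s \<in> carrier (tensor_power K L m)" "t \<in> carrier (tensor_power K M n)"
  shows "ext s t = lin_ext K N (\<lambda>ys. lin_ext K N (\<lambda>xs. G xs ys) s) t"
proof -
  interpret S: double_multilinear K M L N n m "\<lambda>ys xs. G xs ys"
    by unfold_locales (use left right in auto)
  have "S.ext t s = ext s t"
    unfolding ext_def
  proof (rule L.lin_ext_power_unique[where \<phi> = "S.ext t"])
    show "S.ext t \<in> linear_maps K (tensor_power K L m) N"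
      using S.ext_bilinear assms by (auto simp: bilinear_def)
    fix xs assume xs: "xs \<in> power_gens L m"
    show "S.ext t (power_pure K L xs) = lin_ext K N (G xs) t"
    proof (rule M.lin_ext_power_unique[where \<phi> = "\<lambda>t. S.ext t (power_pure K L xs)"])
      show "(\<lambda>t. S.ext t (power_pure K L xs)) \<in> linear_maps K (tensor_power K M n) N"
        using S.ext_bilinear L.M.power_pure_closed[OF xs] by (auto simp: bilinear_def)
    qed (use xs assms right S.ext_pure in auto)
  qed (use assms multilinear_inner in auto)
  then show ?thesis by (simp add: S.ext_def)
qed

end


section \<open>Sweedler calculus\<close>

lemma (in Module.module) tensor_append_locale:
  "double_multilinear R M M (tensor_power R M (m + n)) m n (\<lambda>xs ys. power_pure R M (xs @ ys))"
proof -
  interpret double: two_modules R M "tensor_power R M (m + n)"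
    by (intro two_modules.intro module_axioms tensor_power_module)
  show ?thesis
    by unfold_locales
      (rule multilinear_append_right[OF power_pure_multilinear] multilinear_append_left[OF power_pure_multilinear],
        assumption)+
qed

lemma (in Module.module) tensor_append_ext:
  "tensor_append R M m n = double_multilinear.ext R (tensor_power R M (m + n)) (\<lambda>xs ys. power_pure R M (xs @ ys))"
  by (simp add: tensor_append_def double_multilinear.ext_def[OF tensor_append_locale] fun_eq_iff)

lemma (in Module.module) tensor_append_bilinear:
  "bilinear R (tensor_power R M m) (tensor_power R M n) (tensor_power R M (m + n)) (tensor_append R M m n)"
  unfolding tensor_append_ext by (rule double_multilinear.ext_bilinear[OF tensor_append_locale])

lemma (in Module.module) tensor_append_pure:
  "xs \<in> power_gens M m \<Longrightarrow> ys \<in> power_gens M n \<Longrightarrow>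
    tensor_append R M m n (power_pure R M xs) (power_pure R M ys) = power_pure R M (xs @ ys)"
  unfolding tensor_append_ext by (rule double_multilinear.ext_pure[OF tensor_append_locale])

lemma multilinear_triple:
  assumes "\<And>y z. y \<in> carrier M \<Longrightarrow> z \<in> carrier M \<Longrightarrow> (\<lambda>x. T x y z) \<in> linear_maps K M N"
    and "\<And>x z. x \<in> carrier M \<Longrightarrow> z \<in> carrier M \<Longrightarrow> (\<lambda>y. T x y z) \<in> linear_maps K M N"
    and "\<And>x y. x \<in> carrier M \<Longrightarrow> y \<in> carrier M \<Longrightarrow> (\<lambda>z. T x y z) \<in> linear_maps K M N"
  shows "multilinear K M N 3 (\<lambda>xs. T (xs ! 0) (xs ! 1) (xs ! 2))"
proof (rule multilinearI)
  fix us vs assume *: "Suc (length us + length vs) = 3" "set us \<subseteq> carrier M" "set vs \<subseteq> carrier M"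
  then consider v w where "us = []" "vs = [v, w]" | u v where "us = [u]" "vs = [v]"
    | u v where "us = [u, v]" "vs = []"
    by (cases us; cases vs; cases "tl us"; cases "tl vs") auto
  then show "(\<lambda>x. T ((us @ x # vs) ! 0) ((us @ x # vs) ! 1) ((us @ x # vs) ! 2)) \<in> linear_maps K M N"
    by cases (use * assms in \<open>simp_all add: numeral_2_eq_2\<close>)
next
  fix xs assume "length xs = 3" "set xs \<subseteq> carrier M"
  then have "xs ! 0 \<in> carrier M" "xs ! 1 \<in> carrier M" "xs ! 2 \<in> carrier M"
    by (auto simp: subset_iff)
  then show "T (xs ! 0) (xs ! 1) (xs ! 2) \<in> carrier N" by (blast intro: linear_maps_closed assms)
qed

context hopf_algebra
begin

abbreviation "C \<equiv> carrier H"
abbreviation "linH \<equiv> linear_maps K H H"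
abbreviation "bilH \<equiv> bilinear K H H H"
abbreviation "scal r \<equiv> r \<odot>\<^bsub>H\<^esub> \<one>\<^bsub>H\<^esub>"

abbreviation hmult :: "'h \<Rightarrow> 'h \<Rightarrow> 'h" (infixl \<open>\<cdot>\<close> 70) where
  "x \<cdot> y \<equiv> x \<otimes>\<^bsub>H\<^esub> y"

text \<open>
  \<open>sw h B\<close> stands for the Sweedler sum \<open>\<Sum> B(h\<^sub>(\<^sub>1\<^sub>), h\<^sub>(\<^sub>2\<^sub>))\<close>. Linear forms are
  treated as endomorphisms of \<open>H\<close> with values in the multiples of the unit, so that all
  multilinear expressions take values in \<open>H\<close>; accordingly \<open>eps h\<close> is \<open>\<epsilon>(h) 1\<close>.
\<close>

definition sw :: "'h \<Rightarrow> ('h \<Rightarrow> 'h \<Rightarrow> 'h) \<Rightarrow> 'h" where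
  "sw h B = lin_ext K H (\<lambda>xs. B (xs ! 0) (xs ! 1)) (comult H h)"

definition eps :: "'h \<Rightarrow> 'h" where
  "eps h = scal (counit H h)"

lemma module_H: "Module.module K H"
  using vectorspace_axioms by (rule vectorspace.axioms)

sublocale HH: two_modules K H H
  by (intro two_modules.intro module_H)

lemma comult_closed: "h \<in> C \<Longrightarrow> comult H h \<in> carrier (tensor_power K H 2)"
  by (rule linear_maps_closed[OF comult_hom])

lemma bilI:
  "(\<And>x. x \<in> C \<Longrightarrow> B x \<in> linH) \<Longrightarrow> (\<And>y. y \<in> C \<Longrightarrow> (\<lambda>x. B x y) \<in> linH) \<Longrightarrow> bilH B"
  by (simp add: bilinear_def)

lemma bil_right: "bilH B \<Longrightarrow> x \<in> C \<Longrightarrow> B x \<in> linH"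
  and bil_left: "bilH B \<Longrightarrow> y \<in> C \<Longrightarrow> (\<lambda>x. B x y) \<in> linH"
  by (simp_all add: bilinear_def)

lemma bil_closed: "bilH B \<Longrightarrow> x \<in> C \<Longrightarrow> y \<in> C \<Longrightarrow> B x y \<in> C"
  by (rule linear_maps_closed[OF bil_right])

lemma lin_mult_left: "f \<in> linH \<Longrightarrow> c \<in> C \<Longrightarrow> (\<lambda>x. f x \<cdot> c) \<in> linH"
  by (intro linear_mapsI)
    (simp_all add: linear_maps_closed[of f K H H] linear_maps_add[of f K H H] linear_maps_smult[of f K H H]
      H.l_distr smult_mult_left)

lemma lin_mult_right: "f \<in> linH \<Longrightarrow> c \<in> C \<Longrightarrow> (\<lambda>x. c \<cdot> f x) \<in> linH"
  by (intro linear_mapsI)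
    (simp_all add: linear_maps_closed[of f K H H] linear_maps_add[of f K H H] linear_maps_smult[of f K H H]
      H.r_distr smult_mult_right)

lemma lin_antipode: "f \<in> linH \<Longrightarrow> (\<lambda>x. antipode H (f x)) \<in> linH"
  by (rule linear_maps_compose[OF _ antipode_hom])

lemma scal_hom: "scal \<in> linear_maps K (self_module K) H"
  by (intro linear_mapsI) (auto simp: self_module_def smult_l_distr smult_assoc1)

lemma eps_lin: "eps \<in> linH"
  using linear_maps_compose[OF counit_hom scal_hom] by (simp add: eps_def[abs_def])

lemma lin_eps: "f \<in> linH \<Longrightarrow> (\<lambda>x. eps (f x)) \<in> linH"
  by (rule linear_maps_compose[OF _ eps_lin])

lemma antipode_closed [simp]: "h \<in> C \<Longrightarrow> antipode H h \<in> C"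
  by (rule linear_maps_closed[OF antipode_hom])

lemma eps_closed [simp]: "h \<in> C \<Longrightarrow> eps h \<in> C"
  by (rule linear_maps_closed[OF eps_lin])

lemma counit_closed [simp]: "h \<in> C \<Longrightarrow> counit H h \<in> carrier K"
  using linear_maps_closed[OF counit_hom] by (simp add: self_module_def)

lemma sw_hom: "bilH B \<Longrightarrow> (\<lambda>h. sw h B) \<in> linH"
  unfolding sw_def
  by (rule linear_maps_compose[OF comult_hom HH.lin_ext_power_hom[OF multilinear_pair]])

lemma lin_sw: "f \<in> linH \<Longrightarrow> bilH B \<Longrightarrow> (\<lambda>x. sw (f x) B) \<in> linH"
  by (rule linear_maps_compose[OF _ sw_hom])

lemma sw_closed [simp]: "bilH B \<Longrightarrow> h \<in> C \<Longrightarrow> sw h B \<in> C"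
  by (rule linear_maps_closed[OF sw_hom])

lemma lin_sw_param:
  assumes "h \<in> C" "\<And>x. x \<in> C \<Longrightarrow> bilH (B x)"
    and "\<And>u v. u \<in> C \<Longrightarrow> v \<in> C \<Longrightarrow> (\<lambda>x. B x u v) \<in> linH"
  shows "(\<lambda>x. sw h (B x)) \<in> linH"
  unfolding sw_def
proof (rule HH.linear_maps_lin_ext_param[OF _ module_H _ comult_closed[OF assms(1)]])
  fix xs assume "xs \<in> power_gens H 2"
  then have "xs ! 0 \<in> C" "xs ! 1 \<in> C" by (auto simp: in_power_gens subset_iff)
  then show "(\<lambda>x. B x (xs ! 0) (xs ! 1)) \<in> linH" by (rule assms(3))
qed (intro multilinear_pair assms(2))

text \<open>The rules follow the structure of nested Sweedler expressions. Resolving with them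
  reduces a linearity goal to closure facts for the fixed factors.\<close>

lemmas lin_intros = bilI linear_maps_id eps_lin antipode_hom lin_mult_left lin_mult_right lin_antipode lin_eps lin_sw lin_sw_param

lemma sw_cong:
  assumes "h \<in> C" "bilH B" "\<And>u v. u \<in> C \<Longrightarrow> v \<in> C \<Longrightarrow> B' u v = B u v"
  shows "sw h B' = sw h B"
  unfolding sw_def
proof (rule HH.lin_ext_power_cong[OF multilinear_pair[OF assms(2)] _ comult_closed[OF assms(1)]])
  fix xs assume "xs \<in> power_gens H 2"
  then have "xs ! 0 \<in> C" "xs ! 1 \<in> C" by (auto simp: in_power_gens subset_iff)
  then show "B' (xs ! 0) (xs ! 1) = B (xs ! 0) (xs ! 1)" by (rule assms(3))
qed

lemma sw_lin: "\<phi> \<in> linH \<Longrightarrow> bilH B \<Longrightarrow> h \<in> C \<Longrightarrow> \<phi> (sw h B) = sw h (\<lambda>u v. \<phi> (B u v))"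
  unfolding sw_def by (rule HH.lin_ext_power_compose[OF multilinear_pair module_H _ comult_closed])

text \<open>Sweedler sums over two independent elements commute; this is \<open>ext_swap\<close> for
  two lists of length 2.\<close>

lemma sw_swap:
  assumes "h \<in> C" "k \<in> C"
    and "\<And>x y. x \<in> C \<Longrightarrow> y \<in> C \<Longrightarrow> bilH (B x y)"
    and "\<And>u v. u \<in> C \<Longrightarrow> v \<in> C \<Longrightarrow> bilH (\<lambda>x y. B x y u v)"
  shows "sw h (\<lambda>x y. sw k (B x y)) = sw k (\<lambda>u v. sw h (\<lambda>x y. B x y u v))"
proof -
  interpret D: double_multilinear K H H H 2 2 "\<lambda>xs ys. B (xs ! 0) (xs ! 1) (ys ! 0) (ys ! 1)"
  proof unfold_locales
    fix xs assume "xs \<in> power_gens H 2"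
    then have "xs ! 0 \<in> C" "xs ! 1 \<in> C" by (auto simp: in_power_gens subset_iff)
    then show "multilinear K H H 2 (\<lambda>ys. B (xs ! 0) (xs ! 1) (ys ! 0) (ys ! 1))"
      by (intro multilinear_pair assms)
  next
    fix ys assume "ys \<in> power_gens H 2"
    then have "ys ! 0 \<in> C" "ys ! 1 \<in> C" by (auto simp: in_power_gens subset_iff)
    then show "multilinear K H H 2 (\<lambda>xs. B (xs ! 0) (xs ! 1) (ys ! 0) (ys ! 1))"
      by (intro multilinear_pair[where B = "\<lambda>x y. B x y (ys ! 0) (ys ! 1)"] assms)
  qed
  show ?thesis
    using D.ext_swap[OF comult_closed[OF assms(1)] comult_closed[OF assms(2)]]
    by (simp only: D.ext_def sw_def)
qed

lemma power_pure_gens: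
  "x \<in> C \<Longrightarrow> [x] \<in> power_gens H 1" "x \<in> C \<Longrightarrow> y \<in> C \<Longrightarrow> [x, y] \<in> power_gens H 2"
  by (simp_all add: in_power_gens)

text \<open>Coassociativity is an equation in the third tensor power. The linear extension of the
  trilinear T turns it into an equation in H; the facts 1 and 2 compute that extension on a
  comultiplication with one further leg appended on the right or on the left.\<close>

lemma sw_coassoc:
  assumes h: "h \<in> C"
    and T1: "\<And>y z. y \<in> C \<Longrightarrow> z \<in> C \<Longrightarrow> (\<lambda>x. T x y z) \<in> linH"
    and T2: "\<And>x z. x \<in> C \<Longrightarrow> z \<in> C \<Longrightarrow> (\<lambda>y. T x y z) \<in> linH"
    and T3: "\<And>x y. x \<in> C \<Longrightarrow> y \<in> C \<Longrightarrow> (\<lambda>z. T x y z) \<in> linH"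
  shows "sw h (\<lambda>x z. sw x (\<lambda>u v. T u v z)) = sw h (\<lambda>x z. sw z (\<lambda>u v. T x u v))"
proof -
  let ?\<phi> = "lin_ext K H (\<lambda>xs. T (xs ! 0) (xs ! 1) (xs ! 2))"
  have tri: "multilinear K H H 3 (\<lambda>xs. T (xs ! 0) (xs ! 1) (xs ! 2))"
    by (rule multilinear_triple) (use T1 T2 T3 in auto)
  have \<phi>: "?\<phi> \<in> linear_maps K (tensor_power K H 3) H" by (rule HH.lin_ext_power_hom[OF tri])
  interpret H3: two_modules K H "tensor_power K H 3"
    by (intro two_modules.intro module_H module.tensor_power_module)
  have app: "bilinear K (tensor_power K H 2) (tensor_power K H 1) (tensor_power K H 3) (tensor_append K H 2 1)"
    "bilinear K (tensor_power K H 1) (tensor_power K H 2) (tensor_power K H 3) (tensor_append K H 1 2)"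
    using module.tensor_append_bilinear[of 2 1] module.tensor_append_bilinear[of 1 2] by (simp_all add: eval_nat_numeral)
  have pure1: "(\<lambda>x. power_pure K H [x]) \<in> linear_maps K H (tensor_power K H 1)"
    using multilinearD[OF module.power_pure_multilinear[of 1], of "[]" "[]"] by simp
  have B1: "bilinear K H H (tensor_power K H 3) (\<lambda>x z. tensor_append K H 2 1 (comult H x) (power_pure K H [z]))"
    unfolding bilinear_def
    using app(1) linear_maps_closed[OF pure1]
    by (auto simp: bilinear_def comult_closed intro!: linear_maps_compose[OF comult_hom] linear_maps_compose[OF pure1])
  have B2: "bilinear K H H (tensor_power K H 3) (\<lambda>x z. tensor_append K H 1 2 (power_pure K H [x]) (comult H z))"
    unfolding bilinear_def
    using app(2) linear_maps_closed[OF pure1]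
    by (auto simp: bilinear_def comult_closed intro!: linear_maps_compose[OF comult_hom] linear_maps_compose[OF pure1])
  have 1: "?\<phi> (tensor_append K H 2 1 (comult H x) (power_pure K H [z])) = sw x (\<lambda>u v. T u v z)"
    if "x \<in> C" "z \<in> C" for x z
    unfolding sw_def
  proof (rule HH.lin_ext_power_unique[where \<phi> = "\<lambda>s. ?\<phi> (tensor_append K H 2 1 s (power_pure K H [z]))"])
    show "multilinear K H H 2 (\<lambda>xs. T (xs ! 0) (xs ! 1) z)"
      by (rule multilinear_pair[where B = "\<lambda>x y. T x y z"]) (use that T1 T2 in \<open>auto intro!: bilI\<close>)
    show "(\<lambda>s. ?\<phi> (tensor_append K H 2 1 s (power_pure K H [z]))) \<in> linear_maps K (tensor_power K H 2) H"
      by (rule linear_maps_compose[OF _ \<phi>]) (use app(1) linear_maps_closed[OF pure1] that in \<open>auto simp: bilinear_def\<close>)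
    fix xs assume xs: "xs \<in> power_gens H 2"
    then have "xs @ [z] \<in> power_gens H 3" using that by (auto simp: in_power_gens)
    then show "?\<phi> (tensor_append K H 2 1 (power_pure K H xs) (power_pure K H [z])) = T (xs ! 0) (xs ! 1) z"
      unfolding module.tensor_append_pure[OF xs power_pure_gens(1)[OF that(2)]] using xs
      by (subst HH.lin_ext_power_pure[OF tri]) (simp_all add: nth_append in_power_gens)
  qed (use that comult_closed in auto)
  have 2: "?\<phi> (tensor_append K H 1 2 (power_pure K H [x]) (comult H z)) = sw z (\<lambda>u v. T x u v)"
    if "x \<in> C" "z \<in> C" for x z
    unfolding sw_def
  proof (rule HH.lin_ext_power_unique[where \<phi> = "\<lambda>s. ?\<phi> (tensor_append K H 1 2 (power_pure K H [x]) s)"])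
    show "multilinear K H H 2 (\<lambda>xs. T x (xs ! 0) (xs ! 1))"
      by (rule multilinear_pair) (use that T2 T3 in \<open>auto intro!: bilI\<close>)
    show "(\<lambda>s. ?\<phi> (tensor_append K H 1 2 (power_pure K H [x]) s)) \<in> linear_maps K (tensor_power K H 2) H"
      by (rule linear_maps_compose[OF _ \<phi>]) (use app(2) linear_maps_closed[OF pure1] that in \<open>auto simp: bilinear_def\<close>)
    fix xs assume xs: "xs \<in> power_gens H 2"
    then have "[x] @ xs \<in> power_gens H 3" using that by (auto simp: in_power_gens)
    then show "?\<phi> (tensor_append K H 1 2 (power_pure K H [x]) (power_pure K H xs)) = T x (xs ! 0) (xs ! 1)"
      unfolding module.tensor_append_pure[OF power_pure_gens(1)[OF that(1)] xs]
      by (subst HH.lin_ext_power_pure[OF tri]) (simp_all add: numeral_2_eq_2)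
  qed (use that comult_closed in auto)
  have bil1: "bilH (\<lambda>x z. sw x (\<lambda>u v. T u v z))" and bil2: "bilH (\<lambda>x z. sw z (\<lambda>u v. T x u v))"
    by (intro lin_intros T1 T2 T3; assumption)+
  note lx = H3.lin_ext_power_compose[OF multilinear_pair[OF B1] module_H \<phi> comult_closed[OF h]]
    H3.lin_ext_power_compose[OF multilinear_pair[OF B2] module_H \<phi> comult_closed[OF h]]
  have "sw h (\<lambda>x z. sw x (\<lambda>u v. T u v z)) =
      sw h (\<lambda>x z. ?\<phi> (tensor_append K H 2 1 (comult H x) (power_pure K H [z])))"
    by (rule sw_cong[OF h bil1, symmetric]) (rule 1)
  also have "\<dots> = sw h (\<lambda>x z. ?\<phi> (tensor_append K H 1 2 (power_pure K H [x]) (comult H z)))"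
    using lx coassoc[OF h] by (simp add: sw_def)
  also have "\<dots> = sw h (\<lambda>x z. sw z (\<lambda>u v. T x u v))"
    by (rule sw_cong[OF h bil2]) (rule 2)
  finally show ?thesis .
qed

end


section \<open>Scalars inside H and the convolution algebra of linear endomorphisms\<close>

context hopf_algebra
begin

text \<open>The copy of the ground field in H. It is central, so values of linear forms can be
  multiplied with elements of H and moved freely within products.\<close>

definition scalars :: "'h set" where
  "scalars = scal ` carrier K"

lemma scalar_closed [simp]: "s \<in> scalars \<Longrightarrow> s \<in> C"
  by (auto simp: scalars_def)

lemma eps_scalar [simp]: "h \<in> C \<Longrightarrow> eps h \<in> scalars"
  by (auto simp: scalars_def eps_def)

lemma one_scalar [simp]: "\<one>\<^bsub>H\<^esub> \<in> scalars"
  unfolding scalars_def by (rule image_eqI[of _ _ "\<one>\<^bsub>K\<^esub>"]) auto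

lemma scal_mult: "r \<in> carrier K \<Longrightarrow> h \<in> C \<Longrightarrow> scal r \<cdot> h = r \<odot>\<^bsub>H\<^esub> h"
  by (simp add: smult_mult_left)

lemma scalar_comm: "s \<in> scalars \<Longrightarrow> h \<in> C \<Longrightarrow> h \<cdot> s = s \<cdot> h"
  by (auto simp: scalars_def smult_mult_left smult_mult_right)

lemma scalar_lin: "f \<in> linH \<Longrightarrow> s \<in> scalars \<Longrightarrow> h \<in> C \<Longrightarrow> f (s \<cdot> h) = s \<cdot> f h"
  by (auto simp: scalars_def scal_mult linear_maps_smult[of f K H H] linear_maps_closed[of f K H H])

lemma scalar_lin': "f \<in> linH \<Longrightarrow> s \<in> scalars \<Longrightarrow> h \<in> C \<Longrightarrow> f (h \<cdot> s) = f h \<cdot> s"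
  by (metis scalar_comm linear_maps_closed scalar_lin)

lemma scalar_mult_closed [simp]: "s \<in> scalars \<Longrightarrow> t \<in> scalars \<Longrightarrow> s \<cdot> t \<in> scalars"
  unfolding scalars_def
  by (auto simp: scal_mult smult_assoc1[symmetric] intro!: image_eqI)

lemma eps_mult: "x \<in> C \<Longrightarrow> y \<in> C \<Longrightarrow> eps (x \<cdot> y) = eps x \<cdot> eps y"
  by (simp add: eps_def counit_mult scal_mult smult_assoc1)

lemma eps_one [simp]: "eps \<one>\<^bsub>H\<^esub> = \<one>\<^bsub>H\<^esub>"
  by (simp add: eps_def counit_one)

lemma sw_counit_left:
  assumes "f \<in> linH" "h \<in> C"
  shows "sw h (\<lambda>x y. eps x \<cdot> f y) = f h"
proof -
  have b: "bilH (\<lambda>x y. eps x \<cdot> y)" by (intro lin_intros; simp)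
  have "sw h (\<lambda>x y. counit H x \<odot>\<^bsub>H\<^esub> y) = sw h (\<lambda>x y. eps x \<cdot> y)"
    by (rule sw_cong[OF assms(2) b]) (simp add: eps_def scal_mult)
  then have "sw h (\<lambda>x y. eps x \<cdot> y) = h"
    using counit_left[OF assms(2)] by (simp add: sw_def)
  then have "f h = sw h (\<lambda>x y. f (eps x \<cdot> y))"
    using sw_lin[OF assms(1) b assms(2)] by simp
  also have "\<dots> = sw h (\<lambda>x y. eps x \<cdot> f y)"
    by (rule sw_cong[OF assms(2)])
      (use assms in \<open>auto intro!: lin_intros linear_maps_closed[of f K H H] simp: scalar_lin[OF assms(1)]\<close>)
  finally show ?thesis by simp
qed

lemma sw_counit_right:
  assumes "f \<in> linH" "h \<in> C"
  shows "sw h (\<lambda>x y. f x \<cdot> eps y) = f h"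
proof -
  have b: "bilH (\<lambda>x y. x \<cdot> eps y)" by (intro lin_intros; simp)
  have "sw h (\<lambda>x y. counit H y \<odot>\<^bsub>H\<^esub> x) = sw h (\<lambda>x y. x \<cdot> eps y)"
    by (rule sw_cong[OF assms(2) b]) (simp add: eps_def smult_mult_right)
  then have "sw h (\<lambda>x y. x \<cdot> eps y) = h"
    using counit_right[OF assms(2)] by (simp add: sw_def)
  then have "f h = sw h (\<lambda>x y. f (x \<cdot> eps y))"
    using sw_lin[OF assms(1) b assms(2)] by simp
  also have "\<dots> = sw h (\<lambda>x y. f x \<cdot> eps y)"
    by (rule sw_cong[OF assms(2)])
      (use assms in \<open>auto intro!: lin_intros linear_maps_closed[of f K H H] simp: scalar_lin'[OF assms(1)]\<close>)
  finally show ?thesis by simp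
qed

lemma sw_antipode_left: "h \<in> C \<Longrightarrow> sw h (\<lambda>x y. antipode H x \<cdot> y) = eps h"
  using antipode_left by (simp add: sw_def eps_def)

lemma sw_antipode_right: "h \<in> C \<Longrightarrow> sw h (\<lambda>x y. x \<cdot> antipode H y) = eps h"
  using antipode_right by (simp add: sw_def eps_def)

lemma pure_eval:
  assumes "bilH B" "x \<in> C" "y \<in> C"
  shows "lin_ext K H (\<lambda>xs. B (xs ! 0) (xs ! 1)) (power_pure K H [x, y]) = B x y"
  by (subst HH.lin_ext_power_pure[OF multilinear_pair[OF assms(1)]])
    (use assms in \<open>simp_all add: in_power_gens\<close>)

lemma sw_one: "bilH B \<Longrightarrow> sw \<one>\<^bsub>H\<^esub> B = B \<one>\<^bsub>H\<^esub> \<one>\<^bsub>H\<^esub>"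
  unfolding sw_def comult_one by (rule pure_eval) auto

text \<open>The product of the tensor square is itself a double extension, so multiplicativity of
  the comultiplication unfolds into two nested Sweedler sums.\<close>

lemma sw_mult:
  assumes "bilH B" "x \<in> C" "y \<in> C"
  shows "sw (x \<cdot> y) B = sw x (\<lambda>a b. sw y (\<lambda>c d. B (a \<cdot> c) (b \<cdot> d)))"
proof -
  let ?m = "map2 (mult H)" and ?P = "tensor_power K H 2"
  let ?\<phi> = "lin_ext K H (\<lambda>xs. B (xs ! 0) (xs ! 1))"
  interpret HP: two_modules K H ?P by (intro two_modules.intro module_H module.tensor_power_module)
  \<comment> \<open>With one list fixed, componentwise multiplication applies a list of linear maps
    slot by slot; \<open>m\<close> and \<open>m'\<close> bring it into the form that
    \<open>multilinear_map2\<close> expects, one for each fixed list.\<close>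
  have m: "?m xs ys = map2 (\<lambda>f y. f y) (map (mult H) xs) ys" for xs ys
    by (simp add: zip_map1 split_def)
  have m': "?m xs ys = map2 (\<lambda>f x. f x) (map (\<lambda>y x. x \<cdot> y) ys) xs" for xs ys
    by (subst zip_commute) (simp add: zip_map1 split_def)
  interpret D: double_multilinear K H H ?P 2 2 "\<lambda>xs ys. power_pure K H (?m xs ys)"
  proof unfold_locales
    fix xs assume "xs \<in> power_gens H 2"
    then show "multilinear K H ?P 2 (\<lambda>ys. power_pure K H (?m xs ys))"
      unfolding m by (intro multilinear_map2[OF module.power_pure_multilinear])
        (auto simp: in_power_gens intro!: lin_mult_right[OF linear_maps_id, simplified])
  next
    fix ys assume "ys \<in> power_gens H 2"
    then show "multilinear K H ?P 2 (\<lambda>xs. power_pure K H (?m xs ys))"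
      unfolding m' by (intro multilinear_map2[OF module.power_pure_multilinear])
        (auto simp: in_power_gens intro!: lin_mult_left[OF linear_maps_id, simplified])
  qed
  have \<phi>: "?\<phi> \<in> linear_maps K ?P H" by (rule HH.lin_ext_power_hom[OF multilinear_pair[OF assms(1)]])
  have "sw (x \<cdot> y) B = ?\<phi> (D.ext (comult H x) (comult H y))"
    using assms by (simp add: sw_def comult_mult tensor_mult_def D.ext_def)
  also have "\<dots> = lin_ext K H (\<lambda>xs. ?\<phi> (lin_ext K ?P (\<lambda>ys. power_pure K H (?m xs ys)) (comult H y))) (comult H x)"
    unfolding D.ext_def
    by (rule HP.lin_ext_power_compose[OF D.multilinear_inner[OF comult_closed[OF assms(3)]] module_H \<phi>
          comult_closed[OF assms(2)]])
  also have "\<dots> = sw x (\<lambda>a b. sw y (\<lambda>c d. B (a \<cdot> c) (b \<cdot> d)))"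
    unfolding sw_def
  proof (rule HH.lin_ext_power_cong[OF _ _ comult_closed[OF assms(2)]], goal_cases)
    case 1
    have "bilH (\<lambda>a b. sw y (\<lambda>c d. B (a \<cdot> c) (b \<cdot> d)))"
      by (intro lin_intros assms linear_maps_compose[OF _ bil_right[OF assms(1)]]
          linear_maps_compose[OF _ bil_left[OF assms(1)]]; simp)
    from multilinear_pair[OF this] show ?case by (simp only: sw_def)
  next
    case (2 xs)
    then have xs: "xs ! 0 \<in> C" "xs ! 1 \<in> C" by (auto simp: in_power_gens subset_iff)
    have "?\<phi> (lin_ext K ?P (\<lambda>ys. power_pure K H (?m xs ys)) (comult H y)) =
      lin_ext K H (\<lambda>ys. ?\<phi> (power_pure K H (?m xs ys))) (comult H y)"
      by (rule HP.lin_ext_power_compose[OF D.right[OF 2] module_H \<phi> comult_closed[OF assms(3)]])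
    also have "\<dots> = lin_ext K H (\<lambda>ys. B (xs ! 0 \<cdot> ys ! 0) (xs ! 1 \<cdot> ys ! 1)) (comult H y)"
    proof (rule HH.lin_ext_power_cong[OF _ _ comult_closed[OF assms(3)]], goal_cases)
      case 1
      show ?case
        by (rule multilinear_pair[where B = "\<lambda>c d. B (xs ! 0 \<cdot> c) (xs ! 1 \<cdot> d)"])
          (use xs in \<open>intro lin_intros assms linear_maps_compose[OF _ bil_right[OF assms(1)]]
          linear_maps_compose[OF _ bil_left[OF assms(1)]]; simp\<close>)
    next
      case (2 ys)
      then have ys: "ys ! 0 \<in> C" "ys ! 1 \<in> C" by (auto simp: in_power_gens subset_iff)
      obtain a b c d where eq: "xs = [a, b]" "ys = [c, d]"
        using \<open>xs \<in> power_gens H 2\<close> 2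
        by (auto simp: in_power_gens numeral_2_eq_2 length_Suc_conv)
      then show ?case using xs ys pure_eval[OF assms(1)] by simp
    qed
    finally show ?case .
  qed
  finally show ?thesis .
qed

text \<open>Functions are required to be \<open>undefined\<close> outside the carrier, so that
  equality of functions is equality on H and convolution identities can be used as rewrite
  rules.\<close>

definition lin_ext_set :: "('h \<Rightarrow> 'h) set" (\<open>\<E>\<close>) where
  "\<E> = {f \<in> extensional C. f \<in> linH}"

definition conv :: "('h \<Rightarrow> 'h) \<Rightarrow> ('h \<Rightarrow> 'h) \<Rightarrow> 'h \<Rightarrow> 'h" (infixl \<open>\<star>\<close> 70) where
  "f \<star> g = (\<lambda>h\<in>C. sw h (\<lambda>u v. f u \<cdot> g v))"

definition conv_one :: "'h \<Rightarrow> 'h" (\<open>\<e>\<close>) where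
  "\<e> = (\<lambda>h\<in>C. eps h)"

definition idm :: "'h \<Rightarrow> 'h" where
  "idm = (\<lambda>h\<in>C. h)"

definition S :: "'h \<Rightarrow> 'h" where
  "S = (\<lambda>h\<in>C. antipode H h)"

lemma E_lin: "f \<in> \<E> \<Longrightarrow> f \<in> linH"
  by (simp add: lin_ext_set_def)

lemma E_closed [simp]: "f \<in> \<E> \<Longrightarrow> h \<in> C \<Longrightarrow> f h \<in> C"
  by (rule linear_maps_closed[OF E_lin])

lemma E_eqI: "f \<in> \<E> \<Longrightarrow> g \<in> \<E> \<Longrightarrow> (\<And>h. h \<in> C \<Longrightarrow> f h = g h) \<Longrightarrow> f = g"
  by (auto simp: lin_ext_set_def intro: extensionalityI)

lemma mkE: "f \<in> linH \<Longrightarrow> (\<lambda>h\<in>C. f h) \<in> \<E>"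
  by (auto simp: lin_ext_set_def intro: linear_maps_cong[OF _ module_H])

lemma bil_conv: "f \<in> linH \<Longrightarrow> g \<in> linH \<Longrightarrow> bilH (\<lambda>u v. f u \<cdot> g v)"
  by (intro bilI lin_mult_left lin_mult_right linear_maps_closed[of f K H H] linear_maps_closed[of g K H H])

lemma conv_closed [simp]: "f \<in> \<E> \<Longrightarrow> g \<in> \<E> \<Longrightarrow> f \<star> g \<in> \<E>"
  unfolding conv_def by (intro mkE sw_hom bil_conv E_lin)

lemma conv_apply: "h \<in> C \<Longrightarrow> (f \<star> g) h = sw h (\<lambda>u v. f u \<cdot> g v)"
  by (simp add: conv_def)

lemma conv_restrict:
  assumes "f \<in> linH" "g \<in> linH"
  shows "(\<lambda>h\<in>C. f h) \<star> (\<lambda>h\<in>C. g h) = (\<lambda>h\<in>C. sw h (\<lambda>u v. f u \<cdot> g v))"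
  unfolding conv_def
  by (intro restrict_ext sw_cong bil_conv assms) auto

lemma one_E [simp]: "\<e> \<in> \<E>" and idm_E [simp]: "idm \<in> \<E>" and S_E [simp]: "S \<in> \<E>"
  unfolding conv_one_def idm_def S_def by (intro mkE lin_intros)+

lemma one_apply [simp]: "h \<in> C \<Longrightarrow> \<e> h = eps h" and idm_apply [simp]: "h \<in> C \<Longrightarrow> idm h = h"
  and S_apply: "h \<in> C \<Longrightarrow> S h = antipode H h"
  by (simp_all add: conv_one_def idm_def S_def)

lemma conv_assoc:
  assumes "f \<in> \<E>" "g \<in> \<E>" "k \<in> \<E>"
  shows "f \<star> g \<star> k = f \<star> (g \<star> k)"
proof (rule E_eqI)
  fix h assume h: "h \<in> C"
  note l = assms[THEN E_lin]
  have "(f \<star> g \<star> k) h = sw h (\<lambda>x z. sw x (\<lambda>u v. f u \<cdot> g v \<cdot> k z))"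
    unfolding conv_apply[OF h]
  proof (rule sw_cong[OF h])
    show "bilH (\<lambda>x z. sw x (\<lambda>u v. f u \<cdot> g v \<cdot> k z))"
      by (intro lin_intros l; simp add: assms)
    fix x z assume "x \<in> C" "z \<in> C"
    then show "(f \<star> g) x \<cdot> k z = sw x (\<lambda>u v. f u \<cdot> g v \<cdot> k z)"
      using sw_lin[OF lin_mult_left[OF linear_maps_id] bil_conv[OF l(1,2)], of "k z" x] assms
      by (simp add: conv_apply)
  qed
  also have "\<dots> = sw h (\<lambda>x z. sw z (\<lambda>u v. f x \<cdot> g u \<cdot> k v))"
    by (rule sw_coassoc[OF h, where T = "\<lambda>x y z. f x \<cdot> g y \<cdot> k z"]) (intro lin_intros l; simp add: assms)+
  also have "\<dots> = (f \<star> (g \<star> k)) h"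
    unfolding conv_apply[OF h]
  proof (rule sw_cong[OF h, symmetric])
    show "bilH (\<lambda>x z. sw z (\<lambda>u v. f x \<cdot> g u \<cdot> k v))"
      by (intro lin_intros l; simp add: assms)
    fix x z assume xz: "x \<in> C" "z \<in> C"
    have "f x \<cdot> (g \<star> k) z = sw z (\<lambda>u v. f x \<cdot> (g u \<cdot> k v))"
      using sw_lin[OF lin_mult_right[OF linear_maps_id] bil_conv[OF l(2,3)], of "f x" z] assms xz
      by (simp add: conv_apply)
    also have "\<dots> = sw z (\<lambda>u v. f x \<cdot> g u \<cdot> k v)"
      by (rule sw_cong) (use xz assms in \<open>auto simp: H.m_assoc intro!: lin_intros l\<close>)
    finally show "f x \<cdot> (g \<star> k) z = sw z (\<lambda>u v. f x \<cdot> g u \<cdot> k v)" .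
  qed
  finally show "(f \<star> g \<star> k) h = (f \<star> (g \<star> k)) h" .
qed (use assms in auto)

lemma one_conv [simp]:
  assumes f: "f \<in> \<E>"
  shows "\<e> \<star> f = f"
proof (rule E_eqI)
  fix h assume h: "h \<in> C"
  have "(\<e> \<star> f) h = sw h (\<lambda>u v. eps u \<cdot> f v)"
    unfolding conv_apply[OF h] by (rule sw_cong[OF h bil_conv[OF eps_lin E_lin[OF f]]]) simp
  then show "(\<e> \<star> f) h = f h" by (simp add: sw_counit_left[OF E_lin[OF f] h])
qed (use f in auto)

lemma conv_one [simp]:
  assumes f: "f \<in> \<E>"
  shows "f \<star> \<e> = f"
proof (rule E_eqI)
  fix h assume h: "h \<in> C"
  have "(f \<star> \<e>) h = sw h (\<lambda>u v. f u \<cdot> eps v)"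
    unfolding conv_apply[OF h] by (rule sw_cong[OF h bil_conv[OF E_lin[OF f] eps_lin]]) simp
  then show "(f \<star> \<e>) h = f h" by (simp add: sw_counit_right[OF E_lin[OF f] h])
qed (use f in auto)

lemma S_conv [simp]: "S \<star> idm = \<e>"
  unfolding S_def idm_def using conv_restrict[OF antipode_hom linear_maps_id]
  by (simp add: sw_antipode_left conv_one_def restrict_def cong: if_cong)

lemma conv_S [simp]: "idm \<star> S = \<e>"
  unfolding S_def idm_def using conv_restrict[OF linear_maps_id antipode_hom]
  by (simp add: sw_antipode_right conv_one_def restrict_def cong: if_cong)

text \<open>\<open>S\<close> is a two-sided convolution inverse of \<open>idm\<close>, so a factor
  \<open>idm\<close> can be divided out.\<close>

lemma antipode_solve_left: "Q \<in> \<E> \<Longrightarrow> idm \<star> Q = A \<Longrightarrow> Q = S \<star> A"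
  using conv_assoc[of S idm Q] by simp

lemma antipode_solve_right: "Q \<in> \<E> \<Longrightarrow> Q \<star> idm = A \<Longrightarrow> Q = A \<star> S"
  using conv_assoc[of Q idm S] by simp

end


section \<open>The antipode\<close>

context hopf_algebra
begin

lemma sw_mult_left:
  "bilH B \<Longrightarrow> h \<in> C \<Longrightarrow> c \<in> C \<Longrightarrow> sw h B \<cdot> c = sw h (\<lambda>u v. B u v \<cdot> c)"
  by (rule sw_lin[OF lin_mult_left[OF linear_maps_id]])

lemma sw_mult_right:
  "bilH B \<Longrightarrow> h \<in> C \<Longrightarrow> c \<in> C \<Longrightarrow> c \<cdot> sw h B = sw h (\<lambda>u v. c \<cdot> B u v)"
  by (rule sw_lin[OF lin_mult_right[OF linear_maps_id]])

lemma conv_idm_right: "Q \<in> linH \<Longrightarrow> k \<in> C \<Longrightarrow> ((\<lambda>k\<in>C. Q k) \<star> idm) k = sw k (\<lambda>p q. Q p \<cdot> q)"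
  unfolding idm_def by (simp add: conv_restrict[OF _ linear_maps_id])

lemma conv_S_right: "Q \<in> linH \<Longrightarrow> k \<in> C \<Longrightarrow> ((\<lambda>k\<in>C. Q k) \<star> S) k = sw k (\<lambda>p q. Q p \<cdot> antipode H q)"
  unfolding S_def by (simp add: conv_restrict[OF _ antipode_hom])

text \<open>Division by \<open>idm\<close> in pointwise form. With further variables held fixed it
  replaces the uniqueness of convolution inverses in Hom(H \<otimes> H, H).\<close>

lemma solve_right:
  assumes "Q \<in> linH" "A \<in> linH" "k \<in> C"
    and "\<And>k. k \<in> C \<Longrightarrow> sw k (\<lambda>p q. Q p \<cdot> q) = A k"
  shows "Q k = sw k (\<lambda>p q. A p \<cdot> antipode H q)"
proof -
  have "(\<lambda>k\<in>C. Q k) \<star> idm = (\<lambda>k\<in>C. A k)"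
    by (rule E_eqI) (use assms in \<open>auto simp: conv_idm_right intro!: mkE conv_closed idm_E\<close>)
  from antipode_solve_right[OF mkE[OF assms(1)] this] have "(\<lambda>k\<in>C. Q k) = (\<lambda>k\<in>C. A k) \<star> S" .
  from arg_cong[OF this, of "\<lambda>f. f k"] show ?thesis
    using assms(3) conv_S_right[OF assms(2,3)] by simp
qed

lemma solve_left:
  assumes "Q \<in> linH" "A \<in> linH" "k \<in> C"
    and "\<And>k. k \<in> C \<Longrightarrow> sw k (\<lambda>p q. p \<cdot> Q q) = A k"
  shows "Q k = sw k (\<lambda>p q. antipode H p \<cdot> A q)"
proof -
  have "idm \<star> (\<lambda>k\<in>C. Q k) = (\<lambda>k\<in>C. A k)"
    unfolding idm_def conv_restrict[OF linear_maps_id assms(1)]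
    by (rule restrict_ext) (rule assms(4))
  from antipode_solve_left[OF mkE[OF assms(1)] this] have "(\<lambda>k\<in>C. Q k) = S \<star> (\<lambda>k\<in>C. A k)" .
  also have "\<dots> = (\<lambda>k\<in>C. sw k (\<lambda>p q. antipode H p \<cdot> A q))"
    unfolding S_def by (rule conv_restrict[OF antipode_hom assms(2)])
  finally have "(\<lambda>k\<in>C. Q k) = (\<lambda>k\<in>C. sw k (\<lambda>p q. antipode H p \<cdot> A q))" .
  from arg_cong[OF this, of "\<lambda>f. f k"] show ?thesis using assms(3) by simp
qed

text \<open>The usual argument compares two convolution inverses of the multiplication in Hom(H
  \<otimes> H, H). Here the equation sum S(x1 y1) x2 y2 = eps(xy) is solved twice by
  \<open>solve_right\<close>, once for each variable.\<close>

lemma antipode_mult: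
  assumes x: "x \<in> C" and y: "y \<in> C"
  shows "antipode H (x \<cdot> y) = antipode H y \<cdot> antipode H x"
proof -
  \<comment> \<open>For fixed h this is solved in k: multiplying by the second leg of k gives the
    antipode axiom for the product of h and k.\<close>
  have 1: "sw h (\<lambda>u v. antipode H (u \<cdot> k) \<cdot> v) = eps h \<cdot> antipode H k" if h: "h \<in> C" and k: "k \<in> C" for h k
  proof -
    let ?Q = "\<lambda>k. sw h (\<lambda>u v. antipode H (u \<cdot> k) \<cdot> v)"
    have "?Q k = sw k (\<lambda>p q. (eps h \<cdot> eps p) \<cdot> antipode H q)"
    proof (rule solve_right[OF _ _ k])
      fix k assume k: "k \<in> C"
      have "sw k (\<lambda>p q. ?Q p \<cdot> q) = sw k (\<lambda>p q. sw h (\<lambda>u v. antipode H (u \<cdot> p) \<cdot> (v \<cdot> q)))"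
      proof (rule sw_cong[OF k])
        fix p q assume pq: "p \<in> C" "q \<in> C"
        have "?Q p \<cdot> q = sw h (\<lambda>u v. antipode H (u \<cdot> p) \<cdot> v \<cdot> q)"
          using pq h by (intro sw_mult_left lin_intros) auto
        also have "\<dots> = sw h (\<lambda>u v. antipode H (u \<cdot> p) \<cdot> (v \<cdot> q))"
          using pq h by (intro sw_cong lin_intros) (auto simp: H.m_assoc)
        finally show "?Q p \<cdot> q = \<dots>" .
      qed (use h in \<open>intro lin_intros; simp\<close>)
      also have "\<dots> = sw h (\<lambda>u v. sw k (\<lambda>p q. antipode H (u \<cdot> p) \<cdot> (v \<cdot> q)))"
        by (rule sw_swap[OF k h]; intro lin_intros; simp)
      also have "\<dots> = sw (h \<cdot> k) (\<lambda>u v. antipode H u \<cdot> v)"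
        by (rule sw_mult[symmetric, OF _ h k]) (intro lin_intros; simp)
      also have "\<dots> = eps h \<cdot> eps k" using h k by (simp add: sw_antipode_left eps_mult)
      finally show "sw k (\<lambda>p q. ?Q p \<cdot> q) = eps h \<cdot> eps k" .
    qed (use h in \<open>intro lin_intros; simp\<close>)+
    also have "\<dots> = sw k (\<lambda>p q. eps h \<cdot> (eps p \<cdot> antipode H q))"
      using h k by (intro sw_cong lin_intros) (auto simp: H.m_assoc)
    also have "\<dots> = eps h \<cdot> sw k (\<lambda>p q. eps p \<cdot> antipode H q)"
      by (rule sw_mult_right[symmetric, OF _ k]) (use h in \<open>(intro lin_intros; simp)?, simp?\<close>)
    also have "\<dots> = eps h \<cdot> antipode H k" by (simp add: sw_counit_left[OF antipode_hom k])
    finally show ?thesis .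
  qed
  \<comment> \<open>Second round, now in the variable x; fact 1 is the equation to be
    solved.\<close>
  have "antipode H (x \<cdot> y) = sw x (\<lambda>p q. (antipode H y \<cdot> eps p) \<cdot> antipode H q)"
  proof (rule solve_right[OF _ _ x])
    fix k assume "k \<in> C"
    then show "sw k (\<lambda>p q. antipode H (p \<cdot> y) \<cdot> q) = antipode H y \<cdot> eps k"
      using y 1[of k y] by (simp add: scalar_comm[of "eps k" "antipode H y"])
  qed (use y in \<open>intro lin_intros; simp\<close>)+
  also have "\<dots> = sw x (\<lambda>p q. antipode H y \<cdot> (eps p \<cdot> antipode H q))"
    using x y by (intro sw_cong lin_intros) (auto simp: H.m_assoc)
  also have "\<dots> = antipode H y \<cdot> sw x (\<lambda>p q. eps p \<cdot> antipode H q)"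
    by (rule sw_mult_right[symmetric, OF _ x]) (use y in \<open>(intro lin_intros; simp)?, simp?\<close>)
  finally show ?thesis by (simp add: sw_counit_left[OF antipode_hom x])
qed

lemma antipode_one [simp]: "antipode H \<one>\<^bsub>H\<^esub> = \<one>\<^bsub>H\<^esub>"
proof -
  have "sw \<one>\<^bsub>H\<^esub> (\<lambda>x y. antipode H x \<cdot> y) = antipode H \<one>\<^bsub>H\<^esub> \<cdot> \<one>\<^bsub>H\<^esub>"
    by (rule sw_one) (intro lin_intros; simp)
  then show ?thesis by (simp add: sw_antipode_left)
qed

lemma antipode_scalar [simp]: "s \<in> scalars \<Longrightarrow> antipode H s = s"
  using scalar_lin[OF antipode_hom, of s "\<one>\<^bsub>H\<^esub>"] by simp

lemma eps_scalar_eq [simp]: "s \<in> scalars \<Longrightarrow> eps s = s"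
  using scalar_lin[OF eps_lin, of s "\<one>\<^bsub>H\<^esub>"] by simp

text \<open>Apply the counit to sum S(h1) h2 = eps(h); on the left the factor eps(h2) is absorbed by
  the counit axiom.\<close>

lemma eps_antipode [simp]:
  assumes "h \<in> C"
  shows "eps (antipode H h) = eps h"
proof -
  have "eps h = eps (sw h (\<lambda>x y. antipode H x \<cdot> y))"
    using assms by (simp add: sw_antipode_left)
  also have "\<dots> = sw h (\<lambda>x y. eps (antipode H x \<cdot> y))"
    by (rule sw_lin[OF eps_lin _ assms]) (intro lin_intros; simp)
  also have "\<dots> = sw h (\<lambda>x y. eps (antipode H x) \<cdot> eps y)"
    by (rule sw_cong[OF assms]; (intro lin_intros; simp)?) (simp add: eps_mult)
  also have "\<dots> = eps (antipode H h)"
    by (rule sw_counit_right[OF lin_antipode[OF linear_maps_id, THEN lin_eps] assms])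
  finally show ?thesis by simp
qed

lemma finsum_lin:
  assumes "\<phi> \<in> linH" "finite A" "f \<in> A \<rightarrow> C"
  shows "\<phi> (\<Oplus>\<^bsub>H\<^esub>a\<in>A. f a) = (\<Oplus>\<^bsub>H\<^esub>a\<in>A. \<phi> (f a))"
  using assms(2,3)
proof (induction A rule: finite_induct)
  case empty
  interpret \<phi>: mod_hom K H H \<phi> by (intro mod_homI module_H assms(1))
  show ?case using \<phi>.f0_is_0 by simp
next
  case (insert a A)
  then have "(\<lambda>a. \<phi> (f a)) \<in> A \<rightarrow> C" "\<phi> (f a) \<in> C"
    by (auto intro: linear_maps_closed[OF assms(1)])
  with insert show ?case by (simp add: linear_maps_add[OF assms(1)] Pi_iff)
qed

lemma finsum_swap:
  assumes "finite A" "finite B" "\<And>a b. a \<in> A \<Longrightarrow> b \<in> B \<Longrightarrow> f a b \<in> C"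
  shows "(\<Oplus>\<^bsub>H\<^esub>a\<in>A. \<Oplus>\<^bsub>H\<^esub>b\<in>B. f a b) = (\<Oplus>\<^bsub>H\<^esub>b\<in>B. \<Oplus>\<^bsub>H\<^esub>a\<in>A. f a b)"
  using assms(1,3)
proof (induction A rule: finite_induct)
  case empty
  then show ?case by simp
next
  case (insert a A)
  then have "(\<lambda>x. \<Oplus>\<^bsub>H\<^esub>b\<in>B. f x b) \<in> A \<rightarrow> C" "(\<Oplus>\<^bsub>H\<^esub>b\<in>B. f a b) \<in> C"
    by (auto intro!: module.M.finsum_closed)
  then have "(\<Oplus>\<^bsub>H\<^esub>a\<in>insert a A. \<Oplus>\<^bsub>H\<^esub>b\<in>B. f a b) = (\<Oplus>\<^bsub>H\<^esub>b\<in>B. f a b) \<oplus>\<^bsub>H\<^esub> (\<Oplus>\<^bsub>H\<^esub>b\<in>B. \<Oplus>\<^bsub>H\<^esub>a\<in>A. f a b)"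
    using insert by simp
  also have "\<dots> = (\<Oplus>\<^bsub>H\<^esub>b\<in>B. f a b \<oplus>\<^bsub>H\<^esub> (\<Oplus>\<^bsub>H\<^esub>a\<in>A. f a b))"
    using insert by (intro module.M.finsum_addf[symmetric]) (auto intro!: module.M.finsum_closed)
  also have "\<dots> = (\<Oplus>\<^bsub>H\<^esub>b\<in>B. \<Oplus>\<^bsub>H\<^esub>a\<in>insert a A. f a b)"
    using insert by (intro module.M.finsum_cong') (auto intro!: module.M.finsum_closed)
  finally show ?case .
qed

lemma lin_zero: "(\<lambda>x. \<zero>\<^bsub>H\<^esub>) \<in> linH"
  by (rule linear_mapsI) auto

lemma lin_finsum:
  assumes "finite A" "\<And>a. a \<in> A \<Longrightarrow> f a \<in> linH"
  shows "(\<lambda>x. \<Oplus>\<^bsub>H\<^esub>a\<in>A. f a x) \<in> linH"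
  using assms
proof (induction A rule: finite_induct)
  case empty
  then show ?case using lin_zero by simp
next
  case (insert a A)
  then have "(\<lambda>x. f a x \<oplus>\<^bsub>H\<^esub> (\<Oplus>\<^bsub>H\<^esub>a\<in>A. f a x)) \<in> linH"
    by (intro HH.linear_maps_sum) auto
  moreover have "(\<Oplus>\<^bsub>H\<^esub>a\<in>insert a A. f a x) = f a x \<oplus>\<^bsub>H\<^esub> (\<Oplus>\<^bsub>H\<^esub>a\<in>A. f a x)" if "x \<in> C" for x
    using insert that by (intro module.M.finsum_insert) (auto intro: linear_maps_closed[of _ K H H])
  ultimately show ?case by (rule linear_maps_cong[OF _ module_H])
qed

lemma sw_finsum:
  assumes "finite A" "h \<in> C" "\<And>a. a \<in> A \<Longrightarrow> bilH (B a)"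
  shows "sw h (\<lambda>u v. \<Oplus>\<^bsub>H\<^esub>a\<in>A. B a u v) = (\<Oplus>\<^bsub>H\<^esub>a\<in>A. sw h (B a))"
proof -
  have bil: "bilH (\<lambda>u v. \<Oplus>\<^bsub>H\<^esub>a\<in>A. B a u v)"
    using assms by (intro bilI lin_finsum) (auto intro: bil_left bil_right)
  have "(\<Oplus>\<^bsub>H\<^esub>a\<in>A. sw h (B a)) = sw h (\<lambda>u v. \<Oplus>\<^bsub>H\<^esub>a\<in>A. B a u v)"
    unfolding sw_def
  proof (rule HH.lin_ext_power_unique[OF multilinear_pair[OF bil] _ _ comult_closed[OF assms(2)],
        where \<phi> = "\<lambda>t. \<Oplus>\<^bsub>H\<^esub>a\<in>A. lin_ext K H (\<lambda>xs. B a (xs ! 0) (xs ! 1)) t"])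
    interpret T: two_modules K "tensor_power K H 2" H
      by (intro two_modules.intro module.tensor_power_module module_H)
    note hom = HH.lin_ext_power_hom[OF multilinear_pair[OF assms(3)]]
    show "(\<lambda>t. \<Oplus>\<^bsub>H\<^esub>a\<in>A. lin_ext K H (\<lambda>xs. B a (xs ! 0) (xs ! 1)) t) \<in> linear_maps K (tensor_power K H 2) H"
      using assms(1) hom
    proof (induction A rule: finite_induct)
      case empty
      then show ?case by (auto intro!: linear_mapsI)
    next
      case (insert a A)
      then have "(\<lambda>t. lin_ext K H (\<lambda>xs. B a (xs ! 0) (xs ! 1)) t \<oplus>\<^bsub>H\<^esub>
          (\<Oplus>\<^bsub>H\<^esub>a\<in>A. lin_ext K H (\<lambda>xs. B a (xs ! 0) (xs ! 1)) t)) \<in> linear_maps K (tensor_power K H 2) H"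
        by (intro T.linear_maps_sum) auto
      then show ?case
        by (rule linear_maps_cong[OF _ module.tensor_power_module])
          (intro module.M.finsum_insert insert.hyps Pi_I linear_maps_closed[OF insert.prems]; simp)
    qed
    fix xs assume xs: "xs \<in> power_gens H 2"
    note pure = HH.lin_ext_power_pure[OF multilinear_pair[OF assms(3)] xs]
    have "xs ! 0 \<in> C" "xs ! 1 \<in> C" using xs by (auto simp: in_power_gens subset_iff)
    then show "(\<Oplus>\<^bsub>H\<^esub>a\<in>A. lin_ext K H (\<lambda>xs. B a (xs ! 0) (xs ! 1)) (power_pure K H xs)) =
        (\<Oplus>\<^bsub>H\<^esub>a\<in>A. B a (xs ! 0) (xs ! 1))"
      by (intro module.M.finsum_cong' refl) (auto simp: pure[simplified] intro!: bil_closed[OF assms(3)])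
  qed
  then show ?thesis by (rule sym)
qed

end

section \<open>Coordinates\<close>

locale fd_hopf_algebra = hopf_algebra K H
  for K :: "('k, 'r) ring_scheme" and H :: "('k, 'h, 's) hopf_scheme" +
  assumes fin_dim: fin_dim
begin

definition Bs :: "'h set" where
  "Bs = (SOME B. finite B \<and> basis B)"

lemma Bs: "finite Bs" "basis Bs"
  using someI_ex[OF finite_basis_exists[OF fin_dim]] by (auto simp: Bs_def)

lemma Bs_closed [simp]: "b \<in> Bs \<Longrightarrow> b \<in> C"
  using Bs by (auto simp: basis_def)

definition coord :: "'h \<Rightarrow> 'h \<Rightarrow> 'k" where
  "coord h = (THE a. a \<in> Bs \<rightarrow>\<^sub>E carrier K \<and> lincomb a Bs = h)"

lemma coord:
  assumes "h \<in> C"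
  shows "coord h \<in> Bs \<rightarrow>\<^sub>E carrier K" "lincomb (coord h) Bs = h"
  using theI'[of "\<lambda>a. a \<in> Bs \<rightarrow>\<^sub>E carrier K \<and> lincomb a Bs = h"] assms
    basis_criterion[of Bs] Bs
  by (auto simp: coord_def basis_def)

lemma coord_unique:
  assumes "a \<in> Bs \<rightarrow> carrier K" "b \<in> Bs"
  shows "coord (lincomb a Bs) b = a b"
proof -
  let ?a = "restrict a Bs"
  have 1: "lincomb ?a Bs = lincomb a Bs" using assms Bs unfolding lincomb_def
    by (intro module.M.finsum_cong') auto
  have "lincomb a Bs \<in> C" using assms Bs by (intro lincomb_closed) (auto simp: basis_def)
  then have "\<exists>!a'. a' \<in> Bs \<rightarrow>\<^sub>E carrier K \<and> lincomb a' Bs = lincomb a Bs"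
    using basis_criterion[of Bs] Bs by (auto simp: basis_def)
  moreover have "?a \<in> Bs \<rightarrow>\<^sub>E carrier K" using assms by auto
  ultimately have "coord (lincomb a Bs) = ?a"
    unfolding coord_def using 1 by (intro the1_equality) auto
  then show ?thesis using assms by simp
qed

text \<open>The dual basis, with values moved into \<open>scalars\<close> so that each coordinate
  form is an element of the convolution algebra.\<close>

definition crd :: "'h \<Rightarrow> 'h \<Rightarrow> 'h" where
  "crd b = (\<lambda>h\<in>C. scal (coord h b))"

lemma coord_closed [simp]: "h \<in> C \<Longrightarrow> b \<in> Bs \<Longrightarrow> coord h b \<in> carrier K"
  using coord(1) by auto

lemma crd_scalar [simp]: "h \<in> C \<Longrightarrow> b \<in> Bs \<Longrightarrow> crd b h \<in> scalars"
  by (auto simp: crd_def scalars_def)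

lemma crd_E [simp]:
  assumes b: "b \<in> Bs"
  shows "crd b \<in> \<E>"
  unfolding crd_def
proof (intro mkE linear_mapsI)
  have sub: "Bs \<subseteq> C" by auto
  fix x y assume xy: "x \<in> C" "y \<in> C"
  have "x \<oplus>\<^bsub>H\<^esub> y = lincomb (\<lambda>v. coord x v \<oplus>\<^bsub>K\<^esub> coord y v) Bs"
    using xy by (subst lincomb_sum[OF Bs(1) sub]) (auto simp: coord(2))
  then have "coord (x \<oplus>\<^bsub>H\<^esub> y) b = coord x b \<oplus>\<^bsub>K\<^esub> coord y b"
    using xy b coord_unique[of "\<lambda>v. coord x v \<oplus>\<^bsub>K\<^esub> coord y v"] by simp
  then show "scal (coord (x \<oplus>\<^bsub>H\<^esub> y) b) = scal (coord x b) \<oplus>\<^bsub>H\<^esub> scal (coord y b)"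
    using xy b by (simp add: smult_l_distr)
next
  have sub: "Bs \<subseteq> C" by auto
  fix r x assume rx: "r \<in> carrier K" "x \<in> C"
  have "r \<odot>\<^bsub>H\<^esub> x = lincomb (\<lambda>v. r \<otimes>\<^bsub>K\<^esub> coord x v) Bs"
    using rx by (subst lincomb_smult[OF sub]) (auto simp: coord(2))
  then have "coord (r \<odot>\<^bsub>H\<^esub> x) b = r \<otimes>\<^bsub>K\<^esub> coord x b"
    using rx b coord_unique[of "\<lambda>v. r \<otimes>\<^bsub>K\<^esub> coord x v"] by simp
  then show "scal (coord (r \<odot>\<^bsub>H\<^esub> x) b) = r \<odot>\<^bsub>H\<^esub> scal (coord x b)"
    using rx b by (simp add: smult_assoc1)
qed (use b in auto)

lemma expand:
  assumes "\<phi> \<in> linH" "h \<in> C"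
  shows "\<phi> h = (\<Oplus>\<^bsub>H\<^esub>b\<in>Bs. crd b h \<cdot> \<phi> b)"
proof -
  have "\<phi> h = \<phi> (\<Oplus>\<^bsub>H\<^esub>b\<in>Bs. coord h b \<odot>\<^bsub>H\<^esub> b)"
    using coord(2)[OF assms(2)] by (simp add: lincomb_def)
  also have "\<dots> = (\<Oplus>\<^bsub>H\<^esub>b\<in>Bs. \<phi> (coord h b \<odot>\<^bsub>H\<^esub> b))"
    using assms by (intro finsum_lin Bs) auto
  also have "\<dots> = (\<Oplus>\<^bsub>H\<^esub>b\<in>Bs. crd b h \<cdot> \<phi> b)"
    using assms by (intro module.M.finsum_cong' refl)
      (auto simp: crd_def scal_mult linear_maps_smult[OF assms(1)] linear_maps_closed[OF assms(1)])
  finally show ?thesis .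
qed

lemma crd_basis: "b \<in> Bs \<Longrightarrow> d \<in> Bs \<Longrightarrow> crd d b = (if d = b then \<one>\<^bsub>H\<^esub> else \<zero>\<^bsub>H\<^esub>)"
proof -
  assume bd: "b \<in> Bs" "d \<in> Bs"
  let ?a = "\<lambda>v. if v = b then \<one>\<^bsub>K\<^esub> else \<zero>\<^bsub>K\<^esub>"
  have "lincomb ?a Bs = (\<Oplus>\<^bsub>H\<^esub>v\<in>Bs. if b = v then v else \<zero>\<^bsub>H\<^esub>)"
    unfolding lincomb_def by (intro module.M.finsum_cong') auto
  also have "\<dots> = b" using bd Bs by (intro module.M.add.finprod_singleton) auto
  finally have "coord b d = ?a d" using coord_unique[of ?a d] bd by auto
  then show ?thesis using bd by (simp add: crd_def)
qed

text \<open>An injective endomorphism maps the basis to linearly independent vectors of the same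
  number, hence to a basis.\<close>

lemma lin_surj:
  assumes T: "T \<in> linH" and inj: "\<And>k. k \<in> C \<Longrightarrow> T k = \<zero>\<^bsub>H\<^esub> \<Longrightarrow> k = \<zero>\<^bsub>H\<^esub>" and y: "y \<in> C"
  shows "\<exists>x\<in>C. T x = y"
proof -
  interpret T: linear_map K H H T
    by (intro linear_map.intro mod_homI module_H T vectorspace_axioms)
  have inj': "inj_on T C"
    by (rule T.Ke0_imp_inj) (use inj in \<open>auto simp: T.ker_def\<close>)
  let ?TB = "T ` Bs"
  have TB: "?TB \<subseteq> C" using linear_maps_closed[OF T] by auto
  have card: "card ?TB = dim"
    using Bs dim_basis[of Bs] card_image[OF inj_on_subset[OF inj', of Bs]] by (auto simp: basis_def)
  have "lin_indpt ?TB"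
  proof (rule finite_lin_indpt2)
    fix a assume a: "a \<in> ?TB \<rightarrow> carrier K" and 0: "lincomb a ?TB = \<zero>\<^bsub>H\<^esub>"
    have "T (lincomb (a \<circ> T) Bs) = \<zero>\<^bsub>H\<^esub>"
      using T.lincomb_linear_image[OF inj', of Bs a] a 0 Bs by (auto simp: basis_def)
    then have "lincomb (a \<circ> T) Bs = \<zero>\<^bsub>H\<^esub>"
      by (rule inj[rotated], intro lincomb_closed) (use a in auto)
    moreover have "lincomb (\<lambda>_. \<zero>\<^bsub>K\<^esub>) Bs = \<zero>\<^bsub>H\<^esub>"
      unfolding lincomb_def by (intro module.M.add.finprod_one_eqI) simp
    ultimately have "(a \<circ> T) v = \<zero>\<^bsub>K\<^esub>" if "v \<in> Bs" for v
      using coord_unique[of "a \<circ> T" v] coord_unique[of "\<lambda>_. \<zero>\<^bsub>K\<^esub>" v] a that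
      by (metis (no_types, lifting) Pi_I Pi_iff comp_apply image_eqI module.R.zero_closed)
    then show "\<forall>v\<in>?TB. a v = \<zero>\<^bsub>K\<^esub>" by auto
  qed (use Bs TB in auto)
  then have "basis ?TB" using dim_li_is_basis[OF fin_dim] Bs TB card by auto
  then have "y \<in> span ?TB" using y by (auto simp: basis_def)
  then obtain a where a: "a \<in> ?TB \<rightarrow> carrier K" "lincomb a ?TB = y"
    using finite_in_span[of ?TB y] Bs TB by auto
  then have "T (lincomb (a \<circ> T) Bs) = y"
    using T.lincomb_linear_image[OF inj', of Bs a] Bs by (auto simp: basis_def)
  moreover have "lincomb (a \<circ> T) Bs \<in> C" using a Bs by (intro lincomb_closed) (auto simp: basis_def)
  ultimately show ?thesis by blast
qed

end


section \<open>The antipode reverses the comultiplication\<close>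

context fd_hopf_algebra
begin

text \<open>This is sum S(h1)_1 h2 \<otimes> S(h1)_2 = 1 \<otimes> S(h), with a coordinate form
  applied to the first leg to stay inside H. Multiplying the second leg by h3 turns the left side
  into the comultiplication of sum S(h1) h2 = eps(h), and \<open>solve_right\<close> removes that
  factor again.\<close>

lemma sw_antipode_left_slot:
  assumes h: "h \<in> C" and c: "c \<in> Bs"
  shows "sw h (\<lambda>x y. sw (antipode H x) (\<lambda>p q. crd c (p \<cdot> y) \<cdot> q)) = crd c \<one>\<^bsub>H\<^esub> \<cdot> antipode H h"
    (is "?Q h = _")
proof -
  note lc = linear_maps_compose[OF _ E_lin[OF crd_E[OF c]]]
  note li = sw_closed H.m_closed lin_intros lc E_lin[OF crd_E[OF c]]
  let ?\<phi> = "\<lambda>t. sw t (\<lambda>p q. crd c p \<cdot> q)"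
  have \<phi>: "?\<phi> \<in> linH" by (intro li; simp add: c)
  note l\<phi> = linear_maps_compose[OF _ \<phi>]
  have "?Q h = sw h (\<lambda>p q. (crd c \<one>\<^bsub>H\<^esub> \<cdot> eps p) \<cdot> antipode H q)"
  proof (rule solve_right[OF _ _ h])
    fix h assume h: "h \<in> C"
    have "sw h (\<lambda>x z. ?Q x \<cdot> z) =
        sw h (\<lambda>x z. sw x (\<lambda>x y. sw (antipode H x) (\<lambda>p q. crd c (p \<cdot> y) \<cdot> q) \<cdot> z))"
      by (rule sw_cong[OF h]; (rule sw_mult_left)?; (intro li; simp add: c)?)
    also have "\<dots> = sw h (\<lambda>x z. sw z (\<lambda>y z. sw (antipode H x) (\<lambda>p q. crd c (p \<cdot> y) \<cdot> q) \<cdot> z))"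
      by (rule sw_coassoc[OF h,
            where T = "\<lambda>x y z. sw (antipode H x) (\<lambda>p q. crd c (p \<cdot> y) \<cdot> q) \<cdot> z"];
          intro li; simp add: c)
    also have "\<dots> = sw h (\<lambda>x z. ?\<phi> (antipode H x \<cdot> z))"
    proof (rule sw_cong[OF h])
      show "bilH (\<lambda>x z. ?\<phi> (antipode H x \<cdot> z))" by (intro l\<phi> lin_intros; simp)
      fix x z assume xz: "x \<in> C" "z \<in> C"
      then have ax: "antipode H x \<in> C" by simp
      have "sw z (\<lambda>y z. sw (antipode H x) (\<lambda>p q. crd c (p \<cdot> y) \<cdot> q) \<cdot> z) =
          sw z (\<lambda>y z. sw (antipode H x) (\<lambda>p q. crd c (p \<cdot> y) \<cdot> (q \<cdot> z)))"
      proof (rule sw_cong[OF xz(2)])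
        fix y z assume yz: "y \<in> C" "z \<in> C"
        have "sw (antipode H x) (\<lambda>p q. crd c (p \<cdot> y) \<cdot> q) \<cdot> z =
            sw (antipode H x) (\<lambda>p q. crd c (p \<cdot> y) \<cdot> q \<cdot> z)"
          by (rule sw_mult_left[OF _ ax yz(2)]) (use yz in \<open>intro li; simp add: c\<close>)
        also have "\<dots> = sw (antipode H x) (\<lambda>p q. crd c (p \<cdot> y) \<cdot> (q \<cdot> z))"
          by (rule sw_cong[OF ax]) (use yz c in \<open>(intro li; simp)?, (simp add: H.m_assoc)?\<close>)
        finally show "sw (antipode H x) (\<lambda>p q. crd c (p \<cdot> y) \<cdot> q) \<cdot> z = \<dots>" .
      qed (use ax in \<open>intro li; simp add: c\<close>)
      also have "\<dots> = sw (antipode H x) (\<lambda>p q. sw z (\<lambda>y z. crd c (p \<cdot> y) \<cdot> (q \<cdot> z)))"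
        by (rule sw_swap[OF xz(2) ax]; intro li; simp add: c)
      also have "\<dots> = ?\<phi> (antipode H x \<cdot> z)"
        by (rule sw_mult[OF _ ax xz(2), symmetric]) (intro li; simp add: c)
      finally show "sw z (\<lambda>y z. sw (antipode H x) (\<lambda>p q. crd c (p \<cdot> y) \<cdot> q) \<cdot> z) =
          ?\<phi> (antipode H x \<cdot> z)" .
    qed
    also have "\<dots> = ?\<phi> (sw h (\<lambda>x z. antipode H x \<cdot> z))"
      by (rule sw_lin[OF \<phi> _ h, symmetric]) (intro lin_intros; simp)
    also have "\<dots> = crd c \<one>\<^bsub>H\<^esub> \<cdot> eps h"
    proof -
      have "?\<phi> (eps h \<cdot> \<one>\<^bsub>H\<^esub>) = eps h \<cdot> ?\<phi> \<one>\<^bsub>H\<^esub>"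
        using h by (intro scalar_lin[OF \<phi>]) auto
      moreover have "?\<phi> \<one>\<^bsub>H\<^esub> = crd c \<one>\<^bsub>H\<^esub> \<cdot> \<one>\<^bsub>H\<^esub>"
        by (rule sw_one) (intro li; simp add: c)
      ultimately show ?thesis using h c
        by (simp add: sw_antipode_left scalar_comm[of "eps h" "crd c \<one>\<^bsub>H\<^esub>"])
    qed
    finally show "sw h (\<lambda>x z. ?Q x \<cdot> z) = crd c \<one>\<^bsub>H\<^esub> \<cdot> eps h" .
  qed (use h c in \<open>intro li; simp\<close>)+
  also have "\<dots> = sw h (\<lambda>p q. crd c \<one>\<^bsub>H\<^esub> \<cdot> (eps p \<cdot> antipode H q))"
    using h c by (intro sw_cong lin_intros) (auto simp: H.m_assoc)
  also have "\<dots> = crd c \<one>\<^bsub>H\<^esub> \<cdot> sw h (\<lambda>p q. eps p \<cdot> antipode H q)"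
    by (rule sw_mult_right[symmetric, OF _ h]) (use c in \<open>(intro lin_intros; simp)?, simp?\<close>)
  finally show ?thesis by (simp add: sw_counit_left[OF antipode_hom h])
qed

text \<open>The reversal of the comultiplication by S, tested with a coordinate form d on the second
  leg. By \<open>solve_right\<close> it suffices that sum S(h1)_1 d(S(h1)_2) h2 = d(S(h)); expanding
  the product of S(h1)_1 and h2 in the basis reduces this to
  \<open>sw_antipode_left_slot\<close>.\<close>

lemma sw_antipode_scalar_slot:
  assumes h: "h \<in> C" and d: "d \<in> Bs"
  shows "sw (antipode H h) (\<lambda>p q. p \<cdot> crd d q) = sw h (\<lambda>u v. crd d (antipode H u) \<cdot> antipode H v)"
proof (rule solve_right[OF _ _ h])
  have lc: "f \<in> linH \<Longrightarrow> c \<in> Bs \<Longrightarrow> (\<lambda>x. crd c (f x)) \<in> linH" for c f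
    by (rule linear_maps_compose[OF _ E_lin[OF crd_E]])
  note li = sw_closed H.m_closed lin_intros lc E_lin[OF crd_E] lin_finsum[OF Bs(1)]
  show "(\<lambda>h. sw (antipode H h) (\<lambda>p q. p \<cdot> crd d q)) \<in> linH" "(\<lambda>h. crd d (antipode H h)) \<in> linH"
    by (intro li; simp add: d)+
  fix h assume h: "h \<in> C"
  let ?\<psi> = "\<lambda>c t. c \<cdot> crd d t"
  let ?R = "\<lambda>c x y. sw (antipode H x) (\<lambda>p q. crd c (p \<cdot> y) \<cdot> q)"
  have bR: "bilH (?R c)" if "c \<in> Bs" for c by (intro li; simp add: that)
  have \<psi>: "?\<psi> c \<in> linH" if "c \<in> Bs" for c by (intro li; simp add: that d)
  have b\<psi>: "bilH (\<lambda>x y. ?\<psi> c (?R c x y))" if "c \<in> Bs" for c by (intro li; simp add: that d)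
  have "sw h (\<lambda>x y. sw (antipode H x) (\<lambda>p q. p \<cdot> crd d q) \<cdot> y) =
      sw h (\<lambda>x y. \<Oplus>\<^bsub>H\<^esub>c\<in>Bs. ?\<psi> c (?R c x y))"
  proof (rule sw_cong[OF h])
    show "bilH (\<lambda>x y. \<Oplus>\<^bsub>H\<^esub>c\<in>Bs. ?\<psi> c (?R c x y))"
      by (intro bilI lin_finsum Bs bil_left[OF b\<psi>] bil_right[OF b\<psi>])
    fix x y assume xy: "x \<in> C" "y \<in> C"
    then have ax: "antipode H x \<in> C" by simp
    have bc: "bilH (\<lambda>p q. c \<cdot> crd d (crd c (p \<cdot> y) \<cdot> q))" if "c \<in> Bs" for c
      by (intro li; simp add: that d xy)
    have "sw (antipode H x) (\<lambda>p q. p \<cdot> crd d q) \<cdot> y = sw (antipode H x) (\<lambda>p q. p \<cdot> crd d q \<cdot> y)"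
      by (rule sw_mult_left[OF _ ax xy(2)]) (intro li; simp add: d)
    also have "\<dots> = sw (antipode H x) (\<lambda>p q. \<Oplus>\<^bsub>H\<^esub>c\<in>Bs. c \<cdot> crd d (crd c (p \<cdot> y) \<cdot> q))"
    proof (rule sw_cong[OF ax])
      show "bilH (\<lambda>p q. \<Oplus>\<^bsub>H\<^esub>c\<in>Bs. c \<cdot> crd d (crd c (p \<cdot> y) \<cdot> q))"
        by (intro bilI lin_finsum Bs bil_left[OF bc] bil_right[OF bc])
      fix p q assume pq: "p \<in> C" "q \<in> C"
      have "p \<cdot> crd d q \<cdot> y = (p \<cdot> y) \<cdot> crd d q"
        using pq xy d by (simp add: H.m_assoc scalar_comm[of "crd d q" y])
      also have "\<dots> = (\<Oplus>\<^bsub>H\<^esub>c\<in>Bs. crd c (p \<cdot> y) \<cdot> (c \<cdot> crd d q))"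
        using pq xy d by (intro expand[where \<phi> = "\<lambda>t. t \<cdot> crd d q"] lin_intros) auto
      also have "\<dots> = (\<Oplus>\<^bsub>H\<^esub>c\<in>Bs. c \<cdot> crd d (crd c (p \<cdot> y) \<cdot> q))"
        using pq xy d
        by (intro module.M.finsum_cong' refl)
          (auto simp: scalar_lin[OF E_lin[OF crd_E]] H.m_assoc[symmetric] scalar_comm[of "crd _ (p \<cdot> y)"])
      finally show "p \<cdot> crd d q \<cdot> y = \<dots>" .
    qed
    also have "\<dots> = (\<Oplus>\<^bsub>H\<^esub>c\<in>Bs. sw (antipode H x) (\<lambda>p q. c \<cdot> crd d (crd c (p \<cdot> y) \<cdot> q)))"
      by (rule sw_finsum[OF Bs(1) ax bc])
    also have "\<dots> = (\<Oplus>\<^bsub>H\<^esub>c\<in>Bs. ?\<psi> c (?R c x y))"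
    proof (intro module.M.finsum_cong' refl Pi_I)
      fix c assume c: "c \<in> Bs"
      show "?\<psi> c (?R c x y) \<in> C" by (rule linear_maps_closed[OF \<psi>[OF c] bil_closed[OF bR[OF c] xy]])
      show "sw (antipode H x) (\<lambda>p q. ?\<psi> c (crd c (p \<cdot> y) \<cdot> q)) = ?\<psi> c (?R c x y)"
        by (rule sw_lin[OF \<psi>[OF c] _ ax, symmetric]) (intro li; simp add: c xy)
    qed
    finally show "sw (antipode H x) (\<lambda>p q. p \<cdot> crd d q) \<cdot> y = \<dots>" .
  qed
  also have "\<dots> = (\<Oplus>\<^bsub>H\<^esub>c\<in>Bs. sw h (\<lambda>x y. ?\<psi> c (?R c x y)))" by (rule sw_finsum[OF Bs(1) h b\<psi>])
  also have "\<dots> = (\<Oplus>\<^bsub>H\<^esub>c\<in>Bs. crd c \<one>\<^bsub>H\<^esub> \<cdot> (c \<cdot> crd d (antipode H h)))"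
  proof (intro module.M.finsum_cong' refl)
    fix c assume c: "c \<in> Bs"
    have "sw h (\<lambda>x y. ?\<psi> c (?R c x y)) = ?\<psi> c (sw h (?R c))"
      by (rule sw_lin[OF \<psi>[OF c] bR[OF c] h, symmetric])
    also have "\<dots> = c \<cdot> (crd c \<one>\<^bsub>H\<^esub> \<cdot> crd d (antipode H h))"
      using h c d by (simp add: sw_antipode_left_slot scalar_lin[OF E_lin[OF crd_E]])
    also have "\<dots> = crd c \<one>\<^bsub>H\<^esub> \<cdot> (c \<cdot> crd d (antipode H h))"
      using h c d by (simp add: H.m_assoc[symmetric] scalar_comm[of "crd c \<one>\<^bsub>H\<^esub>" c])
    finally show "sw h (\<lambda>x y. ?\<psi> c (?R c x y)) = \<dots>" .
  qed (use h d in auto)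
  \<comment> \<open>The coordinates of 1, summed against the basis, give back 1.\<close>
  also have "\<dots> = \<one>\<^bsub>H\<^esub> \<cdot> crd d (antipode H h)"
    by (rule expand[symmetric, where \<phi> = "\<lambda>t. t \<cdot> crd d (antipode H h)"])
      (use h d in \<open>auto intro!: lin_intros\<close>)
  finally show "sw h (\<lambda>x y. sw (antipode H x) (\<lambda>p q. p \<cdot> crd d q) \<cdot> y) = crd d (antipode H h)"
    using h d by simp
qed

lemma expand_right:
  assumes "\<phi> \<in> linH" "h \<in> C"
  shows "\<phi> h = (\<Oplus>\<^bsub>H\<^esub>b\<in>Bs. \<phi> b \<cdot> crd b h)"
  unfolding expand[OF assms]
  using assms linear_maps_closed[OF assms(1)]
  by (intro module.M.finsum_cong' refl) (auto simp: scalar_comm[of "crd _ h"])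

text \<open>Expanding the second slot of B in the basis leaves a coordinate form there, to which
  \<open>sw_antipode_scalar_slot\<close> applies; afterwards the expansion is undone.\<close>

lemma sw_antipode:
  assumes B: "bilH B" and h: "h \<in> C"
  shows "sw (antipode H h) B = sw h (\<lambda>u v. B (antipode H v) (antipode H u))"
proof -
  have bl: "(\<lambda>x. B (\<phi> x) y) \<in> linH" if "\<phi> \<in> linH" "y \<in> C" for \<phi> y
    by (rule linear_maps_compose[OF that(1) bil_left[OF B that(2)]])
  have br: "(\<lambda>x. B y (\<phi> x)) \<in> linH" if "\<phi> \<in> linH" "y \<in> C" for \<phi> y
    by (rule linear_maps_compose[OF that(1) bil_right[OF B that(2)]])
  have lc: "f \<in> linH \<Longrightarrow> c \<in> Bs \<Longrightarrow> (\<lambda>x. crd c (f x)) \<in> linH" for c f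
    by (rule linear_maps_compose[OF _ E_lin[OF crd_E]])
  note li = sw_closed H.m_closed lin_intros lc E_lin[OF crd_E] bl br
  note cl = bil_closed[OF B]
  have ah: "antipode H h \<in> C" using h by simp
  have b1: "bilH (\<lambda>p q. B p c \<cdot> crd c q)" if "c \<in> Bs" for c by (intro li; simp add: that cl)
  have b2: "bilH (\<lambda>u v. crd c (antipode H u) \<cdot> B (antipode H v) c)" if "c \<in> Bs" for c
    by (intro li; simp add: that cl)
  have b3: "bilH (\<lambda>u v. B (antipode H v) (antipode H u))" by (intro li; simp)
  have "sw (antipode H h) B = sw (antipode H h) (\<lambda>p q. \<Oplus>\<^bsub>H\<^esub>c\<in>Bs. B p c \<cdot> crd c q)"
    by (rule sw_cong[OF ah])
      (auto intro!: bilI lin_finsum Bs bil_left[OF b1] bil_right[OF b1] expand_right[OF bil_right[OF B]])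
  also have "\<dots> = (\<Oplus>\<^bsub>H\<^esub>c\<in>Bs. sw (antipode H h) (\<lambda>p q. B p c \<cdot> crd c q))"
    by (rule sw_finsum[OF Bs(1) ah b1])
  also have "\<dots> = (\<Oplus>\<^bsub>H\<^esub>c\<in>Bs. sw h (\<lambda>u v. crd c (antipode H u) \<cdot> B (antipode H v) c))"
  proof (intro module.M.finsum_cong' refl)
    fix c assume c: "c \<in> Bs"
    have lB: "(\<lambda>p. B p c) \<in> linH" using c by (intro bil_left[OF B]) simp
    have "sw (antipode H h) (\<lambda>p q. B p c \<cdot> crd c q) = sw (antipode H h) (\<lambda>p q. B (p \<cdot> crd c q) c)"
      by (rule sw_cong[OF ah]; (intro li; simp add: c)?) (simp add: c scalar_lin'[OF lB])
    also have "\<dots> = B (sw (antipode H h) (\<lambda>p q. p \<cdot> crd c q)) c"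
      by (rule sw_lin[OF lB _ ah, symmetric]) (intro li; simp add: c)
    also have "\<dots> = B (sw h (\<lambda>u v. crd c (antipode H u) \<cdot> antipode H v)) c"
      using h c by (simp add: sw_antipode_scalar_slot)
    also have "\<dots> = sw h (\<lambda>u v. B (crd c (antipode H u) \<cdot> antipode H v) c)"
      by (rule sw_lin[OF lB _ h]) (intro li; simp add: c)
    also have "\<dots> = sw h (\<lambda>u v. crd c (antipode H u) \<cdot> B (antipode H v) c)"
      by (rule sw_cong[OF h b2[OF c]]) (simp add: c scalar_lin[OF lB])
    finally show "sw (antipode H h) (\<lambda>p q. B p c \<cdot> crd c q) = \<dots>" .
  qed (use h b2 in auto)
  also have "\<dots> = sw h (\<lambda>u v. \<Oplus>\<^bsub>H\<^esub>c\<in>Bs. crd c (antipode H u) \<cdot> B (antipode H v) c)"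
    by (rule sw_finsum[OF Bs(1) h b2, symmetric])
  also have "\<dots> = sw h (\<lambda>u v. B (antipode H v) (antipode H u))"
    by (rule sw_cong[OF h b3]) (auto intro!: expand[symmetric] bil_right[OF B])
  finally show ?thesis .
qed

end


section \<open>Integrals\<close>

context hopf_algebra
begin

declare E_closed [simp del]

lemma conv_apply_closed [simp]: "f \<in> \<E> \<Longrightarrow> g \<in> \<E> \<Longrightarrow> h \<in> C \<Longrightarrow> (f \<star> g) h \<in> C"
  and S_closed [simp]: "h \<in> C \<Longrightarrow> S h \<in> C"
  by (rule E_closed[OF conv_closed], assumption+) (rule E_closed[OF S_E])

text \<open>The dual space of H, in the encoding by endomorphisms with values in
  \<open>scalars\<close>.\<close>

definition scalar_maps :: "('h \<Rightarrow> 'h) set" (\<open>\<K>\<close>) where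
  "\<K> = {f \<in> \<E>. \<forall>h\<in>C. f h \<in> scalars}"

lemma K_E [simp]: "f \<in> \<K> \<Longrightarrow> f \<in> \<E>"
  and K_scalar: "f \<in> \<K> \<Longrightarrow> h \<in> C \<Longrightarrow> f h \<in> scalars"
  by (simp_all add: scalar_maps_def)

text \<open>The counit projects H onto the scalars. As it commutes with Sweedler sums and finite
  sums, such sums of scalars are recognised as scalars.\<close>

lemma scalarI:
  assumes "s \<in> C" and eq: "eps s = s"
  shows "s \<in> scalars"
  using eps_scalar[OF assms(1)] unfolding eq .

lemma mkK: "f \<in> linH \<Longrightarrow> (\<And>h. h \<in> C \<Longrightarrow> f h \<in> scalars) \<Longrightarrow> (\<lambda>h\<in>C. f h) \<in> \<K>"
  by (simp add: scalar_maps_def mkE del: K_E)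

lemma sw_scalar:
  assumes "bilH B" "h \<in> C" "\<And>u v. u \<in> C \<Longrightarrow> v \<in> C \<Longrightarrow> B u v \<in> scalars"
  shows "sw h B \<in> scalars"
proof (rule scalarI)
  have "eps (sw h B) = sw h (\<lambda>u v. eps (B u v))" by (rule sw_lin[OF eps_lin assms(1,2)])
  also have "\<dots> = sw h B" by (rule sw_cong[OF assms(2,1)]) (simp add: assms(3))
  finally show "eps (sw h B) = sw h B" .
qed (simp add: assms)

lemma conv_scalar [simp]:
  assumes "f \<in> \<K>" "g \<in> \<K>"
  shows "f \<star> g \<in> \<K>"
  unfolding conv_def
  by (intro mkK sw_hom sw_scalar bil_conv E_lin K_E assms scalar_mult_closed K_scalar) (rule assms | assumption)+

lemma lin_E: "F \<in> \<E> \<Longrightarrow> f \<in> linH \<Longrightarrow> (\<lambda>x. F (f x)) \<in> linH"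
  by (rule linear_maps_compose[OF _ E_lin])

lemma finsum_scalar:
  assumes "finite A" "\<And>a. a \<in> A \<Longrightarrow> f a \<in> scalars"
  shows "(\<Oplus>\<^bsub>H\<^esub>a\<in>A. f a) \<in> scalars"
proof (rule scalarI)
  show "eps (\<Oplus>\<^bsub>H\<^esub>a\<in>A. f a) = (\<Oplus>\<^bsub>H\<^esub>a\<in>A. f a)"
    using assms by (subst finsum_lin[OF eps_lin]) (auto intro!: module.M.finsum_cong')
qed (use assms in \<open>auto intro!: module.M.finsum_closed\<close>)

lemma scalar_assoc:
  "s \<in> scalars \<Longrightarrow> x \<in> C \<Longrightarrow> y \<in> C \<Longrightarrow> x \<cdot> s \<cdot> y = x \<cdot> y \<cdot> s"
  by (simp add: H.m_assoc scalar_comm[of s y])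

text \<open>The value D(k2) is a scalar and may be pulled inside the linear map g.\<close>

lemma conv_scalar_right:
  assumes g: "g \<in> \<E>" and D: "D \<in> \<K>" and k: "k \<in> C"
  shows "(g \<star> D) k = g ((idm \<star> D) k)"
proof -
  note [simp] = K_scalar[OF D] E_closed[OF K_E[OF D]] E_closed[OF g]
  have "g ((idm \<star> D) k) = sw k (\<lambda>u v. g (idm u \<cdot> D v))"
    unfolding conv_apply[OF k] by (rule sw_lin) (use assms in \<open>auto intro!: E_lin bil_conv\<close>)
  also have "\<dots> = (g \<star> D) k"
    unfolding conv_apply[OF k]
    by (rule sw_cong) (use assms in \<open>auto intro!: E_lin bil_conv simp: scalar_lin'[OF E_lin]\<close>)
  finally show ?thesis by simp
qed

lemma sw_zero: "h \<in> C \<Longrightarrow> sw h (\<lambda>u v. \<zero>\<^bsub>H\<^esub>) = \<zero>\<^bsub>H\<^esub>"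
  using sw_finsum[of "{}" h] by simp

text \<open>The way back from \<open>solve_right\<close>: a convolution with \<open>idm\<close>
  cancels \<open>S\<close>.\<close>

lemma unsolve_right:
  assumes Q: "Q \<in> linH" and A: "A \<in> linH" and k: "k \<in> C"
    and "\<And>k. k \<in> C \<Longrightarrow> Q k = sw k (\<lambda>p q. A p \<cdot> antipode H q)"
  shows "A k = sw k (\<lambda>p q. Q p \<cdot> q)"
proof -
  have "(\<lambda>k\<in>C. Q k) = (\<lambda>k\<in>C. A k) \<star> S"
    by (rule E_eqI) (use assms in \<open>auto simp: conv_S_right intro!: mkE conv_closed S_E\<close>)
  then have "(\<lambda>k\<in>C. Q k) \<star> idm = (\<lambda>k\<in>C. A k)"
    using A by (simp add: conv_assoc mkE)
  from arg_cong[OF this, of "\<lambda>f. f k"] show ?thesis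
    using k conv_idm_right[OF Q k] by simp
qed

end

section \<open>Left integrals from a trace\<close>

context fd_hopf_algebra
begin

lemma crd_K [simp]: "b \<in> Bs \<Longrightarrow> crd b \<in> \<K>"
  by (simp add: scalar_maps_def del: K_E)

text \<open>The Hopf module axiom for the dual, with the action F(_ S(h)) and the coaction F
  \<mapsto> \<open>idm \<star> F\<close>. Since S reverses the comultiplication, expanding the
  coaction at y S(h) leaves a factor S(h2) at the right end, which \<open>unsolve_right\<close>
  moves to the other side.\<close>

lemma coaction_compat:
  assumes F: "F \<in> \<K>" and y: "y \<in> C" and h: "h \<in> C"
  shows "sw y (\<lambda>u v. u \<cdot> F (v \<cdot> antipode H h))
    = sw h (\<lambda>p q. (idm \<star> F) (y \<cdot> antipode H p) \<cdot> q)"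
proof (rule unsolve_right[OF _ _ h])
  note [simp] = K_scalar[OF F] E_closed[OF K_E[OF F]]
  note li = sw_closed H.m_closed lin_intros lin_E[OF K_E[OF F]] E_lin[OF K_E[OF F]] lin_E[OF conv_closed[OF idm_E K_E[OF F]]]
  show "(\<lambda>h. sw y (\<lambda>u v. u \<cdot> F (v \<cdot> antipode H h))) \<in> linH"
    "(\<lambda>p. (idm \<star> F) (y \<cdot> antipode H p)) \<in> linH"
    by (intro li; simp add: F y)+
  fix h assume h: "h \<in> C"
  let ?f = "\<lambda>a p. F (a \<cdot> antipode H p)"
  have ah: "antipode H h \<in> C" using h by simp
  have "(idm \<star> F) (y \<cdot> antipode H h) = sw (y \<cdot> antipode H h) (\<lambda>u v. u \<cdot> F v)"
    unfolding conv_apply[OF H.m_closed[OF y ah]]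
    by (rule sw_cong[OF H.m_closed[OF y ah]]; (intro li; simp add: F)?) simp
  also have "\<dots> = sw y (\<lambda>a b. sw (antipode H h) (\<lambda>c d. (a \<cdot> c) \<cdot> F (b \<cdot> d)))"
    by (rule sw_mult[OF _ y ah]) (intro li; simp add: F)
  also have "\<dots> = sw y (\<lambda>a b. sw h (\<lambda>p q. (a \<cdot> antipode H q) \<cdot> ?f b p))"
    by (rule sw_cong[OF y]; (rule sw_antipode[OF _ h])?; (intro li; simp add: F h)?)
  also have "\<dots> = sw h (\<lambda>p q. sw y (\<lambda>a b. (a \<cdot> antipode H q) \<cdot> ?f b p))"
    by (rule sw_swap[OF y h]; intro li; simp add: F)
  also have "\<dots> = sw h (\<lambda>p q. sw y (\<lambda>u v. u \<cdot> ?f v p) \<cdot> antipode H q)"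
  proof (rule sw_cong[OF h])
    show "bilH (\<lambda>p q. sw y (\<lambda>u v. u \<cdot> ?f v p) \<cdot> antipode H q)" by (intro li; simp add: F y)
    fix p q assume pq: "p \<in> C" "q \<in> C"
    then have aq: "antipode H q \<in> C" by simp
    have "sw y (\<lambda>u v. u \<cdot> ?f v p) \<cdot> antipode H q = sw y (\<lambda>u v. u \<cdot> ?f v p \<cdot> antipode H q)"
      by (rule sw_mult_left[OF _ y aq]) (intro li; simp add: F pq)
    also have "\<dots> = sw y (\<lambda>a b. (a \<cdot> antipode H q) \<cdot> ?f b p)"
      by (rule sw_cong[OF y]; (intro li; simp add: F pq)?) (rule scalar_assoc; simp add: pq)
    finally show "sw y (\<lambda>a b. (a \<cdot> antipode H q) \<cdot> ?f b p) =
        sw y (\<lambda>u v. u \<cdot> ?f v p) \<cdot> antipode H q" by (rule sym)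
  qed
  finally show "(idm \<star> F) (y \<cdot> antipode H h) = \<dots>" .
qed

text \<open>Summing m(b) against the coordinate forms replaces the form in the convolution by m
  itself. The factor f only has to be moved out of the way, which is possible because its values are
  central.\<close>

lemma conv_sum_coords:
  assumes m: "m \<in> \<E>" and f: "f \<in> \<K>" and y: "y \<in> C"
  shows "(\<Oplus>\<^bsub>H\<^esub>b\<in>Bs. (idm \<star> (crd b \<star> f)) y \<cdot> m b) = (idm \<star> m \<star> f) y"
proof -
  note [simp] = K_scalar[OF f] E_closed[OF K_E[OF f]] E_closed[OF m]
  note li = sw_closed H.m_closed lin_intros lin_E[OF K_E[OF f]] E_lin[OF K_E[OF f]] lin_E[OF crd_E] E_lin[OF crd_E]
    E_lin[OF conv_closed[OF idm_E crd_E]] E_lin[OF m] lin_E[OF m]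
  have bil1: "bilH (\<lambda>u v. (idm \<star> crd b) u \<cdot> m b \<cdot> f v)" if "b \<in> Bs" for b
    by (intro li; simp add: that f m)
  have bil2: "bilH (\<lambda>p q. p \<cdot> (crd b q \<cdot> m b))" if "b \<in> Bs" for b
    by (intro li; simp add: that f m)
  have inner: "(\<Oplus>\<^bsub>H\<^esub>b\<in>Bs. (idm \<star> crd b) u \<cdot> m b) = (idm \<star> m) u" if u: "u \<in> C" for u
  proof -
    have "(\<Oplus>\<^bsub>H\<^esub>b\<in>Bs. (idm \<star> crd b) u \<cdot> m b) = (\<Oplus>\<^bsub>H\<^esub>b\<in>Bs. sw u (\<lambda>p q. p \<cdot> (crd b q \<cdot> m b)))"
    proof (intro module.M.finsum_cong' refl Pi_I)
      fix b assume b: "b \<in> Bs"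
      show "sw u (\<lambda>p q. p \<cdot> (crd b q \<cdot> m b)) \<in> C" by (rule sw_closed[OF bil2[OF b] u])
      have "(idm \<star> crd b) u \<cdot> m b = sw u (\<lambda>p q. idm p \<cdot> crd b q \<cdot> m b)"
        unfolding conv_apply[OF u] using b m u
        by (intro sw_mult_left bil_conv E_lin) auto
      also have "\<dots> = sw u (\<lambda>p q. p \<cdot> (crd b q \<cdot> m b))"
        by (rule sw_cong[OF u bil2[OF b]]) (use b m in \<open>simp add: H.m_assoc\<close>)
      finally show "(idm \<star> crd b) u \<cdot> m b = \<dots>" .
    qed
    also have "\<dots> = sw u (\<lambda>p q. \<Oplus>\<^bsub>H\<^esub>b\<in>Bs. p \<cdot> (crd b q \<cdot> m b))"
      by (rule sw_finsum[OF Bs(1) u bil2, symmetric])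
    also have "\<dots> = (idm \<star> m) u"
      unfolding conv_apply[OF u]
    proof (rule sw_cong[OF u bil_conv[OF E_lin[OF idm_E] E_lin[OF m]]])
      fix p q assume pq: "p \<in> C" "q \<in> C"
      have "(\<Oplus>\<^bsub>H\<^esub>b\<in>Bs. p \<cdot> (crd b q \<cdot> m b)) = p \<cdot> (\<Oplus>\<^bsub>H\<^esub>b\<in>Bs. crd b q \<cdot> m b)"
        using pq m by (intro finsum_lin[symmetric, OF lin_mult_right[OF linear_maps_id]] Bs) auto
      then show "(\<Oplus>\<^bsub>H\<^esub>b\<in>Bs. p \<cdot> (crd b q \<cdot> m b)) = idm p \<cdot> m q"
        using pq expand[OF E_lin[OF m] pq(2)] by simp
    qed
    finally show ?thesis .
  qed
  have "(\<Oplus>\<^bsub>H\<^esub>b\<in>Bs. (idm \<star> (crd b \<star> f)) y \<cdot> m b) =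
      (\<Oplus>\<^bsub>H\<^esub>b\<in>Bs. sw y (\<lambda>u v. (idm \<star> crd b) u \<cdot> m b \<cdot> f v))"
  proof (intro module.M.finsum_cong' refl Pi_I)
    fix b assume b: "b \<in> Bs"
    show "sw y (\<lambda>u v. (idm \<star> crd b) u \<cdot> m b \<cdot> f v) \<in> C" by (rule sw_closed[OF bil1[OF b] y])
    have "(idm \<star> (crd b \<star> f)) y \<cdot> m b = (idm \<star> crd b \<star> f) y \<cdot> m b"
      using b f by (simp add: conv_assoc)
    also have "\<dots> = sw y (\<lambda>u v. (idm \<star> crd b) u \<cdot> f v \<cdot> m b)"
      unfolding conv_apply[OF y] using b m f y
      by (intro sw_mult_left bil_conv E_lin) auto
    also have "\<dots> = sw y (\<lambda>u v. (idm \<star> crd b) u \<cdot> m b \<cdot> f v)"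
      by (rule sw_cong[OF y bil1[OF b]], rule scalar_assoc) (use b in auto)
    finally show "(idm \<star> (crd b \<star> f)) y \<cdot> m b = \<dots>" .
  qed
  also have "\<dots> = sw y (\<lambda>u v. \<Oplus>\<^bsub>H\<^esub>b\<in>Bs. (idm \<star> crd b) u \<cdot> m b \<cdot> f v)"
    by (rule sw_finsum[OF Bs(1) y bil1, symmetric])
  also have "\<dots> = (idm \<star> m \<star> f) y"
    unfolding conv_apply[OF y]
  proof (rule sw_cong[OF y bil_conv[OF E_lin E_lin]])
    fix u v assume uv: "u \<in> C" "v \<in> C"
    have "(\<Oplus>\<^bsub>H\<^esub>b\<in>Bs. (idm \<star> crd b) u \<cdot> m b \<cdot> f v) = (\<Oplus>\<^bsub>H\<^esub>b\<in>Bs. (idm \<star> crd b) u \<cdot> m b) \<cdot> f v"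
      using uv m f
      by (intro finsum_lin[symmetric, OF lin_mult_left[OF linear_maps_id]] Bs Pi_I H.m_closed
        E_closed[OF conv_closed[OF idm_E crd_E]]) auto
    then show "(\<Oplus>\<^bsub>H\<^esub>b\<in>Bs. (idm \<star> crd b) u \<cdot> m b \<cdot> f v) = (idm \<star> m) u \<cdot> f v"
      by (simp add: inner[OF uv(1)])
  qed (use m f in auto)
  finally show ?thesis .
qed

text \<open>
  The dual of \<open>H\<close> is a Hopf module, and \<open>f \<mapsto> tr (h \<mapsto> \<Sum> (x S\<^sup>2(h))\<^sub>(\<^sub>1\<^sub>) f((x S\<^sup>2(h))\<^sub>(\<^sub>2\<^sub>)))\<close> is the canonical
  projection onto its coinvariants, i.e. onto the left integrals.
\<close>

definition trace_integral :: "('h \<Rightarrow> 'h) \<Rightarrow> 'h \<Rightarrow> 'h" where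
  "trace_integral f = (\<lambda>x\<in>C. \<Oplus>\<^bsub>H\<^esub>b\<in>Bs. (crd b \<star> f) (x \<cdot> antipode H (antipode H b)))"

lemma trace_integral_K:
  assumes f: "f \<in> \<K>"
  shows "trace_integral f \<in> \<K>"
  unfolding trace_integral_def
proof (rule mkK)
  show "(\<lambda>x. \<Oplus>\<^bsub>H\<^esub>b\<in>Bs. (crd b \<star> f) (x \<cdot> antipode H (antipode H b))) \<in> linH"
    by (intro lin_finsum Bs lin_E[OF K_E[OF conv_scalar[OF crd_K f]]] lin_intros) auto
  show "(\<Oplus>\<^bsub>H\<^esub>b\<in>Bs. (crd b \<star> f) (x \<cdot> antipode H (antipode H b))) \<in> scalars" if "x \<in> C" for x
    using that by (intro finsum_scalar Bs K_scalar[OF conv_scalar[OF crd_K f]]) auto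
qed

text \<open>The equation \<open>idm \<star> l = l\<close> defines a left integral. The compatibility
  of action and coaction produces coefficients \<open>S \<star> crd d\<close>; summing over b before
  d places them between \<open>idm\<close> and f, where \<open>idm \<star> S\<close> cancels and the
  trace reappears.\<close>

lemma trace_integral_left:
  assumes f: "f \<in> \<K>"
  shows "idm \<star> trace_integral f = trace_integral f"
proof (rule E_eqI)
  fix x assume x: "x \<in> C"
  let ?F = "\<lambda>b. crd b \<star> f" and ?S2 = "\<lambda>h. antipode H (antipode H h)"
  let ?m = "\<lambda>d. S \<star> crd d"
  note [simp] = K_E[OF f]
  have F: "?F b \<in> \<K>" if "b \<in> Bs" for b using that f by simp
  have F': "?F b \<in> \<E>" "idm \<star> ?F b \<in> \<E>" if "b \<in> Bs" for b using that f by simp_all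
  note li = sw_closed H.m_closed lin_intros lin_E[OF F'(1)] lin_E[OF F'(2)] lin_E[OF crd_E] E_lin[OF crd_E]
  have bil1: "bilH (\<lambda>u v. u \<cdot> ?F b (v \<cdot> ?S2 b))" if "b \<in> Bs" for b
    by (intro li; simp add: that F')
  have "(idm \<star> trace_integral f) x = sw x (\<lambda>u v. \<Oplus>\<^bsub>H\<^esub>b\<in>Bs. u \<cdot> ?F b (v \<cdot> ?S2 b))"
    unfolding conv_apply[OF x]
  proof (rule sw_cong[OF x])
    show "bilH (\<lambda>u v. \<Oplus>\<^bsub>H\<^esub>b\<in>Bs. u \<cdot> ?F b (v \<cdot> ?S2 b))"
      by (intro bilI lin_finsum Bs bil_left[OF bil1] bil_right[OF bil1])
    fix u v assume uv: "u \<in> C" "v \<in> C"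
    then show "idm u \<cdot> trace_integral f v = (\<Oplus>\<^bsub>H\<^esub>b\<in>Bs. u \<cdot> ?F b (v \<cdot> ?S2 b))"
      using F' by (simp add: trace_integral_def)
        (intro finsum_lin lin_intros Bs Pi_I; simp)
  qed
  also have "\<dots> = (\<Oplus>\<^bsub>H\<^esub>b\<in>Bs. sw x (\<lambda>u v. u \<cdot> ?F b (v \<cdot> ?S2 b)))"
    by (rule sw_finsum[OF Bs(1) x bil1])
  also have "\<dots> = (\<Oplus>\<^bsub>H\<^esub>b\<in>Bs. \<Oplus>\<^bsub>H\<^esub>d\<in>Bs. (idm \<star> ?F b) (x \<cdot> ?S2 d) \<cdot> ?m d b)"
  proof (intro module.M.finsum_cong' refl Pi_I)
    fix b assume b: "b \<in> Bs"
    let ?\<phi> = "\<lambda>t. (idm \<star> ?F b) (x \<cdot> ?S2 t)"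
    have bC: "b \<in> C" using b by simp
    have \<phi>: "?\<phi> \<in> linH" by (intro li; simp add: b x)
    have \<phi>C: "?\<phi> t \<in> C" if "t \<in> C" for t by (rule linear_maps_closed[OF \<phi> that])
    note li = li linear_maps_compose[OF _ \<phi>] \<phi>
    have bil2: "bilH (\<lambda>p q. ?\<phi> d \<cdot> (antipode H p \<cdot> crd d q))" if "d \<in> Bs" for d
      by (intro li; simp add: that \<phi>C)
    show "(\<Oplus>\<^bsub>H\<^esub>d\<in>Bs. ?\<phi> d \<cdot> ?m d b) \<in> C"
      using bC by (intro module.M.finsum_closed Pi_I H.m_closed \<phi>C conv_apply_closed S_E crd_E) auto
    \<comment> \<open>The compatibility is taken at S(b), because the trace contains the square of
      the antipode.\<close>
    have "sw x (\<lambda>u v. u \<cdot> ?F b (v \<cdot> ?S2 b)) = sw (antipode H b) (\<lambda>p q. (idm \<star> ?F b) (x \<cdot> antipode H p) \<cdot> q)"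
      using F[OF b] x bC by (intro coaction_compat) auto
    also have "\<dots> = sw b (\<lambda>p q. ?\<phi> q \<cdot> antipode H p)"
      by (rule sw_antipode[OF _ bC]) (intro li; simp add: b x F')
    also have "\<dots> = sw b (\<lambda>p q. \<Oplus>\<^bsub>H\<^esub>d\<in>Bs. ?\<phi> d \<cdot> (antipode H p \<cdot> crd d q))"
    proof (rule sw_cong[OF bC])
      show "bilH (\<lambda>p q. \<Oplus>\<^bsub>H\<^esub>d\<in>Bs. ?\<phi> d \<cdot> (antipode H p \<cdot> crd d q))"
        by (intro bilI lin_finsum Bs bil_left[OF bil2] bil_right[OF bil2])
      fix p q assume pq: "p \<in> C" "q \<in> C"
      have "?\<phi> q \<cdot> antipode H p = (\<Oplus>\<^bsub>H\<^esub>d\<in>Bs. (?\<phi> d \<cdot> antipode H p) \<cdot> crd d q)"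
        using pq by (intro expand_right[where \<phi> = "\<lambda>q. ?\<phi> q \<cdot> antipode H p"] lin_mult_left[OF \<phi>]) auto
      also have "\<dots> = (\<Oplus>\<^bsub>H\<^esub>d\<in>Bs. ?\<phi> d \<cdot> (antipode H p \<cdot> crd d q))"
        using pq by (intro module.M.finsum_cong' refl Pi_I H.m_closed H.m_assoc \<phi>C) auto
      finally show "?\<phi> q \<cdot> antipode H p = \<dots>" .
    qed
    also have "\<dots> = (\<Oplus>\<^bsub>H\<^esub>d\<in>Bs. sw b (\<lambda>p q. ?\<phi> d \<cdot> (antipode H p \<cdot> crd d q)))"
      by (rule sw_finsum[OF Bs(1) bC bil2])
    also have "\<dots> = (\<Oplus>\<^bsub>H\<^esub>d\<in>Bs. ?\<phi> d \<cdot> ?m d b)"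
    proof (intro module.M.finsum_cong' refl Pi_I)
      fix d assume d: "d \<in> Bs"
      show "?\<phi> d \<cdot> ?m d b \<in> C"
        using d bC by (intro H.m_closed \<phi>C conv_apply_closed S_E crd_E) auto
      have "?m d b = sw b (\<lambda>p q. antipode H p \<cdot> crd d q)"
        unfolding conv_apply[OF bC]
        by (rule sw_cong[OF bC]; (intro li; simp add: d)?) (simp add: S_apply)
      then show "sw b (\<lambda>p q. ?\<phi> d \<cdot> (antipode H p \<cdot> crd d q)) = ?\<phi> d \<cdot> ?m d b"
        using d bC by (simp, intro sw_mult_right[symmetric] \<phi>C, intro li) auto
    qed
    finally show "sw x (\<lambda>u v. u \<cdot> ?F b (v \<cdot> ?S2 b)) = (\<Oplus>\<^bsub>H\<^esub>d\<in>Bs. ?\<phi> d \<cdot> ?m d b)" .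
  qed
  also have "\<dots> = (\<Oplus>\<^bsub>H\<^esub>d\<in>Bs. \<Oplus>\<^bsub>H\<^esub>b\<in>Bs. (idm \<star> ?F b) (x \<cdot> ?S2 d) \<cdot> ?m d b)"
    using x by (intro finsum_swap Bs H.m_closed E_closed[OF F'(2)] E_closed[OF conv_closed[OF S_E crd_E]]) auto
  also have "\<dots> = (\<Oplus>\<^bsub>H\<^esub>d\<in>Bs. ?F d (x \<cdot> ?S2 d))"
  proof (intro module.M.finsum_cong' refl Pi_I)
    fix d assume d: "d \<in> Bs"
    then show "?F d (x \<cdot> ?S2 d) \<in> C" using x by (intro conv_apply_closed) auto
    have "(\<Oplus>\<^bsub>H\<^esub>b\<in>Bs. (idm \<star> ?F b) (x \<cdot> ?S2 d) \<cdot> ?m d b) = (idm \<star> ?m d \<star> f) (x \<cdot> ?S2 d)"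
      using d f x by (intro conv_sum_coords) auto
    also have "idm \<star> ?m d = crd d" using d by (simp add: conv_assoc[symmetric])
    finally show "(\<Oplus>\<^bsub>H\<^esub>b\<in>Bs. (idm \<star> ?F b) (x \<cdot> ?S2 d) \<cdot> ?m d b) = ?F d (x \<cdot> ?S2 d)" .
  qed
  also have "\<dots> = trace_integral f x" using x by (simp add: trace_integral_def)
  finally show "(idm \<star> trace_integral f) x = trace_integral f x" .
qed (use trace_integral_K[OF f] in auto)

end


section \<open>Existence of a nonzero left integral\<close>

context fd_hopf_algebra
begin

text \<open>\<open>crd d \<star> crd b\<close> at k is the coefficient of d \<otimes> b in the
  comultiplication of k, so the double sum is the expansion of the Sweedler sum in
  coordinates.\<close>

lemma conv_expand_bilinear:
  assumes k: "k \<in> C" and \<beta>: "bilH \<beta>"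
  shows "(\<Oplus>\<^bsub>H\<^esub>b\<in>Bs. \<Oplus>\<^bsub>H\<^esub>d\<in>Bs. (crd d \<star> crd b) k \<cdot> \<beta> d b) = sw k \<beta>"
proof -
  note li = sw_closed H.m_closed lin_intros lin_E[OF crd_E] E_lin[OF crd_E]
  note cl [simp] = bil_closed[OF \<beta>]
  have bil1: "bilH (\<lambda>u v. crd d u \<cdot> crd b v \<cdot> \<beta> d b)" if "b \<in> Bs" "d \<in> Bs" for b d
    by (intro li; simp add: that)
  have bil2: "bilH (\<lambda>u v. \<Oplus>\<^bsub>H\<^esub>d\<in>Bs. crd d u \<cdot> crd b v \<cdot> \<beta> d b)" if "b \<in> Bs" for b
    by (intro bilI lin_finsum Bs bil_left[OF bil1[OF that]] bil_right[OF bil1[OF that]])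
  have "(\<Oplus>\<^bsub>H\<^esub>b\<in>Bs. \<Oplus>\<^bsub>H\<^esub>d\<in>Bs. (crd d \<star> crd b) k \<cdot> \<beta> d b) =
      (\<Oplus>\<^bsub>H\<^esub>b\<in>Bs. sw k (\<lambda>u v. \<Oplus>\<^bsub>H\<^esub>d\<in>Bs. crd d u \<cdot> crd b v \<cdot> \<beta> d b))"
  proof (intro module.M.finsum_cong' refl Pi_I sw_closed[OF bil2 k])
    fix b assume b: "b \<in> Bs"
    have "(\<Oplus>\<^bsub>H\<^esub>d\<in>Bs. (crd d \<star> crd b) k \<cdot> \<beta> d b) =
        (\<Oplus>\<^bsub>H\<^esub>d\<in>Bs. sw k (\<lambda>u v. crd d u \<cdot> crd b v \<cdot> \<beta> d b))"
    proof (intro module.M.finsum_cong' refl Pi_I sw_closed[OF bil1[OF b] k])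
      fix d assume d: "d \<in> Bs"
      show "(crd d \<star> crd b) k \<cdot> \<beta> d b = sw k (\<lambda>u v. crd d u \<cdot> crd b v \<cdot> \<beta> d b)"
        unfolding conv_apply[OF k]
        by (rule sw_mult_left[OF bil_conv[OF E_lin[OF crd_E[OF d]] E_lin[OF crd_E[OF b]]] k]) (simp add: b d)
    qed
    also have "\<dots> = sw k (\<lambda>u v. \<Oplus>\<^bsub>H\<^esub>d\<in>Bs. crd d u \<cdot> crd b v \<cdot> \<beta> d b)"
      by (rule sw_finsum[OF Bs(1) k bil1[OF b], symmetric])
    finally show "(\<Oplus>\<^bsub>H\<^esub>d\<in>Bs. (crd d \<star> crd b) k \<cdot> \<beta> d b) = \<dots>" .
  qed
  also have "\<dots> = sw k (\<lambda>u v. \<Oplus>\<^bsub>H\<^esub>b\<in>Bs. \<Oplus>\<^bsub>H\<^esub>d\<in>Bs. crd d u \<cdot> crd b v \<cdot> \<beta> d b)"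
    by (rule sw_finsum[OF Bs(1) k bil2, symmetric])
  also have "\<dots> = sw k \<beta>"
  proof (rule sw_cong[OF k \<beta>])
    fix u v assume uv: "u \<in> C" "v \<in> C"
    have "\<beta> u v = (\<Oplus>\<^bsub>H\<^esub>b\<in>Bs. crd b v \<cdot> \<beta> u b)"
      by (rule expand[OF bil_right[OF \<beta> uv(1)] uv(2)])
    also have "\<dots> = (\<Oplus>\<^bsub>H\<^esub>b\<in>Bs. \<Oplus>\<^bsub>H\<^esub>d\<in>Bs. crd d u \<cdot> crd b v \<cdot> \<beta> d b)"
    proof (intro module.M.finsum_cong' refl Pi_I)
      fix b assume b: "b \<in> Bs"
      show "(\<Oplus>\<^bsub>H\<^esub>d\<in>Bs. crd d u \<cdot> crd b v \<cdot> \<beta> d b) \<in> C"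
        using uv b by (intro module.M.finsum_closed) auto
      have "crd b v \<cdot> \<beta> u b = (\<Oplus>\<^bsub>H\<^esub>d\<in>Bs. crd d u \<cdot> (crd b v \<cdot> \<beta> d b))"
        using uv b by (intro expand[where \<phi> = "\<lambda>u. crd b v \<cdot> \<beta> u b"] lin_mult_right bil_left[OF \<beta>]) auto
      also have "\<dots> = (\<Oplus>\<^bsub>H\<^esub>d\<in>Bs. crd d u \<cdot> crd b v \<cdot> \<beta> d b)"
        using uv b by (intro module.M.finsum_cong' refl Pi_I) (auto simp: H.m_assoc)
      finally show "crd b v \<cdot> \<beta> u b = \<dots>" .
    qed
    finally show "(\<Oplus>\<^bsub>H\<^esub>b\<in>Bs. \<Oplus>\<^bsub>H\<^esub>d\<in>Bs. crd d u \<cdot> crd b v \<cdot> \<beta> d b) = \<beta> u v" by simp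
  qed
  finally show ?thesis .
qed

text \<open>Shows that not all integrals obtained from the trace vanish. The sum is the trace of k
  \<mapsto> S(sum S(k1) k2) = eps(k) 1, an endomorphism of rank one whose trace is eps(1) =
  1.\<close>

lemma trace_integral_sum: "(\<Oplus>\<^bsub>H\<^esub>b\<in>Bs. trace_integral (crd b) (antipode H b)) = \<one>\<^bsub>H\<^esub>"
proof -
  let ?G = "\<lambda>d b. antipode H (antipode H d \<cdot> b)"
  let ?c = "\<lambda>d b. crd d \<star> crd b"
  have c: "?c d b \<in> \<E>" if "b \<in> Bs" "d \<in> Bs" for b d using that by simp
  have "(\<Oplus>\<^bsub>H\<^esub>b\<in>Bs. trace_integral (crd b) (antipode H b)) = (\<Oplus>\<^bsub>H\<^esub>b\<in>Bs. \<Oplus>\<^bsub>H\<^esub>d\<in>Bs. \<Oplus>\<^bsub>H\<^esub>k\<in>Bs. ?c d b k \<cdot> crd k (?G d b))"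
  proof (intro module.M.finsum_cong' refl Pi_I)
    fix b assume b: "b \<in> Bs"
    show "(\<Oplus>\<^bsub>H\<^esub>d\<in>Bs. \<Oplus>\<^bsub>H\<^esub>k\<in>Bs. ?c d b k \<cdot> crd k (?G d b)) \<in> C"
      using b by (intro module.M.finsum_closed Pi_I H.m_closed conv_apply_closed) auto
    \<comment> \<open>Antimultiplicativity rewrites S(b) S(S(d)) as S(S(d) b), so that the antipode
      axiom can be applied below.\<close>
    have "trace_integral (crd b) (antipode H b) = (\<Oplus>\<^bsub>H\<^esub>d\<in>Bs. ?c d b (?G d b))"
      using b by (auto simp: trace_integral_def antipode_mult intro!: module.M.finsum_cong')
    also have "\<dots> = (\<Oplus>\<^bsub>H\<^esub>d\<in>Bs. \<Oplus>\<^bsub>H\<^esub>k\<in>Bs. ?c d b k \<cdot> crd k (?G d b))"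
      using b by (intro module.M.finsum_cong' refl Pi_I expand_right E_lin[OF c] module.M.finsum_closed) auto
    finally show "trace_integral (crd b) (antipode H b) = \<dots>" .
  qed
  also have "\<dots> = (\<Oplus>\<^bsub>H\<^esub>b\<in>Bs. \<Oplus>\<^bsub>H\<^esub>k\<in>Bs. \<Oplus>\<^bsub>H\<^esub>d\<in>Bs. ?c d b k \<cdot> crd k (?G d b))"
    by (intro module.M.finsum_cong' refl finsum_swap Bs Pi_I module.M.finsum_closed) auto
  also have "\<dots> = (\<Oplus>\<^bsub>H\<^esub>k\<in>Bs. \<Oplus>\<^bsub>H\<^esub>b\<in>Bs. \<Oplus>\<^bsub>H\<^esub>d\<in>Bs. ?c d b k \<cdot> crd k (?G d b))"
    by (intro finsum_swap Bs Pi_I module.M.finsum_closed) auto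
  also have "\<dots> = (\<Oplus>\<^bsub>H\<^esub>k\<in>Bs. crd k \<one>\<^bsub>H\<^esub> \<cdot> eps k)"
  proof (intro module.M.finsum_cong' refl Pi_I)
    fix k assume k: "k \<in> Bs"
    have kC: "k \<in> C" using k by simp
    note li = sw_closed H.m_closed lin_intros lin_E[OF crd_E[OF k]]
    have \<phi>: "(\<lambda>t. crd k (antipode H t)) \<in> linH" by (intro li)
    have "(\<Oplus>\<^bsub>H\<^esub>b\<in>Bs. \<Oplus>\<^bsub>H\<^esub>d\<in>Bs. ?c d b k \<cdot> crd k (?G d b)) = sw k (\<lambda>u v. crd k (?G u v))"
      by (rule conv_expand_bilinear[OF kC]) (intro li; simp)
    also have "\<dots> = crd k (antipode H (sw k (\<lambda>u v. antipode H u \<cdot> v)))"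
      by (rule sw_lin[OF \<phi> _ kC, symmetric]) (intro li; simp)
    also have "\<dots> = crd k (eps k \<cdot> \<one>\<^bsub>H\<^esub>)" using kC by (simp add: sw_antipode_left)
    also have "\<dots> = crd k \<one>\<^bsub>H\<^esub> \<cdot> eps k"
      using k by (subst scalar_lin[OF E_lin[OF crd_E[OF k]]]) (auto simp: scalar_comm[of "eps k" "crd k \<one>\<^bsub>H\<^esub>"])
    finally show "(\<Oplus>\<^bsub>H\<^esub>b\<in>Bs. \<Oplus>\<^bsub>H\<^esub>d\<in>Bs. ?c d b k \<cdot> crd k (?G d b)) = \<dots>" .
  qed auto
  also have "\<dots> = \<one>\<^bsub>H\<^esub>" using expand[OF eps_lin, of "\<one>\<^bsub>H\<^esub>"] by simp
  finally show ?thesis .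
qed

lemma one_not_zero: "\<one>\<^bsub>H\<^esub> \<noteq> \<zero>\<^bsub>H\<^esub>"
proof
  assume "\<one>\<^bsub>H\<^esub> = \<zero>\<^bsub>H\<^esub>"
  then have "\<zero>\<^bsub>K\<^esub> \<odot>\<^bsub>H\<^esub> \<one>\<^bsub>H\<^esub> = \<one>\<^bsub>H\<^esub>" by simp
  then have "counit H (\<zero>\<^bsub>K\<^esub> \<odot>\<^bsub>H\<^esub> \<one>\<^bsub>H\<^esub>) = \<one>\<^bsub>K\<^esub>" by (simp add: counit_one)
  then have "\<zero>\<^bsub>K\<^esub> \<otimes>\<^bsub>K\<^esub> \<one>\<^bsub>K\<^esub> = \<one>\<^bsub>K\<^esub>"
    using linear_maps_smult[OF counit_hom, of "\<zero>\<^bsub>K\<^esub>" "\<one>\<^bsub>H\<^esub>"]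
    by (simp add: self_module_def counit_one)
  then show False by simp
qed

lemma nonzero_integral_exists:
  obtains l x where "l \<in> \<K>" "idm \<star> l = l" "x \<in> C" "l x \<noteq> \<zero>\<^bsub>H\<^esub>"
proof -
  have "\<exists>b\<in>Bs. trace_integral (crd b) (antipode H b) \<noteq> \<zero>\<^bsub>H\<^esub>"
  proof (rule ccontr)
    assume "\<not> ?thesis"
    then have "(\<Oplus>\<^bsub>H\<^esub>b\<in>Bs. trace_integral (crd b) (antipode H b)) = \<zero>\<^bsub>H\<^esub>"
      by (intro module.M.add.finprod_one_eqI) auto
    then show False using trace_integral_sum one_not_zero by simp
  qed
  then obtain b where "b \<in> Bs" "trace_integral (crd b) (antipode H b) \<noteq> \<zero>\<^bsub>H\<^esub>" by blast
  then show ?thesis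
    by (intro that[of "trace_integral (crd b)" "antipode H b"] trace_integral_K trace_integral_left) auto
qed

lemma scalar_nonzero_cancel:
  assumes "s \<in> scalars" "s \<noteq> \<zero>\<^bsub>H\<^esub>" "k \<in> C" "k \<cdot> s = \<zero>\<^bsub>H\<^esub>"
  shows "k = \<zero>\<^bsub>H\<^esub>"
proof -
  obtain c where c: "c \<in> carrier K" "s = scal c" using assms by (auto simp: scalars_def)
  then have "c \<noteq> \<zero>\<^bsub>K\<^esub>" using assms by auto
  then have inv: "inv\<^bsub>K\<^esub> c \<in> carrier K" "inv\<^bsub>K\<^esub> c \<otimes>\<^bsub>K\<^esub> c = \<one>\<^bsub>K\<^esub>"
    using c by (auto simp: field_Units)
  have "c \<odot>\<^bsub>H\<^esub> k = \<zero>\<^bsub>H\<^esub>" using assms c by (simp add: smult_mult_right)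
  then have "inv\<^bsub>K\<^esub> c \<odot>\<^bsub>H\<^esub> (c \<odot>\<^bsub>H\<^esub> k) = \<zero>\<^bsub>H\<^esub>" using inv by simp
  then show ?thesis using c inv assms by (simp add: smult_assoc1[symmetric])
qed

end

section \<open>Nondegeneracy of a left integral and the dual integral in H\<close>

locale left_integral = fd_hopf_algebra +
  fixes l :: "'c \<Rightarrow> 'c" and x0 :: 'c
  assumes l_K: "l \<in> \<K>" and l_integral: "idm \<star> l = l" and x0: "x0 \<in> C" "l x0 \<noteq> \<zero>\<^bsub>H\<^esub>"
begin

lemma l_scalar [simp]: "h \<in> C \<Longrightarrow> l h \<in> scalars"
  by (rule K_scalar[OF l_K])

lemma l_E [simp]: "l \<in> \<E>"
  by (rule K_E[OF l_K])

lemma lin_l: "f \<in> linH \<Longrightarrow> (\<lambda>x. l (f x)) \<in> linH"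
  by (rule lin_E[OF l_E])

lemmas lint = sw_closed H.m_closed lin_intros lin_l E_lin[OF l_E]

lemma l_left: "h \<in> C \<Longrightarrow> sw h (\<lambda>u v. u \<cdot> l v) = l h"
proof -
  assume h: "h \<in> C"
  have "sw h (\<lambda>u v. u \<cdot> l v) = (idm \<star> l) h"
    unfolding conv_apply[OF h]
    by (rule sw_cong[OF h bil_conv[OF E_lin[OF idm_E] E_lin[OF l_E]]]) simp
  then show ?thesis by (simp add: l_integral)
qed

text \<open>Multiplying the left side by the first leg of h gives the comultiplication of hk, to
  which the integral property applies; the value is l(hk), and \<open>solve_left\<close> divides by
  that leg.\<close>

lemma l_shift:
  assumes h: "h \<in> C" and k: "k \<in> C"
  shows "sw k (\<lambda>u v. u \<cdot> l (h \<cdot> v)) = sw h (\<lambda>p q. antipode H p \<cdot> l (q \<cdot> k))"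
proof (rule solve_left[OF _ _ h])
  fix h assume h: "h \<in> C"
  have "sw h (\<lambda>p q. p \<cdot> sw k (\<lambda>u v. u \<cdot> l (q \<cdot> v))) = sw h (\<lambda>p q. sw k (\<lambda>u v. (p \<cdot> u) \<cdot> l (q \<cdot> v)))"
  proof (rule sw_cong[OF h])
    fix p q assume pq: "p \<in> C" "q \<in> C"
    have "p \<cdot> sw k (\<lambda>u v. u \<cdot> l (q \<cdot> v)) = sw k (\<lambda>u v. p \<cdot> (u \<cdot> l (q \<cdot> v)))"
      by (rule sw_mult_right[OF _ k pq(1)]) (intro lint; simp add: pq)
    also have "\<dots> = sw k (\<lambda>u v. (p \<cdot> u) \<cdot> l (q \<cdot> v))"
      by (rule sw_cong[OF k]; (intro lint; simp add: pq)?) (simp add: pq H.m_assoc)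
    finally show "p \<cdot> sw k (\<lambda>u v. u \<cdot> l (q \<cdot> v)) = \<dots>" .
  qed (intro lint; simp add: k)
  also have "\<dots> = sw (h \<cdot> k) (\<lambda>u v. u \<cdot> l v)"
    by (rule sw_mult[OF _ h k, symmetric]) (intro lint; simp)
  finally show "sw h (\<lambda>p q. p \<cdot> sw k (\<lambda>u v. u \<cdot> l (q \<cdot> v))) = l (h \<cdot> k)"
    using h k by (simp add: l_left)
qed (intro lint; simp add: k)+

text \<open>If all l(hk) vanish, \<open>l_shift\<close> makes \<open>idm \<star> l(h _)\<close>
  vanish at k for every h. A suitable combination of these forms, convolved with coordinate forms,
  is l(x0) times the counit, so k l(x0) = 0.\<close>

lemma l_nondegenerate_zero:
  assumes k: "k \<in> C" and l0: "\<And>h. h \<in> C \<Longrightarrow> l (h \<cdot> k) = \<zero>\<^bsub>H\<^esub>"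
  shows "k = \<zero>\<^bsub>H\<^esub>"
proof -
  let ?D = "\<lambda>h. \<lambda>v\<in>C. l (h \<cdot> v)"
  have D: "?D h \<in> \<K>" if "h \<in> C" for h using that by (intro mkK lint) auto
  have 0: "(idm \<star> ?D h) k = \<zero>\<^bsub>H\<^esub>" if h: "h \<in> C" for h
  proof -
    have "(idm \<star> ?D h) k = sw k (\<lambda>u v. u \<cdot> l (h \<cdot> v))"
      unfolding conv_apply[OF k] by (rule sw_cong[OF k]; (intro lint; simp add: h)?) simp
    also have "\<dots> = sw h (\<lambda>p q. antipode H p \<cdot> l (q \<cdot> k))" by (rule l_shift[OF h k])
    also have "\<dots> = sw h (\<lambda>p q. \<zero>\<^bsub>H\<^esub>)"
      by (rule sw_cong[OF h]) (auto intro!: bilI lin_zero simp: l0)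
    finally show ?thesis using h by (simp add: sw_zero)
  qed
  \<comment> \<open>These elements are chosen so that the sum over the basis becomes l(x0 S(v1) v2),
    which the antipode axiom evaluates to l(x0) eps(v).\<close>
  let ?y = "\<lambda>b. x0 \<cdot> antipode H b"
  have y: "?y b \<in> C" if "b \<in> C" for b using that x0 by simp
  define R where "R = (\<lambda>v\<in>C. l x0 \<cdot> eps v)"
  have R: "R \<in> \<E>" unfolding R_def by (intro mkE lint) (auto simp: x0)
  let ?T = "\<lambda>b p q. crd b p \<cdot> l (?y b \<cdot> q)"
  have bT: "bilH (?T b)" if "b \<in> Bs" for b
    by (intro lint lin_E[OF crd_E] E_lin[OF crd_E]; simp add: that x0)
  have sum_R: "(\<Oplus>\<^bsub>H\<^esub>b\<in>Bs. (crd b \<star> ?D (?y b)) v) = R v" if v: "v \<in> C" for v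
  proof -
    have "(\<Oplus>\<^bsub>H\<^esub>b\<in>Bs. (crd b \<star> ?D (?y b)) v) = (\<Oplus>\<^bsub>H\<^esub>b\<in>Bs. sw v (?T b))"
    proof (intro module.M.finsum_cong' refl Pi_I)
      fix b assume b: "b \<in> Bs"
      show "sw v (?T b) \<in> C" by (rule sw_closed[OF bT[OF b] v])
      show "(crd b \<star> ?D (?y b)) v = sw v (?T b)"
        unfolding conv_apply[OF v] by (rule sw_cong[OF v bT[OF b]]) simp
    qed
    also have "\<dots> = sw v (\<lambda>p q. \<Oplus>\<^bsub>H\<^esub>b\<in>Bs. ?T b p q)" by (rule sw_finsum[OF Bs(1) v bT, symmetric])
    also have "\<dots> = sw v (\<lambda>p q. l (?y p \<cdot> q))"
    proof (rule sw_cong[OF v])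
      show "bilH (\<lambda>p q. l (?y p \<cdot> q))" by (intro lint; simp add: x0)
      fix p q assume pq: "p \<in> C" "q \<in> C"
      show "(\<Oplus>\<^bsub>H\<^esub>b\<in>Bs. ?T b p q) = l (?y p \<cdot> q)"
        by (rule expand[symmetric, OF _ pq(1)]) (intro lint; simp add: x0 pq)
    qed
    also have "\<dots> = sw v (\<lambda>p q. l (x0 \<cdot> (antipode H p \<cdot> q)))"
      by (rule sw_cong[OF v]; (intro lint; simp add: x0)?) (simp add: x0 H.m_assoc)
    also have "\<dots> = l (x0 \<cdot> sw v (\<lambda>p q. antipode H p \<cdot> q))"
      by (rule sw_lin[symmetric, OF _ _ v]) (intro lint; simp add: x0)+
    also have "\<dots> = R v"
      using v x0 scalar_lin'[OF E_lin[OF l_E], of "eps v" x0] by (simp add: sw_antipode_left R_def)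
    finally show ?thesis .
  qed
  have bN: "bilH (\<lambda>u v. u \<cdot> (crd b \<star> ?D (?y b)) v)" if "b \<in> Bs" for b
    by (intro lint E_lin[OF conv_closed[OF crd_E K_E[OF D]]]) (auto simp: that y x0 D K_E[OF D])
  have "k \<cdot> l x0 = (idm \<star> R) k"
  proof -
    have "(idm \<star> R) k = sw k (\<lambda>u v. (u \<cdot> l x0) \<cdot> eps v)"
      unfolding conv_apply[OF k]
      by (rule sw_cong[OF k]; (intro lint; simp add: x0)?) (simp add: x0 R_def H.m_assoc)
    also have "\<dots> = k \<cdot> l x0"
      by (rule sw_counit_right[OF _ k]) (intro lint; simp add: x0)
    finally show ?thesis by simp
  qed
  also have "\<dots> = sw k (\<lambda>u v. \<Oplus>\<^bsub>H\<^esub>b\<in>Bs. u \<cdot> (crd b \<star> ?D (?y b)) v)"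
    unfolding conv_apply[OF k]
  proof (rule sw_cong[OF k, symmetric])
    show "bilH (\<lambda>u v. idm u \<cdot> R v)" by (intro bil_conv E_lin idm_E R)
    fix u v assume uv: "u \<in> C" "v \<in> C"
    show "(\<Oplus>\<^bsub>H\<^esub>b\<in>Bs. u \<cdot> (crd b \<star> ?D (?y b)) v) = idm u \<cdot> R v"
      using uv by (simp add: sum_R[symmetric])
        (rule finsum_lin[symmetric, OF lin_mult_right[OF linear_maps_id] Bs(1)],
          auto intro!: conv_apply_closed K_E[OF D] y)
  qed
  also have "\<dots> = (\<Oplus>\<^bsub>H\<^esub>b\<in>Bs. sw k (\<lambda>u v. u \<cdot> (crd b \<star> ?D (?y b)) v))"
    by (rule sw_finsum[OF Bs(1) k bN])
  also have "\<dots> = \<zero>\<^bsub>H\<^esub>"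
  proof (rule module.M.add.finprod_one_eqI)
    fix b assume b: "b \<in> Bs"
    then have yb: "?y b \<in> C" using y by simp
    have "sw k (\<lambda>u v. u \<cdot> (crd b \<star> ?D (?y b)) v) = (idm \<star> (crd b \<star> ?D (?y b))) k"
      unfolding conv_apply[OF k] 
      by (rule sw_cong[OF k bil_conv[OF E_lin[OF idm_E] E_lin[OF conv_closed[OF crd_E[OF b] K_E[OF D[OF yb]]]]]]) simp
    \<comment> \<open>Associativity and centrality of the values of the form put the vanishing
      vector inside a linear map.\<close>
    also have "\<dots> = (idm \<star> crd b) ((idm \<star> ?D (?y b)) k)"
      unfolding conv_assoc[OF idm_E crd_E[OF b] K_E[OF D[OF yb]], symmetric]
      by (rule conv_scalar_right[OF conv_closed[OF idm_E crd_E[OF b]] D[OF yb] k])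
    also have "\<dots> = \<zero>\<^bsub>H\<^esub>"
      using linear_maps_smult[OF E_lin[OF conv_closed[OF idm_E crd_E[OF b]]], of "\<zero>\<^bsub>K\<^esub>" "\<one>\<^bsub>H\<^esub>"] b
      by (simp add: 0[OF yb])
    finally show "sw k (\<lambda>u v. u \<cdot> (crd b \<star> ?D (?y b)) v) = \<zero>\<^bsub>H\<^esub>" .
  qed
  finally show ?thesis using scalar_nonzero_cancel[OF l_scalar[OF x0(1)] x0(2) k] by simp
qed

end

context left_integral
begin

lemma l_nondegenerate:
  assumes "k \<in> C" "k' \<in> C" and eq: "\<And>h. h \<in> C \<Longrightarrow> l (h \<cdot> k) = l (h \<cdot> k')"
  shows "k = k'"
proof -
  interpret l: mod_hom K H H l by (intro mod_homI module_H E_lin l_E)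
  have "l (h \<cdot> (k \<ominus>\<^bsub>H\<^esub> k')) = \<zero>\<^bsub>H\<^esub>" if h: "h \<in> C" for h
  proof -
    have "h \<cdot> (k \<ominus>\<^bsub>H\<^esub> k') = (h \<cdot> k) \<ominus>\<^bsub>H\<^esub> (h \<cdot> k')"
      using h assms by (simp add: a_minus_def H.r_distr H.r_minus)
    then show ?thesis using h assms by (simp add: l.f_minus a_minus_def module.M.r_neg)
  qed
  then have "k \<ominus>\<^bsub>H\<^esub> k' = \<zero>\<^bsub>H\<^esub>" by (rule l_nondegenerate_zero[rotated]) (use assms in auto)
  then show ?thesis using assms by simp
qed

text \<open>Nondegeneracy makes k \<mapsto> l(_ k) injective, hence bijective onto the dual by
  dimension; \<Lambda> is the preimage of the counit. That it is a left integral in H follows by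
  pairing with an arbitrary x.\<close>

lemma dual_integral_exists:
  obtains \<Lambda> where "\<Lambda> \<in> C" "\<And>h. h \<in> C \<Longrightarrow> l (h \<cdot> \<Lambda>) = eps h"
    "\<And>h. h \<in> C \<Longrightarrow> h \<cdot> \<Lambda> = eps h \<cdot> \<Lambda>"
proof -
  have coeff: "crd d (\<Oplus>\<^bsub>H\<^esub>b\<in>Bs. b \<cdot> f b) = f d"
    if f: "\<And>b. b \<in> Bs \<Longrightarrow> f b \<in> scalars" and d: "d \<in> Bs" for f d
  proof -
    have "crd d (\<Oplus>\<^bsub>H\<^esub>b\<in>Bs. b \<cdot> f b) = (\<Oplus>\<^bsub>H\<^esub>b\<in>Bs. crd d (b \<cdot> f b))"
      using f d by (intro finsum_lin E_lin crd_E Bs) auto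
    also have "\<dots> = (\<Oplus>\<^bsub>H\<^esub>b\<in>Bs. if d = b then f b else \<zero>\<^bsub>H\<^esub>)"
      using f d by (intro module.M.finsum_cong' refl)
        (auto simp: scalar_lin'[OF E_lin[OF crd_E[OF d]]] crd_basis)
    also have "\<dots> = f d" using f d Bs by (intro module.M.add.finprod_singleton) auto
    finally show ?thesis .
  qed
  \<comment> \<open>The form l(_ k) is recorded as the vector whose coordinates are its values on
    the basis. This makes k \<mapsto> l(_ k) an endomorphism of H, so that \<open>lin_surj\<close>
    applies.\<close>
  let ?T = "\<lambda>k. \<Oplus>\<^bsub>H\<^esub>b\<in>Bs. b \<cdot> l (b \<cdot> k)"
  have ext: "l (h \<cdot> k) = f h"
    if "\<And>b. b \<in> Bs \<Longrightarrow> l (b \<cdot> k) = f b" "f \<in> linH" "h \<in> C" "k \<in> C" for f h k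
  proof -
    have "l (h \<cdot> k) = (\<Oplus>\<^bsub>H\<^esub>b\<in>Bs. crd b h \<cdot> l (b \<cdot> k))"
      by (rule expand[OF _ that(3)]) (intro lint that)
    also have "\<dots> = f h"
      unfolding expand[OF that(2,3)] using that(1,3) linear_maps_closed[OF that(2)]
      by (intro module.M.finsum_cong' refl) auto
    finally show ?thesis .
  qed
  have "\<exists>\<Lambda>\<in>C. ?T \<Lambda> = (\<Oplus>\<^bsub>H\<^esub>b\<in>Bs. b \<cdot> eps b)"
  proof (rule lin_surj)
    show "?T \<in> linH" by (intro lin_finsum Bs lint; simp)
    fix k assume k: "k \<in> C" and 0: "?T k = \<zero>\<^bsub>H\<^esub>"
    have "l (b \<cdot> k) = \<zero>\<^bsub>H\<^esub>" if "b \<in> Bs" for b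
    proof -
      interpret c: mod_hom K H H "crd b" by (intro mod_homI module_H E_lin crd_E that)
      show ?thesis using coeff[of "\<lambda>b. l (b \<cdot> k)" b] that k 0 c.f0_is_0 by simp
    qed
    then have "l (h \<cdot> k) = \<zero>\<^bsub>H\<^esub>" if "h \<in> C" for h by (rule ext[OF _ lin_zero that k])
    then show "k = \<zero>\<^bsub>H\<^esub>" by (rule l_nondegenerate_zero[OF k])
  qed (auto intro!: module.M.finsum_closed)
  then obtain \<Lambda> where L: "\<Lambda> \<in> C" "?T \<Lambda> = (\<Oplus>\<^bsub>H\<^esub>b\<in>Bs. b \<cdot> eps b)" by blast
  have "l (b \<cdot> \<Lambda>) = eps b" if "b \<in> Bs" for b
    using coeff[of "\<lambda>b. l (b \<cdot> \<Lambda>)" b] coeff[of eps b] that L by simp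
  then have 1: "l (h \<cdot> \<Lambda>) = eps h" if "h \<in> C" for h
    by (rule ext[OF _ eps_lin that L(1)])
  have 2: "h \<cdot> \<Lambda> = eps h \<cdot> \<Lambda>" if h: "h \<in> C" for h
  proof (rule l_nondegenerate)
    fix x assume x: "x \<in> C"
    have "l (x \<cdot> (h \<cdot> \<Lambda>)) = eps x \<cdot> eps h"
      using x h L 1[of "x \<cdot> h"] by (simp add: H.m_assoc eps_mult)
    also have "\<dots> = l (x \<cdot> (eps h \<cdot> \<Lambda>))"
      using x h L scalar_lin[OF E_lin[OF l_E], of "eps h" "x \<cdot> \<Lambda>"]
      by (simp add: H.m_assoc[symmetric] 1 scalar_comm[of "eps h" x] scalar_comm[of "eps h" "eps x"])
    finally show "l (x \<cdot> (h \<cdot> \<Lambda>)) = l (x \<cdot> (eps h \<cdot> \<Lambda>))" .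
  qed (use h L in auto)
  show ?thesis using that L(1) 1 2 by blast
qed

end


section \<open>Radford's formula for the fourth power of the antipode\<close>

locale bij_hopf_algebra = fd_hopf_algebra +
  assumes bij: "bij_betw (antipode H) C C"
begin

definition Si :: "'c \<Rightarrow> 'c" where
  "Si = inv_into C (antipode H)"

lemma Si_closed [simp]: "h \<in> C \<Longrightarrow> Si h \<in> C"
  unfolding Si_def using bij by (metis bij_betw_def inv_into_into)

lemma antipode_Si [simp]: "h \<in> C \<Longrightarrow> antipode H (Si h) = h"
  unfolding Si_def using bij by (metis bij_betw_inv_into_right)

lemma Si_antipode [simp]: "h \<in> C \<Longrightarrow> Si (antipode H h) = h"
  unfolding Si_def using bij by (metis bij_betw_inv_into_left)

lemma antipode_inj: "x \<in> C \<Longrightarrow> y \<in> C \<Longrightarrow> antipode H x = antipode H y \<Longrightarrow> x = y"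
  by (metis Si_antipode)

lemma Si_lin: "Si \<in> linH"
proof (rule linear_mapsI)
  fix x y assume xy: "x \<in> C" "y \<in> C"
  show "Si (x \<oplus>\<^bsub>H\<^esub> y) = Si x \<oplus>\<^bsub>H\<^esub> Si y"
    by (rule antipode_inj) (simp_all add: xy linear_maps_add[OF antipode_hom])
next
  fix r x assume rx: "r \<in> carrier K" "x \<in> C"
  show "Si (r \<odot>\<^bsub>H\<^esub> x) = r \<odot>\<^bsub>H\<^esub> Si x"
    by (rule antipode_inj) (simp_all add: rx linear_maps_smult[OF antipode_hom])
qed simp

lemma lin_Si: "f \<in> linH \<Longrightarrow> (\<lambda>x. Si (f x)) \<in> linH"
  by (rule linear_maps_compose[OF _ Si_lin])

lemma Si_mult: "x \<in> C \<Longrightarrow> y \<in> C \<Longrightarrow> Si (x \<cdot> y) = Si y \<cdot> Si x"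
  by (rule antipode_inj) (simp_all add: antipode_mult)

text \<open>The reversal of the comultiplication by S, applied at the element with image h.\<close>

lemma sw_Si:
  assumes B: "bilH B" and h: "h \<in> C"
  shows "sw (Si h) B = sw h (\<lambda>u v. B (Si v) (Si u))"
proof -
  have b: "bilH (\<lambda>u v. B (Si v) (Si u))"
    by (intro bilI linear_maps_compose[OF Si_lin bil_left[OF B]] linear_maps_compose[OF Si_lin bil_right[OF B]]) auto
  have "sw h (\<lambda>u v. B (Si v) (Si u)) = sw (antipode H (Si h)) (\<lambda>u v. B (Si v) (Si u))" using h by simp
  also have "\<dots> = sw (Si h) (\<lambda>u v. B (Si (antipode H u)) (Si (antipode H v)))"
    by (rule sw_antipode[OF b]) (simp add: h)
  also have "\<dots> = sw (Si h) B" by (rule sw_cong) (simp_all add: h B)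
  finally show ?thesis by simp
qed

end

section \<open>The modular function, the distinguished grouplike element and Radford's
  formula\<close>

locale radford = left_integral + bij_hopf_algebra +
  fixes \<Lambda> :: 'c
  assumes L: "\<Lambda> \<in> C" and l_L: "h \<in> C \<Longrightarrow> l (h \<cdot> \<Lambda>) = eps h"
    and L_left: "h \<in> C \<Longrightarrow> h \<cdot> \<Lambda> = eps h \<cdot> \<Lambda>"
begin

lemmas L_closed [simp] = L

lemmas lis = lint lin_Si Si_lin

text \<open>The modular function of H, which measures how far the left integral \<Lambda> is from
  being a right integral; see \<open>L_right\<close>.\<close>

definition \<alpha> :: "'c \<Rightarrow> 'c" where
  "\<alpha> = (\<lambda>h\<in>C. l (\<Lambda> \<cdot> h))"

text \<open>The distinguished grouplike element. This expression is what the computation in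
  \<open>l_modular\<close> produces; \<open>a_eq\<close> recovers the usual formula sum
  l(\<Lambda>1) \<Lambda>2.\<close>

definition a :: 'c where
  "a = sw \<Lambda> (\<lambda>u v. Si u \<cdot> l (Si v))"

lemma a_closed [simp]: "a \<in> C"
  unfolding a_def by (intro lis; simp)

lemma l_L_one: "l \<Lambda> = \<one>\<^bsub>H\<^esub>"
  using l_L[of "\<one>\<^bsub>H\<^esub>"] by simp

text \<open>\<open>l_shift\<close> at \<Lambda>, where l(q \<Lambda>) is the counit of q. It
  expresses the antipode through the pair of integrals.\<close>

lemma L_antipode: "h \<in> C \<Longrightarrow> sw \<Lambda> (\<lambda>u v. u \<cdot> l (h \<cdot> v)) = antipode H h"
proof -
  assume h: "h \<in> C"
  have "sw \<Lambda> (\<lambda>u v. u \<cdot> l (h \<cdot> v)) = sw h (\<lambda>p q. antipode H p \<cdot> l (q \<cdot> \<Lambda>))"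
    by (rule l_shift[OF h L])
  also have "\<dots> = sw h (\<lambda>p q. antipode H p \<cdot> eps q)"
    by (rule sw_cong[OF h]; (intro lis; simp)?) (simp add: l_L)
  also have "\<dots> = antipode H h" by (rule sw_counit_right[OF antipode_hom h])
  finally show ?thesis .
qed

text \<open>S exchanges left and right and reverses the comultiplication, so composing l with the
  inverse of S turns the left integral into a right integral.\<close>

lemma l_Si_right: "k \<in> C \<Longrightarrow> sw k (\<lambda>p q. l (Si p) \<cdot> q) = l (Si k)"
proof -
  assume k: "k \<in> C"
  let ?t = "Si k"
  have t: "?t \<in> C" using k by simp
  have "sw k (\<lambda>p q. l (Si p) \<cdot> q) = sw (antipode H ?t) (\<lambda>p q. l (Si p) \<cdot> q)" using k by simp
  also have "\<dots> = sw ?t (\<lambda>u v. l (Si (antipode H v)) \<cdot> antipode H u)"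
    by (rule sw_antipode[OF _ t]) (intro lis; simp)
  also have "\<dots> = sw ?t (\<lambda>u v. antipode H (u \<cdot> l v))"
    by (rule sw_cong[OF t]; (intro lis; simp)?) (simp add: scalar_lin[OF antipode_hom] scalar_comm[of "l _"])
  also have "\<dots> = antipode H (sw ?t (\<lambda>u v. u \<cdot> l v))"
    by (rule sw_lin[OF antipode_hom _ t, symmetric]) (intro lis; simp)
  also have "\<dots> = l ?t" using t by (simp add: l_left)
  finally show ?thesis .
qed

text \<open>Usually deduced from the one-dimensionality of the space of integrals. Here h is written
  through \<Lambda> by \<open>L_antipode\<close>; the left side becomes the convolution of the
  inverse antipode, l composed with it, and l(h _), evaluated at \<Lambda>. The last two factors
  merge to a multiple of l(h) by \<open>l_Si_right\<close>.\<close>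

lemma l_modular:
  assumes h: "h \<in> C"
  shows "sw h (\<lambda>u v. l u \<cdot> v) = l h \<cdot> a"
proof -
  let ?m = "\<lambda>h. sw h (\<lambda>u v. l u \<cdot> v)"
  have m: "?m \<in> linH" by (intro lis; simp)
  note lm = linear_maps_compose[OF _ m]
  have m_closed: "?m t \<in> C" if "t \<in> C" for t by (rule linear_maps_closed[OF m that])
  let ?F = "\<lambda>k\<in>C. Si k" and ?R = "\<lambda>k\<in>C. l (Si k)" and ?D = "\<lambda>k\<in>C. l (h \<cdot> k)"
  have E: "?F \<in> \<E>" "?R \<in> \<E>" "?D \<in> \<E>" using h by (intro mkE lis; simp)+
  have FR: "(?F \<star> ?R) u = ?m (Si u)" if u: "u \<in> C" for u
  proof -
    have "?m (Si u) = sw u (\<lambda>p q. l (Si q) \<cdot> Si p)"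
      by (rule sw_Si[OF _ u]) (intro lis; simp)
    also have "\<dots> = (?F \<star> ?R) u"
      unfolding conv_apply[OF u]
      by (rule sw_cong[OF u bil_conv[OF E_lin[OF E(1)] E_lin[OF E(2)]]]) (simp add: scalar_comm[of "l _"])
    finally show ?thesis by simp
  qed
  have RD: "(?R \<star> ?D) k = l h \<cdot> l (Si k)" if k: "k \<in> C" for k
  proof -
    have "(?R \<star> ?D) k = sw k (\<lambda>p q. l (h \<cdot> (l (Si p) \<cdot> q)))"
      unfolding conv_apply[OF k]
    proof (rule sw_cong[OF k])
      show "bilH (\<lambda>p q. l (h \<cdot> (l (Si p) \<cdot> q)))" by (intro lis; simp add: h)
      fix p q assume pq: "p \<in> C" "q \<in> C"
      have "h \<cdot> (l (Si p) \<cdot> q) = l (Si p) \<cdot> (h \<cdot> q)"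
        using h pq by (simp add: H.m_assoc[symmetric] scalar_comm[of "l (Si p)" h])
      then show "?R p \<cdot> ?D q = l (h \<cdot> (l (Si p) \<cdot> q))"
        using h pq by (simp add: scalar_lin[OF E_lin[OF l_E]])
    qed
    also have "\<dots> = l (h \<cdot> sw k (\<lambda>p q. l (Si p) \<cdot> q))"
      by (rule sw_lin[symmetric, OF _ _ k]) (intro lis; simp add: h)+
    also have "\<dots> = l h \<cdot> l (Si k)"
      using h k by (simp add: l_Si_right scalar_lin'[OF E_lin[OF l_E]])
    finally show ?thesis .
  qed
  \<comment> \<open>In this form h occurs only in the argument of a linear form, so its
    comultiplication is traded for that of \<Lambda>.\<close>
  have "h = Si (sw \<Lambda> (\<lambda>u v. u \<cdot> l (h \<cdot> v)))" using h by (simp add: L_antipode)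
  also have "\<dots> = sw \<Lambda> (\<lambda>u v. Si (u \<cdot> l (h \<cdot> v)))"
    by (rule sw_lin[OF Si_lin _ L]) (intro lis; simp add: h)
  finally have "?m h = ?m (sw \<Lambda> (\<lambda>u v. Si (u \<cdot> l (h \<cdot> v))))" by simp
  also have "\<dots> = sw \<Lambda> (\<lambda>u v. ?m (Si (u \<cdot> l (h \<cdot> v))))"
    by (rule sw_lin[OF m _ L]) (intro lis; simp add: h)
  also have "\<dots> = (?F \<star> ?R \<star> ?D) \<Lambda>"
    unfolding conv_apply[OF L]
    by (rule sw_cong[OF L bil_conv[OF E_lin[OF conv_closed[OF E(1,2)]] E_lin[OF E(3)]]])
      (use h in \<open>simp add: FR scalar_lin'[OF Si_lin] scalar_lin'[OF m]\<close>)
  also have "\<dots> = (?F \<star> (?R \<star> ?D)) \<Lambda>" by (simp add: conv_assoc E)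
  also have "\<dots> = sw \<Lambda> (\<lambda>u v. l h \<cdot> (Si u \<cdot> l (Si v)))"
    unfolding conv_apply[OF L]
    by (rule sw_cong[OF L]; (intro lis; simp add: h)?)
      (use h in \<open>simp add: RD H.m_assoc[symmetric] scalar_comm[of "l h"]\<close>)
  also have "\<dots> = l h \<cdot> a"
    unfolding a_def by (rule sw_mult_right[OF _ L, symmetric]; (intro lis; simp)?) (simp add: h)
  finally show ?thesis .
qed

text \<open>The mirror image of \<open>l_shift\<close>. Since l is only a left integral, the factor
  a of \<open>l_modular\<close> appears.\<close>

lemma l_shift_right:
  assumes h: "h \<in> C" and k: "k \<in> C"
  shows "sw h (\<lambda>u v. l (u \<cdot> k) \<cdot> v) = sw k (\<lambda>p q. (l (h \<cdot> p) \<cdot> a) \<cdot> antipode H q)"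
proof (rule solve_right[OF _ _ k])
  fix k assume k: "k \<in> C"
  have "sw k (\<lambda>p q. sw h (\<lambda>u v. l (u \<cdot> p) \<cdot> v) \<cdot> q) = sw k (\<lambda>p q. sw h (\<lambda>u v. l (u \<cdot> p) \<cdot> (v \<cdot> q)))"
  proof (rule sw_cong[OF k])
    fix p q assume pq: "p \<in> C" "q \<in> C"
    have "sw h (\<lambda>u v. l (u \<cdot> p) \<cdot> v) \<cdot> q = sw h (\<lambda>u v. l (u \<cdot> p) \<cdot> v \<cdot> q)"
      by (rule sw_mult_left[OF _ h pq(2)]) (intro lis; simp add: pq)
    also have "\<dots> = sw h (\<lambda>u v. l (u \<cdot> p) \<cdot> (v \<cdot> q))"
      by (rule sw_cong[OF h]; (intro lis; simp add: pq)?) (simp add: pq H.m_assoc)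
    finally show "sw h (\<lambda>u v. l (u \<cdot> p) \<cdot> v) \<cdot> q = \<dots>" .
  qed (intro lis; simp add: h)
  also have "\<dots> = sw h (\<lambda>u v. sw k (\<lambda>p q. l (u \<cdot> p) \<cdot> (v \<cdot> q)))"
    by (rule sw_swap[OF k h]; intro lis; simp)
  also have "\<dots> = sw (h \<cdot> k) (\<lambda>u v. l u \<cdot> v)"
    by (rule sw_mult[OF _ h k, symmetric]) (intro lis; simp)
  finally show "sw k (\<lambda>p q. sw h (\<lambda>u v. l (u \<cdot> p) \<cdot> v) \<cdot> q) = l (h \<cdot> k) \<cdot> a"
    using h k by (simp add: l_modular)
qed (intro lis; simp add: h)+

lemma alpha_K [simp]: "\<alpha> \<in> \<K>"
  unfolding \<alpha>_def by (intro mkK lis; simp)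

lemma alpha_scalar [simp]: "h \<in> C \<Longrightarrow> \<alpha> h \<in> scalars"
  by (rule K_scalar[OF alpha_K])

text \<open>The inverse antipode sends \<Lambda> h to an element r with r k = eps(k) r. Then
  \<Lambda> h = S(r) = sum \<Lambda>1 l(r \<Lambda>2) = \<Lambda> l(r), and applying l identifies
  l(r) with \<alpha>(h).\<close>

lemma L_right:
  assumes h: "h \<in> C"
  shows "\<Lambda> \<cdot> h = \<Lambda> \<cdot> \<alpha> h"
proof -
  let ?r = "Si (\<Lambda> \<cdot> h)"
  have r: "?r \<in> C" using h by simp
  have rk: "?r \<cdot> k = eps k \<cdot> ?r" if k: "k \<in> C" for k
  proof -
    have "?r \<cdot> k = Si (antipode H k \<cdot> \<Lambda> \<cdot> h)"
      using h k by (simp add: H.m_assoc Si_mult[of "antipode H k"])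
    also have "antipode H k \<cdot> \<Lambda> = eps k \<cdot> \<Lambda>"
      using L_left[of "antipode H k"] k by simp
    also have "Si (eps k \<cdot> \<Lambda> \<cdot> h) = eps k \<cdot> ?r"
      using h k by (simp add: H.m_assoc scalar_lin[OF Si_lin])
    finally show ?thesis .
  qed
  have "\<Lambda> \<cdot> h = sw \<Lambda> (\<lambda>u v. u \<cdot> l (?r \<cdot> v))" using L_antipode[OF r] h by simp
  also have "\<dots> = sw \<Lambda> (\<lambda>u v. (u \<cdot> l ?r) \<cdot> eps v)"
    by (rule sw_cong[OF L]; (intro lis; simp add: h)?)
      (use h in \<open>simp add: rk scalar_lin[OF E_lin[OF l_E]] H.m_assoc scalar_comm[of "eps _" "l ?r"]\<close>)
  also have "\<dots> = \<Lambda> \<cdot> l ?r"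
    by (rule sw_counit_right[OF _ L]) (intro lis; simp add: h)
  finally have eq: "\<Lambda> \<cdot> h = \<Lambda> \<cdot> l ?r" .
  then have "\<alpha> h = l (\<Lambda> \<cdot> l ?r)" using h by (simp add: \<alpha>_def)
  also have "\<dots> = l ?r" using r by (simp add: scalar_lin'[OF E_lin[OF l_E]] l_L_one)
  finally show ?thesis using eq by simp
qed

lemma alpha_mult:
  assumes h: "h \<in> C" and k: "k \<in> C"
  shows "\<alpha> (h \<cdot> k) = \<alpha> h \<cdot> \<alpha> k"
proof -
  have "\<Lambda> \<cdot> (h \<cdot> k) = \<Lambda> \<cdot> \<alpha> h \<cdot> k"
    using h k L_right[OF h] by (simp add: H.m_assoc[symmetric])
  also have "\<dots> = (\<Lambda> \<cdot> k) \<cdot> \<alpha> h" using h k by (intro scalar_assoc) auto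
  finally have "\<alpha> (h \<cdot> k) = l ((\<Lambda> \<cdot> k) \<cdot> \<alpha> h)" using h k by (simp add: \<alpha>_def)
  also have "\<dots> = \<alpha> k \<cdot> \<alpha> h"
    using h k scalar_lin'[OF E_lin[OF l_E], of "\<alpha> h" "\<Lambda> \<cdot> k"] by (simp add: \<alpha>_def)
  finally show ?thesis using h k by (simp add: scalar_comm[of "\<alpha> h" "\<alpha> k"])
qed

lemma alpha_one: "\<alpha> \<one>\<^bsub>H\<^esub> = \<one>\<^bsub>H\<^esub>"
  by (simp add: \<alpha>_def l_L_one)

lemma a_eq: "a = sw \<Lambda> (\<lambda>u v. l u \<cdot> v)"
  using l_modular[OF L] by (simp add: l_L_one)

text \<open>Quantification over all bilinear B expresses that the comultiplication of a is a
  \<otimes> a. In sum l(\<Lambda>1) B(\<Lambda>2, \<Lambda>3), coassociativity and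
  \<open>l_modular\<close> first turn \<Lambda>2 into a, and \<open>a_eq\<close> then does the same
  for \<Lambda>3.\<close>

lemma a_grouplike:
  assumes B: "bilH B"
  shows "sw a B = B a a"
proof -
  note Bl = linear_maps_compose[OF _ bil_left[OF B]] and Br = linear_maps_compose[OF _ bil_right[OF B]]
  note cl [simp] = bil_closed[OF B]
  note li = lis Bl Br bil_left[OF B] bil_right[OF B] B
  have "sw a B = sw \<Lambda> (\<lambda>u z. sw (l u \<cdot> z) B)"
    unfolding a_eq by (rule sw_lin[OF sw_hom[OF B] _ L]) (intro li; simp)
  also have "\<dots> = sw \<Lambda> (\<lambda>u z. sw z (\<lambda>p q. l u \<cdot> B p q))"
  proof (rule sw_cong[OF L])
    show "bilH (\<lambda>u z. sw z (\<lambda>p q. l u \<cdot> B p q))" by (intro li; simp)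
    fix u z assume uz: "u \<in> C" "z \<in> C"
    then have "sw (l u \<cdot> z) B = l u \<cdot> sw z B" by (intro scalar_lin[OF sw_hom[OF B]]) auto
    also have "\<dots> = sw z (\<lambda>p q. l u \<cdot> B p q)" using uz by (intro sw_mult_right B) auto
    finally show "sw (l u \<cdot> z) B = \<dots>" .
  qed
  also have "\<dots> = sw \<Lambda> (\<lambda>x z. sw x (\<lambda>u v. l u \<cdot> B v z))"
    by (rule sw_coassoc[OF L, where T = "\<lambda>u p q. l u \<cdot> B p q", symmetric]; intro li; simp)
  also have "\<dots> = sw \<Lambda> (\<lambda>x z. B a (l x \<cdot> z))"
  proof (rule sw_cong[OF L])
    show "bilH (\<lambda>x z. B a (l x \<cdot> z))" by (intro li; simp)
    fix x z assume xz: "x \<in> C" "z \<in> C"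
    have "sw x (\<lambda>u v. l u \<cdot> B v z) = sw x (\<lambda>u v. B (l u \<cdot> v) z)"
      by (rule sw_cong[OF xz(1)]; (intro li; simp add: xz)?) (simp add: xz scalar_lin[OF bil_left[OF B]])
    also have "\<dots> = B (sw x (\<lambda>u v. l u \<cdot> v)) z"
      by (rule sw_lin[OF bil_left[OF B xz(2)] _ xz(1), symmetric]) (intro li; simp)
    also have "\<dots> = B a (l x \<cdot> z)"
      using xz by (simp add: l_modular scalar_lin[OF bil_left[OF B]] scalar_lin[OF bil_right[OF B]])
    finally show "sw x (\<lambda>u v. l u \<cdot> B v z) = \<dots>" .
  qed
  also have "\<dots> = B a (sw \<Lambda> (\<lambda>x z. l x \<cdot> z))"
    by (rule sw_lin[OF bil_right[OF B a_closed] _ L, symmetric]) (intro li; simp)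
  finally show ?thesis by (simp add: a_eq[symmetric])
qed

lemma eps_a: "eps a = \<one>\<^bsub>H\<^esub>"
proof -
  have "eps a = sw \<Lambda> (\<lambda>u v. eps (l u \<cdot> v))"
    unfolding a_eq by (rule sw_lin[OF eps_lin _ L]) (intro lis; simp)
  also have "\<dots> = sw \<Lambda> (\<lambda>u v. l u \<cdot> eps v)"
    by (rule sw_cong[OF L]; (intro lis; simp)?) (simp add: eps_mult)
  also have "\<dots> = l \<Lambda>" by (rule sw_counit_right[OF E_lin[OF l_E] L])
  finally show ?thesis by (simp add: l_L_one)
qed

lemma a_inverse: "antipode H a \<cdot> a = \<one>\<^bsub>H\<^esub>" "a \<cdot> antipode H a = \<one>\<^bsub>H\<^esub>"
proof -
  have "sw a (\<lambda>x y. antipode H x \<cdot> y) = antipode H a \<cdot> a"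
    by (rule a_grouplike) (intro lis; simp)
  then show "antipode H a \<cdot> a = \<one>\<^bsub>H\<^esub>" by (simp add: sw_antipode_left eps_a)
  have "sw a (\<lambda>x y. x \<cdot> antipode H y) = a \<cdot> antipode H a"
    by (rule a_grouplike) (intro lis; simp)
  then show "a \<cdot> antipode H a = \<one>\<^bsub>H\<^esub>" by (simp add: sw_antipode_right eps_a)
qed

text \<open>S(a) is the inverse of a; applying S to S(a) a = 1 shows that S(S(a)) is inverse to
  S(a).\<close>

lemma antipode_sq_a: "antipode H (antipode H a) = a"
proof -
  have "a \<cdot> (antipode H a \<cdot> antipode H (antipode H a)) = a"
    using arg_cong[OF a_inverse(1), of "antipode H"] by (simp add: antipode_mult)
  then show ?thesis by (simp add: H.m_assoc[symmetric] a_inverse)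
qed

text \<open>The counterpart of \<open>L_antipode\<close> in which l pairs with the first leg of
  \<Lambda>. It is the inverse of k \<mapsto> a S(k), as \<open>Z_inverse\<close> and
  \<open>Z_surj\<close> show.\<close>

definition Z :: "'c \<Rightarrow> 'c" where
  "Z h = sw \<Lambda> (\<lambda>u v. l (h \<cdot> u) \<cdot> v)"

lemma Z_closed [simp]: "h \<in> C \<Longrightarrow> Z h \<in> C"
  unfolding Z_def by (intro lis; simp)

lemma a_antipode_sw:
  assumes h: "h \<in> C" and k: "k \<in> C"
  shows "sw k (\<lambda>p q. (l (h \<cdot> p) \<cdot> a) \<cdot> antipode H q)
    = a \<cdot> antipode H (sw k (\<lambda>p q. l (h \<cdot> p) \<cdot> q))"
proof -
  have \<phi>: "(\<lambda>t. a \<cdot> antipode H t) \<in> linH" by (intro lis; simp)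
  have "a \<cdot> antipode H (sw k (\<lambda>p q. l (h \<cdot> p) \<cdot> q)) = sw k (\<lambda>p q. a \<cdot> antipode H (l (h \<cdot> p) \<cdot> q))"
    by (rule sw_lin[OF \<phi> _ k]) (intro lis; simp add: h)
  also have "\<dots> = sw k (\<lambda>p q. (l (h \<cdot> p) \<cdot> a) \<cdot> antipode H q)"
    by (rule sw_cong[OF k]; (intro lis; simp add: h)?)
      (use h in \<open>simp add: scalar_lin[OF antipode_hom] H.m_assoc[symmetric] scalar_comm[of "l (h \<cdot> _)" a]\<close>)
  finally show ?thesis by simp
qed

text \<open>\<open>l_shift_right\<close> at \<Lambda>, whose left side collapses to h because l(u
  \<Lambda>) is the counit of u.\<close>

lemma Z_inverse: "h \<in> C \<Longrightarrow> a \<cdot> antipode H (Z h) = h"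
proof -
  assume h: "h \<in> C"
  have "sw h (\<lambda>u v. l (u \<cdot> \<Lambda>) \<cdot> v) = sw h (\<lambda>u v. eps u \<cdot> v)"
    by (rule sw_cong[OF h]; (intro lis; simp)?) (simp add: l_L)
  also have "\<dots> = h" by (rule sw_counit_left[OF linear_maps_id h])
  finally show ?thesis unfolding Z_def using h by (simp add: l_shift_right a_antipode_sw)
qed

lemma Z_surj:
  assumes k: "k \<in> C"
  shows "Z (a \<cdot> antipode H k) = k"
proof (rule antipode_inj)
  have "antipode H a \<cdot> (a \<cdot> antipode H (Z (a \<cdot> antipode H k))) = antipode H a \<cdot> (a \<cdot> antipode H k)"
    using k by (simp add: Z_inverse)
  then show "antipode H (Z (a \<cdot> antipode H k)) = antipode H k"
    using k by (simp add: H.m_assoc[symmetric] a_inverse)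
qed (use k in auto)

text \<open>The element h with l(hk) = l(kw) for all k, i.e. the Nakayama automorphism of the
  Frobenius form l at w, is computed in two ways: from the first leg of \<Lambda> as S^{-2} of sum
  w1 \<alpha>(w2), and from the second leg, via \<open>Z\<close>, as a conjugate of S^2 of sum
  \<alpha>(w1) w2. Applying S^2 gives the formula.\<close>

theorem radford:
  assumes w: "w \<in> C"
  shows "sw w (\<lambda>p q. p \<cdot> \<alpha> q) \<cdot> a
    = a \<cdot> sw w (\<lambda>p q. \<alpha> p \<cdot> antipode H (antipode H (antipode H (antipode H q))))"
proof -
  let ?S = "antipode H"
  note li = lis lin_E[OF K_E[OF alpha_K]] E_lin[OF K_E[OF alpha_K]]
  let ?y = "sw w (\<lambda>p q. Si p \<cdot> \<alpha> q)"
  let ?h = "Si ?y"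
  have y: "?y \<in> C" by (intro li; simp add: w)
  then have h: "?h \<in> C" by simp
  \<comment> \<open>Applying S reduces this to \<open>l_shift\<close> with \<Lambda> in the role of
    h, where l(\<Lambda> v) is \<alpha>(v) by definition.\<close>
  have Ly: "sw \<Lambda> (\<lambda>u v. u \<cdot> l (v \<cdot> w)) = ?y"
  proof -
    have *: "sw \<Lambda> (\<lambda>u v. u \<cdot> l (v \<cdot> w)) \<in> C" by (intro lis; simp add: w)
    have "?S (sw \<Lambda> (\<lambda>u v. u \<cdot> l (v \<cdot> w))) = sw \<Lambda> (\<lambda>u v. ?S (u \<cdot> l (v \<cdot> w)))"
      by (rule sw_lin[OF antipode_hom _ L]) (intro lis; simp add: w)
    also have "\<dots> = sw \<Lambda> (\<lambda>u v. ?S u \<cdot> l (v \<cdot> w))"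
      by (rule sw_cong[OF L]; (intro lis; simp add: w)?) (simp add: w scalar_lin'[OF antipode_hom])
    also have "\<dots> = sw w (\<lambda>u v. u \<cdot> l (\<Lambda> \<cdot> v))" by (rule l_shift[OF L w, symmetric])
    finally have "sw \<Lambda> (\<lambda>u v. u \<cdot> l (v \<cdot> w)) = Si (sw w (\<lambda>u v. u \<cdot> l (\<Lambda> \<cdot> v)))"
      using * by (metis Si_antipode)
    also have "\<dots> = sw w (\<lambda>u v. Si (u \<cdot> l (\<Lambda> \<cdot> v)))"
      by (rule sw_lin[OF Si_lin _ w]) (intro lis; simp)
    also have "\<dots> = ?y"
      by (rule sw_cong[OF w]; (intro li; simp)?) (simp add: scalar_lin'[OF Si_lin] \<alpha>_def)
    finally show ?thesis .
  qed
  \<comment> \<open>By \<open>main\<close> a form is determined by its contraction with the second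
    leg of \<Lambda>. For l(h _) this contraction is S(h) by \<open>L_antipode\<close>, for l(_ w)
    it is computed in \<open>Ly\<close>; h was chosen to make them equal.\<close>
  have twist: "l (?h \<cdot> k) = l (k \<cdot> w)" if k: "k \<in> C" for k
  proof -
    let ?z = "a \<cdot> ?S k"
    have z: "?z \<in> C" using k by simp
    \<comment> \<open>Write k as \<open>Z\<close> of z = a S(k) and move the value of \<phi> inside
      l.\<close>
    have main: "\<phi> k = l (?z \<cdot> sw \<Lambda> (\<lambda>u v. u \<cdot> \<phi> v))"
      if \<phi>: "\<phi> \<in> linH" and \<phi>s: "\<And>v. v \<in> C \<Longrightarrow> \<phi> v \<in> scalars" for \<phi>
    proof -
      note [simp] = \<phi>s linear_maps_closed[OF \<phi>]
      have "\<phi> k = \<phi> (Z ?z)" using k by (simp add: Z_surj)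
      also have "\<dots> = sw \<Lambda> (\<lambda>u v. \<phi> (l (?z \<cdot> u) \<cdot> v))"
        unfolding Z_def by (rule sw_lin[OF \<phi> _ L]) (intro lis; simp add: k)
      also have "\<dots> = sw \<Lambda> (\<lambda>u v. l (?z \<cdot> (u \<cdot> \<phi> v)))"
        by (rule sw_cong[OF L]; (intro lis \<phi> linear_maps_compose[OF _ \<phi>]; simp add: k)?)
          (use z in \<open>simp add: scalar_lin[OF \<phi>] H.m_assoc[symmetric] scalar_lin'[OF E_lin[OF l_E]]\<close>)
      also have "\<dots> = l (?z \<cdot> sw \<Lambda> (\<lambda>u v. u \<cdot> \<phi> v))"
        by (rule sw_lin[OF _ _ L, symmetric]) (intro lis \<phi>; simp add: k)+
      finally show ?thesis .
    qed
    have "l (?h \<cdot> k) = l (?z \<cdot> ?y)"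
      using main[of "\<lambda>v. l (?h \<cdot> v)"] h y by (simp add: L_antipode lin_l lin_mult_right linear_maps_id)
    also have "\<dots> = l (k \<cdot> w)"
      using main[of "\<lambda>v. l (v \<cdot> w)"] w by (simp add: Ly lin_l lin_mult_left linear_maps_id)
    finally show ?thesis .
  qed
  \<comment> \<open>The twist replaces l(h u) by l(u w), and \<open>l_shift_right\<close> then gives
    the second description of h.\<close>
  have "Z ?h = sw \<Lambda> (\<lambda>u v. l (u \<cdot> w) \<cdot> v)"
    unfolding Z_def by (rule sw_cong[OF L]; (intro lis; simp add: w)?) (simp add: twist)
  also have "\<dots> = a \<cdot> ?S (sw w (\<lambda>p q. l (\<Lambda> \<cdot> p) \<cdot> q))"
    using w by (simp add: l_shift_right a_antipode_sw)
  also have "sw w (\<lambda>p q. l (\<Lambda> \<cdot> p) \<cdot> q) = sw w (\<lambda>p q. \<alpha> p \<cdot> q)"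
    by (rule sw_cong[OF w]; (intro li; simp)?) (simp add: \<alpha>_def)
  finally have Zh: "Z ?h = a \<cdot> ?S (sw w (\<lambda>p q. \<alpha> p \<cdot> q))" .
  let ?x = "sw w (\<lambda>p q. \<alpha> p \<cdot> q)"
  have x: "?x \<in> C" by (intro li; simp add: w)
  have "?h = a \<cdot> (?S (?S ?x) \<cdot> ?S a)"
    using Z_inverse[OF h] x by (simp add: Zh antipode_mult)
  then have "?S (?S ?h) = a \<cdot> (?S (?S (?S (?S ?x))) \<cdot> ?S a)"
    using x by (simp add: antipode_mult antipode_sq_a H.m_assoc)
  moreover have "?S (?S ?h) = sw w (\<lambda>p q. p \<cdot> \<alpha> q)"
  proof -
    have "?S (?S ?h) = sw w (\<lambda>p q. ?S (Si p \<cdot> \<alpha> q))"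
      using y by simp (rule sw_lin[OF antipode_hom _ w], intro li; simp)
    also have "\<dots> = sw w (\<lambda>p q. p \<cdot> \<alpha> q)"
      by (rule sw_cong[OF w]; (intro li; simp)?) (simp add: scalar_lin'[OF antipode_hom])
    finally show ?thesis .
  qed
  moreover have "?S (?S (?S (?S ?x))) = sw w (\<lambda>p q. \<alpha> p \<cdot> ?S (?S (?S (?S q))))"
  proof -
    have \<phi>: "(\<lambda>t. ?S (?S (?S (?S t)))) \<in> linH" by (intro lis)
    have "?S (?S (?S (?S ?x))) = sw w (\<lambda>p q. ?S (?S (?S (?S (\<alpha> p \<cdot> q)))))"
      by (rule sw_lin[OF \<phi> _ w]) (intro li; simp)
    also have "\<dots> = sw w (\<lambda>p q. \<alpha> p \<cdot> ?S (?S (?S (?S q))))"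
      by (rule sw_cong[OF w]; (intro li; simp)?) (simp add: scalar_lin[OF antipode_hom])
    finally show ?thesis .
  qed
  moreover have "sw w (\<lambda>p q. \<alpha> p \<cdot> ?S (?S (?S (?S q)))) \<in> C" by (intro li; simp add: w)
  ultimately show ?thesis
    by (simp add: H.m_assoc a_inverse)
qed

end


section \<open>Twisted powers of the identity\<close>

context bij_hopf_algebra
begin

text \<open>The power S^(2i) for an arbitrary integer i, restricted to the carrier. It thus lies
  both in the convolution algebra and in the group of bijections of the carrier.\<close>

definition G :: "int \<Rightarrow> 'c \<Rightarrow> 'c" where
  "G i = (\<lambda>h\<in>C. if i \<ge> 0 then ((\<lambda>x. antipode H (antipode H x)) ^^ nat i) h
    else ((\<lambda>x. Si (Si x)) ^^ nat (- i)) h)"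

lemma funpow_closed: "(\<And>x. x \<in> C \<Longrightarrow> f x \<in> C) \<Longrightarrow> h \<in> C \<Longrightarrow> (f ^^ n) h \<in> C"
  by (induction n) auto

lemma G_closed [simp]: "h \<in> C \<Longrightarrow> G i h \<in> C"
  by (auto simp: G_def intro!: funpow_closed)

lemma G_0 [simp]: "h \<in> C \<Longrightarrow> G 0 h = h"
  by (simp add: G_def)

lemma G_succ:
  assumes h: "h \<in> C"
  shows "G (i + 1) h = antipode H (antipode H (G i h))"
proof (cases "i \<ge> 0")
  case True
  then have "nat (i + 1) = Suc (nat i)" by simp
  then show ?thesis using True h by (simp add: G_def)
next
  case False
  define k where "k = nat (- (i + 1))"
  have k: "nat (- i) = Suc k" using False by (simp add: k_def)
  have cl: "((\<lambda>x. Si (Si x)) ^^ k) h \<in> C" using h by (auto intro!: funpow_closed)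
  have "G (i + 1) h = ((\<lambda>x. Si (Si x)) ^^ k) h"
    using False h by (cases "i = -1") (auto simp: G_def k_def)
  then show ?thesis using False h k cl by (simp add: G_def)
qed

lemma G_pred:
  assumes h: "h \<in> C"
  shows "G (i - 1) h = Si (Si (G i h))"
  using G_succ[OF h, of "i - 1"] h by simp

lemma G_add: "h \<in> C \<Longrightarrow> G i (G j h) = G (i + j) h"
proof (induction i rule: int_induct[where k = 0])
  case (step1 i)
  then show ?case using G_succ[of "G j h" i] G_succ[of h "i + j"] by (simp add: algebra_simps)
next
  case (step2 i)
  then show ?case using G_pred[of "G j h" i] G_pred[of h "i + j"] by (simp add: algebra_simps)
qed simp

lemma G_lin: "(\<lambda>h. G i h) \<in> linH"
proof (induction i rule: int_induct[where k = 0])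
  case base
  show ?case by (rule linear_maps_cong[OF linear_maps_id module_H]) simp
next
  case (step1 i)
  show ?case
    by (rule linear_maps_cong[OF lin_antipode[OF lin_antipode[OF step1(2)]] module_H]) (simp add: G_succ)
next
  case (step2 i)
  show ?case
    by (rule linear_maps_cong[OF lin_Si[OF lin_Si[OF step2(2)]] module_H]) (simp add: G_pred)
qed

lemma G_E [simp]: "G i \<in> \<E>"
proof -
  have "G i \<in> extensional C" by (simp add: G_def)
  then show ?thesis using G_lin[of i] by (simp add: lin_ext_set_def)
qed

lemma G_mult: "x \<in> C \<Longrightarrow> y \<in> C \<Longrightarrow> G i (x \<cdot> y) = G i x \<cdot> G i y"
proof (induction i rule: int_induct[where k = 0])
  case (step1 i)
  then show ?case by (simp add: G_succ antipode_mult)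
next
  case (step2 i)
  then show ?case by (simp add: G_pred Si_mult)
qed simp

text \<open>The antipode and its inverse reverse the comultiplication, so their squares respect
  it.\<close>

lemma sw_G: "bilH B \<Longrightarrow> h \<in> C \<Longrightarrow> sw (G i h) B = sw h (\<lambda>u v. B (G i u) (G i v))"
proof (induction i arbitrary: B rule: int_induct[where k = 0])
  case base
  then show ?case by (simp, intro sw_cong[symmetric]) auto
next
  case (step1 i)
  let ?B = "\<lambda>u v. B (antipode H (antipode H u)) (antipode H (antipode H v))"
  note Bl = linear_maps_compose[OF _ bil_left[OF step1(3)]] and Br = linear_maps_compose[OF _ bil_right[OF step1(3)]]
  have b1: "bilH (\<lambda>u v. B (antipode H v) (antipode H u))" by (intro lin_intros Bl Br; simp)
  have b2: "bilH ?B" by (intro lin_intros Bl Br; simp)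
  have b3: "bilH (\<lambda>u v. ?B (G i u) (G i v))" by (intro bilI lin_antipode G_lin Bl Br; simp)
  have "sw (G (i + 1) h) B = sw (G i h) ?B"
    using step1 b1 by (simp add: G_succ sw_antipode)
  also have "\<dots> = sw h (\<lambda>u v. ?B (G i u) (G i v))" by (rule step1.IH[OF b2 step1(4)])
  also have "\<dots> = sw h (\<lambda>u v. B (G (i + 1) u) (G (i + 1) v))"
    by (rule sw_cong[OF step1(4) b3, symmetric]) (simp add: G_succ)
  finally show ?case .
next
  case (step2 i)
  let ?B = "\<lambda>u v. B (Si (Si u)) (Si (Si v))"
  note Bl = linear_maps_compose[OF _ bil_left[OF step2(3)]] and Br = linear_maps_compose[OF _ bil_right[OF step2(3)]]
  have b1: "bilH (\<lambda>u v. B (Si v) (Si u))" by (intro lin_intros Bl Br Si_lin lin_Si; simp)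
  have b2: "bilH ?B" by (intro lin_intros Bl Br Si_lin lin_Si; simp)
  have b3: "bilH (\<lambda>u v. ?B (G i u) (G i v))" by (intro bilI lin_Si G_lin Bl Br; simp)
  have "sw (G (i - 1) h) B = sw (G i h) ?B"
    using step2 b1 by (simp add: G_pred sw_Si)
  also have "\<dots> = sw h (\<lambda>u v. ?B (G i u) (G i v))" by (rule step2.IH[OF b2 step2(4)])
  also have "\<dots> = sw h (\<lambda>u v. B (G (i - 1) u) (G (i - 1) v))"
    by (rule sw_cong[OF step2(4) b3, symmetric]) (simp add: G_pred)
  finally show ?case .
qed

lemma G_idm: "G 0 = idm"
  by (rule E_eqI) auto

lemma G_scalar [simp]: "s \<in> scalars \<Longrightarrow> G i s = s"
proof (induction i rule: int_induct[where k = 0])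
  case (step1 i)
  then show ?case by (simp add: G_succ)
next
  case (step2 i)
  then show ?case by (simp add: G_pred) (metis Si_antipode antipode_scalar scalar_closed)
qed simp

definition after :: "('c \<Rightarrow> 'c) \<Rightarrow> ('c \<Rightarrow> 'c) \<Rightarrow> 'c \<Rightarrow> 'c" (infixr \<open>\<bullet>\<close> 75) where
  "\<phi> \<bullet> f = (\<lambda>h\<in>C. \<phi> (f h))"

lemma after_E [simp]: "\<phi> \<in> \<E> \<Longrightarrow> f \<in> \<E> \<Longrightarrow> \<phi> \<bullet> f \<in> \<E>"
  unfolding after_def by (rule mkE[OF linear_maps_compose[OF E_lin E_lin]])

lemma after_apply [simp]: "h \<in> C \<Longrightarrow> (\<phi> \<bullet> f) h = \<phi> (f h)"
  by (simp add: after_def)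

text \<open>Convolution multiplies values, so composition with a multiplicative linear map
  distributes over it. This is used for the powers of S^2 and for the character \<alpha>.\<close>

lemma after_conv:
  assumes E: "\<phi> \<in> \<E>" "f \<in> \<E>" "k \<in> \<E>"
    and mult: "\<And>x y. x \<in> C \<Longrightarrow> y \<in> C \<Longrightarrow> \<phi> (x \<cdot> y) = \<phi> x \<cdot> \<phi> y"
  shows "\<phi> \<bullet> (f \<star> k) = (\<phi> \<bullet> f) \<star> (\<phi> \<bullet> k)"
proof (rule E_eqI)
  fix h assume h: "h \<in> C"
  have "(\<phi> \<bullet> (f \<star> k)) h = sw h (\<lambda>u v. \<phi> (f u \<cdot> k v))"
    using h by (simp add: conv_apply) (rule sw_lin[OF E_lin[OF E(1)] bil_conv[OF E_lin[OF E(2)] E_lin[OF E(3)]]])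
  also have "\<dots> = ((\<phi> \<bullet> f) \<star> (\<phi> \<bullet> k)) h"
    unfolding conv_apply[OF h]
    by (rule sw_cong[OF h]) (use E in \<open>auto simp: mult E_closed[of f] E_closed[of k] intro!: bil_conv E_lin\<close>)
  finally show "(\<phi> \<bullet> (f \<star> k)) h = ((\<phi> \<bullet> f) \<star> (\<phi> \<bullet> k)) h" .
qed (use E in auto)

lemma G_after_conv: "f \<in> \<E> \<Longrightarrow> k \<in> \<E> \<Longrightarrow> G i \<bullet> (f \<star> k) = (G i \<bullet> f) \<star> (G i \<bullet> k)"
  by (intro after_conv G_E G_mult)

lemma G_after_G [simp]: "G i \<bullet> G j = G (i + j)"
  by (rule E_eqI) (auto simp: G_add)

lemma G_after_one [simp]: "G i \<bullet> \<e> = \<e>"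
  by (rule E_eqI) auto

lemma G_after_cancel: "f \<in> \<E> \<Longrightarrow> G i \<bullet> f = \<e> \<Longrightarrow> f = \<e>"
proof (rule E_eqI)
  fix h assume f: "f \<in> \<E>" "G i \<bullet> f = \<e>" and h: "h \<in> C"
  have "G (- i) (G i (f h)) = G (- i) (\<e> h)" using f h by (metis after_apply)
  then show "f h = \<e> h" using h E_closed[OF f(1) h] by (simp add: G_add)
qed auto

text \<open>\<open>P j n\<close> is \<open>id \<star> S\<^sup>2\<^sup>j \<star> \<dots> \<star> S\<^sup>2\<^sup>(\<^sup>n\<^sup>-\<^sup>1\<^sup>)\<^sup>j\<close>; the exponents of \<open>H\<close> are those of \<open>j = 0\<close> and \<open>j = -1\<close>.\<close>

fun P :: "int \<Rightarrow> nat \<Rightarrow> 'c \<Rightarrow> 'c" where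
  "P j 0 = \<e>"
| "P j (Suc n) = P j n \<star> G (int n * j)"

lemma P_E [simp]: "P j n \<in> \<E>"
  by (induction n) auto

lemma P_add: "P j (m + n) = P j m \<star> (G (int m * j) \<bullet> P j n)"
proof (induction n)
  case (Suc n)
  have "P j m \<star> (G (int m * j) \<bullet> P j (Suc n)) = P j m \<star> (G (int m * j) \<bullet> P j n) \<star> G (int m * j + int n * j)"
    by (simp add: G_after_conv conv_assoc)
  then show ?case using Suc by (simp add: algebra_simps)
qed simp

lemma P_trivial_add: "P j m = \<e> \<Longrightarrow> P j (m + n) = \<e> \<longleftrightarrow> P j n = \<e>"
  by (auto simp: P_add intro: G_after_cancel)

lemma P_minus_one_order:
  assumes "P (-1) n = \<e>"
  shows "G (int n) = idm"
proof -
  have "P (-1) (Suc n) = G (- int n)" using assms by simp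
  moreover have "P (-1) (1 + n) = idm"
    unfolding P_add using assms by (simp add: G_idm)
  ultimately have "G (- int n) = idm" by simp
  then have "G (int n) \<bullet> G (- int n) = G (int n) \<bullet> idm" by simp
  moreover have "G (int n) \<bullet> idm = G (int n)" by (rule E_eqI) auto
  ultimately show ?thesis by (simp add: G_idm)
qed

text \<open>The parameter j enters only through multiples of it as exponents of S^2, and these count
  modulo any n with \<open>G n = idm\<close>.\<close>

lemma P_periodic:
  assumes "G (int n) = idm"
  shows "P (j + int n * k) m = P j m"
proof -
  have 1: "G (i + int n) = G i" for i
  proof (rule E_eqI)
    fix h assume h: "h \<in> C"
    then show "G (i + int n) h = G i h"
      using G_add[OF h, of i "int n"] assms by simp
  qed auto
  have 2: "G (i + int n * k) = G i" for i k
  proof (induction k rule: int_induct[where k = 0])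
    case (step1 k)
    then show ?case using 1[of "i + int n * k"] by (simp add: algebra_simps)
  next
    case (step2 k)
    then show ?case using 1[of "i + int n * (k - 1)"] by (simp add: algebra_simps)
  qed simp
  show ?thesis
  proof (induction m)
    case (Suc m)
    have "int m * (j + int n * k) = int m * j + int n * (int m * k)" by (simp add: algebra_simps)
    then show ?case using Suc 2[of "int m * j" "int m * k"] by simp
  qed simp
qed

text \<open>From here on the integrals are forgotten: what is kept is a character, a grouplike
  element and Radford's formula as an identity between convolutions.\<close>

lemma radford_data:
  obtains \<alpha> a where "\<alpha> \<in> \<K>" "a \<in> C"
    "\<And>h k. h \<in> C \<Longrightarrow> k \<in> C \<Longrightarrow> \<alpha> (h \<cdot> k) = \<alpha> h \<cdot> \<alpha> k" "\<alpha> \<one>\<^bsub>H\<^esub> = \<one>\<^bsub>H\<^esub>"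
    "\<And>B. bilH B \<Longrightarrow> sw a B = B a a" "eps a = \<one>\<^bsub>H\<^esub>"
    "antipode H (antipode H a) = a"
    "\<And>w. w \<in> C \<Longrightarrow> (idm \<star> \<alpha>) w \<cdot> a = a \<cdot> (\<alpha> \<star> G 2) w"
proof -
  obtain l x where l: "l \<in> \<K>" "idm \<star> l = l" "x \<in> C" "l x \<noteq> \<zero>\<^bsub>H\<^esub>"
    by (rule nonzero_integral_exists)
  interpret left_integral K H l x by unfold_locales (rule l)+
  obtain \<Lambda> where L: "\<Lambda> \<in> C" "\<And>h. h \<in> C \<Longrightarrow> l (h \<cdot> \<Lambda>) = eps h"
    "\<And>h. h \<in> C \<Longrightarrow> h \<cdot> \<Lambda> = eps h \<cdot> \<Lambda>"
    by (rule dual_integral_exists) blast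
  interpret radford K H l x \<Lambda> by unfold_locales (fact L)+
  have "(idm \<star> \<alpha>) w \<cdot> a = a \<cdot> (\<alpha> \<star> G 2) w" if w: "w \<in> C" for w
  proof -
    note lin = lin_intros E_lin[OF K_E[OF alpha_K]]
    have G2: "G 2 q = antipode H (antipode H (antipode H (antipode H q)))" if "q \<in> C" for q
      using that G_succ[of q 1] G_succ[of q 0] by simp
    have "(idm \<star> \<alpha>) w = sw w (\<lambda>p q. p \<cdot> \<alpha> q)"
      unfolding conv_apply[OF w] by (rule sw_cong[OF w]; (intro lin; simp)?) simp
    moreover have "(\<alpha> \<star> G 2) w = sw w (\<lambda>p q. \<alpha> p \<cdot> antipode H (antipode H (antipode H (antipode H q))))"
      unfolding conv_apply[OF w] by (rule sw_cong[OF w]; (intro lin; simp)?) (simp add: G2)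
    ultimately show ?thesis using radford[OF w] by simp
  qed
  then show ?thesis
    by (intro that[of \<alpha> a] alpha_K a_closed alpha_mult alpha_one a_grouplike eps_a antipode_sq_a)
qed

end


section \<open>From triviality at j + 2 to triviality at j\<close>

context bij_hopf_algebra
begin

text \<open>The hypothesis is used three times: evaluated at a it gives a^n = 1, composed with
  \<alpha> it makes the n-th convolution power of \<alpha> trivial, and transported by \<Theta> it
  makes the interleaved product \<open>Q n\<close> trivial.\<close>

lemma P_shift:
  assumes Pj: "P (j + 2) n = \<e>"
  shows "P j n = \<e>"
proof -
  obtain \<alpha> a where \<alpha>: "\<alpha> \<in> \<K>" and a: "a \<in> C"
    and \<alpha>_mult: "\<And>h k. h \<in> C \<Longrightarrow> k \<in> C \<Longrightarrow> \<alpha> (h \<cdot> k) = \<alpha> h \<cdot> \<alpha> k"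
    and \<alpha>_one: "\<alpha> \<one>\<^bsub>H\<^esub> = \<one>\<^bsub>H\<^esub>"
    and a_sw: "\<And>B. bilH B \<Longrightarrow> sw a B = B a a" and eps_a: "eps a = \<one>\<^bsub>H\<^esub>"
    and a_sq: "antipode H (antipode H a) = a"
    and radford: "\<And>w. w \<in> C \<Longrightarrow> (idm \<star> \<alpha>) w \<cdot> a = a \<cdot> (\<alpha> \<star> G 2) w"
    by (rule radford_data) blast
  note [simp] = K_E[OF \<alpha>] a K_scalar[OF \<alpha>] E_closed[OF K_E[OF \<alpha>]]
  note lin = lin_intros E_lin[OF K_E[OF \<alpha>]] lin_E[OF K_E[OF \<alpha>]] G_lin E_lin[OF G_E] lin_E[OF G_E]
  have \<alpha>_scal: "\<alpha> s = s" if "s \<in> scalars" for s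
    using scalar_lin[OF E_lin[OF K_E[OF \<alpha>]] that, of "\<one>\<^bsub>H\<^esub>"] that by (simp add: \<alpha>_one)
  have Ga [simp]: "G i a = a" for i
  proof (induction i rule: int_induct[where k = 0])
    case (step1 i)
    then show ?case by (simp add: G_succ a_sq)
  next
    case (step2 i)
    have "Si (Si a) = a" using a_sq by (metis Si_antipode a antipode_closed)
    then show ?case using step2 by (simp add: G_pred)
  qed simp
  \<comment> \<open>Composing the character with S inverts it in the convolution algebra, so
    composing with S twice gives \<alpha> back.\<close>
  have \<alpha>_S2: "\<alpha> (antipode H (antipode H h)) = \<alpha> h" if h: "h \<in> C" for h
  proof -
    let ?b = "\<lambda>h\<in>C. \<alpha> (antipode H h)" and ?c = "\<lambda>h\<in>C. \<alpha> (antipode H (antipode H h))"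
    have bc: "?b \<in> \<E>" "?c \<in> \<E>" by (intro mkE lin)+
    have lin\<alpha>S: "(\<lambda>h. \<alpha> (antipode H h)) \<in> linH" by (intro lin)
    have 1: "\<alpha> \<star> ?b = \<e>"
    proof (rule E_eqI)
      fix h assume h: "h \<in> C"
      have "(\<alpha> \<star> ?b) h = sw h (\<lambda>u v. \<alpha> (u \<cdot> antipode H v))"
        unfolding conv_apply[OF h] by (rule sw_cong[OF h]; (intro lin; simp)?) (simp add: \<alpha>_mult)
      also have "\<dots> = \<alpha> (sw h (\<lambda>u v. u \<cdot> antipode H v))"
        by (rule sw_lin[OF E_lin[OF K_E[OF \<alpha>]] _ h, symmetric]) (intro lin; simp)
      finally show "(\<alpha> \<star> ?b) h = \<e> h" using h by (simp add: sw_antipode_right \<alpha>_scal)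
    qed (use bc in auto)
    have 2: "?b \<star> ?c = \<e>"
    proof (rule E_eqI)
      fix h assume h: "h \<in> C"
      have "(?b \<star> ?c) h = sw h (\<lambda>u v. \<alpha> (antipode H (u \<cdot> antipode H v)))"
        unfolding conv_apply[OF h]
      proof (rule sw_cong[OF h])
        show "bilH (\<lambda>u v. \<alpha> (antipode H (u \<cdot> antipode H v)))" by (intro lin; simp)
        fix u v assume uv: "u \<in> C" "v \<in> C"
        then show "?b u \<cdot> ?c v = \<alpha> (antipode H (u \<cdot> antipode H v))"
          by (simp add: \<alpha>_mult antipode_mult
              scalar_comm[of "\<alpha> (antipode H u)" "\<alpha> (antipode H (antipode H v))"])
      qed
      also have "\<dots> = \<alpha> (antipode H (sw h (\<lambda>u v. u \<cdot> antipode H v)))"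
        by (rule sw_lin[OF lin\<alpha>S _ h, symmetric]) (intro lin; simp)
      finally show "(?b \<star> ?c) h = \<e> h" using h by (simp add: sw_antipode_right \<alpha>_scal)
    qed (use bc in auto)
    have "\<alpha> = \<alpha> \<star> (?b \<star> ?c)" using 2 by simp
    also have "\<dots> = ?c" using bc 1 by (simp add: conv_assoc[symmetric])
    finally have "\<alpha> = ?c" .
    from arg_cong[OF this, of "\<lambda>f. f h"] show ?thesis using h by simp
  qed
  have \<alpha>_G [simp]: "\<alpha> (G i h) = \<alpha> h" if h: "h \<in> C" for i h
    using h
  proof (induction i rule: int_induct[where k = 0])
    case (step1 i)
    then show ?case by (simp add: G_succ \<alpha>_S2)
  next
    case (step2 i)
    then show ?case using \<alpha>_S2[of "Si (Si (G i h))"] by (simp add: G_pred)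
  qed simp
  \<comment> \<open>Character and grouplike element are combined in one map, so that Radford's
    formula becomes a commutation rule.\<close>
  define Z where "Z = (\<lambda>h\<in>C. \<alpha> h \<cdot> a)"
  have Z [simp]: "Z \<in> \<E>" unfolding Z_def by (intro mkE lin) simp
  have Z_apply: "Z h = \<alpha> h \<cdot> a" if "h \<in> C" for h using that by (simp add: Z_def)
  have conv_Z: "(f \<star> Z) h = (f \<star> \<alpha>) h \<cdot> a" if f: "f \<in> \<E>" and h: "h \<in> C" for f h
  proof -
    note [simp] = E_closed[OF f]
    have "(f \<star> \<alpha>) h \<cdot> a = sw h (\<lambda>u v. f u \<cdot> \<alpha> v \<cdot> a)"
      unfolding conv_apply[OF h] using f h by (intro sw_mult_left bil_conv E_lin) auto
    also have "\<dots> = (f \<star> Z) h"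
      unfolding conv_apply[OF h]
      by (rule sw_cong[OF h bil_conv[OF E_lin[OF f] E_lin[OF Z]]]) (simp add: Z_apply H.m_assoc)
    finally show ?thesis by simp
  qed
  have Z_conv: "(Z \<star> f) h = a \<cdot> (\<alpha> \<star> f) h" if f: "f \<in> \<E>" and h: "h \<in> C" for f h
  proof -
    note [simp] = E_closed[OF f]
    have "a \<cdot> (\<alpha> \<star> f) h = sw h (\<lambda>u v. a \<cdot> (\<alpha> u \<cdot> f v))"
      unfolding conv_apply[OF h] using f h by (intro sw_mult_right bil_conv E_lin) auto
    also have "\<dots> = (Z \<star> f) h"
      unfolding conv_apply[OF h]
      by (rule sw_cong[OF h bil_conv[OF E_lin[OF Z] E_lin[OF f]]])
        (simp add: Z_apply H.m_assoc[symmetric] scalar_comm[of "\<alpha> _" a])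
    finally show ?thesis by simp
  qed
  have GZ: "G i \<bullet> Z = Z" for i
    by (rule E_eqI) (auto simp: Z_apply G_mult)
  \<comment> \<open>Radford's formula is the case i = 0. The general case follows by composing with
    \<open>G i\<close>, which fixes Z because it fixes a and leaves the values of \<alpha>
    unchanged.\<close>
  have commute: "G i \<star> Z = Z \<star> G (i + 2)" for i
  proof -
    have "idm \<star> Z = Z \<star> G 2"
      by (rule E_eqI) (auto simp: conv_Z Z_conv radford)
    then have "G i \<bullet> (G 0 \<star> Z) = G i \<bullet> (Z \<star> G 2)" by (simp add: G_idm)
    then show ?thesis by (simp add: G_after_conv GZ)
  qed
  have P_commute: "P j m \<star> Z = Z \<star> (G 2 \<bullet> P j m)" for m
  proof (induction m)
    case (Suc m)
    have "P j (Suc m) \<star> Z = P j m \<star> (Z \<star> G (int m * j + 2))" by (simp add: conv_assoc commute)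
    also have "\<dots> = Z \<star> (G 2 \<bullet> P j m) \<star> G (2 + int m * j)" using Suc by (simp add: conv_assoc[symmetric] add.commute)
    also have "\<dots> = Z \<star> (G 2 \<bullet> P j (Suc m))" by (simp add: conv_assoc G_after_conv)
    finally show ?case .
  qed simp
  \<comment> \<open>Moving every \<open>Z\<close> in \<open>Q n = (G 0 \<star> Z) \<star> \<dots> \<star> (G ((n - 1) (j + 2)) \<star> Z)\<close> to the left by \<open>commute\<close>
    turns \<open>P (j + 2) n\<close> into a translate of \<open>P j n\<close>. On the other hand \<open>f \<mapsto> \<Theta> f\<close> below is a homomorphism
    for \<open>\<star>\<close> that takes \<open>G i\<close> to \<open>G i \<star> Z\<close> up to the scalar \<open>s\<close>, so that \<open>Q n\<close> is trivial.\<close>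
  define Zp where "Zp = rec_nat \<e> (\<lambda>_ f. f \<star> Z)"
  have Zp_simps [simp]: "Zp 0 = \<e>" "Zp (Suc m) = Zp m \<star> Z" for m by (simp_all add: Zp_def)
  have Zp_E [simp]: "Zp m \<in> \<E>" for m by (induction m) auto
  define Q where "Q = rec_nat \<e> (\<lambda>m f. f \<star> (G (int m * (j + 2)) \<star> Z))"
  have Q_simps [simp]: "Q 0 = \<e>" "Q (Suc m) = Q m \<star> (G (int m * (j + 2)) \<star> Z)" for m by (simp_all add: Q_def)
  have Q_E [simp]: "Q m \<in> \<E>" for m by (induction m) auto
  \<comment> \<open>Each Z that passes to the left raises every twist it meets by 2. A factor of
    index i in \<open>Q m\<close> already carries 2i and is met by m - i of them, whence the uniform
    shift by 2m.\<close>
  have Q_eq: "Q m = Zp m \<star> (G (2 * int m) \<bullet> P j m)" for m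
  proof (induction m)
    case (Suc m)
    have "(G (2 * int m) \<bullet> P j m) \<star> (G (int m * (j + 2)) \<star> Z) = G (2 * int m) \<bullet> (P j (Suc m) \<star> Z)"
      by (simp add: G_after_conv GZ conv_assoc algebra_simps)
    also have "\<dots> = Z \<star> (G (2 * int m) \<bullet> (G 2 \<bullet> P j (Suc m)))"
      by (simp only: P_commute) (simp add: G_after_conv GZ del: P.simps)
    also have "G (2 * int m) \<bullet> (G 2 \<bullet> P j (Suc m)) = G (2 * int (Suc m)) \<bullet> P j (Suc m)"
      by (rule E_eqI) (auto simp: G_add E_closed[OF P_E] algebra_simps simp del: P.simps)
    finally have "(G (2 * int m) \<bullet> P j m) \<star> (G (int m * (j + 2)) \<star> Z) = Z \<star> (G (2 * int (Suc m)) \<bullet> P j (Suc m))" .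
    then show ?case using Suc by (simp add: conv_assoc del: P.simps)
  qed (rule E_eqI; simp)
  note [simp del] = Zp_simps Q_simps
  \<comment> \<open>Evaluation at a grouplike element is multiplicative for convolution; as every
    \<open>G i\<close> fixes a, the value of any P at a is a power of a.\<close>
  have conv_a: "(f \<star> k) a = f a \<cdot> k a" if "f \<in> \<E>" "k \<in> \<E>" for f k
    using that by (simp add: conv_apply a_sw bil_conv E_lin)
  have P_a: "P i m a = a [^]\<^bsub>H\<^esub> m" for i m
    by (induction m) (simp_all add: conv_a eps_a)
  then have an: "a [^]\<^bsub>H\<^esub> n = \<one>\<^bsub>H\<^esub>" using P_a[of "j + 2" n] Pj by (simp add: eps_a)
  have \<alpha>_pow: "\<alpha> (a [^]\<^bsub>H\<^esub> m) = \<alpha> a [^]\<^bsub>H\<^esub> m" for m :: nat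
    by (induction m) (simp_all add: \<alpha>_mult \<alpha>_one)
  \<comment> \<open>The scalar by which \<phi> below multiplies a. Its n-th power is \<alpha>(a^n) =
    1, which removes all scalars at the end.\<close>
  define s where "s = \<alpha> a"
  have s [simp]: "s \<in> scalars" by (simp add: s_def)
  have sm [simp]: "s [^]\<^bsub>H\<^esub> m \<in> scalars" for m :: nat by (induction m) simp_all
  have sn: "s [^]\<^bsub>H\<^esub> n = \<one>\<^bsub>H\<^esub>" using \<alpha>_pow[of n] an by (simp add: s_def \<alpha>_one)
  define \<alpha>p where "\<alpha>p = rec_nat \<e> (\<lambda>_ f. f \<star> \<alpha>)"
  have \<alpha>p_simps: "\<alpha>p 0 = \<e>" "\<alpha>p (Suc m) = \<alpha>p m \<star> \<alpha>" for m by (simp_all add: \<alpha>p_def)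
  have \<alpha>p_K [simp]: "\<alpha>p m \<in> \<K>" for m
  proof (induction m)
    case 0
    show ?case unfolding \<alpha>p_simps conv_one_def by (intro mkK eps_lin) simp
  qed (simp add: \<alpha>p_simps \<alpha>)
  \<comment> \<open>The character ignores the twists, so composing it with any P gives its
    convolution powers, whatever the parameter i.\<close>
  have \<alpha>p_P: "\<alpha>p m = \<alpha> \<bullet> P i m" for i m
  proof (induction m)
    case 0
    show ?case by (rule E_eqI) (auto simp: \<alpha>p_simps \<alpha>_scal)
  next
    case (Suc m)
    have "\<alpha> \<bullet> G (int m * i) = \<alpha>" by (rule E_eqI) auto
    then show ?case using Suc by (simp add: \<alpha>p_simps after_conv \<alpha>_mult)
  qed
  have "\<alpha>p n = \<alpha> \<bullet> \<e>" using \<alpha>p_P[of n "j + 2"] Pj by simp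
  also have "\<dots> = \<e>" by (rule E_eqI) (auto simp: \<alpha>_scal)
  finally have \<alpha>n: "\<alpha>p n = \<e>" .
  \<comment> \<open>Since the values of \<alpha> are central, a convolution power of Z separates
    into one of \<alpha> and an ordinary power of a; both are trivial for the exponent n.\<close>
  have Zp_eq: "Zp m h = \<alpha>p m h \<cdot> a [^]\<^bsub>H\<^esub> m" if "h \<in> C" for m h
    using that
  proof (induction m arbitrary: h)
    case 0
    then show ?case by (simp add: Zp_simps \<alpha>p_simps)
  next
    case (Suc m)
    have "Zp (Suc m) h = sw h (\<lambda>u v. (\<alpha>p m u \<cdot> \<alpha> v) \<cdot> (a [^]\<^bsub>H\<^esub> m \<cdot> a))"
      unfolding Zp_simps conv_apply[OF Suc.prems]
    proof (rule sw_cong[OF Suc.prems])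
      show "bilH (\<lambda>u v. (\<alpha>p m u \<cdot> \<alpha> v) \<cdot> (a [^]\<^bsub>H\<^esub> m \<cdot> a))"
        by (intro lin E_lin[OF K_E[OF \<alpha>p_K]]) (auto simp: E_closed[OF K_E[OF \<alpha>p_K]])
      fix u v assume uv: "u \<in> C" "v \<in> C"
      have "(\<alpha>p m u \<cdot> a [^]\<^bsub>H\<^esub> m) \<cdot> (\<alpha> v \<cdot> a) = \<alpha>p m u \<cdot> (a [^]\<^bsub>H\<^esub> m \<cdot> \<alpha> v) \<cdot> a"
        using uv by (simp add: H.m_assoc E_closed[OF K_E[OF \<alpha>p_K]])
      also have "a [^]\<^bsub>H\<^esub> m \<cdot> \<alpha> v = \<alpha> v \<cdot> a [^]\<^bsub>H\<^esub> m" using uv by (intro scalar_comm) auto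
      finally show "Zp m u \<cdot> Z v = (\<alpha>p m u \<cdot> \<alpha> v) \<cdot> (a [^]\<^bsub>H\<^esub> m \<cdot> a)"
        using uv by (simp add: Suc.IH Z_apply H.m_assoc E_closed[OF K_E[OF \<alpha>p_K]])
    qed
    also have "\<dots> = sw h (\<lambda>u v. \<alpha>p m u \<cdot> \<alpha> v) \<cdot> (a [^]\<^bsub>H\<^esub> m \<cdot> a)"
      using Suc.prems by (intro sw_mult_left[symmetric] bil_conv E_lin) auto
    finally show ?case using Suc.prems by (simp add: \<alpha>p_simps conv_apply)
  qed
  have Zn: "Zp n = \<e>"
    by (rule E_eqI) (auto simp: Zp_eq \<alpha>n an)
  \<comment> \<open>Translation by the character, an algebra endomorphism of H because \<alpha> is
    multiplicative. Together with right multiplication by a it supplies the factor Z after each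
    twist.\<close>
  define \<phi> where "\<phi> = idm \<star> \<alpha>"
  have \<phi> [simp]: "\<phi> \<in> \<E>" by (simp add: \<phi>_def)
  have \<phi>_apply: "\<phi> h = sw h (\<lambda>u v. u \<cdot> \<alpha> v)" if h: "h \<in> C" for h
    unfolding \<phi>_def conv_apply[OF h] by (rule sw_cong[OF h]; (intro lin; simp)?) simp
  have \<phi>_closed [simp]: "\<phi> h \<in> C" if "h \<in> C" for h by (rule E_closed[OF \<phi> that])
  have \<phi>_mult: "\<phi> (x \<cdot> y) = \<phi> x \<cdot> \<phi> y" if x: "x \<in> C" and y: "y \<in> C" for x y
  proof -
    have "\<phi> (x \<cdot> y) = sw x (\<lambda>p q. sw y (\<lambda>u v. (p \<cdot> u) \<cdot> \<alpha> (q \<cdot> v)))"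
      using x y by (subst \<phi>_apply) (auto intro!: sw_mult lin)
    also have "\<dots> = sw x (\<lambda>p q. (p \<cdot> \<alpha> q) \<cdot> \<phi> y)"
    proof (rule sw_cong[OF x])
      show "bilH (\<lambda>p q. (p \<cdot> \<alpha> q) \<cdot> \<phi> y)" by (intro lin; simp add: y)
      fix p q assume pq: "p \<in> C" "q \<in> C"
      have "(p \<cdot> \<alpha> q) \<cdot> \<phi> y = sw y (\<lambda>u v. (p \<cdot> \<alpha> q) \<cdot> (u \<cdot> \<alpha> v))"
        unfolding \<phi>_apply[OF y] by (rule sw_mult_right[OF _ y]; (intro lin; simp)?) (simp add: pq)
      also have "\<dots> = sw y (\<lambda>u v. (p \<cdot> u) \<cdot> \<alpha> (q \<cdot> v))"
      proof (rule sw_cong[OF y])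
        show "bilH (\<lambda>u v. (p \<cdot> u) \<cdot> \<alpha> (q \<cdot> v))" by (intro lin; simp add: pq)
        fix u v assume uv: "u \<in> C" "v \<in> C"
        then show "(p \<cdot> \<alpha> q) \<cdot> (u \<cdot> \<alpha> v) = (p \<cdot> u) \<cdot> \<alpha> (q \<cdot> v)"
          using pq scalar_assoc[of "\<alpha> q" p u] by (simp add: \<alpha>_mult H.m_assoc[symmetric])
      qed
      finally show "sw y (\<lambda>u v. (p \<cdot> u) \<cdot> \<alpha> (q \<cdot> v)) = (p \<cdot> \<alpha> q) \<cdot> \<phi> y" by (rule sym)
    qed
    also have "\<dots> = sw x (\<lambda>p q. p \<cdot> \<alpha> q) \<cdot> \<phi> y"
      by (rule sw_mult_left[OF _ x, symmetric]; (intro lin; simp)?) (simp add: y)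
    finally show ?thesis using x by (simp add: \<phi>_apply)
  qed
  have \<phi>_a: "\<phi> a = a \<cdot> s" by (simp add: \<phi>_def conv_a s_def)
  have \<phi>_G: "\<phi> (G i h) = (G i \<star> \<alpha>) h" if h: "h \<in> C" for i h
  proof -
    have "\<phi> (G i h) = sw h (\<lambda>u v. G i u \<cdot> \<alpha> (G i v))"
      using h by (subst \<phi>_apply) (auto intro!: sw_G lin)
    also have "\<dots> = (G i \<star> \<alpha>) h"
      unfolding conv_apply[OF h] by (rule sw_cong[OF h bil_conv[OF G_lin E_lin]]) auto
    finally show ?thesis .
  qed
  define \<Theta> where "\<Theta> f = (\<lambda>h\<in>C. \<phi> (f (h \<cdot> a)))" for f
  have \<Theta>_E [simp]: "\<Theta> f \<in> \<E>" if "f \<in> \<E>" for f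
    unfolding \<Theta>_def by (intro mkE lin_E[OF \<phi>] lin_E[OF that] lin) simp
  \<comment> \<open>The comultiplication of ha is sum h1 a \<otimes> h2 a because a is grouplike,
    and \<phi> is multiplicative on the values.\<close>
  have \<Theta>_conv: "\<Theta> (f \<star> k) = \<Theta> f \<star> \<Theta> k" if f: "f \<in> \<E>" and k: "k \<in> \<E>" for f k
  proof (rule E_eqI)
    fix h assume h: "h \<in> C"
    note [simp] = E_closed[OF f] E_closed[OF k]
    have bfk: "bilH (\<lambda>u v. f u \<cdot> k v)" by (intro bil_conv E_lin f k)
    have "(f \<star> k) (h \<cdot> a) = sw h (\<lambda>p q. sw a (\<lambda>u v. f (p \<cdot> u) \<cdot> k (q \<cdot> v)))"
      using h by (simp add: conv_apply) (rule sw_mult[OF bfk h a])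
    also have "\<dots> = sw h (\<lambda>p q. f (p \<cdot> a) \<cdot> k (q \<cdot> a))"
    proof (rule sw_cong[OF h])
      show "bilH (\<lambda>p q. f (p \<cdot> a) \<cdot> k (q \<cdot> a))"
        by (intro lin lin_E[OF f] lin_E[OF k]; simp)
      fix p q assume pq: "p \<in> C" "q \<in> C"
      show "sw a (\<lambda>u v. f (p \<cdot> u) \<cdot> k (q \<cdot> v)) = f (p \<cdot> a) \<cdot> k (q \<cdot> a)"
        by (rule a_sw) (intro lin lin_E[OF f] lin_E[OF k]; simp add: pq)
    qed
    finally have "\<Theta> (f \<star> k) h = \<phi> (sw h (\<lambda>p q. f (p \<cdot> a) \<cdot> k (q \<cdot> a)))"
      using h by (simp add: \<Theta>_def)
    also have "\<dots> = sw h (\<lambda>p q. \<phi> (f (p \<cdot> a) \<cdot> k (q \<cdot> a)))"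
      by (rule sw_lin[OF E_lin[OF \<phi>] _ h]) (intro lin lin_E[OF f] lin_E[OF k]; simp)
    also have "\<dots> = (\<Theta> f \<star> \<Theta> k) h"
      unfolding conv_apply[OF h]
      by (rule sw_cong[OF h bil_conv[OF E_lin[OF \<Theta>_E[OF f]] E_lin[OF \<Theta>_E[OF k]]]]) (simp add: \<Theta>_def \<phi>_mult)
    finally show "\<Theta> (f \<star> k) h = (\<Theta> f \<star> \<Theta> k) h" .
  qed (use f k in auto)
  have \<Theta>_G: "\<Theta> (G i) h = (G i \<star> Z) h \<cdot> s" if h: "h \<in> C" for i h
    using h by (simp add: \<Theta>_def G_mult \<phi>_mult \<phi>_a \<phi>_G conv_Z H.m_assoc)
  have \<phi>_scal: "\<phi> t = t" if "t \<in> scalars" for t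
  proof -
    have "bilH (\<lambda>u v. u \<cdot> \<alpha> v)" by (intro lin; simp)
    from sw_one[OF this] have "\<phi> \<one>\<^bsub>H\<^esub> = \<one>\<^bsub>H\<^esub> \<cdot> \<alpha> \<one>\<^bsub>H\<^esub>" by (simp add: \<phi>_apply)
    then show ?thesis
      using that scalar_lin[OF E_lin[OF \<phi>] that, of "\<one>\<^bsub>H\<^esub>"] by (simp add: \<alpha>_one)
  qed
  have \<Theta>_one: "\<Theta> \<e> = \<e>"
    by (rule E_eqI[OF \<Theta>_E[OF one_E] one_E]) (auto simp: \<Theta>_def \<phi>_scal eps_mult eps_a)
  have \<Theta>_P: "\<Theta> (P (j + 2) m) h = Q m h \<cdot> s [^]\<^bsub>H\<^esub> m" if "h \<in> C" for m h
    using that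
  proof (induction m arbitrary: h)
    case 0
    then show ?case by (simp add: \<Theta>_one Q_simps)
  next
    case (Suc m)
    let ?GZ = "G (int m * (j + 2)) \<star> Z"
    note [simp] = E_closed[OF Q_E]
    have "\<Theta> (P (j + 2) (Suc m)) h = (\<Theta> (P (j + 2) m) \<star> \<Theta> (G (int m * (j + 2)))) h"
      by (simp add: \<Theta>_conv)
    also have "\<dots> = sw h (\<lambda>u v. (Q m u \<cdot> ?GZ v) \<cdot> (s [^]\<^bsub>H\<^esub> m \<cdot> s))"
      unfolding conv_apply[OF Suc.prems]
    proof (rule sw_cong[OF Suc.prems])
      show "bilH (\<lambda>u v. (Q m u \<cdot> ?GZ v) \<cdot> (s [^]\<^bsub>H\<^esub> m \<cdot> s))"
        by (intro bilI lin_mult_left lin_mult_right E_lin) auto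
      fix u v assume uv: "u \<in> C" "v \<in> C"
      have "Q m u \<cdot> s [^]\<^bsub>H\<^esub> m \<cdot> (?GZ v \<cdot> s) = (Q m u \<cdot> s [^]\<^bsub>H\<^esub> m \<cdot> ?GZ v) \<cdot> s"
        using uv by (simp add: H.m_assoc)
      also have "Q m u \<cdot> s [^]\<^bsub>H\<^esub> m \<cdot> ?GZ v = Q m u \<cdot> ?GZ v \<cdot> s [^]\<^bsub>H\<^esub> m"
        using uv by (intro scalar_assoc) auto
      finally show "\<Theta> (P (j + 2) m) u \<cdot> \<Theta> (G (int m * (j + 2))) v =
          (Q m u \<cdot> ?GZ v) \<cdot> (s [^]\<^bsub>H\<^esub> m \<cdot> s)"
        using uv by (simp add: Suc.IH \<Theta>_G H.m_assoc)
    qed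
    also have "\<dots> = sw h (\<lambda>u v. Q m u \<cdot> ?GZ v) \<cdot> (s [^]\<^bsub>H\<^esub> m \<cdot> s)"
      using Suc.prems by (intro sw_mult_left[symmetric] bil_conv E_lin) auto
    finally show ?case using Suc.prems by (simp add: Q_simps conv_apply[of h "Q m"])
  qed
  \<comment> \<open>The left side of \<open>\<Theta>_P\<close> is trivial by hypothesis and the
    scalar on its right side is s^n = 1.\<close>
  have "Q n = \<e>"
    by (rule E_eqI) (use \<Theta>_P[of _ n] in \<open>auto simp: Pj \<Theta>_one sn E_closed[OF Q_E]\<close>)
  then have "G (2 * int n) \<bullet> P j n = \<e>" using Q_eq[of n] by (simp add: Zn)
  then show ?thesis by (rule G_after_cancel[OF P_E])
qed

lemma P_shift_many: "P (j + 2 * int m) n = \<e> \<Longrightarrow> P j n = \<e>"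
proof (induction m)
  case (Suc m)
  have "P (j + 2 * int m) n = \<e>"
    by (rule P_shift) (use Suc.prems in \<open>simp add: algebra_simps\<close>)
  then show ?case by (rule Suc.IH)
qed simp

lemma P_trivial_all:
  assumes 0: "P 0 n = \<e>" and 1: "P (-1) n = \<e>" and n: "n \<ge> 1"
  shows "P j n = \<e>"
proof -
  \<comment> \<open>\<open>P_shift\<close> only lowers the parameter, so 0 and -1 reach just the
    parameters up to 0. Subtracting a large multiple of n moves j into that range without changing
    P.\<close>
  have per: "P (j - int n * (2 * \<bar>j\<bar>)) n = P j n"
    using P_periodic[OF P_minus_one_order[OF 1], of j "- (2 * \<bar>j\<bar>)" n] by simp
  have ge: "int n * (2 * \<bar>j\<bar>) \<ge> 2 * \<bar>j\<bar>" using n by (simp add: mult_le_cancel_right1)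
  define i where "i = j - int n * (2 * \<bar>j\<bar>)"
  have i: "i \<le> 0" using ge by (simp add: i_def)
  have "P i n = \<e>"
  proof (cases "even i")
    case True
    then obtain m where "i + 2 * int m = 0" using i by (intro that[of "nat (- i div 2)"]) auto
    then show ?thesis using P_shift_many[of i m n] 0 by simp
  next
    case False
    then obtain b where b: "i = 2 * b + 1" by (elim oddE)
    with i have "b \<le> -1" by presburger
    with b have "i + 2 * int (nat (-1 - b)) = -1" by simp
    then obtain m where "i + 2 * int m = -1" by blast
    then show ?thesis using P_shift_many[of i m n] 1 by simp
  qed
  then show ?thesis using per by (simp add: i_def)
qed

end


section \<open>Iterated comultiplication\<close>

text \<open>The structure that the statements about iterated comultiplication need. It is shared by
  H and the smash product, so that the latter enters the argument without a verification of all Hopf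
  algebra axioms.\<close>

locale comultiplicative_algebra = Module.module K A
  for K :: "('k, 'r) ring_scheme" and A :: "('k, 'h, 's) hopf_scheme" +
  assumes mult_bilinear: "bilinear K A A A (mult A)"
    and one_mem: "\<one>\<^bsub>A\<^esub> \<in> carrier A"
    and comult_linear: "comult A \<in> linear_maps K A (tensor_power K A 2)"
begin

lemma AA: "two_modules K A A"
  by (intro two_modules.intro module_axioms)

lemma A_power: "two_modules K A (tensor_power K A n)"
  by (intro two_modules.intro module_axioms tensor_power_module)

lemma mult_mem: "x \<in> carrier A \<Longrightarrow> y \<in> carrier A \<Longrightarrow> x \<otimes>\<^bsub>A\<^esub> y \<in> carrier A"
  using mult_bilinear unfolding bilinear_def by (blast intro: linear_maps_closed)

lemma foldr_mult_closed: "set xs \<subseteq> carrier A \<Longrightarrow> foldr (mult A) xs \<one>\<^bsub>A\<^esub> \<in> carrier A"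
  by (induction xs) (auto simp: one_mem mult_mem)

lemma multilinear_foldr: "multilinear K A A n (\<lambda>xs. foldr (mult A) xs \<one>\<^bsub>A\<^esub>)"
proof (rule multilinearI)
  fix us vs assume "set us \<subseteq> carrier A" and vs: "set vs \<subseteq> carrier A"
  then show "(\<lambda>x. foldr (mult A) (us @ x # vs) \<one>\<^bsub>A\<^esub>) \<in> linear_maps K A A"
  proof (induction us)
    case Nil
    then show ?case using mult_bilinear foldr_mult_closed[OF vs] by (simp add: bilinear_def)
  next
    case (Cons u us)
    then have "u \<in> carrier A" by simp
    then have "mult A u \<in> linear_maps K A A" using mult_bilinear by (auto simp: bilinear_def)
    from linear_maps_compose[OF _ this] Cons show ?case by simp
  qed
qed (simp add: foldr_mult_closed)

text \<open>Fuses the two successive extensions, twisting the factors and multiplying them, into one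
  extension of a multilinear map on lists.\<close>

lemma iter_mult_tensor_maps:
  assumes fs: "set fs \<subseteq> linear_maps K A A" "length fs = n"
    and t: "t \<in> carrier (tensor_power K A n)"
  shows "iter_mult K A (tensor_maps K A fs t) =
    lin_ext K A (\<lambda>xs. foldr (mult A) (map2 (\<lambda>f x. f x) fs xs) \<one>\<^bsub>A\<^esub>) t"
proof -
  interpret AA: two_modules K A A by (rule AA)
  interpret AP: two_modules K A "tensor_power K A n" by (rule A_power)
  have m: "multilinear K A (tensor_power K A n) n (\<lambda>xs. power_pure K A (map2 (\<lambda>f x. f x) fs xs))"
    by (rule multilinear_map2[OF power_pure_multilinear fs])
  have "iter_mult K A (tensor_maps K A fs t) =
      lin_ext K A (\<lambda>xs. iter_mult K A (power_pure K A (map2 (\<lambda>f x. f x) fs xs))) t"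
    unfolding tensor_maps_def fs(2)
    by (rule AP.lin_ext_power_compose[OF m module_axioms _ t])
      (simp add: iter_mult_def AA.lin_ext_power_hom[OF multilinear_foldr])
  also have "\<dots> = lin_ext K A (\<lambda>xs. foldr (mult A) (map2 (\<lambda>f x. f x) fs xs) \<one>\<^bsub>A\<^esub>) t"
  proof (rule AA.lin_ext_power_cong[OF multilinear_map2[OF multilinear_foldr fs] _ t])
    fix xs assume xs: "xs \<in> power_gens A n"
    have "map2 (\<lambda>f x. f x) fs xs \<in> power_gens A n"
      using xs fs map2_closed[OF fs(1), of xs] by (auto simp: in_power_gens)
    then show "iter_mult K A (power_pure K A (map2 (\<lambda>f x. f x) fs xs)) =
        foldr (mult A) (map2 (\<lambda>f x. f x) fs xs) \<one>\<^bsub>A\<^esub>"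
      unfolding iter_mult_def by (rule AA.lin_ext_power_pure[OF multilinear_foldr])
  qed
  finally show ?thesis .
qed

lemma pure_single_linear: "(\<lambda>x. power_pure K A [x]) \<in> linear_maps K A (tensor_power K A 1)"
  using multilinearD[OF power_pure_multilinear[of 1], of "[]" "[]"] by simp

lemma append_single_bilinear:
  assumes "f \<in> linear_maps K A (tensor_power K A n)"
  shows "bilinear K A A (tensor_power K A (Suc n))
    (\<lambda>x y. tensor_append K A n 1 (f x) (power_pure K A [y]))"
  using tensor_append_bilinear[of n 1] assms linear_maps_closed[OF pure_single_linear] linear_maps_closed[OF assms]
  unfolding bilinear_def
  by (auto intro!: linear_maps_compose[OF assms] linear_maps_compose[OF pure_single_linear])

lemma iter_comult_linear: "iter_comult K A (Suc n) \<in> linear_maps K A (tensor_power K A (Suc n))"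
proof (induction n)
  case 0
  show ?case using pure_single_linear by simp
next
  case (Suc n)
  interpret AP: two_modules K A "tensor_power K A (Suc (Suc n))" by (rule A_power)
  show ?case
    using linear_maps_compose[OF comult_linear AP.lin_ext_power_hom[OF multilinear_pair[OF append_single_bilinear[OF Suc]]]]
    by (rule linear_maps_cong[OF _ module_axioms]) simp
qed

lemma iter_comult_closed: "h \<in> carrier A \<Longrightarrow> iter_comult K A (Suc n) h \<in> carrier (tensor_power K A (Suc n))"
  by (rule linear_maps_closed[OF iter_comult_linear])

lemma apply_iter_comult:
  assumes N: "Module.module K N" and \<Psi>: "\<Psi> \<in> linear_maps K (tensor_power K A (Suc (Suc n))) N"
    and h: "h \<in> carrier A"
  shows "\<Psi> (iter_comult K A (Suc (Suc n)) h) =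
    lin_ext K N (\<lambda>xs. \<Psi> (tensor_append K A (Suc n) 1 (iter_comult K A (Suc n) (xs ! 0)) (power_pure K A [xs ! 1])))
      (comult A h)"
proof -
  interpret AP: two_modules K A "tensor_power K A (Suc (Suc n))" by (rule A_power)
  show ?thesis
    unfolding iter_comult.simps
    by (rule AP.lin_ext_power_compose[OF multilinear_pair[OF append_single_bilinear[OF iter_comult_linear]] N \<Psi>
          linear_maps_closed[OF comult_linear h]])
qed

end

context hopf_algebra
begin

lemma mult_bilinear: "bilH (mult H)"
  using lin_mult_left[OF linear_maps_id] lin_mult_right[OF linear_maps_id] by (intro bilI) auto

sublocale CA: comultiplicative_algebra K H
  by (intro comultiplicative_algebra.intro module_H comultiplicative_algebra_axioms.intro mult_bilinear
      comult_hom H.one_closed)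

end

context bij_hopf_algebra
begin

abbreviation twists :: "int \<Rightarrow> nat \<Rightarrow> ('c \<Rightarrow> 'c) list" where
  "twists j n \<equiv> map (\<lambda>i. G (int i * j)) [0..<n]"

lemma twists_linear: "set (twists j n) \<subseteq> linH"
  by (auto intro: E_lin G_E)

lemma foldr_append_single:
  assumes "set ys \<subseteq> C" "y \<in> C"
  shows "foldr (mult H) (ys @ [y]) \<one>\<^bsub>H\<^esub> = foldr (mult H) ys \<one>\<^bsub>H\<^esub> \<cdot> y"
  using assms(1)
proof (induction ys)
  case (Cons x ys)
  then have "foldr (mult H) ys \<one>\<^bsub>H\<^esub> \<in> C" by (intro CA.foldr_mult_closed) auto
  then show ?case using Cons assms(2) by (simp add: H.m_assoc)
qed (use assms in simp)

abbreviation twisted_mult :: "int \<Rightarrow> nat \<Rightarrow> 'c list \<Rightarrow> 'c" where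
  "twisted_mult j n xs \<equiv> foldr (mult H) (map2 (\<lambda>f x. f x) (twists j n) xs) \<one>\<^bsub>H\<^esub>"

lemma twisted_mult_multilinear: "multilinear K H H n (twisted_mult j n)"
  by (rule multilinear_map2[OF CA.multilinear_foldr twists_linear]) simp

text \<open>Translates the expressions in tensor powers into convolution powers. The recursion of
  \<open>iter_comult\<close> comultiplies the first leg further and keeps the second as last factor,
  which matches the last convolution factor in the recursion of \<open>P\<close>.\<close>

lemma twisted_iter_comult:
  assumes "h \<in> C"
  shows "lin_ext K H (twisted_mult j (Suc n)) (iter_comult K H (Suc n) h) = P j (Suc n) h"
  using assms
proof (induction n arbitrary: h)
  case 0
  have "lin_ext K H (twisted_mult j 1) (power_pure K H [h]) = twisted_mult j 1 [h]"
    by (rule HH.lin_ext_power_pure[OF twisted_mult_multilinear]) (use 0 in \<open>simp add: in_power_gens\<close>)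
  then show ?case using 0 by simp
next
  case (Suc n)
  let ?\<Psi> = "lin_ext K H (twisted_mult j (Suc (Suc n)))"
  let ?f = "G (int (Suc n) * j)"
  \<comment> \<open>On tensors with one more leg the twisted product splits off its last factor;
    both sides are linear in s, so pure tensors suffice.\<close>
  have append: "?\<Psi> (tensor_append K H (Suc n) 1 s (power_pure K H [y])) =
      lin_ext K H (twisted_mult j (Suc n)) s \<cdot> ?f y"
    if s: "s \<in> carrier (tensor_power K H (Suc n))" and y: "y \<in> C" for s y
  proof (rule HH.power_hom_eq[OF _ _ _ s,
        where f = "\<lambda>s. ?\<Psi> (tensor_append K H (Suc n) 1 s (power_pure K H [y]))"])
    have "(\<lambda>s. tensor_append K H (Suc n) 1 s (power_pure K H [y]))
        \<in> linear_maps K (tensor_power K H (Suc n)) (tensor_power K H (Suc (Suc n)))"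
      using module.tensor_append_bilinear[of "Suc n" 1] linear_maps_closed[OF CA.pure_single_linear y]
      by (simp add: bilinear_def)
    from linear_maps_compose[OF this HH.lin_ext_power_hom[OF twisted_mult_multilinear]]
    show "(\<lambda>s. ?\<Psi> (tensor_append K H (Suc n) 1 s (power_pure K H [y])))
        \<in> linear_maps K (tensor_power K H (Suc n)) H" .
    show "(\<lambda>s. lin_ext K H (twisted_mult j (Suc n)) s \<cdot> ?f y) \<in> linear_maps K (tensor_power K H (Suc n)) H"
      by (rule linear_maps_compose[OF HH.lin_ext_power_hom[OF twisted_mult_multilinear]
            lin_mult_left[OF linear_maps_id]]) (simp add: y)
    fix xs assume xs: "xs \<in> power_gens H (Suc n)"
    then have xsy: "xs @ [y] \<in> power_gens H (Suc (Suc n))" using y by (simp add: in_power_gens)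
    have cl: "set (map2 (\<lambda>f x. f x) (twists j (Suc n)) xs) \<subseteq> C"
      by (rule map2_closed[OF twists_linear]) (use xs in \<open>auto simp: in_power_gens\<close>)
    have len: "length (twists j (Suc n)) = length xs" using xs by (simp add: in_power_gens)
    have "?\<Psi> (tensor_append K H (Suc n) 1 (power_pure K H xs) (power_pure K H [y])) = ?\<Psi> (power_pure K H (xs @ [y]))"
      using module.tensor_append_pure[OF xs power_pure_gens(1)[OF y]] by simp
    also have "\<dots> = twisted_mult j (Suc (Suc n)) (xs @ [y])"
      by (rule HH.lin_ext_power_pure[OF twisted_mult_multilinear xsy])
    also have "map2 (\<lambda>f x. f x) (twists j (Suc (Suc n))) (xs @ [y]) =
        map2 (\<lambda>f x. f x) (twists j (Suc n)) xs @ [?f y]"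
      using zip_append[OF len, of "[?f]" "[y]"] by simp
    also have "foldr (mult H) \<dots> \<one>\<^bsub>H\<^esub> = twisted_mult j (Suc n) xs \<cdot> ?f y"
      by (rule foldr_append_single[OF cl]) (simp add: y)
    also have "twisted_mult j (Suc n) xs = lin_ext K H (twisted_mult j (Suc n)) (power_pure K H xs)"
      by (rule HH.lin_ext_power_pure[OF twisted_mult_multilinear xs, symmetric])
    finally show "?\<Psi> (tensor_append K H (Suc n) 1 (power_pure K H xs) (power_pure K H [y])) =
        lin_ext K H (twisted_mult j (Suc n)) (power_pure K H xs) \<cdot> ?f y" .
  qed
  have "?\<Psi> (iter_comult K H (Suc (Suc n)) h) =
      sw h (\<lambda>x y. ?\<Psi> (tensor_append K H (Suc n) 1 (iter_comult K H (Suc n) x) (power_pure K H [y])))"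
    unfolding sw_def
    by (rule CA.apply_iter_comult[OF module_H HH.lin_ext_power_hom[OF twisted_mult_multilinear] Suc.prems])
  also have "\<dots> = sw h (\<lambda>x y. P j (Suc n) x \<cdot> ?f y)"
    by (rule sw_cong[OF Suc.prems bil_conv[OF E_lin[OF P_E] E_lin[OF G_E]]])
      (simp only: append[OF CA.iter_comult_closed] Suc.IH)
  also have "\<dots> = P j (Suc (Suc n)) h"
    using Suc.prems by (simp only: P.simps(2)[of j "Suc n"] conv_apply)
  finally show ?case .
qed

end


section \<open>The smash product\<close>

text \<open>\<open>group_algebra\<close> and \<open>smash_product\<close> are larger records over a
  free module and a tensor product. Being a module concerns only the fields listed here, so the
  facts carry over.\<close>

lemma module_cong:
  fixes M :: "('k, 'm, 's) module_scheme" and M' :: "('k, 'm, 't) module_scheme"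
  assumes M: "Module.module K M"
    and eq: "carrier M' = carrier M" "add M' = add M" "zero M' = zero M" "smult M' = smult M"
  shows "Module.module K M'"
proof -
  interpret Module.module K M by fact
  show ?thesis
  proof (rule moduleI)
    show "abelian_group M'"
    proof (rule abelian_groupI)
      fix x assume "x \<in> carrier M'"
      then show "\<exists>y\<in>carrier M'. y \<oplus>\<^bsub>M'\<^esub> x = \<zero>\<^bsub>M'\<^esub>"
        unfolding eq by (intro bexI[of _ "\<ominus>\<^bsub>M\<^esub> x"]) (auto simp: M.l_neg)
    qed (simp_all add: eq M.a_ac)
  qed (simp_all add: eq smult_l_distr smult_r_distr smult_assoc1 R.is_cring)
qed

lemma tensor_power_module': "Module.module K M \<Longrightarrow> Module.module K (tensor_power K M n)"
  by (rule module.tensor_power_module)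

lemma linear_maps_eq:
  assumes "carrier M' = carrier M" "add M' = add M" "smult M' = smult M"
    and "carrier N' = carrier N" "add N' = add N" "smult N' = smult N"
  shows "linear_maps K M' N' = linear_maps K M N"
  using assms by (simp add: LinearCombinations.module_hom_def)

lemma tensor_power_eq:
  fixes M :: "('k, 'm, 's) module_scheme" and M' :: "('k, 'm, 't) module_scheme"
  assumes "carrier M' = carrier M" "add M' = add M" "smult M' = smult M"
  shows "tensor_power K M' n = tensor_power K M n" "power_pure K M' = power_pure K M"
  using assms
  by (simp_all add: tensor_power_def power_pure_def power_gens_def multilinear_rels_def fun_eq_iff)

context bij_hopf_algebra
begin

definition \<Gamma> :: "('c \<Rightarrow> 'c) monoid" where
  "\<Gamma> = antipode_sq_group H"

lemma G_Bij: "G i \<in> Bij C"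
proof -
  have "bij_betw (G i) C C"
    by (rule bij_betw_byWitness[where f' = "G (- i)"]) (auto simp: G_add)
  then show ?thesis by (simp add: Bij_def G_def)
qed

lemma BijGroup_G: "G i \<otimes>\<^bsub>BijGroup C\<^esub> G j = G (i + j)"
  using G_Bij by (simp add: BijGroup_def compose_def) (rule E_eqI[OF _ G_E], auto simp: G_add intro!: mkE linear_maps_compose[OF G_lin G_lin, simplified])

lemma BijGroup_one: "\<one>\<^bsub>BijGroup C\<^esub> = G 0"
  by (simp add: BijGroup_def G_idm idm_def)

lemma G_in_BijGroup [simp]: "G i \<in> carrier (BijGroup C)"
  using G_Bij by (simp add: BijGroup_def)

lemma BijGroup_inv: "inv\<^bsub>BijGroup C\<^esub> (G i) = G (- i)"
  by (rule group.inv_equality[OF group_BijGroup]) (simp_all add: BijGroup_G BijGroup_one)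

lemma G_1: "G 1 = (\<lambda>h\<in>C. antipode H (antipode H h))"
  by (simp add: G_def)

text \<open>Every group element is some \<open>G i\<close>, but i is determined only up to periods
  of S^2; maps on the group therefore have to be given as functions of the element and not of the
  index.\<close>

lemma \<Gamma>_carrier: "carrier \<Gamma> = range G"
proof -
  let ?B = "BijGroup C"
  have carr: "carrier ?B \<inter> {G 1} = {G 1}" using G_Bij by (auto simp: BijGroup_def)
  have "carrier \<Gamma> = generate ?B {G 1}"
    unfolding \<Gamma>_def antipode_sq_group_def G_1[symmetric] carrier_subgroup_generated carr ..
  also have "\<dots> = range G"
  proof
    show "generate ?B {G 1} \<subseteq> range G"
    proof
      fix x assume "x \<in> generate ?B {G 1}"
      then show "x \<in> range G"
        by induction (auto simp: BijGroup_one BijGroup_inv BijGroup_G)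
    qed
    have "G i \<in> generate ?B {G 1}" for i
    proof (induction i rule: int_induct[where k = 0])
      case base
      show ?case using generate.one[of ?B] by (simp add: BijGroup_one)
    next
      case (step1 i)
      show ?case using generate.eng[OF step1(2) generate.incl[of "G 1"]] by (simp add: BijGroup_G)
    next
      case (step2 i)
      show ?case using generate.eng[OF step2(2) generate.inv[of "G 1"]] by (simp add: BijGroup_G BijGroup_inv)
    qed
    then show "range G \<subseteq> generate ?B {G 1}" by auto
  qed
  finally show ?thesis .
qed

lemma \<Gamma>_mult [simp]: "G i \<otimes>\<^bsub>\<Gamma>\<^esub> G j = G (i + j)"
  by (simp add: \<Gamma>_def antipode_sq_group_def BijGroup_G)

lemma \<Gamma>_one [simp]: "\<one>\<^bsub>\<Gamma>\<^esub> = G 0"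
  by (simp add: \<Gamma>_def antipode_sq_group_def BijGroup_one)

lemma \<Gamma>_group: "group \<Gamma>"
  unfolding \<Gamma>_def antipode_sq_group_def
  by (rule group.group_subgroup_generated[OF group_BijGroup])

lemma \<Gamma>_inv [simp]: "inv\<^bsub>\<Gamma>\<^esub> (G i) = G (- i)"
  by (rule group.inv_equality[OF \<Gamma>_group]) (auto simp: \<Gamma>_carrier)

lemma G_in_\<Gamma> [simp]: "G i \<in> carrier \<Gamma>"
  by (simp add: \<Gamma>_carrier)

abbreviation "KG \<equiv> group_algebra K \<Gamma>"
abbreviation "FG \<equiv> free_module K (carrier \<Gamma>)"
abbreviation "T \<equiv> tensor_product K H KG"
abbreviation "el h \<sigma> \<equiv> tensor_pure K H KG h (free_gen K \<sigma>)"

lemma KG_simps [simp]: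
  "carrier KG = carrier FG" "add KG = add FG" "zero KG = zero FG" "smult KG = smult FG"
  by (simp_all add: group_algebra_def Let_def)

lemma KG_module: "Module.module K KG"
  by (rule module_cong[OF module.R.free_module_module]) simp_all

lemma HT: "two_modules K H KG"
  by (intro two_modules.intro module_H KG_module)

lemma T_module: "Module.module K T"
  by (rule two_modules.tensor_product_module[OF HT])

lemma gen_KG [simp]: "free_gen K (G i) \<in> carrier FG"
  by (rule module.R.free_gen_closed) simp

lemma el_closed [simp]: "h \<in> C \<Longrightarrow> el h (G i) \<in> carrier T"
  by (rule two_modules.tensor_pure_closed[OF HT]) auto

lemma el_linear: "(\<lambda>h. el h (G i)) \<in> linear_maps K H T"
  using two_modules.tensor_pure_bilinear[OF HT] by (simp add: bilinear_def)

text \<open>A linear map out of the tensor product, given on h \<otimes> \<sigma>. It has the shape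
  of the expressions in \<open>smash_product\<close>, so multiplication and antipode there are
  instances; taking \<sigma> as argument avoids any question of dependence on an index.\<close>

definition el_ext ::
  "('a, 'n, 't) module_scheme \<Rightarrow> ('c \<Rightarrow> ('c \<Rightarrow> 'c) \<Rightarrow> 'n) \<Rightarrow> ('c \<times> (('c \<Rightarrow> 'c) \<Rightarrow> 'a) \<Rightarrow> 'a) set \<Rightarrow> 'n" where
  "el_ext N f = lin_ext K N (\<lambda>(h, p). free_ext K N (f h) p)"

text \<open>Linearity in the group algebra argument is that of \<open>free_ext\<close>. Linearity in
  h is proved by induction on the combination of group elements in the second argument.\<close>

lemma el_ext_bilinear:
  assumes N: "Module.module K N" and f: "\<And>i. (\<lambda>h. f h (G i)) \<in> linear_maps K H N"
  shows "bilinear K H KG N (\<lambda>h p. case (h, p) of (h, p) \<Rightarrow> free_ext K N (f h) p)"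
proof -
  interpret N: Module.module K N by (rule N)
  interpret HN: two_modules K H N by (intro two_modules.intro module_H N)
  have fX: "f h \<in> carrier \<Gamma> \<rightarrow> carrier N" if "h \<in> C" for h
    using linear_maps_closed[OF f that] by (auto simp: \<Gamma>_carrier)
  have lin: "free_ext K N (f h) \<in> linear_maps K FG N" if "h \<in> C" for h
    by (rule N.free_ext_hom[OF fX[OF that]])
  have "(\<lambda>h. free_ext K N (f h) p) \<in> linear_maps K H N" if p: "p \<in> carrier FG" for p
    using p
  proof (rule module.R.free_induct)
    have "free_ext K N (f h) (\<lambda>_. \<zero>\<^bsub>K\<^esub>) = \<zero>\<^bsub>N\<^esub>" for h by (simp add: free_ext_def)
    then show "(\<lambda>h. free_ext K N (f h) (\<lambda>_. \<zero>\<^bsub>K\<^esub>)) \<in> linear_maps K H N"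
      by (intro linear_mapsI) simp_all
  next
    fix c \<sigma> p
    assume *: "c \<in> carrier K" "\<sigma> \<in> carrier \<Gamma>" "p \<in> carrier FG"
      and IH: "(\<lambda>h. free_ext K N (f h) p) \<in> linear_maps K H N"
    interpret F: Module.module K FG by (rule module.R.free_module_module)
    obtain i where i: "\<sigma> = G i" using * by (auto simp: \<Gamma>_carrier)
    have "(\<lambda>h. c \<odot>\<^bsub>N\<^esub> f h (G i) \<oplus>\<^bsub>N\<^esub> free_ext K N (f h) p) \<in> linear_maps K H N"
      by (intro HN.linear_maps_sum HN.linear_maps_scale f IH *)
    moreover have "free_ext K N (f h) (c \<odot>\<^bsub>FG\<^esub> free_gen K \<sigma> \<oplus>\<^bsub>FG\<^esub> p) =
        c \<odot>\<^bsub>N\<^esub> f h (G i) \<oplus>\<^bsub>N\<^esub> free_ext K N (f h) p" if "h \<in> C" for h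
      using * by (simp add: i linear_maps_add[OF lin[OF that]] linear_maps_smult[OF lin[OF that]]
          N.free_ext_gen[OF fX[OF that]])
    ultimately show "(\<lambda>h. free_ext K N (f h) (c \<odot>\<^bsub>FG\<^esub> free_gen K \<sigma> \<oplus>\<^bsub>FG\<^esub> p)) \<in> linear_maps K H N"
      by (rule linear_maps_cong[OF _ module_H])
  qed
  moreover have "free_ext K N (f h) \<in> linear_maps K KG N" if "h \<in> C" for h
    using lin[OF that] linear_maps_eq[of KG FG N N K] by simp
  ultimately show ?thesis by (simp add: bilinear_def)
qed

lemma el_ext_linear:
  assumes "Module.module K N" "\<And>i. (\<lambda>h. f h (G i)) \<in> linear_maps K H N"
  shows "el_ext N f \<in> linear_maps K T N"
  unfolding el_ext_def
  by (rule two_modules.lin_ext_product_hom[OF HT assms(1) el_ext_bilinear[where f = f, OF assms]])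

lemma el_ext_el:
  assumes N: "Module.module K N" and f: "\<And>i. (\<lambda>h. f h (G i)) \<in> linear_maps K H N"
    and h: "h \<in> C"
  shows "el_ext N f (el h (G i)) = f h (G i)"
proof -
  interpret N: Module.module K N by (rule N)
  have "el_ext N f (el h (G i)) = free_ext K N (f h) (free_gen K (G i))"
    unfolding el_ext_def
    by (subst two_modules.lin_ext_product_pure[OF HT N el_ext_bilinear[where f = f, OF N f] h]) simp_all
  also have "\<dots> = f h (G i)"
    by (rule N.free_ext_gen[of _ "carrier \<Gamma>"]) (use linear_maps_closed[OF f h] in \<open>auto simp: \<Gamma>_carrier\<close>)
  finally show ?thesis .
qed

text \<open>Pure tensors are spanned by those with a group element in the second leg.\<close>

lemma el_hom_eq:
  assumes N: "Module.module K N" and f: "f \<in> linear_maps K T N" and g: "g \<in> linear_maps K T N"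
    and eq: "\<And>h i. h \<in> C \<Longrightarrow> f (el h (G i)) = g (el h (G i))" and t: "t \<in> carrier T"
  shows "f t = g t"
proof (rule two_modules.product_hom_eq[OF HT N f g _ t])
  fix h p assume h: "h \<in> C" and p: "p \<in> carrier KG"
  have lin: "tensor_pure K H KG h \<in> linear_maps K FG T"
    using two_modules.tensor_pure_bilinear[OF HT] h linear_maps_eq[of KG FG T T K] by (simp add: bilinear_def)
  have fp: "(\<lambda>p. f (tensor_pure K H KG h p)) \<in> linear_maps K FG N"
    and gp: "(\<lambda>p. g (tensor_pure K H KG h p)) \<in> linear_maps K FG N"
    by (rule linear_maps_compose[OF lin f] linear_maps_compose[OF lin g])+
  interpret F: Module.module K FG by (rule module.R.free_module_module)
  interpret f: mod_hom K FG N "\<lambda>p. f (tensor_pure K H KG h p)"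
    by (intro mod_homI N F.module_axioms fp)
  interpret g: mod_hom K FG N "\<lambda>p. g (tensor_pure K H KG h p)"
    by (intro mod_homI N F.module_axioms gp)
  have "p \<in> carrier FG" using p by simp
  then show "f (tensor_pure K H KG h p) = g (tensor_pure K H KG h p)"
  proof (rule module.R.free_induct)
    show "f (tensor_pure K H KG h (\<lambda>_. \<zero>\<^bsub>K\<^esub>)) = g (tensor_pure K H KG h (\<lambda>_. \<zero>\<^bsub>K\<^esub>))"
      using f.f0_is_0 g.f0_is_0 by (simp add: free_simps)
  next
    fix c \<sigma> p assume *: "c \<in> carrier K" "\<sigma> \<in> carrier \<Gamma>" "p \<in> carrier FG"
      "f (tensor_pure K H KG h p) = g (tensor_pure K H KG h p)"
    then obtain i where "\<sigma> = G i" by (auto simp: \<Gamma>_carrier)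
    then show "f (tensor_pure K H KG h (c \<odot>\<^bsub>FG\<^esub> free_gen K \<sigma> \<oplus>\<^bsub>FG\<^esub> p)) =
        g (tensor_pure K H KG h (c \<odot>\<^bsub>FG\<^esub> free_gen K \<sigma> \<oplus>\<^bsub>FG\<^esub> p))"
      using * eq[OF h] by (simp add: f.f_add f.f_smult g.f_add g.f_smult)
  qed
qed

text \<open>Needed for the nested extension that defines the product of the smash product, which has
  to be linear in the variable of the outer and of the inner extension.\<close>

lemma el_ext_param:
  assumes N: "Module.module K N" and V: "Module.module K V"
    and f: "\<And>x i. x \<in> carrier V \<Longrightarrow> (\<lambda>h. f x h (G i)) \<in> linear_maps K H N"
    and lin: "\<And>h i. h \<in> C \<Longrightarrow> (\<lambda>x. f x h (G i)) \<in> linear_maps K V N"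
    and t: "t \<in> carrier T"
  shows "(\<lambda>x. el_ext N (f x) t) \<in> linear_maps K V N"
proof -
  interpret V: Module.module K V by (rule V)
  interpret TN: two_modules K T N by (intro two_modules.intro T_module N)
  have lin_ext: "el_ext N (f x) \<in> linear_maps K T N" if "x \<in> carrier V" for x
    by (rule el_ext_linear[where f = "f x", OF N f[OF that]])
  have ext_el: "el_ext N (f x) (el h (G i)) = f x h (G i)" if "x \<in> carrier V" "h \<in> C" for x h i
    by (rule el_ext_el[where f = "f x", OF N f[OF that(1)] that(2)])
  show ?thesis
  proof (rule linear_mapsI)
    fix x assume "x \<in> carrier V"
    then show "el_ext N (f x) t \<in> carrier N" by (intro linear_maps_closed[OF lin_ext t])
  next
    fix x y assume x: "x \<in> carrier V" and y: "y \<in> carrier V"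
    then have xy: "x \<oplus>\<^bsub>V\<^esub> y \<in> carrier V" by simp
    show "el_ext N (f (x \<oplus>\<^bsub>V\<^esub> y)) t = el_ext N (f x) t \<oplus>\<^bsub>N\<^esub> el_ext N (f y) t"
      by (rule el_hom_eq[OF N lin_ext[OF xy] TN.linear_maps_sum[OF lin_ext[OF x] lin_ext[OF y]] _ t])
        (simp add: ext_el x y linear_maps_add[OF lin])
  next
    fix r x assume r: "r \<in> carrier K" and x: "x \<in> carrier V"
    then have rx: "r \<odot>\<^bsub>V\<^esub> x \<in> carrier V" by simp
    show "el_ext N (f (r \<odot>\<^bsub>V\<^esub> x)) t = r \<odot>\<^bsub>N\<^esub> el_ext N (f x) t"
      by (rule el_hom_eq[OF N lin_ext[OF rx] TN.linear_maps_scale[OF lin_ext[OF x] r] _ t])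
        (simp add: ext_el r x linear_maps_smult[OF lin])
  qed
qed

abbreviation "Sm \<equiv> smash_product K H \<Gamma>"

lemma Sm_simps [simp]:
  "carrier Sm = carrier T" "add Sm = add T" "zero Sm = zero T" "smult Sm = smult T"
  "\<one>\<^bsub>Sm\<^esub> = el \<one>\<^bsub>H\<^esub> (G 0)" "comult Sm = tensor_comult K H KG" "counit Sm = tensor_counit K H KG"
  by (simp_all add: smash_product_def Let_def)

lemma Sm_module: "Module.module K Sm"
  by (rule module_cong[OF T_module]) simp_all

lemma Sm_linear_maps: "linear_maps K Sm N = linear_maps K T N" "linear_maps K N Sm = linear_maps K N T"
  by (intro linear_maps_eq; simp)+

lemma Sm_power: "tensor_power K Sm n = tensor_power K T n" "power_pure K Sm = power_pure K T"
  by (intro tensor_power_eq; simp)+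

lemma Sm_mult:
  "s \<otimes>\<^bsub>Sm\<^esub> t = el_ext T (\<lambda>h \<sigma>. el_ext T (\<lambda>k \<tau>. el (h \<cdot> \<sigma> k) (\<sigma> \<otimes>\<^bsub>\<Gamma>\<^esub> \<tau>)) t) s"
  by (simp add: smash_product_def Let_def el_ext_def)

lemma Sm_antipode: "antipode Sm = el_ext T (\<lambda>h \<sigma>. el ((inv\<^bsub>\<Gamma>\<^esub> \<sigma>) (antipode H h)) (inv\<^bsub>\<Gamma>\<^esub> \<sigma>))"
  by (simp add: smash_product_def Let_def el_ext_def)

lemma Sm_mult_inner_linear:
  assumes "h \<in> C"
  shows "(\<lambda>k. el (h \<cdot> G i k) (G i \<otimes>\<^bsub>\<Gamma>\<^esub> G j)) \<in> linear_maps K H T"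
  using linear_maps_compose[OF lin_mult_right[OF G_lin assms] el_linear] by simp

lemma Sm_mult_outer_linear:
  assumes "t \<in> carrier T"
  shows "(\<lambda>h. el_ext T (\<lambda>k \<tau>. el (h \<cdot> G i k) (G i \<otimes>\<^bsub>\<Gamma>\<^esub> \<tau>)) t) \<in> linear_maps K H T"
proof (rule el_ext_param[OF T_module module_H _ _ assms])
  fix k j assume "k \<in> C"
  then show "(\<lambda>h. el (h \<cdot> G i k) (G i \<otimes>\<^bsub>\<Gamma>\<^esub> G j)) \<in> linear_maps K H T"
    using linear_maps_compose[OF lin_mult_left[OF linear_maps_id] el_linear] by simp
qed (rule Sm_mult_inner_linear)

lemma Sm_mult_el:
  assumes "h \<in> C" "k \<in> C"
  shows "el h (G i) \<otimes>\<^bsub>Sm\<^esub> el k (G j) = el (h \<cdot> G i k) (G (i + j))"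
proof -
  have "el h (G i) \<otimes>\<^bsub>Sm\<^esub> el k (G j) = el_ext T (\<lambda>k \<tau>. el (h \<cdot> G i k) (G i \<otimes>\<^bsub>\<Gamma>\<^esub> \<tau>)) (el k (G j))"
    unfolding Sm_mult by (subst el_ext_el[OF T_module _ assms(1)]; (rule Sm_mult_outer_linear)?) (simp_all add: assms)
  also have "\<dots> = el (h \<cdot> G i k) (G i \<otimes>\<^bsub>\<Gamma>\<^esub> G j)"
    by (rule el_ext_el[OF T_module _ assms(2)]) (rule Sm_mult_inner_linear[OF assms(1)])
  finally show ?thesis by simp
qed

lemma Sm_mult_bilinear: "bilinear K Sm Sm Sm (mult Sm)"
  unfolding bilinear_def Sm_linear_maps
proof (intro conjI ballI)
  fix t assume "t \<in> carrier Sm"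
  then have "t \<in> carrier T" by simp
  then show "(\<lambda>s. s \<otimes>\<^bsub>Sm\<^esub> t) \<in> linear_maps K T T"
    unfolding Sm_mult by (intro el_ext_linear[OF T_module] Sm_mult_outer_linear)
next
  fix s assume "s \<in> carrier Sm"
  then have s: "s \<in> carrier T" by simp
  show "mult Sm s \<in> linear_maps K T T"
    unfolding Sm_mult[abs_def]
  proof (rule el_ext_param[OF T_module T_module _ _ s])
    fix t i assume "t \<in> carrier T"
    then show "(\<lambda>h. el_ext T (\<lambda>k \<tau>. el (h \<cdot> G i k) (G i \<otimes>\<^bsub>\<Gamma>\<^esub> \<tau>)) t) \<in> linear_maps K H T"
      by (rule Sm_mult_outer_linear)
  next
    fix h i assume "h \<in> C"
    then show "el_ext T (\<lambda>k \<tau>. el (h \<cdot> G i k) (G i \<otimes>\<^bsub>\<Gamma>\<^esub> \<tau>)) \<in> linear_maps K T T"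
      by (intro el_ext_linear[OF T_module] Sm_mult_inner_linear)
  qed
qed

lemma KG_comult_linear: "comult KG \<in> linear_maps K KG (tensor_power K KG 2)"
  and KG_comult_gen: "comult KG (free_gen K (G i)) = power_pure K KG [free_gen K (G i), free_gen K (G i)]"
proof -
  interpret F: Module.module K FG by (rule module.R.free_module_module)
  interpret P: Module.module K "tensor_power K FG 2" by (rule F.tensor_power_module)
  let ?f = "\<lambda>g. power_pure K FG [free_gen K g, free_gen K g]"
  have eq: "comult KG = free_ext K (tensor_power K FG 2) ?f"
    by (simp add: group_algebra_def Let_def)
  have pw: "tensor_power K KG 2 = tensor_power K FG 2" "power_pure K KG = power_pure K FG"
    by (intro tensor_power_eq; simp)+
  have f: "?f \<in> carrier \<Gamma> \<rightarrow> carrier (tensor_power K FG 2)"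
    by (rule Pi_I, rule F.power_pure_closed) (simp add: in_power_gens module.R.free_gen_closed)
  show "comult KG \<in> linear_maps K KG (tensor_power K KG 2)"
    using P.free_ext_hom[OF f] linear_maps_eq[of KG FG "tensor_power K FG 2" "tensor_power K FG 2" K]
    by (simp add: eq pw)
  show "comult KG (free_gen K (G i)) = power_pure K KG [free_gen K (G i), free_gen K (G i)]"
    using P.free_ext_gen[OF f, of "G i"] by (simp add: eq pw)
qed

text \<open>The pattern (c1 \<otimes> d1) \<otimes> (c2 \<otimes> d2) of the summand in
  \<open>tensor_comult\<close>.\<close>

lemma bilinear_pair_lists:
  assumes B: "bilinear K L M N' B" and \<beta>: "bilinear K N' N' N \<beta>"
    and mods: "Module.module K L" "Module.module K M" "Module.module K N"
  shows "double_multilinear K L M N 2 2 (\<lambda>xs ys. \<beta> (B (xs ! 0) (ys ! 0)) (B (xs ! 1) (ys ! 1)))"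
proof -
  have B1: "B x \<in> linear_maps K M N'" if "x \<in> carrier L" for x using B that by (simp add: bilinear_def)
  have B2: "(\<lambda>x. B x y) \<in> linear_maps K L N'" if "y \<in> carrier M" for y using B that by (simp add: bilinear_def)
  have Bc: "B x y \<in> carrier N'" if "x \<in> carrier L" "y \<in> carrier M" for x y
    by (rule linear_maps_closed[OF B1[OF that(1)] that(2)])
  have P1: "\<beta> x \<in> linear_maps K N' N" "(\<lambda>y. \<beta> y x) \<in> linear_maps K N' N" if "x \<in> carrier N'" for x
    using \<beta> that by (simp_all add: bilinear_def)
  have nth: "xs ! 0 \<in> carrier L \<and> xs ! 1 \<in> carrier L" if "xs \<in> power_gens L 2" for xs
    using that by (auto simp: in_power_gens subset_iff)
  have nth': "ys ! 0 \<in> carrier M \<and> ys ! 1 \<in> carrier M" if "ys \<in> power_gens M 2" for ys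
    using that by (auto simp: in_power_gens subset_iff)
  interpret L: two_modules K L N by (intro two_modules.intro mods)
  interpret M: two_modules K M N by (intro two_modules.intro mods)
  show ?thesis
  proof unfold_locales
    fix xs assume "xs \<in> power_gens L 2"
    note x = nth[OF this, THEN conjunct1] nth[OF this, THEN conjunct2]
    have "bilinear K M M N (\<lambda>y z. \<beta> (B (xs ! 0) y) (B (xs ! 1) z))"
      unfolding bilinear_def
      by (intro conjI ballI linear_maps_compose[OF B1[OF x(1)] P1(2)] linear_maps_compose[OF B1[OF x(2)] P1(1)] Bc x)
    then show "multilinear K M N 2 (\<lambda>ys. \<beta> (B (xs ! 0) (ys ! 0)) (B (xs ! 1) (ys ! 1)))"
      by (rule multilinear_pair)
  next
    fix ys assume "ys \<in> power_gens M 2"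
    note y = nth'[OF this, THEN conjunct1] nth'[OF this, THEN conjunct2]
    have "bilinear K L L N (\<lambda>x z. \<beta> (B x (ys ! 0)) (B z (ys ! 1)))"
      unfolding bilinear_def
      by (intro conjI ballI linear_maps_compose[OF B2[OF y(1)] P1(2)] linear_maps_compose[OF B2[OF y(2)] P1(1)] Bc y)
    then show "multilinear K L N 2 (\<lambda>xs. \<beta> (B (xs ! 0) (ys ! 0)) (B (xs ! 1) (ys ! 1)))"
      by (rule multilinear_pair)
  qed
qed

lemma pure_pair_bilinear: "bilinear K T T (tensor_power K T 2) (\<lambda>x y. power_pure K T [x, y])"
proof -
  interpret TT: Module.module K T by (rule T_module)
  have "(\<lambda>x. power_pure K T [x, y]) \<in> linear_maps K T (tensor_power K T 2)"
    "(\<lambda>x. power_pure K T [y, x]) \<in> linear_maps K T (tensor_power K T 2)" if "y \<in> carrier T" for y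
    using multilinearD[OF TT.power_pure_multilinear[of 2], of "[]" "[y]"]
      multilinearD[OF TT.power_pure_multilinear[of 2], of "[y]" "[]"] that by simp_all
  then show ?thesis by (simp add: bilinear_def)
qed

abbreviation "pure2 xs ys \<equiv> power_pure K T
  [tensor_pure K H KG (xs ! 0) (ys ! 0), tensor_pure K H KG (xs ! 1) (ys ! 1)]"

lemma pure2_double: "double_multilinear K H KG (tensor_power K T 2) 2 2 pure2"
  by (rule bilinear_pair_lists[OF two_modules.tensor_pure_bilinear[OF HT] pure_pair_bilinear module_H KG_module
        tensor_power_module'[OF T_module]])

lemma Sm_comult_bilinear:
  "bilinear K H KG (tensor_power K T 2) (\<lambda>h p. case (h, p) of (c, d) \<Rightarrow>
    lin_ext K (tensor_power K T 2) (\<lambda>xs. lin_ext K (tensor_power K T 2) (pure2 xs) (comult KG d)) (comult H c))"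
proof -
  interpret D: double_multilinear K H KG "tensor_power K T 2" 2 2 pure2 by (rule pure2_double)
  have "bilinear K H KG (tensor_power K T 2) (\<lambda>h p. D.ext (comult H h) (comult KG p))"
    using D.ext_bilinear linear_maps_closed[OF comult_hom] linear_maps_closed[OF KG_comult_linear]
    by (auto simp: bilinear_def intro!: linear_maps_compose[OF comult_hom] linear_maps_compose[OF KG_comult_linear])
  then show ?thesis by (simp only: D.ext_def prod.case)
qed

lemma Sm_comult_linear: "comult Sm \<in> linear_maps K Sm (tensor_power K Sm 2)"
  using two_modules.lin_ext_product_hom[OF HT tensor_power_module'[OF T_module] Sm_comult_bilinear]
  by (simp add: Sm_linear_maps Sm_power tensor_comult_def Let_def)

end


lemma module_self_module: "cring K \<Longrightarrow> Module.module K (self_module K)"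
proof -
  assume "cring K"
  then interpret cring K .
  show ?thesis
    by (rule moduleI)
      (auto simp: self_module_def l_distr r_distr m_assoc is_cring intro!: abelian_groupI a_comm a_assoc
        bexI[of _ "\<ominus>\<^bsub>K\<^esub> _"] l_neg)
qed

section \<open>The twisted powers of the smash product\<close>

context bij_hopf_algebra
begin

lemma K_cring: "cring K"
  by (rule module.R.is_cring)

interpretation CS: comultiplicative_algebra K Sm
  by (intro comultiplicative_algebra.intro Sm_module comultiplicative_algebra_axioms.intro
      Sm_mult_bilinear Sm_comult_linear) simp

interpretation HS: two_modules K H Sm
  by (intro two_modules.intro module_H Sm_module)

interpretation SS: two_modules K Sm Sm
  by (intro two_modules.intro Sm_module)

lemma el_Sm_linear: "(\<lambda>h. el h (G i)) \<in> linear_maps K H Sm"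
  unfolding Sm_linear_maps by (rule el_linear)

text \<open>The n-th tensor power of the linear map h \<mapsto> \<open>el h (G i)\<close>.\<close>

definition el_power :: "int \<Rightarrow> nat \<Rightarrow> ('c list \<Rightarrow> 'a) set \<Rightarrow> (('c \<times> (('c \<Rightarrow> 'c) \<Rightarrow> 'a) \<Rightarrow> 'a) set list \<Rightarrow> 'a) set" where
  "el_power i n = lin_ext K (tensor_power K Sm n)
    (\<lambda>xs. power_pure K Sm (map2 (\<lambda>f x. f x) (replicate n (\<lambda>x. el x (G i))) xs))"

lemma el_power_multilinear:
  "multilinear K H (tensor_power K Sm n) n
    (\<lambda>xs. power_pure K Sm (map2 (\<lambda>f x. f x) (replicate n (\<lambda>x. el x (G i))) xs))"
  by (rule multilinear_map2[OF CS.power_pure_multilinear]) (use el_Sm_linear in auto)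

lemma HSn: "two_modules K H (tensor_power K Sm n)"
  by (intro two_modules.intro module_H CS.tensor_power_module)

lemma el_power_linear: "el_power i n \<in> linear_maps K (tensor_power K H n) (tensor_power K Sm n)"
  unfolding el_power_def by (rule two_modules.lin_ext_power_hom[OF HSn el_power_multilinear])

lemma el_power_pure:
  "xs \<in> power_gens H n \<Longrightarrow> el_power i n (power_pure K H xs) =
    power_pure K Sm (map2 (\<lambda>f x. f x) (replicate n (\<lambda>x. el x (G i))) xs)"
  unfolding el_power_def by (rule two_modules.lin_ext_power_pure[OF HSn el_power_multilinear])

text \<open>Group elements are grouplike in the group algebra, so for fixed i the embedding h
  \<mapsto> \<open>el h (G i)\<close> is compatible with the comultiplications.\<close>

lemma Sm_comult_el:
  assumes h: "h \<in> C"
  shows "comult Sm (el h (G i)) = el_power i 2 (comult H h)"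
proof -
  let ?\<delta> = "free_gen K (G i)"
  interpret D: double_multilinear K H KG "tensor_power K T 2" 2 2 pure2 by (rule pure2_double)
  have \<delta>: "[?\<delta>, ?\<delta>] \<in> power_gens KG 2" by (simp add: in_power_gens)
  have "comult Sm (el h (G i)) =
      lin_ext K (tensor_power K T 2) (\<lambda>xs. lin_ext K (tensor_power K T 2) (pure2 xs) (comult KG ?\<delta>)) (comult H h)"
    unfolding Sm_simps tensor_comult_def Let_def
    by (subst two_modules.lin_ext_product_pure[OF HT tensor_power_module'[OF T_module] Sm_comult_bilinear h])
      (simp_all only: prod.case KG_simps gen_KG)
  also have "\<dots> = lin_ext K (tensor_power K T 2) (\<lambda>xs. pure2 xs [?\<delta>, ?\<delta>]) (comult H h)"
  proof (rule D.L.lin_ext_power_cong[OF D.left[OF \<delta>] _ comult_closed[OF h]])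
    fix xs assume "xs \<in> power_gens H 2"
    then show "lin_ext K (tensor_power K T 2) (pure2 xs) (comult KG ?\<delta>) = pure2 xs [?\<delta>, ?\<delta>]"
      unfolding KG_comult_gen by (intro D.M.lin_ext_power_pure[OF D.right \<delta>])
  qed
  also have "\<dots> = el_power i 2 (comult H h)"
    unfolding el_power_def Sm_power
  proof (rule D.L.lin_ext_power_cong[OF _ _ comult_closed[OF h]])
    show "multilinear K H (tensor_power K T 2) 2
        (\<lambda>xs. power_pure K T (map2 (\<lambda>f x. f x) (replicate 2 (\<lambda>x. el x (G i))) xs))"
      using el_power_multilinear[of 2 i] by (simp only: Sm_power)
    fix xs assume "xs \<in> power_gens H 2"
    then obtain x y where "xs = [x, y]" by (auto simp: in_power_gens numeral_2_eq_2 length_Suc_conv)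
    then show "pure2 xs [?\<delta>, ?\<delta>] = power_pure K T (map2 (\<lambda>f x. f x) (replicate 2 (\<lambda>x. el x (G i))) xs)"
      by (simp add: numeral_2_eq_2)
  qed
  finally show ?thesis .
qed

lemma el_power_append:
  assumes s: "s \<in> carrier (tensor_power K H m)" and y: "y \<in> C"
  shows "tensor_append K Sm m 1 (el_power i m s) (power_pure K Sm [el y (G i)]) =
    el_power i (Suc m) (tensor_append K H m 1 s (power_pure K H [y]))"
proof (rule two_modules.power_hom_eq[OF HSn, where t = s,
      where f = "\<lambda>s. tensor_append K Sm m 1 (el_power i m s) (power_pure K Sm [el y (G i)])"])
  let ?n = "Suc m"
  have ely: "[el y (G i)] \<in> power_gens Sm 1" using y by (simp add: in_power_gens)
  have "(\<lambda>s. tensor_append K Sm m 1 s (power_pure K Sm [el y (G i)]))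
      \<in> linear_maps K (tensor_power K Sm m) (tensor_power K Sm ?n)"
    using CS.tensor_append_bilinear[of m 1] CS.power_pure_closed[OF ely] by (simp add: bilinear_def)
  from linear_maps_compose[OF el_power_linear this]
  show "(\<lambda>s. tensor_append K Sm m 1 (el_power i m s) (power_pure K Sm [el y (G i)]))
      \<in> linear_maps K (tensor_power K H m) (tensor_power K Sm ?n)" .
  have "(\<lambda>s. tensor_append K H m 1 s (power_pure K H [y])) \<in> linear_maps K (tensor_power K H m) (tensor_power K H ?n)"
    using module.tensor_append_bilinear[of m 1] linear_maps_closed[OF CA.pure_single_linear y]
    by (simp add: bilinear_def)
  from linear_maps_compose[OF this el_power_linear]
  show "(\<lambda>s. el_power i ?n (tensor_append K H m 1 s (power_pure K H [y])))
      \<in> linear_maps K (tensor_power K H m) (tensor_power K Sm ?n)" .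
  fix xs assume xs: "xs \<in> power_gens H m"
  let ?fs = "\<lambda>n. replicate n (\<lambda>x. el x (G i))"
  have xsy: "xs @ [y] \<in> power_gens H ?n" using xs y by (simp add: in_power_gens)
  have len: "length (?fs m) = length xs" using xs by (simp add: in_power_gens)
  have elxs: "map2 (\<lambda>f x. f x) (?fs m) xs \<in> power_gens Sm m"
  proof -
    have "set (?fs m) \<subseteq> linear_maps K H Sm" using el_Sm_linear by auto
    from map2_closed[OF this len[symmetric]] show ?thesis using xs by (simp add: in_power_gens)
  qed
  have "map2 (\<lambda>f x. f x) (?fs ?n) (xs @ [y]) = map2 (\<lambda>f x. f x) (?fs m) xs @ [el y (G i)]"
    using zip_append[OF len, of "[\<lambda>x. el x (G i)]" "[y]"] by (simp only: replicate_Suc replicate_append_same[symmetric]) simp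
  then show "tensor_append K Sm m 1 (el_power i m (power_pure K H xs)) (power_pure K Sm [el y (G i)]) =
      el_power i ?n (tensor_append K H m 1 (power_pure K H xs) (power_pure K H [y]))"
    unfolding module.tensor_append_pure[OF xs power_pure_gens(1)[OF y]] el_power_pure[OF xs] el_power_pure[OF xsy]
      CS.tensor_append_pure[OF elxs ely] by simp
qed (rule s)

text \<open>By \<open>Sm_comult_el\<close> and \<open>el_power_append\<close> the embedding respects
  each step of the recursion, so no new computation with the comultiplication of the smash product
  is required.\<close>

lemma Sm_iter_comult_el:
  assumes "h \<in> C"
  shows "iter_comult K Sm (Suc n) (el h (G i)) = el_power i (Suc n) (iter_comult K H (Suc n) h)"
  using assms
proof (induction n arbitrary: h)
  case 0
  then show ?case using el_power_pure[of "[h]" 1 i] by (simp add: in_power_gens)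
next
  case (Suc n)
  let ?n = "Suc (Suc n)"
  interpret SP: two_modules K Sm "tensor_power K Sm ?n"
    by (intro two_modules.intro Sm_module CS.tensor_power_module)
  let ?R = "lin_ext K (tensor_power K Sm ?n)
    (\<lambda>xs. tensor_append K Sm (Suc n) 1 (iter_comult K Sm (Suc n) (xs ! 0)) (power_pure K Sm [xs ! 1]))"
  note mR = multilinear_pair[OF CS.append_single_bilinear[OF CS.iter_comult_linear[of n]]]
  have R: "?R \<in> linear_maps K (tensor_power K Sm 2) (tensor_power K Sm ?n)"
    by (rule SP.lin_ext_power_hom[OF mR])
  let ?Q = "\<lambda>xs. el_power i ?n (tensor_append K H (Suc n) 1 (iter_comult K H (Suc n) (xs ! 0)) (power_pure K H [xs ! 1]))"
  have mQ: "multilinear K H (tensor_power K Sm ?n) 2 ?Q"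
    by (rule multilinear_compose[OF multilinear_pair[OF CA.append_single_bilinear[OF CA.iter_comult_linear]] el_power_linear])
  have "iter_comult K Sm ?n (el h (G i)) = ?R (el_power i 2 (comult H h))"
    using Suc.prems by (simp only: iter_comult.simps Sm_comult_el)
  also have "\<dots> = lin_ext K (tensor_power K Sm ?n) ?Q (comult H h)"
  proof (rule two_modules.lin_ext_power_unique[OF HSn mQ linear_maps_compose[OF el_power_linear R] _ comult_closed[OF Suc.prems]])
    fix xs assume xs: "xs \<in> power_gens H 2"
    then obtain x y where xy: "xs = [x, y]" "x \<in> C" "y \<in> C"
      by (auto simp: in_power_gens numeral_2_eq_2 length_Suc_conv)
    have "?R (el_power i 2 (power_pure K H xs)) = ?R (power_pure K Sm [el x (G i), el y (G i)])"
      unfolding el_power_pure[OF xs] by (simp add: xy numeral_2_eq_2)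
    also have "\<dots> = tensor_append K Sm (Suc n) 1 (iter_comult K Sm (Suc n) (el x (G i))) (power_pure K Sm [el y (G i)])"
      by (subst SP.lin_ext_power_pure[OF mR]) (simp_all add: in_power_gens xy)
    also have "\<dots> = ?Q xs"
      using el_power_append[OF CA.iter_comult_closed[OF xy(2)] xy(3)] xy by (simp only: Suc.IH) simp
    finally show "?R (el_power i 2 (power_pure K H xs)) = ?Q xs" .
  qed
  also have "\<dots> = el_power i ?n (iter_comult K H ?n h)"
    by (rule CA.apply_iter_comult[OF CS.tensor_power_module el_power_linear Suc.prems, symmetric])
  finally show ?case .
qed

text \<open>S^(2i) on the first leg and the identity on the second; these are the even powers of the
  antipode of the smash product.\<close>

definition twist_maps :: "int \<Rightarrow> ('c \<times> (('c \<Rightarrow> 'c) \<Rightarrow> 'a) \<Rightarrow> 'a) set \<Rightarrow> ('c \<times> (('c \<Rightarrow> 'c) \<Rightarrow> 'a) \<Rightarrow> 'a) set" where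
  "twist_maps i = el_ext T (\<lambda>h \<sigma>. el (G i h) \<sigma>)"

lemma twist_maps_linear: "twist_maps i \<in> linear_maps K T T"
  unfolding twist_maps_def
  by (rule el_ext_linear[OF T_module]) (rule linear_maps_compose[OF G_lin el_linear])

lemma twist_maps_el: "h \<in> C \<Longrightarrow> twist_maps i (el h (G j)) = el (G i h) (G j)"
  unfolding twist_maps_def
  by (rule el_ext_el[OF T_module]) (rule linear_maps_compose[OF G_lin el_linear])

lemma twist_maps_closed [simp]: "t \<in> carrier T \<Longrightarrow> twist_maps i t \<in> carrier T"
  by (rule linear_maps_closed[OF twist_maps_linear])

lemma twist_maps_add: "t \<in> carrier T \<Longrightarrow> twist_maps i (twist_maps j t) = twist_maps (i + j) t"
  by (rule el_hom_eq[OF T_module linear_maps_compose[OF twist_maps_linear twist_maps_linear] twist_maps_linear])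
    (auto simp: twist_maps_el G_add)

lemma twist_maps_0: "t \<in> carrier T \<Longrightarrow> twist_maps 0 t = t"
  by (rule el_hom_eq[OF T_module twist_maps_linear linear_maps_id]) (auto simp: twist_maps_el)

lemma Sm_antipode_linear_slot: "(\<lambda>h. el ((inv\<^bsub>\<Gamma>\<^esub> (G i)) (antipode H h)) (inv\<^bsub>\<Gamma>\<^esub> (G i))) \<in> linear_maps K H T"
  using linear_maps_compose[OF linear_maps_compose[OF antipode_hom G_lin] el_linear] by simp

lemma Sm_antipode_linear: "antipode Sm \<in> linear_maps K T T"
  unfolding Sm_antipode by (rule el_ext_linear[OF T_module]) (rule Sm_antipode_linear_slot)

lemma Sm_antipode_el: "h \<in> C \<Longrightarrow> antipode Sm (el h (G i)) = el (G (- i) (antipode H h)) (G (- i))"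
  unfolding Sm_antipode
  by (subst el_ext_el[OF T_module]; (rule Sm_antipode_linear_slot)?) simp_all

lemma G_antipode: "h \<in> C \<Longrightarrow> G i (antipode H h) = antipode H (G i h)"
proof (induction i rule: int_induct[where k = 0])
  case (step1 i)
  then show ?case by (simp add: G_succ)
next
  case (step2 i)
  then show ?case by (simp add: G_pred)
qed simp

text \<open>The two inversions of the group element cancel, and its action on the first leg cancels
  as well because powers of S^2 commute with S.\<close>

lemma Sm_antipode_sq:
  assumes "t \<in> carrier T"
  shows "antipode Sm (antipode Sm t) = twist_maps 1 t"
proof (rule el_hom_eq[OF T_module linear_maps_compose[OF Sm_antipode_linear Sm_antipode_linear] twist_maps_linear _ assms])
  fix h i assume h: "h \<in> C"
  then show "antipode Sm (antipode Sm (el h (G i))) = twist_maps 1 (el h (G i))"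
    using G_succ[OF h, of 0] by (simp add: Sm_antipode_el twist_maps_el G_antipode G_add)
qed

text \<open>Only even powers occur in the exponent, so the inverse antipode itself need not be
  determined: two applications of it invert the known square.\<close>

lemma Sm_antipode_inverse_pow:
  assumes "t \<in> carrier T"
  shows "(inv_into (carrier Sm) (antipode Sm) ^^ (2 * i)) t = twist_maps (- int i) t"
proof -
  let ?a = "antipode Sm" and ?b = "inv_into (carrier T) (antipode Sm)"
  have a: "?a t \<in> carrier T" if "t \<in> carrier T" for t by (rule linear_maps_closed[OF Sm_antipode_linear that])
  \<comment> \<open>Surjectivity follows from the invertibility of the square; it is what makes
    \<open>inv_into\<close> a right inverse.\<close>
  have surj: "t \<in> ?a ` carrier T" if t: "t \<in> carrier T" for t
  proof -
    have "t = ?a (?a (twist_maps (-1) t))" using t by (simp add: Sm_antipode_sq twist_maps_add twist_maps_0)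
    moreover have "?a (twist_maps (-1) t) \<in> carrier T" using t by (intro a) simp
    ultimately show ?thesis by (rule image_eqI)
  qed
  have b: "?b t \<in> carrier T" "?a (?b t) = t" if "t \<in> carrier T" for t
    using inv_into_into[OF surj[OF that]] f_inv_into_f[OF surj[OF that]] by auto
  have bb: "?b (?b t) = twist_maps (-1) t" if t: "t \<in> carrier T" for t
  proof -
    have "?b (?b t) = twist_maps (-1) (twist_maps 1 (?b (?b t)))"
      using t b by (simp add: twist_maps_add twist_maps_0)
    also have "twist_maps 1 (?b (?b t)) = t" using t b by (simp add: Sm_antipode_sq[symmetric])
    finally show ?thesis .
  qed
  show ?thesis using assms
  proof (induction i)
    case 0
    then show ?case by (simp add: twist_maps_0)
  next
    case (Suc i)
    then show ?case by (simp add: bb twist_maps_add)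
  qed
qed

abbreviation "inverse_twists n \<equiv> map (\<lambda>i. inv_into (carrier Sm) (antipode Sm) ^^ (2 * i)) [0..<n]"

lemma inverse_twists_linear: "set (inverse_twists n) \<subseteq> linear_maps K Sm Sm"
proof -
  have "(inv_into (carrier Sm) (antipode Sm) ^^ (2 * i)) \<in> linear_maps K Sm Sm" for i
    unfolding Sm_linear_maps
    by (rule linear_maps_cong[OF twist_maps_linear T_module Sm_antipode_inverse_pow])
  then show ?thesis by auto
qed

text \<open>In a product of factors with the same group element, each one acts on everything to its
  right, which gives a Horner scheme in the first leg.\<close>

lemma foldr_smash:
  "set ys \<subseteq> C \<Longrightarrow> foldr (\<lambda>y z. y \<cdot> G j z) ys \<one>\<^bsub>H\<^esub> \<in> C \<and>
    foldr (mult Sm) (map (\<lambda>y. el y (G j)) ys) \<one>\<^bsub>Sm\<^esub> =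
      el (foldr (\<lambda>y z. y \<cdot> G j z) ys \<one>\<^bsub>H\<^esub>) (G (int (length ys) * j))"
  by (induction ys) (simp_all add: Sm_mult_el algebra_simps del: \<Gamma>_one)

text \<open>Multiplying out the Horner scheme, factor i receives S^(2ij) from the group elements and
  S^(-2i) from the definition of the exponent, in total S^(2i(j-1)). The offset k and the outer
  power of S^2 make the statement inductive.\<close>

lemma foldr_twists:
  "set xs \<subseteq> C \<Longrightarrow>
    foldr (\<lambda>y z. y \<cdot> G j z) (map2 (\<lambda>i x. G (- int i) x) [k..<k + length xs] xs) \<one>\<^bsub>H\<^esub> \<in> C \<and>
    G (int k * j) (foldr (\<lambda>y z. y \<cdot> G j z) (map2 (\<lambda>i x. G (- int i) x) [k..<k + length xs] xs) \<one>\<^bsub>H\<^esub>) =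
      foldr (mult H) (map2 (\<lambda>i x. G (int i * (j - 1)) x) [k..<k + length xs] xs) \<one>\<^bsub>H\<^esub>"
proof (induction xs arbitrary: k)
  case (Cons x xs)
  let ?z = "foldr (\<lambda>y z. y \<cdot> G j z) (map2 (\<lambda>i x. G (- int i) x) [Suc k..<Suc k + length xs] xs) \<one>\<^bsub>H\<^esub>"
  have upt: "[k..<k + length (x # xs)] = k # [Suc k..<Suc k + length xs]"
    by (simp add: upt_conv_Cons del: upt_Suc)
  have x: "x \<in> C" and IH: "?z \<in> C" "G (int (Suc k) * j) ?z =
      foldr (mult H) (map2 (\<lambda>i x. G (int i * (j - 1)) x) [Suc k..<Suc k + length xs] xs) \<one>\<^bsub>H\<^esub>"
    using Cons.prems Cons.IH[of "Suc k"] by auto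
  have "G (int k * j) (G (- int k) x \<cdot> G j ?z) = G (int k * (j - 1)) x \<cdot> G (int (Suc k) * j) ?z"
    using x IH(1) by (simp add: G_mult G_add algebra_simps)
  then show ?case using x IH unfolding upt by (simp del: upt_Suc)
qed simp

text \<open>The key computation for the smash product. The parameter is j - 1 and not j because of
  the negative powers of the antipode in the definition of the exponent, so j = 1 yields
  \<open>hopf_exp0\<close> and j = 0 yields \<open>hopf_exp\<close> of H.\<close>

lemma Sm_exp_value:
  assumes h: "h \<in> C"
  shows "iter_mult K Sm (tensor_maps K Sm (inverse_twists (Suc n)) (iter_comult K Sm (Suc n) (el h (G j)))) =
    el (P (j - 1) (Suc n) h) (G (int (Suc n) * j))"
proof -
  let ?n = "Suc n"
  let ?F = "\<lambda>ys. foldr (mult Sm) (map2 (\<lambda>f x. f x) (inverse_twists ?n) ys) \<one>\<^bsub>Sm\<^esub>"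
  let ?t = "iter_comult K H ?n h"
  have t: "?t \<in> carrier (tensor_power K H ?n)" by (rule CA.iter_comult_closed[OF h])
  have mF: "multilinear K Sm Sm ?n ?F"
    by (rule multilinear_map2[OF CS.multilinear_foldr inverse_twists_linear]) simp
  let ?\<psi> = "\<lambda>h. el h (G (int ?n * j))"
  have "iter_mult K Sm (tensor_maps K Sm (inverse_twists ?n) (iter_comult K Sm ?n (el h (G j)))) =
      lin_ext K Sm ?F (el_power j ?n ?t)"
    unfolding Sm_iter_comult_el[OF h]
    by (rule CS.iter_mult_tensor_maps[OF inverse_twists_linear _ linear_maps_closed[OF el_power_linear t]]) simp
  also have "\<dots> = lin_ext K Sm (\<lambda>xs. lin_ext K Sm ?F (power_pure K Sm (map2 (\<lambda>f x. f x) (replicate ?n (\<lambda>x. el x (G j))) xs))) ?t"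
    unfolding el_power_def
    by (rule two_modules.lin_ext_power_compose[OF HSn el_power_multilinear Sm_module SS.lin_ext_power_hom[OF mF] t])
  also have "\<dots> = lin_ext K Sm (\<lambda>xs. ?\<psi> (twisted_mult (j - 1) ?n xs)) ?t"
  proof (rule HS.lin_ext_power_cong[OF multilinear_compose[OF twisted_mult_multilinear el_Sm_linear] _ t])
    fix xs assume xs: "xs \<in> power_gens H ?n"
    then have len: "length xs = ?n" and xsC: "set xs \<subseteq> C" by (auto simp: in_power_gens)
    let ?els = "map2 (\<lambda>f x. f x) (replicate ?n (\<lambda>x. el x (G j))) xs"
    have els: "?els = map (\<lambda>x. el x (G j)) xs"
      using len by (simp add: zip_replicate1[of ?n] del: replicate_Suc)
    have "?els \<in> power_gens Sm ?n" unfolding els using len xsC by (auto simp: in_power_gens)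
    then have "lin_ext K Sm ?F (power_pure K Sm ?els) = ?F ?els"
      by (rule SS.lin_ext_power_pure[OF mF])
    also have "map2 (\<lambda>f x. f x) (inverse_twists ?n) ?els =
        map (\<lambda>y. el y (G j)) (map2 (\<lambda>i x. G (- int i) x) [0..<0 + length xs] xs)"
      unfolding els
    proof (rule nth_equalityI)
      fix i assume "i < length (map2 (\<lambda>f x. f x) (inverse_twists ?n) (map (\<lambda>x. el x (G j)) xs))"
      then have i: "i < ?n" "i < length xs" using len by simp_all
      then have "xs ! i \<in> C" using xsC by (auto simp: subset_iff)
      then show "map2 (\<lambda>f x. f x) (inverse_twists ?n) (map (\<lambda>x. el x (G j)) xs) ! i =
          map (\<lambda>y. el y (G j)) (map2 (\<lambda>i x. G (- int i) x) [0..<0 + length xs] xs) ! i"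
        using i len Sm_antipode_inverse_pow[of "el (xs ! i) (G j)" i]
        by (simp add: twist_maps_el del: upt_Suc)
    qed (use len in simp)
    also have "foldr (mult Sm) \<dots> \<one>\<^bsub>Sm\<^esub> =
        el (foldr (\<lambda>y z. y \<cdot> G j z) (map2 (\<lambda>i x. G (- int i) x) [0..<0 + length xs] xs) \<one>\<^bsub>H\<^esub>) (G (int ?n * j))"
    proof -
      let ?ys = "map2 (\<lambda>i x. G (- int i) x) [0..<0 + length xs] xs"
      have "set ?ys \<subseteq> C" using xsC by (auto dest!: set_zip_rightD)
      moreover have "length ?ys = ?n" using len by simp
      ultimately show ?thesis using foldr_smash[of ?ys j] by (simp only:)
    qed
    also have "foldr (\<lambda>y z. y \<cdot> G j z) (map2 (\<lambda>i x. G (- int i) x) [0..<0 + length xs] xs) \<one>\<^bsub>H\<^esub> =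
        foldr (mult H) (map2 (\<lambda>i x. G (int i * (j - 1)) x) [0..<0 + length xs] xs) \<one>\<^bsub>H\<^esub>"
      using foldr_twists[OF xsC, of j 0, THEN conjunct1] foldr_twists[OF xsC, of j 0, THEN conjunct2] by simp
    also have "map2 (\<lambda>i x. G (int i * (j - 1)) x) [0..<0 + length xs] xs = map2 (\<lambda>f x. f x) (twists (j - 1) ?n) xs"
      using len by (intro nth_equalityI) (simp_all del: upt_Suc)
    finally show "lin_ext K Sm ?F (power_pure K Sm ?els) = ?\<psi> (twisted_mult (j - 1) ?n xs)" .
  qed
  also have "\<dots> = ?\<psi> (lin_ext K H (twisted_mult (j - 1) ?n) ?t)"
    by (rule HH.lin_ext_power_compose[OF twisted_mult_multilinear Sm_module el_Sm_linear t, symmetric])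
  also have "lin_ext K H (twisted_mult (j - 1) ?n) ?t = P (j - 1) ?n h"
    by (rule twisted_iter_comult[OF h])
  finally show ?thesis .
qed

end


section \<open>Exponents\<close>

context bij_hopf_algebra
begin

interpretation CS: comultiplicative_algebra K Sm
  by (intro comultiplicative_algebra.intro Sm_module comultiplicative_algebra_axioms.intro
      Sm_mult_bilinear Sm_comult_linear) simp

lemma P_eq_one_iff: "P j n = \<e> \<longleftrightarrow> (\<forall>h\<in>C. P j n h = eps h)"
  by (auto intro: E_eqI)

lemma exp0_iff:
  "(\<forall>h\<in>C. iter_mult K H (iter_comult K H (Suc n) h) = scal (counit H h)) \<longleftrightarrow> P 0 (Suc n) = \<e>"
proof -
  have "iter_mult K H (iter_comult K H (Suc n) h) = P 0 (Suc n) h" if h: "h \<in> C" for h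
    unfolding twisted_iter_comult[OF h, symmetric] iter_mult_def
  proof (rule HH.lin_ext_power_cong[OF twisted_mult_multilinear _ CA.iter_comult_closed[OF h]])
    fix xs assume xs: "xs \<in> power_gens H (Suc n)"
    then have "map2 (\<lambda>f x. f x) (twists 0 (Suc n)) xs = xs"
      by (intro nth_equalityI) (auto simp: in_power_gens subset_iff simp del: upt_Suc)
    then show "foldr (mult H) xs \<one>\<^bsub>H\<^esub> = twisted_mult 0 (Suc n) xs" by simp
  qed
  then show ?thesis by (simp add: P_eq_one_iff eps_def del: P.simps)
qed

lemma Si_pow: "h \<in> C \<Longrightarrow> (Si ^^ (2 * i)) h = G (- int i) h"
proof (induction i)
  case (Suc i)
  have "(Si ^^ (2 * Suc i)) h = G (- int i - 1) h" using Suc by (simp add: G_pred)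
  also have "- int i - 1 = - int (Suc i)" by simp
  finally show ?case .
qed simp

lemma exp_iff:
  "(\<forall>h\<in>C. iter_mult K H (tensor_maps K H (map (\<lambda>i. inv_into C (antipode H) ^^ (2 * i)) [0..<Suc n])
      (iter_comult K H (Suc n) h)) = scal (counit H h)) \<longleftrightarrow> P (-1) (Suc n) = \<e>"
proof -
  let ?fs = "map (\<lambda>i. Si ^^ (2 * i)) [0..<Suc n]"
  have "(Si ^^ (2 * i)) \<in> linH" for i
    by (rule linear_maps_cong[OF G_lin module_H Si_pow])
  then have fs: "set ?fs \<subseteq> linH" "length ?fs = Suc n" by auto
  have "iter_mult K H (tensor_maps K H ?fs (iter_comult K H (Suc n) h)) = P (-1) (Suc n) h" if h: "h \<in> C" for h
    unfolding twisted_iter_comult[OF h, symmetric] CA.iter_mult_tensor_maps[OF fs CA.iter_comult_closed[OF h]]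
  proof (rule HH.lin_ext_power_cong[OF twisted_mult_multilinear _ CA.iter_comult_closed[OF h]])
    fix xs assume xs: "xs \<in> power_gens H (Suc n)"
    then have "map2 (\<lambda>f x. f x) ?fs xs = map2 (\<lambda>f x. f x) (twists (-1) (Suc n)) xs"
      by (intro nth_equalityI) (auto simp: in_power_gens subset_iff Si_pow simp del: upt_Suc)
    then show "foldr (mult H) (map2 (\<lambda>f x. f x) ?fs xs) \<one>\<^bsub>H\<^esub> = twisted_mult (-1) (Suc n) xs" by simp
  qed
  then show ?thesis by (simp add: P_eq_one_iff eps_def Si_def[symmetric] del: P.simps upt_Suc)
qed

lemma self_K: "Module.module K (self_module K)"
  by (rule module_self_module[OF K_cring])

lemma KG_counit: "counit KG \<in> linear_maps K KG (self_module K)" "counit KG (free_gen K (G i)) = \<one>\<^bsub>K\<^esub>"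
proof -
  interpret S: Module.module K "self_module K" by (rule self_K)
  have eq: "counit KG = free_ext K (self_module K) (\<lambda>_. \<one>\<^bsub>K\<^esub>)"
    by (simp add: group_algebra_def Let_def)
  have f: "(\<lambda>_. \<one>\<^bsub>K\<^esub>) \<in> carrier \<Gamma> \<rightarrow> carrier (self_module K)" by (simp add: self_module_def)
  show "counit KG \<in> linear_maps K KG (self_module K)"
    using S.free_ext_hom[OF f] linear_maps_eq[of KG FG "self_module K" "self_module K" K] by (simp add: eq)
  show "counit KG (free_gen K (G i)) = \<one>\<^bsub>K\<^esub>"
    unfolding eq using S.free_ext_gen[OF f G_in_\<Gamma>] by simp
qed

lemma Sm_counit_bilinear:
  "bilinear K H KG (self_module K) (\<lambda>h p. case (h, p) of (c, d) \<Rightarrow> counit H c \<otimes>\<^bsub>K\<^esub> counit KG d)"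
proof -
  have l: "(\<lambda>x. r \<otimes>\<^bsub>K\<^esub> x) \<in> linear_maps K (self_module K) (self_module K)"
    "(\<lambda>x. x \<otimes>\<^bsub>K\<^esub> r) \<in> linear_maps K (self_module K) (self_module K)" if "r \<in> carrier K" for r
    using that by (auto intro!: linear_mapsI simp: self_module_def module.R.r_distr module.R.l_distr module.R.m_ac)
  have c: "counit KG p \<in> carrier K" if "p \<in> carrier KG" for p
    using linear_maps_closed[OF KG_counit(1) that] by (simp add: self_module_def)
  show ?thesis
    unfolding bilinear_def prod.case
    by (intro conjI ballI linear_maps_compose[OF KG_counit(1) l(1)] linear_maps_compose[OF counit_hom l(2)] c
        counit_closed)
qed

lemma Sm_counit_linear: "counit Sm \<in> linear_maps K T (self_module K)"
  unfolding Sm_simps tensor_counit_def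
  by (rule two_modules.lin_ext_product_hom[OF HT self_K Sm_counit_bilinear])

lemma Sm_counit_el: "h \<in> C \<Longrightarrow> counit Sm (el h (G i)) = counit H h"
  unfolding Sm_simps tensor_counit_def
  by (subst two_modules.lin_ext_product_pure[OF HT self_K Sm_counit_bilinear]) (simp_all add: KG_counit(2))

text \<open>The group elements with j = 1 and j = 0 already give the two conditions on the right.
  Conversely these two give triviality for every j by \<open>P_trivial_all\<close>, and elements
  \<open>el h (G j)\<close> suffice by linearity.\<close>

lemma smash_exp_iff:
  "(\<forall>s\<in>carrier Sm. iter_mult K Sm (tensor_maps K Sm (inverse_twists (Suc n)) (iter_comult K Sm (Suc n) s))
      = counit Sm s \<odot>\<^bsub>Sm\<^esub> \<one>\<^bsub>Sm\<^esub>) \<longleftrightarrow> P 0 (Suc n) = \<e> \<and> P (-1) (Suc n) = \<e>"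
    (is "(\<forall>s\<in>carrier Sm. ?L s = ?R s) \<longleftrightarrow> ?rhs")
proof -
  interpret T: Module.module K T by (rule T_module)
  have R_el: "?R (el h (G j)) = el (eps h) (G 0)" if h: "h \<in> C" for h j
    using h linear_maps_smult[OF el_linear[of 0], of "counit H h" "\<one>\<^bsub>H\<^esub>"]
    by (simp only: Sm_counit_el) (simp add: eps_def)
  note L_el = Sm_exp_value
  show ?thesis
  proof
    assume *: "\<forall>s\<in>carrier Sm. ?L s = ?R s"
    have proj: "(\<lambda>h. h) \<in> linear_maps K H H" by (rule linear_maps_id)
    \<comment> \<open>The map h \<otimes> \<sigma> \<mapsto> h is a left inverse of the embedding
      for every group element, so first legs can be compared even though the second legs are written
      differently.\<close>
    let ?\<pi> = "el_ext H (\<lambda>h \<sigma>. h)"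
    have \<pi>: "?\<pi> (el h (G j)) = h" if "h \<in> C" for h j
      by (rule el_ext_el[OF module_H proj that])
    have "P (j - 1) (Suc n) h = eps h" if h: "h \<in> C" for h j
    proof -
      have "el (P (j - 1) (Suc n) h) (G (int (Suc n) * j)) = el (eps h) (G 0)"
        using * h L_el[OF h, of n j] R_el[OF h, of j] by (simp del: P.simps upt_Suc iter_comult.simps)
      then show ?thesis using \<pi> h E_closed[OF P_E h] by (metis eps_closed)
    qed
    from this[of _ 1] this[of _ 0] show ?rhs by (simp add: P_eq_one_iff del: P.simps)
  next
    assume rhs: ?rhs
    then have order: "G (int (Suc n)) = idm" and triv: "P j (Suc n) = \<e>" for j
      using P_minus_one_order[of "Suc n"] P_trivial_all[of "Suc n" j] by auto
    \<comment> \<open>\<open>P_periodic\<close> speaks about P only; at m = 2 one has P i 2 =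
      \<open>idm \<star> G i\<close>, and cancelling \<open>idm\<close> with \<open>S\<close>
      recovers periodicity of G.\<close>
    have Gn: "G (int (Suc n) * j) = G 0" for j
    proof -
      have "P (1 + int (Suc n) * j) 2 = P 1 2" by (rule P_periodic[OF order])
      then have "idm \<star> G (1 + int (Suc n) * j) = idm \<star> G 1"
        by (simp add: numeral_2_eq_2 G_idm)
      then have "S \<star> (idm \<star> G (1 + int (Suc n) * j)) = S \<star> (idm \<star> G 1)" by simp
      then have "G (1 + int (Suc n) * j) = G 1" by (simp add: conv_assoc[symmetric])
      then have "G (-1) \<bullet> G (1 + int (Suc n) * j) = G (-1) \<bullet> G 1" by simp
      then show ?thesis by simp
    qed
    have L: "?L \<in> linear_maps K T T"
    proof -
      have maps: "tensor_maps K Sm (inverse_twists (Suc n)) \<in> linear_maps K (tensor_power K Sm (Suc n)) (tensor_power K Sm (Suc n))"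
        unfolding tensor_maps_def
        using two_modules.lin_ext_power_hom[OF CS.A_power multilinear_map2[OF CS.power_pure_multilinear inverse_twists_linear]]
        by (simp del: upt_Suc)
      have "iter_mult K Sm \<in> linear_maps K (tensor_power K Sm (Suc n)) Sm"
        unfolding iter_mult_def by (rule two_modules.lin_ext_power_hom[OF CS.AA CS.multilinear_foldr])
      from linear_maps_compose[OF linear_maps_compose[OF CS.iter_comult_linear maps] this]
      have "?L \<in> linear_maps K Sm Sm" .
      then show ?thesis by (simp only: Sm_linear_maps)
    qed
    have "(\<lambda>r. r \<odot>\<^bsub>T\<^esub> el \<one>\<^bsub>H\<^esub> (G 0)) \<in> linear_maps K (self_module K) T"
      by (rule linear_mapsI) (simp_all add: self_module_def T.smult_l_distr T.smult_assoc1)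
    from linear_maps_compose[OF Sm_counit_linear this] have R: "?R \<in> linear_maps K T T" by simp
    show "\<forall>s\<in>carrier Sm. ?L s = ?R s"
    proof
      fix s assume "s \<in> carrier Sm"
      then have s: "s \<in> carrier T" by simp
      show "?L s = ?R s"
      proof (rule el_hom_eq[OF T_module L R _ s])
        fix h j assume h: "h \<in> C"
        show "?L (el h (G j)) = ?R (el h (G j))"
          using h by (simp only: L_el R_el triv Gn one_apply)
      qed
    qed
  qed
qed

end

text \<open>Membership is invariant under subtracting the least element d, so a positive integer can
  be reduced until it is at most d, where only d itself belongs to the set.\<close>

lemma multiples_of_least:
  fixes A :: "nat set"
  assumes add: "\<And>m n. m \<in> A \<Longrightarrow> n \<ge> 1 \<Longrightarrow> m + n \<in> A \<longleftrightarrow> n \<in> A" and "0 \<notin> A" and "A \<noteq> {}"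
  obtains d where "d \<ge> 1" "A = {k. k \<ge> 1 \<and> d dvd k}"
proof -
  define d where "d = (LEAST n. n \<in> A)"
  have d: "d \<in> A" "\<And>n. n \<in> A \<Longrightarrow> d \<le> n"
    using assms(3) by (auto simp: d_def intro: LeastI Least_le)
  then have d1: "d \<ge> 1" using assms(2) by (cases d) auto
  have "n \<in> A \<longleftrightarrow> d dvd n" if "n \<ge> 1" for n
    using that
  proof (induction n rule: less_induct)
    case (less n)
    consider "n < d" | "n = d" | "n > d" by linarith
    then show ?case
    proof cases
      case 1
      then show ?thesis using d(2)[of n] less.prems by (auto dest: dvd_imp_le)
    next
      case 3
      then have "n \<in> A \<longleftrightarrow> n - d \<in> A" using add[OF d(1), of "n - d"] by simp
      also have "\<dots> \<longleftrightarrow> d dvd n - d" using 3 d1 by (intro less.IH) auto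
      finally show ?thesis using 3 by (simp add: dvd_minus_self)
    qed (use d in auto)
  qed
  moreover have "k \<ge> 1" if "k \<in> A" for k using that assms(2) by (cases k) auto
  ultimately show ?thesis using that[OF d1] by blast
qed

lemma Inf_multiples: "d \<ge> 1 \<Longrightarrow> Inf (enat ` {k. k \<ge> 1 \<and> d dvd k}) = enat d"
  by (rule antisym) (auto intro!: Inf_lower Inf_greatest dest: dvd_imp_le)

lemma Inf_Int_lcm:
  fixes A B :: "nat set"
  assumes "\<And>m n. m \<in> A \<Longrightarrow> n \<ge> 1 \<Longrightarrow> m + n \<in> A \<longleftrightarrow> n \<in> A" "0 \<notin> A"
    and "\<And>m n. m \<in> B \<Longrightarrow> n \<ge> 1 \<Longrightarrow> m + n \<in> B \<longleftrightarrow> n \<in> B" "0 \<notin> B"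
  shows "Inf (enat ` (A \<inter> B)) = enat_lcm (Inf (enat ` A)) (Inf (enat ` B))"
proof (cases "A = {} \<or> B = {}")
  case True
  \<comment> \<open>Both sides are infinite; the case distinction is needed because
    \<open>enat_lcm\<close> is defined by patterns and its first argument may be finite.\<close>
  then show ?thesis by (cases "Inf (enat ` A)") (auto simp: top_enat_def)
next
  case False
  obtain d where d: "d \<ge> 1" "A = {k. k \<ge> 1 \<and> d dvd k}"
    using multiples_of_least[of A] assms False by metis
  obtain e where e: "e \<ge> 1" "B = {k. k \<ge> 1 \<and> e dvd k}"
    using multiples_of_least[of B] assms False by metis
  have "A \<inter> B = {k. k \<ge> 1 \<and> lcm d e dvd k}" using d e by auto
  moreover have "lcm d e \<ge> 1" using d e by (simp add: Suc_le_eq lcm_pos_nat)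
  ultimately show ?thesis by (simp only: d e Inf_multiples enat_lcm.simps)
qed

context bij_hopf_algebra
begin

definition trivial_set :: "int \<Rightarrow> nat set" where
  "trivial_set j = {n. 1 \<le> n \<and> P j n = \<e>}"

lemma trivial_set_add: "m \<in> trivial_set j \<Longrightarrow> n \<ge> 1 \<Longrightarrow> m + n \<in> trivial_set j \<longleftrightarrow> n \<in> trivial_set j"
  by (auto simp: trivial_set_def P_trivial_add)

lemma hopf_exp0_eq: "hopf_exp0 K H = Inf (enat ` trivial_set 0)"
proof -
  have "{n. 1 \<le> n \<and> (\<forall>h\<in>C. iter_mult K H (iter_comult K H n h) = scal (counit H h))} = trivial_set 0"
    unfolding trivial_set_def using exp0_iff by (auto simp: Suc_le_eq gr0_conv_Suc simp del: P.simps)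
  then show ?thesis by (simp only: hopf_exp0_def)
qed

lemma hopf_exp_eq: "hopf_exp K H = Inf (enat ` trivial_set (-1))"
proof -
  have "{n. 1 \<le> n \<and> (\<forall>h\<in>C. iter_mult K H (tensor_maps K H (map (\<lambda>i. inv_into C (antipode H) ^^ (2 * i)) [0..<n])
      (iter_comult K H n h)) = scal (counit H h))} = trivial_set (-1)"
    unfolding trivial_set_def using exp_iff by (auto simp: Suc_le_eq gr0_conv_Suc simp del: P.simps upt_Suc)
  then show ?thesis by (simp only: hopf_exp_def)
qed

lemma hopf_exp_smash_eq: "hopf_exp K Sm = Inf (enat ` (trivial_set 0 \<inter> trivial_set (-1)))"
proof -
  have "{n. 1 \<le> n \<and> (\<forall>s\<in>carrier Sm. iter_mult K Sm (tensor_maps K Sm (inverse_twists n) (iter_comult K Sm n s))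
      = counit Sm s \<odot>\<^bsub>Sm\<^esub> \<one>\<^bsub>Sm\<^esub>)} = trivial_set 0 \<inter> trivial_set (-1)"
    (is "{n. 1 \<le> n \<and> ?Q n} = _")
  proof (rule Set.set_eqI)
    fix n
    show "n \<in> {n. 1 \<le> n \<and> ?Q n} \<longleftrightarrow> n \<in> trivial_set 0 \<inter> trivial_set (-1)"
    proof (cases n)
      case (Suc m)
      then show ?thesis
        using smash_exp_iff[of m] by (simp only: trivial_set_def mem_Collect_eq Int_iff) blast
    qed (simp add: trivial_set_def)
  qed
  then show ?thesis by (simp only: hopf_exp_def)
qed

theorem hopf_exp_smash_product: "hopf_exp K Sm = enat_lcm (hopf_exp0 K H) (hopf_exp K H)"
  unfolding hopf_exp_smash_eq hopf_exp0_eq hopf_exp_eq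
  by (rule Inf_Int_lcm[OF trivial_set_add _ trivial_set_add]) (auto simp: trivial_set_def)

end

theorem corollary3p7:
  fixes K :: "('k, 'r) ring_scheme" and H :: "('k, 'h) hopf"
  assumes "hopf_algebra K H"
    and "vectorspace.fin_dim K H"
    and "bij_betw (antipode H) (carrier H) (carrier H)"
  shows "hopf_exp K (smash_product K H (antipode_sq_group H))
    = enat_lcm (hopf_exp0 K H) (hopf_exp K H)"
proof -
  interpret bij_hopf_algebra K H
    by (intro bij_hopf_algebra.intro fd_hopf_algebra.intro fd_hopf_algebra_axioms.intro
        bij_hopf_algebra_axioms.intro assms)
  show ?thesis using hopf_exp_smash_product by (simp only: \<Gamma>_def)
qed

end
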